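(* Let $A$ be a finite-dimensional algebra over a field $k$, $Q$ a finite acyclic quiver, $I$ an ideal of $kQ$ generated by monomial relations, and $\Lambda = A\otimes_k kQ/I$. Let $X = (X_i, X_\alpha, i\in Q_0, \alpha\in Q_1)$ be an arbitrary (finitely generated) $\Lambda$-module, viewed as a representation of $(Q,I)$ over $A$. Then $X$ is a Gorenstein-projective $\Lambda$-module if and only if $X$ is a monic $\Lambda$-module such that for each $i\in Q_0$, both $X_i$ and $X_i/\big(\sum_{\alpha\in Q_1,\, e(\alpha)=i}\operatorname{Im} X_\alpha\big)$ are Gorenstein-projective $A$-modules.
   Context: Throughout, $k$ is a field, $A$ is a finite-dimensional $k$-algebra, modules are finitely generated left modules, $Q=(Q_0,Q_1)$ is a finite acyclic quiver with $Q_0=\{1,\dots,n\}$, and $I$ is an ideal of the path algebra $kQ$ generated by a set of paths of length at least $2$ (monomial relations), with minimal generating set of paths $\rho=\{\rho_1,\dots,\rho_t\}$. For an arrow or path $p$, $s(p)$, $e(p)$ are its starting and ending vertices and $l(p)$ its length; paths are composed from right to left; $p$ is non-zero if $p\notin I$. A representation of $(Q,I)$ over $A$ is a datum $X=(X_i,X_\alpha,i\in Q_0,\alpha\in Q_1)$ with each $X_i$ a finitely generated $A$-module and each $X_\alpha:X_{s(\alpha)}\to X_{e(\alpha)}$ an $A$-map, such that $X_{\rho_j}=0$ for all $j$, where for a path $p=\alpha_l\cdots\alpha_1$ one puts $X_p=X_{\alpha_l}\cdots X_{\alpha_1}$. Morphisms are families of $A$-maps $f_i:X_i\to Y_i$ with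 $Y_\alpha f_{s(\alpha)}=f_{e(\alpha)}X_\alpha$ for all arrows $\alpha$. The category $\Lambda\text{-mod}$ with $\Lambda=A\otimes_k kQ/I$ is identified with the category $\mathrm{rep}(Q,I,A)$ of such representations. For a non-zero path $p$ with $l(p)\ge 1$, put $K_p=\{q \text{ a path}: e(q)=s(p),\ l(q)\ge1,\ q\notin I,\ pq\in I\}$. A representation $X$ (equivalently a $\Lambda$-module) is monic if: (m1) for each $i\in Q_0$ the sum $\sum_{\alpha\in Q_1, e(\alpha)=i}\operatorname{Im}X_\alpha$ of submodules of $X_i$ is direct (sum indexed by arrows); and (m2) for each $\alpha\in Q_1$, $\operatorname{Ker}X_\alpha=\sum_{q\in K_\alpha}\operatorname{Im}X_q$ (an empty sum is $0$). For a finite-dimensional algebra $B$, a $B$-module $M$ is Gorenstein-projective if there is an exact sequence $P^\bullet=\cdots\to P^{-1}\to P^0\xrightarrow{d^0}P^1\to\cdots$ of finitely generated projective $B$-modules such that $\operatorname{Hom}_B(P^\bullet,B)$ is exact and $M\cong\operatorname{Ker}d^0$. *)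

theory Defs
  imports
    "HOL-Algebra.QuotRing"
    "HOL-Algebra.Module"
    "HOL-Algebra.Generated_Groups"
    "HOL-Algebra.Free_Abelian_Groups"
    "Graph_Theory.Arc_Walk"
begin

section \<open>Modules over noncommutative rings\<close>

text \<open>
  The locale \<^locale>\<open>module\<close> requires a commutative ring of scalars; the following is its version
  for left modules over an arbitrary ring.  As there, modules are elements of the record type
  \<^typ>\<open>('r, 'm) module\<close>, whose fields \<^const>\<open>mult\<close> and \<^const>\<open>one\<close> carry no meaning for a module.
\<close>

locale left_module = R?: ring R + M?: abelian_group M
    for R (structure) and M (structure) +
  assumes smult_closed [simp, intro]:
      "\<lbrakk>a \<in> carrier R; x \<in> carrier M\<rbrakk> \<Longrightarrow> a \<odot>\<^bsub>M\<^esub> x \<in> carrier M"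
    and smult_l_distr:
      "\<lbrakk>a \<in> carrier R; b \<in> carrier R; x \<in> carrier M\<rbrakk> \<Longrightarrow>
        (a \<oplus> b) \<odot>\<^bsub>M\<^esub> x = a \<odot>\<^bsub>M\<^esub> x \<oplus>\<^bsub>M\<^esub> b \<odot>\<^bsub>M\<^esub> x"
    and smult_r_distr:
      "\<lbrakk>a \<in> carrier R; x \<in> carrier M; y \<in> carrier M\<rbrakk> \<Longrightarrow>
        a \<odot>\<^bsub>M\<^esub> (x \<oplus>\<^bsub>M\<^esub> y) = a \<odot>\<^bsub>M\<^esub> x \<oplus>\<^bsub>M\<^esub> a \<odot>\<^bsub>M\<^esub> y"
    and smult_assoc1:
      "\<lbrakk>a \<in> carrier R; b \<in> carrier R; x \<in> carrier M\<rbrakk> \<Longrightarrow>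
        (a \<otimes> b) \<odot>\<^bsub>M\<^esub> x = a \<odot>\<^bsub>M\<^esub> (b \<odot>\<^bsub>M\<^esub> x)"
    and smult_one [simp]:
      "x \<in> carrier M \<Longrightarrow> \<one> \<odot>\<^bsub>M\<^esub> x = x"

definition finitely_generated :: "('r, 'q) ring_scheme \<Rightarrow> ('r, 'm, 'w) module_scheme \<Rightarrow> bool" where
  "finitely_generated R M \<longleftrightarrow>
    (\<exists>S. finite S \<and> S \<subseteq> carrier M \<and>
      (\<forall>x \<in> carrier M. \<exists>c \<in> S \<rightarrow> carrier R. x = (\<Oplus>\<^bsub>M\<^esub>s\<in>S. c s \<odot>\<^bsub>M\<^esub> s)))"

definition module_hom ::
  "('r, 'q) ring_scheme \<Rightarrow> ('r, 'm, 'w) module_scheme \<Rightarrow> ('r, 'n, 'z) module_scheme \<Rightarrow> ('m \<Rightarrow> 'n) set"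
where
  "module_hom R M N = {f \<in> carrier M \<rightarrow> carrier N.
    (\<forall>x \<in> carrier M. \<forall>y \<in> carrier M. f (x \<oplus>\<^bsub>M\<^esub> y) = f x \<oplus>\<^bsub>N\<^esub> f y) \<and>
    (\<forall>r \<in> carrier R. \<forall>x \<in> carrier M. f (r \<odot>\<^bsub>M\<^esub> x) = r \<odot>\<^bsub>N\<^esub> f x)}"

definition module_isomorphic ::
  "('r, 'q) ring_scheme \<Rightarrow> ('r, 'm, 'w) module_scheme \<Rightarrow> ('r, 'n, 'z) module_scheme \<Rightarrow> bool"
where
  "module_isomorphic R M N \<longleftrightarrow> (\<exists>f \<in> module_hom R M N. bij_betw f (carrier M) (carrier N))"

definition hom_ker ::
  "('r, 'm, 'w) module_scheme \<Rightarrow> ('r, 'n, 'z) module_scheme \<Rightarrow> ('m \<Rightarrow> 'n) \<Rightarrow> 'm set" where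
  "hom_ker M N f = {x \<in> carrier M. f x = \<zero>\<^bsub>N\<^esub>}"

definition regular_module :: "('r, 'q) ring_scheme \<Rightarrow> ('r, 'r) module" where
  "regular_module R = \<lparr>carrier = carrier R, mult = mult R, one = \<one>\<^bsub>R\<^esub>,
     ring.zero = \<zero>\<^bsub>R\<^esub>, add = add R, smult = mult R\<rparr>"

text \<open>
  The quotient of a module by a submodule, and likewise the quotient of an algebra by a two-sided
  ideal: its ring structure is \<^term>\<open>M Quot N\<close>, and \<open>r \<odot> (N +> x) = N +> r \<odot> x\<close>.
\<close>

definition quot_module :: "('r, 'm, 'w) module_scheme \<Rightarrow> 'm set \<Rightarrow> ('r, 'm set) module" where
  "quot_module M N = \<lparr>carrier = carrier (M Quot N), mult = mult (M Quot N), one = one (M Quot N),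
     ring.zero = ring.zero (M Quot N), add = add (M Quot N),
     smult = (\<lambda>r U. \<Union>x\<in>U. N +>\<^bsub>M\<^esub> (r \<odot>\<^bsub>M\<^esub> x))\<rparr>"

text \<open>
  The index sets are finite wherever the following two definitions are used, as required for
  \<^const>\<open>finsum\<close>; the empty sum is the zero submodule.
\<close>

definition submodule_sum :: "('r, 'm, 'w) module_scheme \<Rightarrow> ('i \<Rightarrow> 'm set) \<Rightarrow> 'i set \<Rightarrow> 'm set" where
  "submodule_sum M N S = {(\<Oplus>\<^bsub>M\<^esub>i\<in>S. x i) | x. \<forall>i\<in>S. x i \<in> N i}"

definition sum_is_direct :: "('r, 'm, 'w) module_scheme \<Rightarrow> ('i \<Rightarrow> 'm set) \<Rightarrow> 'i set \<Rightarrow> bool" where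
  "sum_is_direct M N S \<longleftrightarrow>
    (\<forall>x. (\<forall>i\<in>S. x i \<in> N i) \<and> (\<Oplus>\<^bsub>M\<^esub>i\<in>S. x i) = \<zero>\<^bsub>M\<^esub> \<longrightarrow> (\<forall>i\<in>S. x i = \<zero>\<^bsub>M\<^esub>))"


section \<open>Finitely generated projective and Gorenstein-projective modules\<close>

text \<open>
  HOL cannot quantify over all modules over \<open>R\<close>, so a universe has to be fixed: the modules whose
  elements have type \<^typ>\<open>nat \<Rightarrow> 'r\<close>.  It contains every finitely generated \<open>R\<close>-module up to
  isomorphism: such a module is a quotient of some \<open>R\<^sup>n\<close>, and picking representatives identifies its
  elements with a subset of \<open>R\<^sup>n\<close>.  In particular, for a finitely generated \<open>P\<close>, it suffices to test
  the lifting property in this universe, which contains the surjections \<open>R\<^sup>n \<rightarrow> P\<close>.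
\<close>

definition fg_projective :: "('r, 'q) ring_scheme \<Rightarrow> ('r, 'm, 'w) module_scheme \<Rightarrow> bool" where
  "fg_projective R P \<longleftrightarrow> left_module R P \<and> finitely_generated R P \<and>
    (\<forall>(N :: ('r, nat \<Rightarrow> 'r) module) (N' :: ('r, nat \<Rightarrow> 'r) module) g f.
      left_module R N \<and> left_module R N' \<and>
      g \<in> module_hom R N N' \<and> g ` carrier N = carrier N' \<and> f \<in> module_hom R P N' \<longrightarrow>
      (\<exists>h \<in> module_hom R P N. \<forall>x \<in> carrier P. g (h x) = f x))"

definition gorenstein_projective :: "('r, 'q) ring_scheme \<Rightarrow> ('r, 'm, 'w) module_scheme \<Rightarrow> bool" where
  "gorenstein_projective R M \<longleftrightarrow> left_module R M \<and>
    (\<exists>(P :: int \<Rightarrow> ('r, nat \<Rightarrow> 'r) module) (d :: int \<Rightarrow> (nat \<Rightarrow> 'r) \<Rightarrow> (nat \<Rightarrow> 'r)).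
      (\<forall>i. fg_projective R (P i)) \<and>
      (\<forall>i. d i \<in> module_hom R (P i) (P (i + 1))) \<and>
      (\<forall>i. hom_ker (P (i + 1)) (P (i + 2)) (d (i + 1)) = d i ` carrier (P i)) \<and>
      (\<forall>i. \<forall>f \<in> module_hom R (P (i + 1)) (regular_module R).
        (\<forall>x \<in> carrier (P i). f (d i x) = \<zero>\<^bsub>R\<^esub>) \<longleftrightarrow>
        (\<exists>g \<in> module_hom R (P (i + 2)) (regular_module R).
          \<forall>x \<in> carrier (P (i + 1)). f x = g (d (i + 1) x))) \<and>
      module_isomorphic R M ((P 0)\<lparr>carrier := hom_ker (P 0) (P 1) (d 0)\<rparr>))"


section \<open>Finite-dimensional algebras and their tensor product\<close>

locale assoc_algebra = Module.module R M + ring M for R (structure) and M (structure) +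
  assumes smult_assoc2:
      "\<lbrakk>a \<in> carrier R; x \<in> carrier M; y \<in> carrier M\<rbrakk> \<Longrightarrow>
        (a \<odot>\<^bsub>M\<^esub> x) \<otimes>\<^bsub>M\<^esub> y = a \<odot>\<^bsub>M\<^esub> (x \<otimes>\<^bsub>M\<^esub> y)"
    and smult_assoc3:
      "\<lbrakk>a \<in> carrier R; x \<in> carrier M; y \<in> carrier M\<rbrakk> \<Longrightarrow>
        x \<otimes>\<^bsub>M\<^esub> (a \<odot>\<^bsub>M\<^esub> y) = a \<odot>\<^bsub>M\<^esub> (x \<otimes>\<^bsub>M\<^esub> y)"

locale fin_dim_algebra = assoc_algebra R M + field R for R (structure) and M (structure) +
  assumes finite_dimensional: "finitely_generated R M"

text \<open>
  The additive group of \<open>A \<otimes>\<^sub>k B\<close> is the quotient of the free abelian group on \<open>A \<times> B\<close> by the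
  subgroup generated by the bilinearity relations; the multiplication is induced by
  \<open>(a, b) (a', b') = (a a', b b')\<close>.
\<close>

definition pair_ring ::
  "('a, 'p) ring_scheme \<Rightarrow> ('b, 'q) ring_scheme \<Rightarrow> ('a \<times> 'b \<Rightarrow>\<^sub>0 int) ring"
where
  "pair_ring A B =
    \<lparr>carrier = carrier (free_Abelian_group (carrier A \<times> carrier B)),
     mult = (\<lambda>x y. frag_extend (\<lambda>(a, b). frag_extend (\<lambda>(a', b').
               frag_of (a \<otimes>\<^bsub>A\<^esub> a', b \<otimes>\<^bsub>B\<^esub> b')) y) x),
     one = frag_of (\<one>\<^bsub>A\<^esub>, \<one>\<^bsub>B\<^esub>), ring.zero = 0, add = (+)\<rparr>"

definition tensor_relations ::
  "('k, 'r) ring_scheme \<Rightarrow> ('k, 'a, 'p) module_scheme \<Rightarrow> ('k, 'b, 'q) module_scheme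
    \<Rightarrow> ('a \<times> 'b \<Rightarrow>\<^sub>0 int) set"
where
  "tensor_relations K A B =
     {frag_of (a \<oplus>\<^bsub>A\<^esub> a', b) - frag_of (a, b) - frag_of (a', b) | a a' b.
        a \<in> carrier A \<and> a' \<in> carrier A \<and> b \<in> carrier B}
   \<union> {frag_of (a, b \<oplus>\<^bsub>B\<^esub> b') - frag_of (a, b) - frag_of (a, b') | a b b'.
        a \<in> carrier A \<and> b \<in> carrier B \<and> b' \<in> carrier B}
   \<union> {frag_of (c \<odot>\<^bsub>A\<^esub> a, b) - frag_of (a, c \<odot>\<^bsub>B\<^esub> b) | c a b.
        c \<in> carrier K \<and> a \<in> carrier A \<and> b \<in> carrier B}"

definition tensor_kernel ::
  "('k, 'r) ring_scheme \<Rightarrow> ('k, 'a, 'p) module_scheme \<Rightarrow> ('k, 'b, 'q) module_scheme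
    \<Rightarrow> ('a \<times> 'b \<Rightarrow>\<^sub>0 int) set"
where
  "tensor_kernel K A B =
    generate (free_Abelian_group (carrier A \<times> carrier B)) (tensor_relations K A B)"

definition tensor_algebra ::
  "('k, 'r) ring_scheme \<Rightarrow> ('k, 'a, 'p) module_scheme \<Rightarrow> ('k, 'b, 'q) module_scheme
    \<Rightarrow> ('a \<times> 'b \<Rightarrow>\<^sub>0 int) set ring"
where
  "tensor_algebra K A B = pair_ring A B Quot tensor_kernel K A B"

definition pure_tensor ::
  "('k, 'r) ring_scheme \<Rightarrow> ('k, 'a, 'p) module_scheme \<Rightarrow> ('k, 'b, 'q) module_scheme
    \<Rightarrow> 'a \<Rightarrow> 'b \<Rightarrow> ('a \<times> 'b \<Rightarrow>\<^sub>0 int) set"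
where
  "pure_tensor K A B a b = tensor_kernel K A B +>\<^bsub>pair_ring A B\<^esub> frag_of (a, b)"


section \<open>Path algebras with monomial relations\<close>

text \<open>
  A quiver is a \<^locale>\<open>fin_digraph\<close> (parallel arrows and loops are allowed there).  A path is a pair
  of its starting vertex and the list of its arrows in the order in which they are traversed; thus
  the path \<open>\<alpha>\<^sub>l \<cdots> \<alpha>\<^sub>1\<close>, written from right to left, has the list \<open>[\<alpha>\<^sub>1, \<dots>, \<alpha>\<^sub>l]\<close>.
\<close>

type_synonym ('v, 'e) path = "'v \<times> 'e list"

definition acyclic_quiver :: "('v, 'e) pre_digraph \<Rightarrow> bool" where
  "acyclic_quiver Q \<longleftrightarrow> (\<nexists>c. pre_digraph.cycle Q c)"

definition paths :: "('v, 'e) pre_digraph \<Rightarrow> ('v, 'e) path set" where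
  "paths Q = {(u, es). \<exists>v. pre_digraph.awalk Q u es v}"

definition path_start :: "('v, 'e) path \<Rightarrow> 'v" where
  "path_start p = fst p"

definition path_end :: "('v, 'e) pre_digraph \<Rightarrow> ('v, 'e) path \<Rightarrow> 'v" where
  "path_end Q p = last (pre_digraph.awalk_verts Q (fst p) (snd p))"

definition path_length :: "('v, 'e) path \<Rightarrow> nat" where
  "path_length p = length (snd p)"

definition trivial_path :: "'v \<Rightarrow> ('v, 'e) path" where
  "trivial_path i = (i, [])"

definition arrow_path :: "('v, 'e) pre_digraph \<Rightarrow> 'e \<Rightarrow> ('v, 'e) path" where
  "arrow_path Q \<alpha> = (tail Q \<alpha>, [\<alpha>])"

text \<open>The path \<open>p q\<close> (first \<open>q\<close>, then \<open>p\<close>), meaningful if \<open>q\<close> ends where \<open>p\<close> starts.\<close>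

definition path_comp :: "('v, 'e) path \<Rightarrow> ('v, 'e) path \<Rightarrow> ('v, 'e) path" where
  "path_comp p q = (fst q, snd q @ snd p)"

text \<open>
  Elements of \<open>kQ\<close> are the finitely supported coefficient functions on paths.  The coefficient of
  \<open>f g\<close> at a path is the sum over all ways of cutting it into an initial part, whose coefficient is
  taken in \<open>g\<close>, and a remaining part, whose coefficient is taken in \<open>f\<close>.
\<close>

definition path_algebra ::
  "('k, 'r) ring_scheme \<Rightarrow> ('v, 'e) pre_digraph \<Rightarrow> ('k, ('v, 'e) path \<Rightarrow> 'k) module"
where
  "path_algebra K Q =
    \<lparr>carrier = {f. range f \<subseteq> carrier K \<and>
                   {p. f p \<noteq> \<zero>\<^bsub>K\<^esub>} \<subseteq> paths Q \<and> finite {p. f p \<noteq> \<zero>\<^bsub>K\<^esub>}},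
     mult = (\<lambda>f g (u, es). \<Oplus>\<^bsub>K\<^esub>i\<in>{..length es}.
               f (path_end Q (u, take i es), drop i es) \<otimes>\<^bsub>K\<^esub> g (u, take i es)),
     one = (\<lambda>(u, es). if u \<in> verts Q \<and> es = [] then \<one>\<^bsub>K\<^esub> else \<zero>\<^bsub>K\<^esub>),
     ring.zero = (\<lambda>p. \<zero>\<^bsub>K\<^esub>),
     add = (\<lambda>f g p. f p \<oplus>\<^bsub>K\<^esub> g p),
     smult = (\<lambda>c f p. c \<otimes>\<^bsub>K\<^esub> f p)\<rparr>"

definition path_elem :: "('k, 'r) ring_scheme \<Rightarrow> ('v, 'e) path \<Rightarrow> ('v, 'e) path \<Rightarrow> 'k" where
  "path_elem K p = (\<lambda>q. if q = p then \<one>\<^bsub>K\<^esub> else \<zero>\<^bsub>K\<^esub>)"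

definition relation_ideal ::
  "('k, 'r) ring_scheme \<Rightarrow> ('v, 'e) pre_digraph \<Rightarrow> ('v, 'e) path set \<Rightarrow> (('v, 'e) path \<Rightarrow> 'k) set"
where
  "relation_ideal K Q \<rho> = Idl\<^bsub>path_algebra K Q\<^esub> (path_elem K ` \<rho>)"

definition nonzero_path ::
  "('k, 'r) ring_scheme \<Rightarrow> (('v, 'e) path \<Rightarrow> 'k) set \<Rightarrow> ('v, 'e) path \<Rightarrow> bool"
where
  "nonzero_path K I p \<longleftrightarrow> path_elem K p \<notin> I"

definition K_paths ::
  "('k, 'r) ring_scheme \<Rightarrow> ('v, 'e) pre_digraph \<Rightarrow> (('v, 'e) path \<Rightarrow> 'k) set
    \<Rightarrow> ('v, 'e) path \<Rightarrow> ('v, 'e) path set"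
where
  "K_paths K Q I p = {q \<in> paths Q. path_end Q q = path_start p \<and> path_length q \<ge> 1 \<and>
     nonzero_path K I q \<and> \<not> nonzero_path K I (path_comp p q)}"


section \<open>Representations and monic representations\<close>

record ('v, 'e, 'a, 'm) quiver_rep =
  rep_space :: "'v \<Rightarrow> ('a, 'm) module"
  rep_map :: "'e \<Rightarrow> 'm \<Rightarrow> 'm"

definition rep_path :: "('v, 'e, 'a, 'm) quiver_rep \<Rightarrow> ('v, 'e) path \<Rightarrow> 'm \<Rightarrow> 'm" where
  "rep_path X p = fold (rep_map X) (snd p)"

definition rep_path_image :: "('v, 'e, 'a, 'm) quiver_rep \<Rightarrow> ('v, 'e) path \<Rightarrow> 'm set" where
  "rep_path_image X p = rep_path X p ` carrier (rep_space X (path_start p))"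

text \<open>
  For \<open>I\<close> generated by a set \<open>\<rho>\<close> of paths, a path lies in \<open>I\<close> iff it contains a path from \<open>\<rho>\<close>; so
  the last condition below says that the relations in \<open>\<rho>\<close> are satisfied, for any choice of \<open>\<rho>\<close>.
\<close>

definition quiver_representation ::
  "('k, 'r) ring_scheme \<Rightarrow> ('a, 's) ring_scheme \<Rightarrow> ('v, 'e) pre_digraph
    \<Rightarrow> (('v, 'e) path \<Rightarrow> 'k) set \<Rightarrow> ('v, 'e, 'a, 'm) quiver_rep \<Rightarrow> bool"
where
  "quiver_representation K A Q I X \<longleftrightarrow>
    (\<forall>i \<in> verts Q. left_module A (rep_space X i) \<and> finitely_generated A (rep_space X i)) \<and>
    (\<forall>\<alpha> \<in> arcs Q. rep_map X \<alpha> \<in>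
       module_hom A (rep_space X (tail Q \<alpha>)) (rep_space X (head Q \<alpha>))) \<and>
    (\<forall>p \<in> paths Q. \<not> nonzero_path K I p \<longrightarrow>
       (\<forall>x \<in> carrier (rep_space X (path_start p)).
         rep_path X p x = \<zero>\<^bsub>rep_space X (path_end Q p)\<^esub>))"

text \<open>The sum of the images of the maps at the arrows ending in \<open>i\<close>.\<close>

definition rep_radical ::
  "('v, 'e) pre_digraph \<Rightarrow> ('v, 'e, 'a, 'm) quiver_rep \<Rightarrow> 'v \<Rightarrow> 'm set"
where
  "rep_radical Q X i =
    submodule_sum (rep_space X i) (\<lambda>\<alpha>. rep_path_image X (arrow_path Q \<alpha>)) (in_arcs Q i)"

definition monic_rep ::
  "('k, 'r) ring_scheme \<Rightarrow> ('a, 's) ring_scheme \<Rightarrow> ('v, 'e) pre_digraph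
    \<Rightarrow> (('v, 'e) path \<Rightarrow> 'k) set \<Rightarrow> ('v, 'e, 'a, 'm) quiver_rep \<Rightarrow> bool"
where
  "monic_rep K A Q I X \<longleftrightarrow> quiver_representation K A Q I X \<and>
    (\<forall>i \<in> verts Q.
      sum_is_direct (rep_space X i) (\<lambda>\<alpha>. rep_path_image X (arrow_path Q \<alpha>)) (in_arcs Q i)) \<and>
    (\<forall>\<alpha> \<in> arcs Q.
      hom_ker (rep_space X (tail Q \<alpha>)) (rep_space X (head Q \<alpha>)) (rep_map X \<alpha>) =
      submodule_sum (rep_space X (tail Q \<alpha>)) (rep_path_image X) (K_paths K Q I (arrow_path Q \<alpha>)))"

text \<open>
  The algebra \<open>\<Lambda> = A \<otimes>\<^sub>k kQ/I\<close> and the identification of its modules with representations: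
  \<open>X\<^sub>i = (1 \<otimes> e\<^sub>i) X\<close>, with \<open>a \<in> A\<close> acting as \<open>a \<otimes> 1\<close>, and \<open>X\<^sub>\<alpha>\<close> is the action of \<open>1 \<otimes> \<alpha>\<close>.
\<close>

definition bound_quiver_algebra ::
  "('k, 'r) ring_scheme \<Rightarrow> ('v, 'e) pre_digraph \<Rightarrow> (('v, 'e) path \<Rightarrow> 'k) set
    \<Rightarrow> ('k, (('v, 'e) path \<Rightarrow> 'k) set) module"
where
  "bound_quiver_algebra K Q I = quot_module (path_algebra K Q) I"

definition path_class ::
  "('k, 'r) ring_scheme \<Rightarrow> ('v, 'e) pre_digraph \<Rightarrow> (('v, 'e) path \<Rightarrow> 'k) set
    \<Rightarrow> ('v, 'e) path \<Rightarrow> (('v, 'e) path \<Rightarrow> 'k) set"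
where
  "path_class K Q I p = I +>\<^bsub>path_algebra K Q\<^esub> path_elem K p"

definition Lambda_algebra ::
  "('k, 'r) ring_scheme \<Rightarrow> ('k, 'a, 's) module_scheme \<Rightarrow> ('v, 'e) pre_digraph
    \<Rightarrow> (('v, 'e) path \<Rightarrow> 'k) set \<Rightarrow> ('a \<times> (('v, 'e) path \<Rightarrow> 'k) set \<Rightarrow>\<^sub>0 int) set ring"
where
  "Lambda_algebra K A Q I = tensor_algebra K A (bound_quiver_algebra K Q I)"

definition rep_of_module ::
  "('k, 'r) ring_scheme \<Rightarrow> ('k, 'a, 's) module_scheme \<Rightarrow> ('v, 'e) pre_digraph
    \<Rightarrow> (('v, 'e) path \<Rightarrow> 'k) set
    \<Rightarrow> (('a \<times> (('v, 'e) path \<Rightarrow> 'k) set \<Rightarrow>\<^sub>0 int) set, 'm, 'w) module_scheme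
    \<Rightarrow> ('v, 'e, 'a, 'm) quiver_rep"
where
  "rep_of_module K A Q I M =
    (let B = bound_quiver_algebra K Q I in
     \<lparr>rep_space = (\<lambda>i.
        \<lparr>carrier = (\<lambda>x. pure_tensor K A B \<one>\<^bsub>A\<^esub> (path_class K Q I (trivial_path i)) \<odot>\<^bsub>M\<^esub> x) ` carrier M,
         mult = mult M, one = one M, ring.zero = ring.zero M, add = add M,
         smult = (\<lambda>a x. pure_tensor K A B a \<one>\<^bsub>B\<^esub> \<odot>\<^bsub>M\<^esub> x)\<rparr>),
      rep_map = (\<lambda>\<alpha> x. pure_tensor K A B \<one>\<^bsub>A\<^esub> (path_class K Q I (arrow_path Q \<alpha>)) \<odot>\<^bsub>M\<^esub> x)\<rparr>)"

end

theory Submission imports Defs begin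

text \<open>
 \<open>\<Lambda>\<close> is a free left \<open>A\<close>-module on the set \<open>N\<close> of non-zero paths, which commute with \<open>A\<close> and are
 multiplied by concatenation; nothing else about \<open>\<Lambda>\<close> matters.  A \<open>\<Lambda>\<close>-module \<open>M\<close> is monic iff it is flat with
 respect to paths: for every path \<open>p\<close> and every right ideal \<open>J\<close> of paths, \<open>p x \<in> J M\<close> forces \<open>x \<in> (J : p) M\<close>.
 Projective modules are flat, and so are the cycles of a complete resolution.  Taking the top at a vertex sends
 complete resolutions over \<open>\<Lambda>\<close> to complete resolutions over \<open>A\<close> (by induction over the acyclic quiver), and for flat
 \<open>M\<close> each \<open>e\<^sub>v M\<close> is filtered by tops of \<open>M\<close>, which gives necessity.  Conversely, ordering the vertices by height
 filters a flat \<open>M\<close> with subquotients \<open>\<Lambda> e\<^sub>w \<otimes> T\<^sub>w\<close>, where \<open>T\<^sub>w\<close> is the top of \<open>M\<close> at \<open>w\<close>; these are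
 Gorenstein-projective if the tops are, and Gorenstein-projective modules are closed under extensions.
\<close>

text \<open>A right ideal J of paths is dismantled by deleting a shortest path p: nontrivial right
  multiples of p are longer and stay in J, and flatness identifies what is lost from J M with the
  top of M at the start of p. That start lies strictly lower than the end, so exactness of J P and
  of tops climbs the quiver. The dual statement descends. An A-functional on the top at v lifts to a
  functional into \<Lambda> that need not kill boundaries; its error takes values in the left ideal
  of nontrivial paths from v, and the ends of these paths lie strictly higher.

  The formal obstacle is the universe. A complete resolution has to consist of functions on nat with
  values in the ring, whereas tops are made of cosets and extensions of pairs. Projectivity is
  therefore expressed by finite dual bases: their coordinates carry any complete resolution into
  that universe, and they pass through direct sums, tops and induction. Maps on modules whose
  elements have no unique decomposition are given by their graphs.\<close>

abbreviation (input) zero_sub ("\<zero>\<^sub>_" [1000] 1000) where "\<zero>\<^sub>M \<equiv> ring.zero M"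
abbreviation (input) one_sub ("\<one>\<^sub>_" [1000] 1000) where "\<one>\<^sub>M \<equiv> monoid.one M"
abbreviation (input) add_sub ("(_ \<oplus>\<^sub>_ _)" [65, 1000, 66] 65) where "x \<oplus>\<^sub>M y \<equiv> ring.add M x y"
abbreviation (input) mult_sub ("(_ \<otimes>\<^sub>_ _)" [70, 1000, 71] 70) where "x \<otimes>\<^sub>M y \<equiv> monoid.mult M x y"
abbreviation (input) smult_sub ("(_ \<odot>\<^sub>_ _)" [70, 1000, 71] 70) where "x \<odot>\<^sub>M y \<equiv> module.smult M x y"
abbreviation (input) minus_sub ("(_ \<ominus>\<^sub>_ _)" [65, 1000, 66] 65) where "x \<ominus>\<^sub>M y \<equiv> a_minus M x y"
abbreviation (input) uminus_sub ("(\<ominus>\<^sub>_ _)" [1000, 81] 80) where "\<ominus>\<^sub>M x \<equiv> a_inv M x"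
syntax "_finsum_sub" :: "'m \<Rightarrow> idt \<Rightarrow> 'i set \<Rightarrow> 'a \<Rightarrow> 'a"  ("(3\<Oplus>\<^sub>_ _\<in>_. _)" [1000, 0, 51, 10] 10)
translations "\<Oplus>\<^sub>M i\<in>S. x" \<rightharpoonup> "CONST finsum M (\<lambda>i. x) S"

abbreviation (input) "dual R M \<equiv> module_hom R M (regular_module R)"

section \<open>Modules and homomorphisms\<close>

context left_module
begin

lemma smult_r_null [simp]: "a \<in> carrier R \<Longrightarrow> a \<odot>\<^sub>M \<zero>\<^sub>M = \<zero>\<^sub>M"
proof -
 assume a: "a \<in> carrier R"
 have "a \<odot>\<^sub>M \<zero>\<^sub>M \<oplus>\<^sub>M a \<odot>\<^sub>M \<zero>\<^sub>M = a \<odot>\<^sub>M \<zero>\<^sub>M \<oplus>\<^sub>M \<zero>\<^sub>M"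
  using a smult_r_distr[of a "\<zero>\<^sub>M" "\<zero>\<^sub>M"] by simp
 then show ?thesis using a by (simp del: M.r_zero)
qed

lemma smult_l_null [simp]: "x \<in> carrier M \<Longrightarrow> \<zero> \<odot>\<^sub>M x = \<zero>\<^sub>M"
proof -
 assume x: "x \<in> carrier M"
 have "\<zero> \<odot>\<^sub>M x \<oplus>\<^sub>M \<zero> \<odot>\<^sub>M x = \<zero> \<odot>\<^sub>M x \<oplus>\<^sub>M \<zero>\<^sub>M"
  using x smult_l_distr[of \<zero> \<zero> x] by simp
 then show ?thesis using x by (simp del: M.r_zero)
qed

lemma smult_minus_one: "x \<in> carrier M \<Longrightarrow> (\<ominus> \<one>) \<odot>\<^sub>M x = \<ominus>\<^sub>M x"
proof -
 assume x: "x \<in> carrier M"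
 have "(\<ominus> \<one>) \<odot>\<^sub>M x \<oplus>\<^sub>M x = \<zero>\<^sub>M"
  using x smult_l_distr[of "\<ominus> \<one>" \<one> x] by (simp add: R.l_neg)
 then show ?thesis using x by (simp add: M.minus_equality)
qed

lemma smult_finsum:
 "finite S \<Longrightarrow> a \<in> carrier R \<Longrightarrow> f \<in> S \<rightarrow> carrier M \<Longrightarrow>
  a \<odot>\<^sub>M (\<Oplus>\<^sub>M i\<in>S. f i) = (\<Oplus>\<^sub>M i\<in>S. a \<odot>\<^sub>M f i)"
 by (induction S rule: finite_induct) (auto simp: smult_r_distr Pi_iff)

end

lemma module_homI:
 assumes "\<And>x. x \<in> carrier M \<Longrightarrow> f x \<in> carrier N"
  and "\<And>x y. x \<in> carrier M \<Longrightarrow> y \<in> carrier M \<Longrightarrow> f (x \<oplus>\<^sub>M y) = f x \<oplus>\<^sub>N f y"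
  and "\<And>r x. r \<in> carrier R \<Longrightarrow> x \<in> carrier M \<Longrightarrow> f (r \<odot>\<^sub>M x) = r \<odot>\<^sub>N f x"
 shows "f \<in> module_hom R M N"
 using assms by (auto simp: module_hom_def)

lemma module_homD:
 assumes "f \<in> module_hom R M N"
 shows hom_closed: "x \<in> carrier M \<Longrightarrow> f x \<in> carrier N"
  and hom_add: "x \<in> carrier M \<Longrightarrow> y \<in> carrier M \<Longrightarrow> f (x \<oplus>\<^sub>M y) = f x \<oplus>\<^sub>N f y"
  and hom_smult: "r \<in> carrier R \<Longrightarrow> x \<in> carrier M \<Longrightarrow> f (r \<odot>\<^sub>M x) = r \<odot>\<^sub>N f x"
 using assms by (auto simp: module_hom_def)

lemma dual_closed: "f \<in> dual R M \<Longrightarrow> x \<in> carrier M \<Longrightarrow> f x \<in> carrier R"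
 by (auto simp: module_hom_def regular_module_def)

lemma hom_zero:
 assumes "left_module R M" "left_module R N" "f \<in> module_hom R M N"
 shows "f \<zero>\<^sub>M = \<zero>\<^sub>N"
proof -
 interpret M: left_module R M by fact
 interpret N: left_module R N by fact
 have "f (\<zero>\<^sub>R \<odot>\<^sub>M \<zero>\<^sub>M) = \<zero>\<^sub>R \<odot>\<^sub>N f \<zero>\<^sub>M"
  by (rule hom_smult[OF assms(3)]) auto
 then show ?thesis using hom_closed[OF assms(3), of "\<zero>\<^sub>M"] by simp
qed

lemma hom_minus:
 assumes "left_module R M" "left_module R N" "f \<in> module_hom R M N" "x \<in> carrier M"
 shows "f (\<ominus>\<^sub>M x) = \<ominus>\<^sub>N f x"
proof -
 interpret M: left_module R M by fact
 interpret N: left_module R N by fact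
 have "f ((\<ominus>\<^sub>R \<one>\<^sub>R) \<odot>\<^sub>M x) = (\<ominus>\<^sub>R \<one>\<^sub>R) \<odot>\<^sub>N f x"
  by (rule hom_smult[OF assms(3)]) (auto simp: assms)
 then show ?thesis
  using hom_closed[OF assms(3,4)] assms(4) by (simp add: M.smult_minus_one N.smult_minus_one)
qed

lemma hom_diff:
 assumes "left_module R M" "left_module R N" "f \<in> module_hom R M N" "x \<in> carrier M" "y \<in> carrier M"
 shows "f (x \<ominus>\<^sub>M y) = f x \<ominus>\<^sub>N f y"
proof -
 interpret M: left_module R M by fact
 show ?thesis
  using assms by (simp add: a_minus_def hom_add[OF assms(3)] hom_minus[OF assms(1-3)])
qed

lemma hom_finsum:
 assumes "left_module R M" "left_module R N" "f \<in> module_hom R M N" "finite S" "g \<in> S \<rightarrow> carrier M"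
 shows "f (\<Oplus>\<^sub>M i\<in>S. g i) = (\<Oplus>\<^sub>N i\<in>S. f (g i))"
proof -
 interpret M: left_module R M by fact
 interpret N: left_module R N by fact
 show ?thesis
  using assms(4,5)
  by (induction S rule: finite_induct)
   (auto simp: hom_zero[OF assms(1-3)] hom_add[OF assms(3)] hom_closed[OF assms(3)] Pi_iff)
qed

lemma hom_comp:
 assumes "f \<in> module_hom R M N" "g \<in> module_hom R N P"
 shows "(\<lambda>x. g (f x)) \<in> module_hom R M P"
 using assms by (auto simp: module_hom_def Pi_iff)

lemma hom_plus:
 assumes "left_module R N" "f \<in> module_hom R M N" "g \<in> module_hom R M N"
 shows "(\<lambda>x. f x \<oplus>\<^sub>N g x) \<in> module_hom R M N"
proof -
 interpret N: left_module R N by fact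
 show ?thesis
  using assms(2,3)
  by (intro module_homI) (auto simp: module_hom_def Pi_iff N.smult_r_distr N.M.add.m_ac)
qed

lemma hom_uminus:
 assumes "left_module R N" "f \<in> module_hom R M N"
 shows "(\<lambda>x. \<ominus>\<^sub>N f x) \<in> module_hom R M N"
proof -
 interpret N: left_module R N by fact
 have *: "r \<odot>\<^sub>N (\<ominus>\<^sub>N x) = \<ominus>\<^sub>N (r \<odot>\<^sub>N x)" if "r \<in> carrier R" "x \<in> carrier N" for r x
 proof -
  have "r \<odot>\<^sub>N (\<ominus>\<^sub>N x) \<oplus>\<^sub>N r \<odot>\<^sub>N x = \<zero>\<^sub>N"
   using that N.smult_r_distr[of r "\<ominus>\<^sub>N x" x] by (simp add: N.M.l_neg)
  then show ?thesis using that by (simp add: N.M.minus_equality)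
 qed
 show ?thesis
  using assms(2)
  by (intro module_homI) (auto simp: module_hom_def Pi_iff N.M.minus_add *)
qed

lemma hom_zero_map:
 assumes "left_module R N"
 shows "(\<lambda>x. \<zero>\<^sub>N) \<in> module_hom R M N"
proof -
 interpret N: left_module R N by fact
 show ?thesis by (intro module_homI) auto
qed

lemma hom_sum:
 assumes "left_module R N" "finite S" "\<And>i. i \<in> S \<Longrightarrow> f i \<in> module_hom R M N"
 shows "(\<lambda>x. \<Oplus>\<^sub>N i\<in>S. f i x) \<in> module_hom R M N"
proof -
 interpret N: left_module R N by fact
 note cl = hom_closed[OF assms(3)]
 show ?thesis
 proof (intro module_homI)
  show "(\<Oplus>\<^sub>N i\<in>S. f i x) \<in> carrier N" if "x \<in> carrier M" for x
   using that cl by auto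
  show "(\<Oplus>\<^sub>N i\<in>S. f i (x \<oplus>\<^sub>M y)) = (\<Oplus>\<^sub>N i\<in>S. f i x) \<oplus>\<^sub>N (\<Oplus>\<^sub>N i\<in>S. f i y)"
   if "x \<in> carrier M" "y \<in> carrier M" for x y
  proof -
   have "(\<Oplus>\<^sub>N i\<in>S. f i (x \<oplus>\<^sub>M y)) = (\<Oplus>\<^sub>N i\<in>S. f i x \<oplus>\<^sub>N f i y)"
    using that cl hom_add[OF assms(3)] by (intro N.M.finsum_cong') auto
   then show ?thesis using that cl by simp
  qed
  show "(\<Oplus>\<^sub>N i\<in>S. f i (r \<odot>\<^sub>M x)) = r \<odot>\<^sub>N (\<Oplus>\<^sub>N i\<in>S. f i x)"
   if "r \<in> carrier R" "x \<in> carrier M" for r x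
   using that cl hom_smult[OF assms(3)] assms(2)
   by (subst N.smult_finsum) (auto intro!: N.M.finsum_cong')
 qed
qed

lemma regular_module_simps [simp]:
 "carrier (regular_module R) = carrier R" "\<zero>\<^bsub>regular_module R\<^esub> = \<zero>\<^sub>R"
 "x \<oplus>\<^bsub>regular_module R\<^esub> y = x \<oplus>\<^sub>R y" "x \<odot>\<^bsub>regular_module R\<^esub> y = x \<otimes>\<^sub>R y"
 by (simp_all add: regular_module_def)

text \<open>The scalar \<open>\<ominus>\<^sub>R \<one>\<^sub>R\<close> supplies additive inverses,
  so a module is recognised without naming them. The price is the last hypothesis: without
  cancellation, distributivity alone does not make zero times x vanish.\<close>

lemma left_moduleI:
 assumes "ring R"
  and "\<And>x y. x \<in> carrier M \<Longrightarrow> y \<in> carrier M \<Longrightarrow> x \<oplus>\<^sub>M y \<in> carrier M"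
  and "\<zero>\<^sub>M \<in> carrier M"
  and "\<And>x y z. x \<in> carrier M \<Longrightarrow> y \<in> carrier M \<Longrightarrow> z \<in> carrier M \<Longrightarrow>
   (x \<oplus>\<^sub>M y) \<oplus>\<^sub>M z = x \<oplus>\<^sub>M (y \<oplus>\<^sub>M z)"
  and "\<And>x y. x \<in> carrier M \<Longrightarrow> y \<in> carrier M \<Longrightarrow> x \<oplus>\<^sub>M y = y \<oplus>\<^sub>M x"
  and "\<And>x. x \<in> carrier M \<Longrightarrow> \<zero>\<^sub>M \<oplus>\<^sub>M x = x"
  and "\<And>a x. a \<in> carrier R \<Longrightarrow> x \<in> carrier M \<Longrightarrow> a \<odot>\<^sub>M x \<in> carrier M"
  and "\<And>a b x. a \<in> carrier R \<Longrightarrow> b \<in> carrier R \<Longrightarrow> x \<in> carrier M \<Longrightarrow>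
   (a \<oplus>\<^sub>R b) \<odot>\<^sub>M x = a \<odot>\<^sub>M x \<oplus>\<^sub>M b \<odot>\<^sub>M x"
  and "\<And>a x y. a \<in> carrier R \<Longrightarrow> x \<in> carrier M \<Longrightarrow> y \<in> carrier M \<Longrightarrow>
   a \<odot>\<^sub>M (x \<oplus>\<^sub>M y) = a \<odot>\<^sub>M x \<oplus>\<^sub>M a \<odot>\<^sub>M y"
  and "\<And>a b x. a \<in> carrier R \<Longrightarrow> b \<in> carrier R \<Longrightarrow> x \<in> carrier M \<Longrightarrow>
   (a \<otimes>\<^sub>R b) \<odot>\<^sub>M x = a \<odot>\<^sub>M (b \<odot>\<^sub>M x)"
  and "\<And>x. x \<in> carrier M \<Longrightarrow> \<one>\<^sub>R \<odot>\<^sub>M x = x"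
  and "\<And>x. x \<in> carrier M \<Longrightarrow> \<zero>\<^sub>R \<odot>\<^sub>M x = \<zero>\<^sub>M"
 shows "left_module R M"
proof -
 interpret R: ring R by fact
 have "\<exists>y\<in>carrier M. y \<oplus>\<^sub>M x = \<zero>\<^sub>M" if x: "x \<in> carrier M" for x
 proof
  show "(\<ominus>\<^sub>R \<one>\<^sub>R) \<odot>\<^sub>M x \<in> carrier M" using x assms(7) by auto
  have "(\<ominus>\<^sub>R \<one>\<^sub>R) \<odot>\<^sub>M x \<oplus>\<^sub>M x = (\<ominus>\<^sub>R \<one>\<^sub>R \<oplus>\<^sub>R \<one>\<^sub>R) \<odot>\<^sub>M x"
   using x assms(8)[of "\<ominus>\<^sub>R \<one>\<^sub>R" "\<one>\<^sub>R" x] assms(11) by auto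
  then show "(\<ominus>\<^sub>R \<one>\<^sub>R) \<odot>\<^sub>M x \<oplus>\<^sub>M x = \<zero>\<^sub>M" using x assms(12) by (simp add: R.l_neg)
 qed
 then have "abelian_group M" using assms by (intro abelian_groupI) auto
 then show ?thesis
  using assms by (intro left_module.intro left_module_axioms.intro) auto
qed

lemma left_module_regular:
 assumes "ring R" shows "left_module R (regular_module R)"
proof -
 interpret R: ring R by fact
 show ?thesis
  by (rule left_moduleI[OF assms])
   (auto simp: R.add.m_ac R.l_distr R.r_distr R.m_assoc)
qed

text \<open>The axioms are equations, hence pass to any structure that is the image of a module
  under an operation-preserving map. This serves quotients and also carriers that consist of chosen
  representatives.\<close>

lemma surj_left_module:
 assumes "left_module R M" and surj: "\<pi> ` carrier M = carrier T"
  and add: "\<And>x y. x \<in> carrier M \<Longrightarrow> y \<in> carrier M \<Longrightarrow> \<pi> (x \<oplus>\<^sub>M y) = \<pi> x \<oplus>\<^sub>T \<pi> y"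
  and smult: "\<And>r x. r \<in> carrier R \<Longrightarrow> x \<in> carrier M \<Longrightarrow> \<pi> (r \<odot>\<^sub>M x) = r \<odot>\<^sub>T \<pi> x"
  and zero: "\<pi> \<zero>\<^sub>M = \<zero>\<^sub>T"
 shows "left_module R T"
proof -
 interpret M: left_module R M by fact
 have ex: "\<exists>x\<in>carrier M. t = \<pi> x" if "t \<in> carrier T" for t using surj that by blast
 have cl: "\<pi> x \<in> carrier T" if "x \<in> carrier M" for x using surj that by blast
 note s = add[symmetric] smult[symmetric] zero[symmetric] cl
 show ?thesis
 proof (rule left_moduleI)
  show "ring R" by (rule M.R.ring_axioms)
 next
  fix a b x assume "a \<in> carrier R" "b \<in> carrier R" "x \<in> carrier T"
  then show "(a \<oplus>\<^sub>R b) \<odot>\<^sub>T x = a \<odot>\<^sub>T x \<oplus>\<^sub>T b \<odot>\<^sub>T x"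
   using M.smult_l_distr by (auto dest!: ex simp: s)
 next
  fix a x y assume "a \<in> carrier R" "x \<in> carrier T" "y \<in> carrier T"
  then show "a \<odot>\<^sub>T (x \<oplus>\<^sub>T y) = a \<odot>\<^sub>T x \<oplus>\<^sub>T a \<odot>\<^sub>T y"
   using M.smult_r_distr by (auto dest!: ex simp: s)
 next
  fix a b x assume "a \<in> carrier R" "b \<in> carrier R" "x \<in> carrier T"
  then show "(a \<otimes>\<^sub>R b) \<odot>\<^sub>T x = a \<odot>\<^sub>T (b \<odot>\<^sub>T x)"
   using M.smult_assoc1 by (auto dest!: ex simp: s)
 qed (auto dest!: ex simp: s M.M.add.m_ac)
qed

section \<open>Submodules, and homomorphisms given by their graphs\<close>

definition submod :: "('r, 'q) ring_scheme \<Rightarrow> ('r, 'm, 'w) module_scheme \<Rightarrow> 'm set \<Rightarrow> bool" where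
 "submod R M H \<longleftrightarrow> H \<subseteq> carrier M \<and> \<zero>\<^sub>M \<in> H \<and> (\<forall>x\<in>H. \<forall>y\<in>H. x \<oplus>\<^sub>M y \<in> H) \<and>
  (\<forall>r\<in>carrier R. \<forall>x\<in>H. r \<odot>\<^sub>M x \<in> H)"

lemma left_module_submod:
 assumes "left_module R M" "submod R M H"
 shows "left_module R (M\<lparr>carrier := H\<rparr>)"
proof -
 interpret M: left_module R M by fact
 have H: "x \<in> carrier M" if "x \<in> H" for x using that assms(2) by (auto simp: submod_def)
 show ?thesis
  using assms(2)
  by (intro left_moduleI)
   (auto simp: submod_def H M.R.ring_axioms M.M.add.m_ac M.smult_l_distr
    M.smult_r_distr M.smult_assoc1)
qed

lemma submod_minus:
 assumes "left_module R M" "submod R M H" "x \<in> H"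
 shows "\<ominus>\<^sub>M x \<in> H"
proof -
 interpret M: left_module R M by fact
 have "(\<ominus>\<^sub>R \<one>\<^sub>R) \<odot>\<^sub>M x \<in> H" using assms by (auto simp: submod_def)
 moreover have "x \<in> carrier M" using assms by (auto simp: submod_def)
 ultimately show ?thesis by (simp add: M.smult_minus_one)
qed

lemma submod_ker:
 assumes "left_module R M" "left_module R N" "f \<in> module_hom R M N"
 shows "submod R M (hom_ker M N f)"
proof -
 interpret M: left_module R M by fact
 interpret N: left_module R N by fact
 show ?thesis
  by (auto simp: submod_def hom_ker_def hom_zero[OF assms] hom_add[OF assms(3)] hom_smult[OF assms(3)])
qed

text \<open>Subtracting two pairs over the same element gives a pair over zero, so single-valuedness
  has to be checked only there. The conclusion keeps the whole graph, so that kernel and image of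
  the map can be read off from the relation.\<close>

lemma rel_hom:
 assumes "left_module R E" "left_module R N"
  and dom: "\<And>e n. Q e n \<Longrightarrow> e \<in> carrier E \<and> n \<in> carrier N"
  and tot: "\<And>e. e \<in> carrier E \<Longrightarrow> \<exists>n. Q e n"
  and add: "\<And>e e' n n'. Q e n \<Longrightarrow> Q e' n' \<Longrightarrow> Q (e \<oplus>\<^sub>E e') (n \<oplus>\<^sub>N n')"
  and smult: "\<And>r e n. r \<in> carrier R \<Longrightarrow> Q e n \<Longrightarrow> Q (r \<odot>\<^sub>E e) (r \<odot>\<^sub>N n)"
  and zero: "\<And>n. Q \<zero>\<^sub>E n \<Longrightarrow> n = \<zero>\<^sub>N"
 shows "\<exists>h \<in> module_hom R E N. \<forall>e n. Q e n \<longleftrightarrow> e \<in> carrier E \<and> n = h e"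
proof -
 interpret E: left_module R E by fact
 interpret N: left_module R N by fact
 have fn: "n = n'" if "Q e n" "Q e n'" for e n n'
 proof -
  note d = dom[OF that(1)] dom[OF that(2)]
  have "Q (e \<oplus>\<^sub>E (\<ominus>\<^sub>R \<one>\<^sub>R) \<odot>\<^sub>E e) (n \<oplus>\<^sub>N (\<ominus>\<^sub>R \<one>\<^sub>R) \<odot>\<^sub>N n')"
   by (intro add smult that) simp
  then have "n \<oplus>\<^sub>N (\<ominus>\<^sub>N n') = \<zero>\<^sub>N"
   using d zero by (simp add: E.smult_minus_one N.smult_minus_one E.M.r_neg)
  then show ?thesis using d by (metis N.M.minus_equality N.M.minus_minus N.M.a_inv_closed)
 qed
 obtain h where h: "\<And>e. e \<in> carrier E \<Longrightarrow> Q e (h e)" using tot by metis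
 have "h \<in> module_hom R E N"
 proof (rule module_homI)
  show "h x \<in> carrier N" if "x \<in> carrier E" for x using dom[OF h[OF that]] by simp
  show "h (x \<oplus>\<^sub>E y) = h x \<oplus>\<^sub>N h y" if "x \<in> carrier E" "y \<in> carrier E" for x y
   using that by (intro fn[OF h add[OF h h]]) auto
  show "h (r \<odot>\<^sub>E x) = r \<odot>\<^sub>N h x" if "r \<in> carrier R" "x \<in> carrier E" for r x
   using that by (intro fn[OF h smult[OF _ h]]) auto
 qed
 then show ?thesis using h fn dom by blast
qed

section \<open>Finitely generated projective modules\<close>

text \<open>The dual basis criterion for finitely generated projective modules. It quantifies over
  no other modules and so makes sense for elements of any type.\<close>

definition fgp :: "('r, 'q) ring_scheme \<Rightarrow> ('r, 'm, 'w) module_scheme \<Rightarrow> bool" where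
 "fgp R P \<longleftrightarrow> left_module R P \<and>
  (\<exists>(n::nat) x f. (\<forall>i<n. x i \<in> carrier P) \<and> (\<forall>i<n. f i \<in> dual R P) \<and>
   (\<forall>y\<in>carrier P. y = (\<Oplus>\<^sub>P i\<in>{..<n}. f i y \<odot>\<^sub>P x i)))"

lemma fgpE:
 assumes "fgp R P"
 obtains n :: nat and x f where "\<And>i. i < n \<Longrightarrow> x i \<in> carrier P"
  "\<And>i. i < n \<Longrightarrow> f i \<in> dual R P"
  "\<And>y. y \<in> carrier P \<Longrightarrow> y = (\<Oplus>\<^sub>P i\<in>{..<n}. f i y \<odot>\<^sub>P x i)"
 using assms unfolding fgp_def by blast

lemma fgpI:
 assumes "left_module R P" "\<And>i. i < (n::nat) \<Longrightarrow> x i \<in> carrier P"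
  "\<And>i. i < n \<Longrightarrow> f i \<in> dual R P"
  "\<And>y. y \<in> carrier P \<Longrightarrow> y = (\<Oplus>\<^sub>P i\<in>{..<n}. f i y \<odot>\<^sub>P x i)"
 shows "fgp R P"
 unfolding fgp_def using assms by blast

lemma fgp_left_module: "fgp R P \<Longrightarrow> left_module R P"
 by (simp add: fgp_def)

lemma hom_mult_elem:
 assumes "left_module R N" "f \<in> dual R M" "x \<in> carrier N"
 shows "(\<lambda>y. f y \<odot>\<^sub>N x) \<in> module_hom R M N"
proof -
 interpret N: left_module R N by fact
 show ?thesis
  using assms(2,3)
  by (intro module_homI) (auto simp: module_hom_def Pi_iff N.smult_l_distr N.smult_assoc1)
qed

lemma hom_lincomb:
 assumes "left_module R N" "\<And>i. i < (n::nat) \<Longrightarrow> f i \<in> dual R M"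
  "\<And>i. i < n \<Longrightarrow> x i \<in> carrier N"
 shows "(\<lambda>y. \<Oplus>\<^sub>N i\<in>{..<n}. f i y \<odot>\<^sub>N x i) \<in> module_hom R M N"
 using assms by (intro hom_sum hom_mult_elem) auto

text \<open>The lift is prescribed on the finitely many dual basis elements and extended by the
  coordinate functionals. Only the values of f have to lie in the image of g, so maps into cycles
  lift without restricting a codomain.\<close>

lemma fgp_lift:
 assumes P: "fgp R P" and E: "left_module R E" and N: "left_module R N"
  and g: "g \<in> module_hom R E N" and f: "f \<in> module_hom R P N"
  and im: "\<And>x. x \<in> carrier P \<Longrightarrow> \<exists>e\<in>carrier E. f x = g e"
 shows "\<exists>h\<in>module_hom R P E. \<forall>x\<in>carrier P. g (h x) = f x"
proof -
 from P obtain n :: nat and x c where x: "\<And>i. i < n \<Longrightarrow> x i \<in> carrier P"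
  and c: "\<And>i. i < n \<Longrightarrow> c i \<in> dual R P"
  and sum: "\<And>y. y \<in> carrier P \<Longrightarrow> y = (\<Oplus>\<^sub>P i\<in>{..<n}. c i y \<odot>\<^sub>P x i)" by (rule fgpE) blast
 have P': "left_module R P" using P by (rule fgp_left_module)
 interpret P: left_module R P by fact
 interpret E: left_module R E by fact
 interpret N: left_module R N by fact
 note cc = dual_closed[OF c]
 obtain e where e: "\<And>i. i < n \<Longrightarrow> e i \<in> carrier E" "\<And>i. i < n \<Longrightarrow> f (x i) = g (e i)"
  using im[OF x] by metis
 let ?h = "\<lambda>y. \<Oplus>\<^sub>E i\<in>{..<n}. c i y \<odot>\<^sub>E e i"
 have h: "?h \<in> module_hom R P E" by (intro hom_lincomb E c e) auto
 have "g (?h y) = f y" if y: "y \<in> carrier P" for y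
 proof -
  have "g (?h y) = (\<Oplus>\<^sub>N i\<in>{..<n}. c i y \<odot>\<^sub>N g (e i))"
   using y e cc hom_closed[OF g]
   by (subst hom_finsum[OF E N g]) (auto simp: hom_smult[OF g] intro!: N.M.finsum_cong')
  also have "\<dots> = (\<Oplus>\<^sub>N i\<in>{..<n}. c i y \<odot>\<^sub>N f (x i))"
   using y e cc hom_closed[OF g] by (intro N.M.finsum_cong') auto
  also have "\<dots> = f (\<Oplus>\<^sub>P i\<in>{..<n}. c i y \<odot>\<^sub>P x i)"
   using y x cc hom_closed[OF f]
   by (subst hom_finsum[OF P' N f]) (auto simp: hom_smult[OF f] intro!: N.M.finsum_cong')
  finally show ?thesis using sum[OF y] by simp
 qed
 then show ?thesis by (intro bexI[OF _ h] ballI)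
qed



section \<open>Finite generation, and dual bases versus the lifting property\<close>

definition lincombs :: "('r, 'q) ring_scheme \<Rightarrow> ('r, 'm, 'w) module_scheme \<Rightarrow> 'm set \<Rightarrow> 'm set" where
 "lincombs R M S = {(\<Oplus>\<^sub>M s\<in>S. c s \<odot>\<^sub>M s) | c. c \<in> S \<rightarrow> carrier R}"

lemma submod_lincombs:
 assumes "left_module R M" "finite S" "S \<subseteq> carrier M"
 shows "submod R M (lincombs R M S)"
proof -
 interpret M: left_module R M by fact
 have S: "s \<in> carrier M" if "s \<in> S" for s using that assms by auto
 have c: "c s \<in> carrier R" if "c \<in> S \<rightarrow> carrier R" "s \<in> S" for c s using that by auto
 show ?thesis
  unfolding submod_def lincombs_def
 proof (intro conjI ballI subsetI)
  show "\<zero>\<^sub>M \<in> {(\<Oplus>\<^sub>M s\<in>S. c s \<odot>\<^sub>M s) | c. c \<in> S \<rightarrow> carrier R}"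
   using S by (intro CollectI exI[of _ "\<lambda>_. \<zero>\<^sub>R"]) (auto intro!: M.M.add.finprod_one_eqI[symmetric])
  show "x \<in> carrier M" if "x \<in> {(\<Oplus>\<^sub>M s\<in>S. c s \<odot>\<^sub>M s) | c. c \<in> S \<rightarrow> carrier R}" for x
   using that S by (auto intro!: M.M.finsum_closed)
 next
  fix x y assume "x \<in> {(\<Oplus>\<^sub>M s\<in>S. c s \<odot>\<^sub>M s) | c. c \<in> S \<rightarrow> carrier R}"
   "y \<in> {(\<Oplus>\<^sub>M s\<in>S. c s \<odot>\<^sub>M s) | c. c \<in> S \<rightarrow> carrier R}"
  then obtain a b where ab: "a \<in> S \<rightarrow> carrier R" "b \<in> S \<rightarrow> carrier R"
   "x = (\<Oplus>\<^sub>M s\<in>S. a s \<odot>\<^sub>M s)" "y = (\<Oplus>\<^sub>M s\<in>S. b s \<odot>\<^sub>M s)" by blast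
  show "x \<oplus>\<^sub>M y \<in> {(\<Oplus>\<^sub>M s\<in>S. c s \<odot>\<^sub>M s) | c. c \<in> S \<rightarrow> carrier R}"
  proof (intro CollectI exI[of _ "\<lambda>s. a s \<oplus>\<^sub>R b s"] conjI)
   have "(\<Oplus>\<^sub>M s\<in>S. (a s \<oplus>\<^sub>R b s) \<odot>\<^sub>M s) = (\<Oplus>\<^sub>M s\<in>S. a s \<odot>\<^sub>M s \<oplus>\<^sub>M b s \<odot>\<^sub>M s)"
    using ab(1,2) S by (intro M.M.finsum_cong') (auto simp: M.smult_l_distr Pi_iff)
   then show "x \<oplus>\<^sub>M y = (\<Oplus>\<^sub>M s\<in>S. (a s \<oplus>\<^sub>R b s) \<odot>\<^sub>M s)"
    using ab S by (simp add: Pi_iff)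
  qed (use ab in auto)
 next
  fix r x assume r: "r \<in> carrier R" and "x \<in> {(\<Oplus>\<^sub>M s\<in>S. c s \<odot>\<^sub>M s) | c. c \<in> S \<rightarrow> carrier R}"
  then obtain a where a: "a \<in> S \<rightarrow> carrier R" "x = (\<Oplus>\<^sub>M s\<in>S. a s \<odot>\<^sub>M s)" by blast
  show "r \<odot>\<^sub>M x \<in> {(\<Oplus>\<^sub>M s\<in>S. c s \<odot>\<^sub>M s) | c. c \<in> S \<rightarrow> carrier R}"
   using a(1) S c r assms(2) unfolding a(2)
   by (intro CollectI exI[of _ "\<lambda>s. r \<otimes>\<^sub>R a s"] conjI, subst M.smult_finsum)
    (auto simp: M.smult_assoc1 intro!: M.M.finsum_cong')
 qed
qed

lemma lincombs_base:
 assumes "left_module R M" "finite S" "S \<subseteq> carrier M" "t \<in> S"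
 shows "t \<in> lincombs R M S"
proof -
 interpret M: left_module R M by fact
 have S: "s \<in> carrier M" if "s \<in> S" for s using that assms by auto
 have "(\<Oplus>\<^sub>M s\<in>S. (if t = s then \<one>\<^sub>R else \<zero>\<^sub>R) \<odot>\<^sub>M s) = (\<Oplus>\<^sub>M s\<in>S. if t = s then s else \<zero>\<^sub>M)"
  using S by (intro M.M.finsum_cong') auto
 also have "\<dots> = t" using M.M.finsum_singleton[OF assms(4,2), of "\<lambda>s. s"] S by auto
 finally show ?thesis
  unfolding lincombs_def by (intro CollectI exI[of _ "\<lambda>s. if t = s then \<one>\<^sub>R else \<zero>\<^sub>R"]) auto
qed

text \<open>The linear combinations of S form a submodule containing S, so it is enough that no
  proper submodule contains S. Applications then avoid explicit coefficients.\<close>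

lemma finitely_generatedI:
 assumes "left_module R M" "finite S" "S \<subseteq> carrier M"
  and "\<And>H x. submod R M H \<Longrightarrow> S \<subseteq> H \<Longrightarrow> x \<in> carrier M \<Longrightarrow> x \<in> H"
 shows "finitely_generated R M"
 using assms(4)[OF submod_lincombs[OF assms(1-3)]] lincombs_base[OF assms(1-3)] assms(2,3)
 unfolding finitely_generated_def lincombs_def by blast

lemma submod_finsum:
 assumes "left_module R M" "submod R M H" "finite S" "\<And>i. i \<in> S \<Longrightarrow> f i \<in> H"
 shows "(\<Oplus>\<^sub>M i\<in>S. f i) \<in> H"
proof -
 interpret M: left_module R M by fact
 have H: "H \<subseteq> carrier M" using assms(2) by (simp add: submod_def)
 show ?thesis using assms(3,4)
 proof (induction S rule: finite_induct)
  case empty then show ?case using assms(2) by (simp add: submod_def)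
 next
  case (insert s S)
  then show ?case using assms(2) H by (subst M.M.finsum_insert) (auto simp: submod_def)
 qed
qed

lemma fgp_finitely_generated:
 assumes "fgp R P" shows "finitely_generated R P"
proof -
 from assms obtain n :: nat and x f where x: "\<And>i. i < n \<Longrightarrow> x i \<in> carrier P"
  and f: "\<And>i. i < n \<Longrightarrow> f i \<in> dual R P"
  and sum: "\<And>y. y \<in> carrier P \<Longrightarrow> y = (\<Oplus>\<^sub>P i\<in>{..<n}. f i y \<odot>\<^sub>P x i)" by (rule fgpE) blast
 note P = fgp_left_module[OF assms]
 show ?thesis
 proof (rule finitely_generatedI[OF P, of "x ` {..<n}"])
  fix H y assume H: "submod R P H" "x ` {..<n} \<subseteq> H" and y: "y \<in> carrier P"
  have "(\<Oplus>\<^sub>P i\<in>{..<n}. f i y \<odot>\<^sub>P x i) \<in> H"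
   using H y hom_closed[OF f] by (intro submod_finsum[OF P H(1)]) (auto simp: submod_def)
  then show "y \<in> H" using sum[OF y] by simp
 qed (use x in auto)
qed

text \<open>Enumerating the generators by an initial segment of nat turns families of coefficients
  into functions on nat, the universe of the lifting property.\<close>

lemma finitely_generated_ex:
 assumes "left_module R M" "finitely_generated R M"
 shows "\<exists>(n::nat) x. (\<forall>i<n. x i \<in> carrier M) \<and>
  (\<forall>y\<in>carrier M. \<exists>c. (\<forall>i<n. c i \<in> carrier R) \<and> y = (\<Oplus>\<^sub>M i\<in>{..<n}. c i \<odot>\<^sub>M x i))"
proof -
 interpret M: left_module R M by fact
 from assms(2) obtain S where S: "finite S" "S \<subseteq> carrier M"
  and gen: "\<And>x. x \<in> carrier M \<Longrightarrow> \<exists>c \<in> S \<rightarrow> carrier R. x = (\<Oplus>\<^sub>M s\<in>S. c s \<odot>\<^sub>M s)"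
  unfolding finitely_generated_def by blast
 obtain x where x: "bij_betw x {..<card S} S"
  using ex_bij_betw_nat_finite[OF S(1)] by (auto simp: lessThan_atLeast0)
 show ?thesis
 proof (intro exI[of _ "card S"] exI[of _ x] conjI ballI allI impI)
  show "x i \<in> carrier M" if "i < card S" for i using x S that by (auto simp: bij_betw_def)
  fix y assume "y \<in> carrier M"
  then obtain c where c: "c \<in> S \<rightarrow> carrier R" "y = (\<Oplus>\<^sub>M s\<in>S. c s \<odot>\<^sub>M s)" using gen by blast
  have "(\<Oplus>\<^sub>M s\<in>x ` {..<card S}. c s \<odot>\<^sub>M s) = (\<Oplus>\<^sub>M i\<in>{..<card S}. c (x i) \<odot>\<^sub>M x i)"
   using x S c by (intro M.M.finsum_reindex) (auto simp: bij_betw_def)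
  then show "\<exists>c. (\<forall>i<card S. c i \<in> carrier R) \<and> y = (\<Oplus>\<^sub>M i\<in>{..<card S}. c i \<odot>\<^sub>M x i)"
   using c x by (intro exI[of _ "c \<circ> x"]) (auto simp: bij_betw_def)
 qed
qed

text \<open>Every module with a dual basis is isomorphic to one of these via its coordinates.\<close>

definition fmod :: "('r, 'q) ring_scheme \<Rightarrow> (nat \<Rightarrow> 'r) set \<Rightarrow> ('r, nat \<Rightarrow> 'r) module" where
 "fmod R H = \<lparr>carrier = H, mult = (\<lambda>v w j. v j \<otimes>\<^sub>R w j), one = (\<lambda>j. \<one>\<^sub>R),
   ring.zero = (\<lambda>j. \<zero>\<^sub>R), add = (\<lambda>v w j. v j \<oplus>\<^sub>R w j), smult = (\<lambda>r v j. r \<otimes>\<^sub>R v j)\<rparr>"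

lemma fmod_simps [simp]:
 "carrier (fmod R H) = H" "\<zero>\<^bsub>fmod R H\<^esub> = (\<lambda>j. \<zero>\<^sub>R)"
 "v \<oplus>\<^bsub>fmod R H\<^esub> w = (\<lambda>j. v j \<oplus>\<^sub>R w j)" "r \<odot>\<^bsub>fmod R H\<^esub> v = (\<lambda>j. r \<otimes>\<^sub>R v j)"
 by (simp_all add: fmod_def)

lemma left_module_fmod:
 assumes "ring R" "\<And>v j. v \<in> H \<Longrightarrow> v j \<in> carrier R"
  and "(\<lambda>j. \<zero>\<^sub>R) \<in> H" "\<And>v w. v \<in> H \<Longrightarrow> w \<in> H \<Longrightarrow> (\<lambda>j. v j \<oplus>\<^sub>R w j) \<in> H"
  and "\<And>r v. r \<in> carrier R \<Longrightarrow> v \<in> H \<Longrightarrow> (\<lambda>j. r \<otimes>\<^sub>R v j) \<in> H"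
 shows "left_module R (fmod R H)"
proof -
 interpret R: ring R by fact
 show ?thesis
  by (rule left_moduleI)
   (auto simp: assms R.add.m_ac R.l_distr R.r_distr R.m_assoc)
qed

text \<open>From a dual basis, \<open>fgp_lift\<close> gives the lifting property. Conversely,
  lifting is available only against modules of functions on nat, so P is replaced by a copy there:
  it is a quotient of a free module F, and a choice of preimages embeds it into F as a set. Lifting
  the identification of P with this copy back to F produces the coordinate functionals.\<close>

lemma fg_projective_iff_fgp: "fg_projective R P \<longleftrightarrow> fgp R P"
proof
 assume P: "fgp R P"
 note P' = fgp_left_module[OF P]
 show "fg_projective R P"
  unfolding fg_projective_def
 proof (intro conjI allI impI P' fgp_finitely_generated[OF P], elim conjE)
  fix N N' :: "('a, nat \<Rightarrow> 'a) module" and g f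
  assume a: "left_module R N" "left_module R N'" "g \<in> module_hom R N N'"
   "g ` carrier N = carrier N'" "f \<in> module_hom R P N'"
  have "\<exists>e\<in>carrier N. f x = g e" if "x \<in> carrier P" for x
   using hom_closed[OF a(5) that] a(4) by (metis imageE)
  then show "\<exists>h\<in>module_hom R P N. \<forall>x\<in>carrier P. g (h x) = f x"
   by (intro fgp_lift[OF P a(1,2,3,5)]) auto
 qed
next
 assume *: "fg_projective R P"
 then have P: "left_module R P" and fg: "finitely_generated R P"
  by (simp_all add: fg_projective_def)
 have lift: "\<And>(N :: ('a, nat \<Rightarrow> 'a) module) (N' :: ('a, nat \<Rightarrow> 'a) module) g f.
   left_module R N \<Longrightarrow> left_module R N' \<Longrightarrow>
   g \<in> module_hom R N N' \<Longrightarrow> g ` carrier N = carrier N' \<Longrightarrow> f \<in> module_hom R P N' \<Longrightarrow>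
   (\<exists>h \<in> module_hom R P N. \<forall>x \<in> carrier P. g (h x) = f x)"
 proof -
  fix N N' :: "('a, nat \<Rightarrow> 'a) module" and g f
  assume a: "left_module R N" "left_module R N'" "g \<in> module_hom R N N'"
   "g ` carrier N = carrier N'" "f \<in> module_hom R P N'"
  from * have "\<forall>(N :: ('a, nat \<Rightarrow> 'a) module) (N' :: ('a, nat \<Rightarrow> 'a) module) g f.
   left_module R N \<and> left_module R N' \<and> g \<in> module_hom R N N' \<and> g ` carrier N = carrier N' \<and>
   f \<in> module_hom R P N' \<longrightarrow> (\<exists>h \<in> module_hom R P N. \<forall>x \<in> carrier P. g (h x) = f x)"
   unfolding fg_projective_def by (elim conjE)
  note lift = this[THEN spec, THEN spec, THEN spec, THEN spec, THEN mp]
  show "\<exists>h \<in> module_hom R P N. \<forall>x \<in> carrier P. g (h x) = f x"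
   by (rule lift[of N N' g f]) (intro conjI a)
 qed
 interpret P: left_module R P by fact
 obtain n :: nat and x where nx: "(\<forall>i<n. x i \<in> carrier P) \<and>
  (\<forall>y\<in>carrier P. \<exists>c. (\<forall>i<n. c i \<in> carrier R) \<and> y = (\<Oplus>\<^sub>P i\<in>{..<n}. c i \<odot>\<^sub>P x i))"
  using finitely_generated_ex[OF P fg] by (elim exE)
 from nx have x: "x i \<in> carrier P" if "i < n" for i using that by simp
 from nx have gen: "\<exists>c. (\<forall>i<n. c i \<in> carrier R) \<and> y = (\<Oplus>\<^sub>P i\<in>{..<n}. c i \<odot>\<^sub>P x i)"
  if "y \<in> carrier P" for y using that by (elim conjE) (rule bspec)
 define F where "F = {v. (\<forall>i. v i \<in> carrier R) \<and> (\<forall>i\<ge>n. v i = \<zero>\<^sub>R)}"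
 have F: "left_module R (fmod R F)"
  by (rule left_module_fmod) (auto simp: F_def P.R.ring_axioms)
 define g0 where "g0 v = (\<Oplus>\<^sub>P i\<in>{..<n}. v i \<odot>\<^sub>P x i)" for v
 have g0: "g0 \<in> module_hom R (fmod R F) P"
  unfolding g0_def by (intro hom_lincomb P x module_homI) (auto simp: F_def)
 have surj: "\<exists>v\<in>F. g0 v = y" if y: "y \<in> carrier P" for y
 proof -
  obtain c where c: "\<And>i. i < n \<Longrightarrow> c i \<in> carrier R" "y = (\<Oplus>\<^sub>P i\<in>{..<n}. c i \<odot>\<^sub>P x i)"
   using gen[OF y] by blast
  show ?thesis
   using c x by (intro bexI[of _ "\<lambda>i. if i < n then c i else \<zero>\<^sub>R"])
    (auto simp: F_def g0_def intro!: P.M.finsum_cong')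
 qed
 then obtain \<sigma> where \<sigma>: "\<And>y. y \<in> carrier P \<Longrightarrow> \<sigma> y \<in> F" "\<And>y. y \<in> carrier P \<Longrightarrow> g0 (\<sigma> y) = y" by metis
 \<comment> \<open>The copy of P: its elements are the chosen representatives, and sums and
   multiples are computed in P and represented again. It is in general not a submodule of F.\<close>
 define N' :: "('a, nat \<Rightarrow> 'a) module" where "N' = \<lparr>carrier = \<sigma> ` carrier P, mult = undefined, one = undefined,
   ring.zero = \<sigma> \<zero>\<^sub>P, add = (\<lambda>v w. \<sigma> (g0 v \<oplus>\<^sub>P g0 w)), smult = (\<lambda>r v. \<sigma> (r \<odot>\<^sub>P g0 v))\<rparr>"
 have N': "left_module R N'"
  by (rule surj_left_module[OF P, of \<sigma>]) (auto simp: N'_def \<sigma>)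
 have g0c: "g0 v \<in> carrier P" if "v \<in> F" for v using hom_closed[OF g0] that by simp
 have g: "(\<lambda>v. \<sigma> (g0 v)) \<in> module_hom R (fmod R F) N'"
  using hom_add[OF g0] hom_smult[OF g0] g0c by (intro module_homI) (auto simp: N'_def \<sigma>)
 have \<sigma>': "\<sigma> \<in> module_hom R P N'" by (intro module_homI) (auto simp: N'_def \<sigma>)
 have "(\<lambda>v. \<sigma> (g0 v)) ` carrier (fmod R F) = carrier N'"
  using surj g0c by (force simp: N'_def)
 \<comment> \<open>A lift of \<open>\<sigma>\<close> along the surjection from F onto the copy
   splits \<open>g0\<close>.\<close>
 from lift[OF F N' g this \<sigma>'] obtain h where h: "h \<in> module_hom R P (fmod R F)"
  and hs: "\<And>y. y \<in> carrier P \<Longrightarrow> \<sigma> (g0 (h y)) = \<sigma> y" by blast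
 have hF: "h y \<in> F" if "y \<in> carrier P" for y using hom_closed[OF h that] by simp
 have h0: "g0 (h y) = y" if "y \<in> carrier P" for y
  using hs[OF that] \<sigma>(2)[OF that] \<sigma>(2)[OF g0c[OF hF[OF that]]] by simp
 show "fgp R P"
 proof (rule fgpI[OF P, of n x "\<lambda>i y. h y i"])
  show "(\<lambda>y. h y i) \<in> dual R P" for i
   using hom_add[OF h] hom_smult[OF h] hF by (intro module_homI) (auto simp: F_def)
  show "y = (\<Oplus>\<^sub>P i\<in>{..<n}. h y i \<odot>\<^sub>P x i)" if "y \<in> carrier P" for y
   using h0[OF that] by (simp add: g0_def)
 qed (rule x)
qed

section \<open>Complete resolutions\<close>

text \<open>The terms may have elements of any type. For the dual complex only the inclusion of
  kernel in image is recorded, because the reverse inclusion follows from the vanishing of composed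
  differentials.\<close>

definition complete_resolution ::
 "('r, 'q) ring_scheme \<Rightarrow> (int \<Rightarrow> ('r, 'p, 'w) module_scheme) \<Rightarrow> (int \<Rightarrow> 'p \<Rightarrow> 'p) \<Rightarrow> bool" where
 "complete_resolution R P d \<longleftrightarrow> (\<forall>i. fgp R (P i)) \<and> (\<forall>i. d i \<in> module_hom R (P i) (P (i + 1))) \<and>
  (\<forall>i. \<forall>x\<in>carrier (P i). d (i + 1) (d i x) = \<zero>\<^bsub>P (i + 2)\<^esub>) \<and>
  (\<forall>i. \<forall>x\<in>carrier (P (i + 1)). d (i + 1) x = \<zero>\<^bsub>P (i + 2)\<^esub> \<longrightarrow> (\<exists>y\<in>carrier (P i). x = d i y)) \<and>
  (\<forall>i. \<forall>f\<in>dual R (P (i + 1)).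
   (\<forall>x\<in>carrier (P i). f (d i x) = \<zero>\<^sub>R) \<longrightarrow>
   (\<exists>g\<in>dual R (P (i + 2)). \<forall>x\<in>carrier (P (i + 1)). f x = g (d (i + 1) x)))"

lemma complete_resolutionI:
 assumes "\<And>i. fgp R (P i)" "\<And>i. d i \<in> module_hom R (P i) (P (i + 1))"
  and "\<And>i x. x \<in> carrier (P i) \<Longrightarrow> d (i + 1) (d i x) = \<zero>\<^bsub>P (i + 2)\<^esub>"
  and "\<And>i x. x \<in> carrier (P (i + 1)) \<Longrightarrow> d (i + 1) x = \<zero>\<^bsub>P (i + 2)\<^esub> \<Longrightarrow> \<exists>y\<in>carrier (P i). x = d i y"
  and "\<And>i f. f \<in> dual R (P (i + 1)) \<Longrightarrow>
   (\<And>x. x \<in> carrier (P i) \<Longrightarrow> f (d i x) = \<zero>\<^sub>R) \<Longrightarrow>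
   \<exists>g\<in>dual R (P (i + 2)). \<forall>x\<in>carrier (P (i + 1)). f x = g (d (i + 1) x)"
 shows "complete_resolution R P d"
 unfolding complete_resolution_def using assms by (intro conjI allI ballI impI) blast+

lemma complete_resolutionD:
 assumes "complete_resolution R P d"
 shows cr_fgp: "\<And>i. fgp R (P i)"
  and cr_left_module: "\<And>i. left_module R (P i)"
  and cr_hom: "\<And>i. d i \<in> module_hom R (P i) (P (i + 1))"
  and cr_dd: "\<And>i x. x \<in> carrier (P i) \<Longrightarrow> d (i + 1) (d i x) = \<zero>\<^bsub>P (i + 2)\<^esub>"
  and cr_exact: "\<And>i x. x \<in> carrier (P (i + 1)) \<Longrightarrow> d (i + 1) x = \<zero>\<^bsub>P (i + 2)\<^esub> \<Longrightarrow> \<exists>y\<in>carrier (P i). x = d i y"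
  and cr_hom_exact: "\<And>i f. f \<in> dual R (P (i + 1)) \<Longrightarrow>
   (\<And>x. x \<in> carrier (P i) \<Longrightarrow> f (d i x) = \<zero>\<^sub>R) \<Longrightarrow>
   \<exists>g\<in>dual R (P (i + 2)). \<forall>x\<in>carrier (P (i + 1)). f x = g (d (i + 1) x)"
proof -
 note a = assms[unfolded complete_resolution_def]
 show f: "\<And>i. fgp R (P i)" using a by blast
 show "\<And>i. left_module R (P i)" using f fgp_left_module by blast
 show "\<And>i. d i \<in> module_hom R (P i) (P (i + 1))" using a by blast
 show "\<And>i x. x \<in> carrier (P i) \<Longrightarrow> d (i + 1) (d i x) = \<zero>\<^bsub>P (i + 2)\<^esub>" using a by blast
 show "\<And>i x. x \<in> carrier (P (i + 1)) \<Longrightarrow> d (i + 1) x = \<zero>\<^bsub>P (i + 2)\<^esub> \<Longrightarrow> \<exists>y\<in>carrier (P i). x = d i y"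
  using a by blast
 show "\<And>i f. f \<in> dual R (P (i + 1)) \<Longrightarrow>
   (\<And>x. x \<in> carrier (P i) \<Longrightarrow> f (d i x) = \<zero>\<^sub>R) \<Longrightarrow>
   \<exists>g\<in>dual R (P (i + 2)). \<forall>x\<in>carrier (P (i + 1)). f x = g (d (i + 1) x)"
  using a by blast
qed

text \<open>An isomorphism with the cycles in degree 0, encoded as an embedding into
  \<open>P 0\<close> so that no submodule record has to be carried around.\<close>

definition cycle_iso ::
 "('r, 'q) ring_scheme \<Rightarrow> ('r, 'm, 'w) module_scheme \<Rightarrow> (int \<Rightarrow> ('r, 'p, 'z) module_scheme)
  \<Rightarrow> (int \<Rightarrow> 'p \<Rightarrow> 'p) \<Rightarrow> ('m \<Rightarrow> 'p) \<Rightarrow> bool" where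
 "cycle_iso R M P d f \<longleftrightarrow> f \<in> module_hom R M (P 0) \<and> inj_on f (carrier M) \<and>
  f ` carrier M = {x \<in> carrier (P 0). d 0 x = \<zero>\<^bsub>P 1\<^esub>}"

lemma (in abelian_group) minus_eq_zero_iff:
 assumes "x \<in> carrier G" "y \<in> carrier G" shows "x \<ominus> y = \<zero> \<longleftrightarrow> x = y"
proof
 assume "x \<ominus> y = \<zero>"
 then have "\<ominus> (\<ominus> y) = x" using assms by (intro minus_equality) (auto simp: a_minus_def)
 then show "x = y" using assms by simp
qed (use assms in \<open>simp add: a_minus_def r_neg\<close>)

lemma (in abelian_group) minus_add_cancel:
 assumes "x \<in> carrier G" "y \<in> carrier G" shows "(x \<ominus> y) \<oplus> y = x"
 using assms by (simp add: a_minus_def a_assoc l_neg)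

lemma inj_on_homI:
 assumes "left_module R M" "left_module R N" "f \<in> module_hom R M N"
  and "\<And>x. x \<in> carrier M \<Longrightarrow> f x = \<zero>\<^sub>N \<Longrightarrow> x = \<zero>\<^sub>M"
 shows "inj_on f (carrier M)"
proof (rule inj_onI)
 interpret M: left_module R M by fact
 interpret N: left_module R N by fact
 fix x y assume xy: "x \<in> carrier M" "y \<in> carrier M" "f x = f y"
 have "f (x \<ominus>\<^sub>M y) = f x \<ominus>\<^sub>N f y" using xy by (intro hom_diff[OF assms(1-3)])
 then have "f (x \<ominus>\<^sub>M y) = \<zero>\<^sub>N"
  using xy hom_closed[OF assms(3)] by (simp add: a_minus_def N.M.r_neg)
 then have "x \<ominus>\<^sub>M y = \<zero>\<^sub>M" using xy assms(4) by simp
 then show "x = y" using xy by (simp add: M.M.minus_eq_zero_iff)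
qed

lemma fgp_iso:
 assumes "fgp R P" "left_module R P'" "\<sigma> \<in> module_hom R P P'" "bij_betw \<sigma> (carrier P) (carrier P')"
 shows "fgp R P'"
proof -
 from assms(1) obtain n :: nat and x c where x: "\<And>i. i < n \<Longrightarrow> x i \<in> carrier P"
  and c: "\<And>i. i < n \<Longrightarrow> c i \<in> dual R P"
  and sum: "\<And>y. y \<in> carrier P \<Longrightarrow> y = (\<Oplus>\<^sub>P i\<in>{..<n}. c i y \<odot>\<^sub>P x i)" by (rule fgpE) blast
 note P = fgp_left_module[OF assms(1)]
 interpret P: left_module R P by fact
 interpret P': left_module R P' by fact
 define \<tau> where "\<tau> = the_inv_into (carrier P) \<sigma>"
 have \<tau>c: "\<tau> y \<in> carrier P" and \<sigma>\<tau>: "\<sigma> (\<tau> y) = y" if "y \<in> carrier P'" for y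
  using assms(4) that unfolding \<tau>_def bij_betw_def
  by (auto simp: f_the_inv_into_f intro!: the_inv_into_into)
 have eqI: "u = v" if "u \<in> carrier P" "v \<in> carrier P" "\<sigma> u = \<sigma> v" for u v
  using assms(4) that by (auto simp: bij_betw_def dest: inj_onD)
 have \<tau>: "\<tau> \<in> module_hom R P' P"
  by (rule module_homI; (rule eqI)?)
   (auto simp: \<tau>c \<sigma>\<tau> hom_add[OF assms(3)] hom_smult[OF assms(3)])
 note \<sigma>c = hom_closed[OF assms(3)]
 note cc = dual_closed[OF c]
 show ?thesis
 proof (rule fgpI[OF assms(2), of n "\<lambda>i. \<sigma> (x i)" "\<lambda>i y. c i (\<tau> y)"])
  fix y assume y: "y \<in> carrier P'"
  have "y = \<sigma> (\<Oplus>\<^sub>P i\<in>{..<n}. c i (\<tau> y) \<odot>\<^sub>P x i)" using sum[OF \<tau>c[OF y]] \<sigma>\<tau>[OF y] by simp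
  also have "\<dots> = (\<Oplus>\<^sub>P' i\<in>{..<n}. \<sigma> (c i (\<tau> y) \<odot>\<^sub>P x i))"
   using y x cc \<tau>c by (intro hom_finsum[OF P assms(2,3)]) auto
  also have "\<dots> = (\<Oplus>\<^sub>P' i\<in>{..<n}. c i (\<tau> y) \<odot>\<^sub>P' \<sigma> (x i))"
   using y x cc \<tau>c \<sigma>c by (intro P'.M.finsum_cong') (auto simp: hom_smult[OF assms(3)])
  finally show "y = (\<Oplus>\<^sub>P' i\<in>{..<n}. c i (\<tau> y) \<odot>\<^sub>P' \<sigma> (x i))" .
 qed (use \<sigma>c x in \<open>auto intro!: hom_comp[OF \<tau> c]\<close>)
qed

text \<open>The functionals of a dual basis separate elements, because the expansion recovers an
  element from its coordinates. Coordinates from n on are set to zero.\<close>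

lemma fgp_coordinates:
 assumes "fgp R P"
 shows "\<exists>H \<sigma>. left_module R (fmod R H) \<and> (\<forall>v\<in>H. \<forall>j. v j \<in> carrier R) \<and>
  \<sigma> \<in> module_hom R P (fmod R H) \<and> bij_betw \<sigma> (carrier P) H"
proof -
 from assms obtain n :: nat and x c where x: "\<And>i. i < n \<Longrightarrow> x i \<in> carrier P"
  and c: "\<And>i. i < n \<Longrightarrow> c i \<in> dual R P"
  and sum: "\<And>y. y \<in> carrier P \<Longrightarrow> y = (\<Oplus>\<^sub>P i\<in>{..<n}. c i y \<odot>\<^sub>P x i)" by (rule fgpE) blast
 note P = fgp_left_module[OF assms]
 interpret P: left_module R P by fact
 define \<sigma> where "\<sigma> y = (\<lambda>i. if i < n then c i y else \<zero>\<^sub>R)" for y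
 define H where "H = \<sigma> ` carrier P"
 note cc = dual_closed[OF c]
 have add: "\<sigma> (y \<oplus>\<^sub>P z) = (\<lambda>j. \<sigma> y j \<oplus>\<^sub>R \<sigma> z j)" if "y \<in> carrier P" "z \<in> carrier P" for y z
  using that hom_add[OF c] by (auto simp: \<sigma>_def)
 have smult: "\<sigma> (r \<odot>\<^sub>P y) = (\<lambda>j. r \<otimes>\<^sub>R \<sigma> y j)" if "r \<in> carrier R" "y \<in> carrier P" for r y
  using that hom_smult[OF c] by (auto simp: \<sigma>_def)
 have "\<sigma> \<zero>\<^sub>P = (\<lambda>j. \<zero>\<^sub>R)"
  using hom_zero[OF P left_module_regular[OF P.R.ring_axioms] c] by (auto simp: \<sigma>_def)
 then have lm: "left_module R (fmod R H)"
  by (intro surj_left_module[OF P, of \<sigma>]) (auto simp: H_def add smult)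
 have hom: "\<sigma> \<in> module_hom R P (fmod R H)"
  by (intro module_homI) (auto simp: H_def add smult)
 have "inj_on \<sigma> (carrier P)"
 proof (rule inj_onI)
  fix y z assume yz: "y \<in> carrier P" "z \<in> carrier P" "\<sigma> y = \<sigma> z"
  have "c i y = c i z" if "i < n" for i using fun_cong[OF yz(3), of i] that by (simp add: \<sigma>_def)
  then have "(\<Oplus>\<^sub>P i\<in>{..<n}. c i y \<odot>\<^sub>P x i) = (\<Oplus>\<^sub>P i\<in>{..<n}. c i z \<odot>\<^sub>P x i)"
   using yz cc x by (intro P.M.finsum_cong') auto
  then show "y = z" using sum yz by metis
 qed
 moreover have "\<forall>v\<in>H. \<forall>j. v j \<in> carrier R" by (auto simp: H_def \<sigma>_def cc)
 ultimately show ?thesis using lm hom by (intro exI[of _ H] exI[of _ \<sigma>]) (auto simp: H_def bij_betw_def)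
qed

text \<open>Conjugating the differentials by the coordinate isomorphisms moves a complete resolution
  of any type into functions on nat. That all entries lie in the ring is recorded for later
  entrywise constructions on these vectors.\<close>

lemma complete_resolution_fmod:
 assumes cr: "complete_resolution R P d" and M: "cycle_iso R M P d f"
 shows "\<exists>H d' f'. complete_resolution R (\<lambda>i. fmod R (H i)) d' \<and> cycle_iso R M (\<lambda>i. fmod R (H i)) d' f' \<and>
  (\<forall>i. \<forall>v\<in>H i. \<forall>j. v j \<in> carrier R)"
proof -
 obtain H \<sigma> where H: "\<And>i. left_module R (fmod R (H i))" "\<And>i v j. v \<in> H i \<Longrightarrow> v j \<in> carrier R"
  and \<sigma>: "\<And>i. \<sigma> i \<in> module_hom R (P i) (fmod R (H i))" "\<And>i. bij_betw (\<sigma> i) (carrier (P i)) (H i)"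
  using fgp_coordinates[OF cr_fgp[OF cr]] by metis
 note lm = cr_left_module[OF cr]
 define \<tau> where "\<tau> i = the_inv_into (carrier (P i)) (\<sigma> i)" for i
 have \<sigma>c: "\<sigma> i y \<in> H i" if "y \<in> carrier (P i)" for i y using hom_closed[OF \<sigma>(1) that] by simp
 have \<tau>c: "\<tau> i v \<in> carrier (P i)" and \<sigma>\<tau>: "\<sigma> i (\<tau> i v) = v" if "v \<in> H i" for i v
  using \<sigma>(2)[of i] that unfolding \<tau>_def bij_betw_def
  by (auto simp: f_the_inv_into_f intro!: the_inv_into_into)
 have \<tau>\<sigma>: "\<tau> i (\<sigma> i y) = y" if "y \<in> carrier (P i)" for i y
  using \<sigma>(2)[of i] that unfolding \<tau>_def bij_betw_def by (auto simp: the_inv_into_f_f)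
 have \<tau>: "\<tau> i \<in> module_hom R (fmod R (H i)) (P i)" for i
 proof -
  interpret left_module R "P i" by (rule lm)
  interpret F: left_module R "fmod R (H i)" by (rule H)
  have eqI: "u = v" if "u \<in> carrier (P i)" "v \<in> carrier (P i)" "\<sigma> i u = \<sigma> i v" for u v
   using \<sigma>(2)[of i] that by (auto simp: bij_betw_def dest: inj_onD)
  show ?thesis
  proof (rule module_homI)
   show "\<tau> i x \<in> carrier (P i)" if "x \<in> carrier (fmod R (H i))" for x using that \<tau>c by simp
   fix x y r assume x: "x \<in> carrier (fmod R (H i))"
   show "\<tau> i (r \<odot>\<^bsub>fmod R (H i)\<^esub> x) = r \<odot>\<^bsub>P i\<^esub> \<tau> i x" if "r \<in> carrier R"
    using F.smult_closed[OF that x] x that hom_smult[OF \<sigma>(1)]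
    by (intro eqI) (auto simp: \<tau>c \<sigma>\<tau>)
   show "\<tau> i (x \<oplus>\<^bsub>fmod R (H i)\<^esub> y) = \<tau> i x \<oplus>\<^bsub>P i\<^esub> \<tau> i y" if "y \<in> carrier (fmod R (H i))"
    using F.M.a_closed[OF x that] x that hom_add[OF \<sigma>(1)]
    by (intro eqI) (auto simp: \<tau>c \<sigma>\<tau>)
  qed
 qed
 have \<sigma>0: "\<sigma> i \<zero>\<^bsub>P i\<^esub> = (\<lambda>j. \<zero>\<^sub>R)" for i using hom_zero[OF lm[of i] H(1)[of i] \<sigma>(1)] by simp
 have \<sigma>0D: "y = \<zero>\<^bsub>P i\<^esub>" if "y \<in> carrier (P i)" "\<sigma> i y = (\<lambda>j. \<zero>\<^sub>R)" for i y
  using \<tau>\<sigma>[OF that(1)] that(2) hom_zero[OF H(1)[of i] lm[of i] \<tau>] by simp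
 define d' where "d' i v = \<sigma> (i + 1) (d i (\<tau> i v))" for i v
 note dc = hom_closed[OF cr_hom[OF cr]]
 \<comment> \<open>As a term, the successor of degree i + 1 is i + 1 + 1; it has to be restated as i
   + 2 to match the exactness conditions. The same restatement recurs for every complex
   below.\<close>
 have d2: "d (i + 1) x \<in> carrier (P (i + 2))" if "x \<in> carrier (P (i + 1))" for i x
  using dc[OF that] by (simp add: add.assoc)
 have d'2: "d' (i + 1) v = \<sigma> (i + 2) (d (i + 1) (\<tau> (i + 1) v))" for i v
  by (simp add: d'_def add.assoc)
 have d'\<sigma>: "d' i (\<sigma> i x) = \<sigma> (i + 1) (d i x)" if "x \<in> carrier (P i)" for i x
  by (simp add: d'_def \<tau>\<sigma> that)
 have "complete_resolution R (\<lambda>i. fmod R (H i)) d'"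
 proof (rule complete_resolutionI)
  show "fgp R (fmod R (H i))" for i
   using \<sigma>(2) by (intro fgp_iso[OF cr_fgp[OF cr] H(1) \<sigma>(1)]) simp
  show "d' i \<in> module_hom R (fmod R (H i)) (fmod R (H (i + 1)))" for i
   unfolding d'_def by (intro hom_comp[OF \<tau>] hom_comp[OF cr_hom[OF cr] \<sigma>(1)])
  show "d' (i + 1) (d' i v) = \<zero>\<^bsub>fmod R (H (i + 2))\<^esub>" if "v \<in> carrier (fmod R (H i))" for i v
   using that by (simp only: d'2) (simp add: d'_def \<tau>\<sigma> dc \<tau>c cr_dd[OF cr] \<sigma>0)
 next
  fix i v assume v: "v \<in> carrier (fmod R (H (i + 1)))" "d' (i + 1) v = \<zero>\<^bsub>fmod R (H (i + 2))\<^esub>"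
  then have "d (i + 1) (\<tau> (i + 1) v) = \<zero>\<^bsub>P (i + 2)\<^esub>"
   by (intro \<sigma>0D) (auto simp: d'2 \<tau>c intro!: d2)
  then obtain y where "y \<in> carrier (P i)" "\<tau> (i + 1) v = d i y"
   using cr_exact[OF cr] \<tau>c v by fastforce
  then show "\<exists>y\<in>carrier (fmod R (H i)). v = d' i y"
   using v \<sigma>\<tau>[of v "i + 1"] by (intro bexI[of _ "\<sigma> i y"]) (auto simp: d'\<sigma> \<sigma>c)
 next
  fix i g assume g: "g \<in> dual R (fmod R (H (i + 1)))"
   and z: "\<And>x. x \<in> carrier (fmod R (H i)) \<Longrightarrow> g (d' i x) = \<zero>\<^sub>R"
  have "g (\<sigma> (i + 1) (d i x)) = \<zero>\<^sub>R" if "x \<in> carrier (P i)" for x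
   using z[of "\<sigma> i x"] that by (simp add: d'\<sigma> \<sigma>c)
  then obtain g' where g': "g' \<in> dual R (P (i + 2))"
   and eq: "\<And>x. x \<in> carrier (P (i + 1)) \<Longrightarrow> g (\<sigma> (i + 1) x) = g' (d (i + 1) x)"
   using cr_hom_exact[OF cr hom_comp[OF \<sigma>(1) g]] by metis
  have "g x = g' (\<tau> (i + 2) (d' (i + 1) x))" if x: "x \<in> H (i + 1)" for x
   using eq[OF \<tau>c[OF x]] \<sigma>\<tau>[OF x] by (simp add: d'2 \<tau>\<sigma> d2 \<tau>c[OF x])
  then show "\<exists>h\<in>dual R (fmod R (H (i + 2))).
    \<forall>x\<in>carrier (fmod R (H (i + 1))). g x = h (d' (i + 1) x)"
   by (intro bexI[OF _ hom_comp[OF \<tau> g']]) auto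
 qed
 moreover have "cycle_iso R M (\<lambda>i. fmod R (H i)) d' (\<lambda>x. \<sigma> 0 (f x))"
  unfolding cycle_iso_def
 proof (intro conjI)
  note m = M[unfolded cycle_iso_def]
  show "(\<lambda>x. \<sigma> 0 (f x)) \<in> module_hom R M (fmod R (H 0))"
   using m by (intro hom_comp[OF _ \<sigma>(1)]) auto
  have fc: "f x \<in> carrier (P 0)" if "x \<in> carrier M" for x using m that by fastforce
  show "inj_on (\<lambda>x. \<sigma> 0 (f x)) (carrier M)"
  proof (rule inj_onI)
   fix x y assume xy: "x \<in> carrier M" "y \<in> carrier M" "\<sigma> 0 (f x) = \<sigma> 0 (f y)"
   have "f x = f y" using \<tau>\<sigma>[OF fc[OF xy(1)]] \<tau>\<sigma>[OF fc[OF xy(2)]] unfolding xy(3) by (rule trans[OF sym])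
   then show "x = y" using m xy by (auto dest: inj_onD)
  qed
  have d0: "d' 0 v = \<sigma> 1 (d 0 (\<tau> 0 v))" for v by (simp add: d'_def)
  have dc0: "d 0 x \<in> carrier (P 1)" if "x \<in> carrier (P 0)" for x using dc[OF that] by simp
  show "(\<lambda>x. \<sigma> 0 (f x)) ` carrier M = {x \<in> carrier (fmod R (H 0)). d' 0 x = \<zero>\<^bsub>fmod R (H 1)\<^esub>}" (is "?l = ?r")
  proof
   have "d 0 (f x) = \<zero>\<^bsub>P 1\<^esub>" if "x \<in> carrier M" for x using m that by blast
   then show "?l \<subseteq> ?r" by (auto simp: fc \<sigma>c d0 \<tau>\<sigma> \<sigma>0)
   show "?r \<subseteq> ?l"
   proof
    fix v assume v: "v \<in> ?r"
    then have "d 0 (\<tau> 0 v) = \<zero>\<^bsub>P 1\<^esub>" by (intro \<sigma>0D) (auto simp: d0 \<tau>c intro!: dc0)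
    then have "\<tau> 0 v \<in> f ` carrier M" using m \<tau>c v by auto
    then show "v \<in> ?l" using v \<sigma>\<tau>[of v 0] by auto
   qed
  qed
 qed
 ultimately show ?thesis using H(2) by blast
qed

text \<open>Dual bases replace the lifting property, and an embedding onto the cycles replaces the
  isomorphism with a submodule record. The resolution still consists of functions on nat.\<close>

lemma gorenstein_projective_iff:
 fixes R :: "('r, 'q) ring_scheme" and M :: "('r, 'm, 'w) module_scheme"
 shows "gorenstein_projective R M \<longleftrightarrow> left_module R M \<and>
  (\<exists>(P :: int \<Rightarrow> ('r, nat \<Rightarrow> 'r) module) d f. complete_resolution R P d \<and> cycle_iso R M P d f)"
proof -
 have "(\<forall>i. fg_projective R (P i)) \<and>
   (\<forall>i. d i \<in> module_hom R (P i) (P (i + 1))) \<and>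
   (\<forall>i. hom_ker (P (i + 1)) (P (i + 2)) (d (i + 1)) = d i ` carrier (P i)) \<and>
   (\<forall>i. \<forall>f \<in> dual R (P (i + 1)).
    (\<forall>x \<in> carrier (P i). f (d i x) = \<zero>\<^sub>R) \<longleftrightarrow>
    (\<exists>g \<in> dual R (P (i + 2)).
     \<forall>x \<in> carrier (P (i + 1)). f x = g (d (i + 1) x))) \<longleftrightarrow> complete_resolution R P d" (is "?l \<longleftrightarrow> ?r")
  for P :: "int \<Rightarrow> ('r, nat \<Rightarrow> 'r) module" and d
 proof
  assume l: ?l
  show ?r
  proof (rule complete_resolutionI)
   show "fgp R (P i)" for i using l by (simp add: fg_projective_iff_fgp)
   show "d i \<in> module_hom R (P i) (P (i + 1))" for i using l by blast
   have k: "hom_ker (P (i + 1)) (P (i + 2)) (d (i + 1)) = d i ` carrier (P i)" for i using l by blast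
   show "d (i + 1) (d i x) = \<zero>\<^bsub>P (i + 2)\<^esub>" if "x \<in> carrier (P i)" for i x
    using k[of i] that by (auto simp: hom_ker_def)
   show "\<exists>y\<in>carrier (P i). x = d i y" if "x \<in> carrier (P (i + 1))" "d (i + 1) x = \<zero>\<^bsub>P (i + 2)\<^esub>" for i x
    using k[of i] that by (auto simp: hom_ker_def)
   show "\<exists>g\<in>dual R (P (i + 2)). \<forall>x\<in>carrier (P (i + 1)). f x = g (d (i + 1) x)"
    if f: "f \<in> dual R (P (i + 1))"
     "\<And>x. x \<in> carrier (P i) \<Longrightarrow> f (d i x) = \<zero>\<^sub>R" for i f
   proof -
    from l have "\<forall>i. \<forall>f \<in> dual R (P (i + 1)).
     (\<forall>x \<in> carrier (P i). f (d i x) = \<zero>\<^sub>R) \<longleftrightarrow>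
     (\<exists>g \<in> dual R (P (i + 2)). \<forall>x \<in> carrier (P (i + 1)). f x = g (d (i + 1) x))"
     by (elim conjE)
    note this[THEN spec, THEN bspec, OF f(1)]
    then show ?thesis using f(2) by (elim iffD1) (rule ballI)
   qed
  qed
 next
  assume r: ?r
  have "hom_ker (P (i + 1)) (P (i + 2)) (d (i + 1)) = d i ` carrier (P i)" for i
   using cr_exact[OF r, of _ i] cr_dd[OF r, of _ i] hom_closed[OF cr_hom[OF r], of _ i]
   by (auto simp: hom_ker_def)
  moreover have "(\<forall>x \<in> carrier (P i). f (d i x) = \<zero>\<^sub>R) \<longleftrightarrow>
    (\<exists>g \<in> dual R (P (i + 2)). \<forall>x \<in> carrier (P (i + 1)). f x = g (d (i + 1) x))"
   if f: "f \<in> dual R (P (i + 1))" for i f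
  proof
   assume "\<exists>g \<in> dual R (P (i + 2)). \<forall>x \<in> carrier (P (i + 1)). f x = g (d (i + 1) x)"
   then obtain g where g: "g \<in> dual R (P (i + 2))"
    "\<And>x. x \<in> carrier (P (i + 1)) \<Longrightarrow> f x = g (d (i + 1) x)" by blast
   have "ring R" using cr_left_module[OF r] left_module.axioms(1) by blast
   then show "\<forall>x \<in> carrier (P i). f (d i x) = \<zero>\<^sub>R"
    using g(2) hom_closed[OF cr_hom[OF r]] cr_dd[OF r] hom_zero[OF cr_left_module[OF r] left_module_regular g(1)]
    by simp
  qed (use cr_hom_exact[OF r f] in blast)
  ultimately show ?l using r cr_fgp[OF r] cr_hom[OF r] by (simp add: fg_projective_iff_fgp)
 qed
 moreover have "module_isomorphic R M ((P 0)\<lparr>carrier := hom_ker (P 0) (P 1) (d 0)\<rparr>) \<longleftrightarrow> (\<exists>f. cycle_iso R M P d f)"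
  for P :: "int \<Rightarrow> ('r, nat \<Rightarrow> 'r) module" and d
 proof -
  have "f \<in> module_hom R M ((P 0)\<lparr>carrier := hom_ker (P 0) (P 1) (d 0)\<rparr>) \<and>
    bij_betw f (carrier M) (hom_ker (P 0) (P 1) (d 0)) \<longleftrightarrow> cycle_iso R M P d f" for f
   unfolding cycle_iso_def bij_betw_def hom_ker_def module_hom_def by auto
  then show ?thesis unfolding module_isomorphic_def by auto
 qed
 ultimately show ?thesis
  unfolding gorenstein_projective_def by (simp only: conj_assoc[symmetric]) auto
qed

text \<open>The resolution may consist of cosets, pairs or vectors: its type is free, and
  coordinates bring it into the universe of the definition.\<close>

lemma gorenstein_projectiveI:
 fixes R :: "('r, 'q) ring_scheme" and M :: "('r, 'm, 'w) module_scheme"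
 assumes "left_module R M" "complete_resolution R P d" "cycle_iso R M P d f"
 shows "gorenstein_projective R M"
 unfolding gorenstein_projective_iff using complete_resolution_fmod[OF assms(2,3)] assms(1) by blast

text \<open>Coordinate vectors with entries in R are the input form for inducing a resolution along
  paths.\<close>

lemma gorenstein_projectiveE:
 fixes R :: "('r, 'q) ring_scheme" and M :: "('r, 'm, 'w) module_scheme"
 assumes "gorenstein_projective R M"
 obtains H d f where "complete_resolution R (\<lambda>i. fmod R (H i)) d" "cycle_iso R M (\<lambda>i. fmod R (H i)) d f"
  "\<And>i v j. v \<in> H i \<Longrightarrow> v j \<in> carrier R"
proof -
 obtain P :: "int \<Rightarrow> ('r, nat \<Rightarrow> 'r) module" and d f where
  "complete_resolution R P d" "cycle_iso R M P d f"
  using assms unfolding gorenstein_projective_iff by (elim conjE exE)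
 from complete_resolution_fmod[OF this] obtain H d' f' where
  *: "complete_resolution R (\<lambda>i. fmod R (H i)) d'" "cycle_iso R M (\<lambda>i. fmod R (H i)) d' f'"
   "\<forall>i. \<forall>v\<in>H i. \<forall>j. v j \<in> carrier R"
  by (elim conjE exE)
 show ?thesis using *(3) by (intro that[OF *(1,2)]) simp
qed

section \<open>Extensions of Gorenstein-projective modules\<close>

definition dsum_module ::
 "('r, 'm, 'w) module_scheme \<Rightarrow> ('r, 'n, 'z) module_scheme \<Rightarrow> ('r, 'm \<times> 'n) module" where
 "dsum_module M N = \<lparr>carrier = carrier M \<times> carrier N,
   mult = (\<lambda>u v. (fst u \<otimes>\<^sub>M fst v, snd u \<otimes>\<^sub>N snd v)), one = (\<one>\<^sub>M, \<one>\<^sub>N),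
   ring.zero = (\<zero>\<^sub>M, \<zero>\<^sub>N), add = (\<lambda>u v. (fst u \<oplus>\<^sub>M fst v, snd u \<oplus>\<^sub>N snd v)),
   smult = (\<lambda>r u. (r \<odot>\<^sub>M fst u, r \<odot>\<^sub>N snd u))\<rparr>"

lemma dsum_module_simps [simp]:
 "carrier (dsum_module M N) = carrier M \<times> carrier N" "\<zero>\<^bsub>dsum_module M N\<^esub> = (\<zero>\<^sub>M, \<zero>\<^sub>N)"
 "u \<oplus>\<^bsub>dsum_module M N\<^esub> v = (fst u \<oplus>\<^sub>M fst v, snd u \<oplus>\<^sub>N snd v)"
 "r \<odot>\<^bsub>dsum_module M N\<^esub> u = (r \<odot>\<^sub>M fst u, r \<odot>\<^sub>N snd u)"
 by (simp_all add: dsum_module_def)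

lemma left_module_dsum:
 assumes "left_module R M" "left_module R N"
 shows "left_module R (dsum_module M N)"
proof -
 interpret M: left_module R M by fact
 interpret N: left_module R N by fact
 show ?thesis
  by (rule left_moduleI)
   (auto simp: M.R.ring_axioms M.M.add.m_ac N.M.add.m_ac M.smult_l_distr N.smult_l_distr
    M.smult_r_distr N.smult_r_distr M.smult_assoc1 N.smult_assoc1)
qed

text \<open>The two dual bases are concatenated; indices from n on belong to N.\<close>

lemma fgp_dsum:
 assumes M: "fgp R M" and N: "fgp R N"
 shows "fgp R (dsum_module M N)"
proof -
 from M obtain n :: nat and x c where x: "\<And>i. i < n \<Longrightarrow> x i \<in> carrier M"
  and c: "\<And>i. i < n \<Longrightarrow> c i \<in> dual R M"
  and sum: "\<And>y. y \<in> carrier M \<Longrightarrow> y = (\<Oplus>\<^sub>M i\<in>{..<n}. c i y \<odot>\<^sub>M x i)" by (rule fgpE) blast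
 from N obtain n' :: nat and x' c' where x': "\<And>i. i < n' \<Longrightarrow> x' i \<in> carrier N"
  and c': "\<And>i. i < n' \<Longrightarrow> c' i \<in> dual R N"
  and sum': "\<And>y. y \<in> carrier N \<Longrightarrow> y = (\<Oplus>\<^sub>N i\<in>{..<n'}. c' i y \<odot>\<^sub>N x' i)" by (rule fgpE) blast
 note lm = fgp_left_module[OF M] fgp_left_module[OF N]
 let ?S = "dsum_module M N"
 note S = left_module_dsum[OF lm]
 interpret M: left_module R M by (rule lm)
 interpret N: left_module R N by (rule lm)
 interpret S: left_module R ?S by (rule S)
 note cc = dual_closed[OF c]
 note cc' = dual_closed[OF c']
 have i1: "(\<lambda>y. (y, \<zero>\<^sub>N)) \<in> module_hom R M ?S" by (rule module_homI) auto
 have i2: "(\<lambda>y. (\<zero>\<^sub>M, y)) \<in> module_hom R N ?S" by (rule module_homI) auto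
 have p1: "fst \<in> module_hom R ?S M" by (rule module_homI) auto
 have p2: "snd \<in> module_hom R ?S N" by (rule module_homI) auto
 define z where "z i = (if i < n then (x i, \<zero>\<^sub>N) else (\<zero>\<^sub>M, x' (i - n)))" for i
 define e where "e i = (\<lambda>y. if i < n then c i (fst y) else c' (i - n) (snd y))" for i
 have zc: "z i \<in> carrier ?S" if "i < n + n'" for i using that x x' by (auto simp: z_def)
 have ec: "e i y \<in> carrier R" if "i < n + n'" "y \<in> carrier ?S" for i y
  using that cc cc' by (auto simp: e_def)
 show ?thesis
 proof (rule fgpI[OF S, of "n + n'" z e])
  show "e i \<in> module_hom R ?S (regular_module R)" if "i < n + n'" for i
   using that hom_comp[OF p1 c] hom_comp[OF p2 c'] by (cases "i < n") (auto simp: e_def)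
  fix y assume y: "y \<in> carrier ?S"
  then obtain y1 y2 where y12: "y = (y1, y2)" "y1 \<in> carrier M" "y2 \<in> carrier N" by auto
  let ?f = "\<lambda>i. e i y \<odot>\<^bsub>?S\<^esub> z i"
  have fc: "?f i \<in> carrier ?S" if "i < n + n'" for i using S.smult_closed[OF ec[OF that y] zc[OF that]] .
  have "(\<Oplus>\<^bsub>?S\<^esub>i\<in>{..<n + n'}. ?f i) = (\<Oplus>\<^bsub>?S\<^esub>i\<in>{..<n} \<union> {n..<n + n'}. ?f i)"
   by (rule arg_cong[where f = "finsum ?S ?f"]) auto
  also have "\<dots> = (\<Oplus>\<^bsub>?S\<^esub>i\<in>{..<n}. ?f i) \<oplus>\<^bsub>?S\<^esub> (\<Oplus>\<^bsub>?S\<^esub>i\<in>{n..<n + n'}. ?f i)"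
   using fc by (intro S.M.finsum_Un_disjoint) auto
  also have "(\<Oplus>\<^bsub>?S\<^esub>i\<in>{n..<n + n'}. ?f i) = (\<Oplus>\<^bsub>?S\<^esub>i\<in>(\<lambda>i. i + n) ` {..<n'}. ?f i)"
  proof (rule arg_cong[where f = "finsum ?S ?f"])
   have "i \<in> (\<lambda>i. i + n) ` {..<n'}" if "i \<in> {n..<n + n'}" for i
    using that by (intro image_eqI[of _ _ "i - n"]) auto
   then show "{n..<n + n'} = (\<lambda>i. i + n) ` {..<n'}" by auto
  qed
  also have "\<dots> = (\<Oplus>\<^bsub>?S\<^esub>i\<in>{..<n'}. ?f (i + n))"
   using fc by (intro S.M.finsum_reindex) auto
  also have "\<dots> = (\<Oplus>\<^bsub>?S\<^esub>i\<in>{..<n'}. (\<zero>\<^sub>M, c' i y2 \<odot>\<^sub>N x' i))"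
   using y12 x' cc' by (intro S.M.finsum_cong') (auto simp: e_def z_def)
  also have "\<dots> = (\<zero>\<^sub>M, \<Oplus>\<^sub>N i\<in>{..<n'}. c' i y2 \<odot>\<^sub>N x' i)"
   using y12 x' cc' by (intro hom_finsum[OF lm(2) S i2, symmetric]) auto
  also have "(\<Oplus>\<^bsub>?S\<^esub>i\<in>{..<n}. ?f i) = (\<Oplus>\<^bsub>?S\<^esub>i\<in>{..<n}. (c i y1 \<odot>\<^sub>M x i, \<zero>\<^sub>N))"
   using y12 x cc by (intro S.M.finsum_cong') (auto simp: e_def z_def)
  also have "\<dots> = (\<Oplus>\<^sub>M i\<in>{..<n}. c i y1 \<odot>\<^sub>M x i, \<zero>\<^sub>N)"
   using y12 x cc by (intro hom_finsum[OF lm(1) S i1, symmetric]) auto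
  finally show "y = (\<Oplus>\<^bsub>?S\<^esub>i\<in>{..<n + n'}. ?f i)"
   using sum[OF y12(2)] sum'[OF y12(3)] y12 by simp
 qed (use zc in auto)
qed

text \<open>Dependent choice along the integers: a datum satisfying G extends by one step in either
  direction, and two recursions starting from \<open>h0\<close> are glued. G has to carry enough
  information for both kinds of step.\<close>

lemma int_chain:
 fixes G :: "int \<Rightarrow> 'a \<Rightarrow> bool" and S :: "int \<Rightarrow> 'a \<Rightarrow> 'a \<Rightarrow> bool"
 assumes base: "G 0 h0"
  and up: "\<And>i h. G i h \<Longrightarrow> \<exists>h'. G (i + 1) h' \<and> S i h h'"
  and down: "\<And>i h. G (i + 1) h \<Longrightarrow> \<exists>h'. G i h' \<and> S i h' h"
 shows "\<exists>H. H 0 = h0 \<and> (\<forall>i. G i (H i)) \<and> (\<forall>i. S i (H i) (H (i + 1)))"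
proof -
 obtain u where u: "\<And>i h. G i h \<Longrightarrow> G (i + 1) (u i h) \<and> S i h (u i h)" using up by metis
 obtain l where l: "\<And>i h. G (i + 1) h \<Longrightarrow> G i (l i h) \<and> S i (l i h) h" using down by metis
 define U where "U = rec_nat h0 (\<lambda>n. u (int n))"
 \<comment> \<open>\<open>L n\<close> sits in degree - n, and the step from it leads down to degree
   - n - 1; both recursions start at degree 0 with \<open>h0\<close>.\<close>
 define L where "L = rec_nat h0 (\<lambda>n. l (- int n - 1))"
 define H where "H i = (if 0 \<le> i then U (nat i) else L (nat (- i)))" for i
 have U: "G (int n) (U n)" for n
 proof (induction n)
  case (Suc n)
  then show ?case using u[OF Suc] by (simp add: U_def add.commute)
 qed (simp add: U_def base)
 have US: "S (int n) (U n) (U (Suc n))" for n using u[OF U[of n]] by (simp add: U_def)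
 have L: "G (- int n) (L n)" for n
 proof (induction n)
  case (Suc n)
  have eq: "- int (Suc n) = - int n - 1" by simp
  show ?case unfolding eq using l[of "- int n - 1" "L n"] Suc by (simp add: L_def)
 qed (simp add: L_def base)
 have LS: "S (- int n - 1) (L (Suc n)) (L n)" for n using l[of "- int n - 1" "L n"] L[of n] by (simp add: L_def)
 have "G i (H i)" for i using U[of "nat i"] L[of "nat (- i)"] by (auto simp: H_def)
 moreover have "S i (H i) (H (i + 1))" for i
 proof -
  consider "0 \<le> i" | "i = -1" | "i < -1" by linarith
  then show ?thesis
  proof cases
   case 1
   then have "nat (i + 1) = Suc (nat i)" by simp
   then show ?thesis using US[of "nat i"] 1 by (simp add: H_def)
  next
   case 2
   have "U 0 = L 0" by (simp add: U_def L_def)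
   then show ?thesis using LS[of 0] 2 by (simp add: H_def)
  next
   case 3
   then have "nat (- i) = Suc (nat (- (i + 1)))" "- int (nat (- (i + 1))) - 1 = i" by simp_all
   then show ?thesis using LS[of "nat (- (i + 1))"] 3 by (simp add: H_def)
  qed
 qed
 moreover have "H 0 = h0" by (simp add: H_def U_def)
 ultimately show ?thesis by blast
qed

text \<open>Dual exactness is given for functionals only. Composing f with the functionals of a dual
  basis of P reduces to that case, and the basis elements reassemble the extension.\<close>

lemma cr_hom_extend:
 assumes cr: "complete_resolution R Q d" and P: "fgp R P"
  and f: "f \<in> module_hom R (Q (i + 1)) P" and z: "\<And>x. x \<in> carrier (Q i) \<Longrightarrow> f (d i x) = \<zero>\<^sub>P"
 shows "\<exists>g\<in>module_hom R (Q (i + 2)) P. \<forall>x\<in>carrier (Q (i + 1)). f x = g (d (i + 1) x)"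
proof -
 from P obtain n :: nat and x c where x: "\<And>i. i < n \<Longrightarrow> x i \<in> carrier P"
  and c: "\<And>i. i < n \<Longrightarrow> c i \<in> dual R P"
  and sum: "\<And>y. y \<in> carrier P \<Longrightarrow> y = (\<Oplus>\<^sub>P i\<in>{..<n}. c i y \<odot>\<^sub>P x i)" by (rule fgpE) blast
 note lm = fgp_left_module[OF P]
 interpret P: left_module R P by (rule lm)
 have reg: "left_module R (regular_module R)" by (rule left_module_regular) (rule P.R.ring_axioms)
 have "\<exists>g\<in>dual R (Q (i + 2)). \<forall>x\<in>carrier (Q (i + 1)). c k (f x) = g (d (i + 1) x)"
  if k: "k < n" for k
  using hom_zero[OF lm reg c[OF k]] z by (intro cr_hom_exact[OF cr hom_comp[OF f c[OF k]]]) auto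
 then obtain g where g: "\<And>k. k < n \<Longrightarrow> g k \<in> dual R (Q (i + 2))"
  and gd: "\<And>k x. k < n \<Longrightarrow> x \<in> carrier (Q (i + 1)) \<Longrightarrow> c k (f x) = g k (d (i + 1) x)" by metis
 have "f y = (\<Oplus>\<^sub>P k\<in>{..<n}. g k (d (i + 1) y) \<odot>\<^sub>P x k)" if y: "y \<in> carrier (Q (i + 1))" for y
 proof -
  note fy = hom_closed[OF f y]
  note cf = dual_closed[OF c fy]
  have "(\<Oplus>\<^sub>P k\<in>{..<n}. c k (f y) \<odot>\<^sub>P x k) = (\<Oplus>\<^sub>P k\<in>{..<n}. g k (d (i + 1) y) \<odot>\<^sub>P x k)"
   using cf x gd[OF _ y] by (intro P.M.finsum_cong') auto
  then show ?thesis using sum[OF fy] by simp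
 qed
 then show ?thesis by (intro bexI[OF _ hom_lincomb[OF lm g x]]) auto
qed

text \<open>The middle term \<open>E\<close> is the module of cycles of the complex \<open>P\<^sup>i \<oplus> Q\<^sup>i\<close> with differential
 \<open>(x, y) \<mapsto> (d x + h y, d y)\<close>, where the twist \<open>h\<close> is built step by step in both directions,
 starting from an extension \<open>a : E \<rightarrow> P\<^sup>0\<close> of \<open>M \<rightarrow> P\<^sup>0\<close>.\<close>

lemma gorenstein_projective_extension:
 fixes R :: "('r, 'q) ring_scheme" and M :: "('r, 'm, 'w) module_scheme"
  and E :: "('r, 'e, 'y) module_scheme" and N :: "('r, 'n, 'z) module_scheme"
 assumes E: "left_module R E" and M: "gorenstein_projective R M" and N: "gorenstein_projective R N"
  and i: "i \<in> module_hom R M E" "inj_on i (carrier M)"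
  and p: "p \<in> module_hom R E N" "p ` carrier E = carrier N"
  and ker: "\<And>e. e \<in> carrier E \<Longrightarrow> p e = \<zero>\<^sub>N \<longleftrightarrow> e \<in> i ` carrier M"
 shows "gorenstein_projective R E"
proof -
 obtain P :: "int \<Rightarrow> ('r, nat \<Rightarrow> 'r) module" and dP fM where
  crP: "complete_resolution R P dP" and fM: "cycle_iso R M P dP fM"
  using M unfolding gorenstein_projective_iff by (elim conjE exE)
 obtain Q :: "int \<Rightarrow> ('r, nat \<Rightarrow> 'r) module" and dQ fN where
  crQ: "complete_resolution R Q dQ" and fN: "cycle_iso R N Q dQ fN"
  using N unfolding gorenstein_projective_iff by (elim conjE exE)
 have M': "left_module R M" and N': "left_module R N"
  using M N by (auto simp: gorenstein_projective_iff)
 note P = cr_left_module[OF crP] and Q = cr_left_module[OF crQ]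
 note fMh = conjunct1[OF fM[unfolded cycle_iso_def]] and fNh = conjunct1[OF fN[unfolded cycle_iso_def]]
 interpret E: left_module R E by (rule E)
 interpret M: left_module R M by (rule M')
 interpret N: left_module R N by (rule N')
 interpret P: left_module R "P j" for j by (rule P)
 interpret Q: left_module R "Q j" for j by (rule Q)
 note dPc = hom_closed[OF cr_hom[OF crP]]
 note dQc = hom_closed[OF cr_hom[OF crQ]]
 note fMc = hom_closed[OF fMh]
 have fMd: "dP 0 (fM m) = \<zero>\<^bsub>P 1\<^esub>" if "m \<in> carrier M" for m
  using fM that unfolding cycle_iso_def by blast
 have fMs: "\<exists>m\<in>carrier M. x = fM m" if "x \<in> carrier (P 0)" "dP 0 x = \<zero>\<^bsub>P 1\<^esub>" for x
 proof -
  have "x \<in> fM ` carrier M" using fM that unfolding cycle_iso_def by simp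
  then show ?thesis by blast
 qed
 define q where "q e = fN (p e)" for e
 have q: "q \<in> module_hom R E (Q 0)" unfolding q_def by (rule hom_comp[OF p(1) fNh])
 note qc = hom_closed[OF q]
 have qd: "dQ 0 (q e) = \<zero>\<^bsub>Q 1\<^esub>" if "e \<in> carrier E" for e
  using fN hom_closed[OF p(1) that] unfolding cycle_iso_def q_def by blast
 have qs: "\<exists>e\<in>carrier E. x = q e" if "x \<in> carrier (Q 0)" "dQ 0 x = \<zero>\<^bsub>Q 1\<^esub>" for x
 proof -
  have "x \<in> fN ` carrier N" using fN that unfolding cycle_iso_def by simp
  then obtain n where n: "n \<in> carrier N" "x = fN n" by blast
  then have "n \<in> p ` carrier E" using p(2) by simp
  then show ?thesis using n(2) unfolding q_def by blast
 qed
 have qk: "q e = \<zero>\<^bsub>Q 0\<^esub> \<longleftrightarrow> e \<in> i ` carrier M" if e: "e \<in> carrier E" for e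
 proof -
  note pe = hom_closed[OF p(1) e]
  have inj: "inj_on fN (carrier N)" using fN unfolding cycle_iso_def by blast
  have "q e = \<zero>\<^bsub>Q 0\<^esub> \<longleftrightarrow> p e = \<zero>\<^sub>N"
   using inj_on_eq_iff[OF inj pe N.M.zero_closed] hom_zero[OF N' Q fNh] by (simp add: q_def)
  then show ?thesis using ker[OF e] by simp
 qed
 note ic = hom_closed[OF i(1)]
 have iD: "m = m'" if "i m = i m'" "m \<in> carrier M" "m' \<in> carrier M" for m m'
  using that i(2) by (auto dest: inj_onD)
 have qi: "q (i m) = \<zero>\<^bsub>Q 0\<^esub>" if "m \<in> carrier M" for m using qk[OF ic[OF that]] that by blast
 have dQm1: "dQ (-1) \<in> module_hom R (Q (-1)) (Q 0)" using cr_hom[OF crQ, of "-1"] by simp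
 have dQm1c: "dQ (-1) x \<in> carrier (Q 0)" if "x \<in> carrier (Q (-1))" for x using dQc[OF that] by simp
 have dQm2c: "dQ (-2) x \<in> carrier (Q (-1))" if "x \<in> carrier (Q (-2))" for x using dQc[OF that] by simp
 have dQ01: "dQ 0 (dQ (-1) x) = \<zero>\<^bsub>Q 1\<^esub>" if "x \<in> carrier (Q (-1))" for x
  using cr_dd[OF crQ that] by simp
 have dQ12: "dQ (-1) (dQ (-2) x) = \<zero>\<^bsub>Q 0\<^esub>" if "x \<in> carrier (Q (-2))" for x
  using cr_dd[OF crQ that] by simp
 have dQ23: "dQ (-2) (dQ (-3) x) = \<zero>\<^bsub>Q (-1)\<^esub>" if "x \<in> carrier (Q (-3))" for x
  using cr_dd[OF crQ that] by simp
 have exQ0: "\<exists>y\<in>carrier (Q (-1)). x = dQ (-1) y" if "x \<in> carrier (Q 0)" "dQ 0 x = \<zero>\<^bsub>Q 1\<^esub>" for x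
  using cr_exact[OF crQ, of x "-1"] that by simp
 have exQ1: "\<exists>y\<in>carrier (Q (-2)). x = dQ (-2) y" if "x \<in> carrier (Q (-1))" "dQ (-1) x = \<zero>\<^bsub>Q 0\<^esub>" for x
  using cr_exact[OF crQ, of x "-2"] that by simp
 \<comment> \<open>The cycles of \<open>Q 0\<close> are the image of q and \<open>Q (-1)\<close> is
   projective, so its differential lifts to E. Thus E is the sum of the images of i and s, and their
   overlap comes from \<open>Q (-2)\<close>.\<close>
 obtain s where s: "s \<in> module_hom R (Q (-1)) E" and qs': "\<And>x. x \<in> carrier (Q (-1)) \<Longrightarrow> q (s x) = dQ (-1) x"
  using fgp_lift[OF cr_fgp[OF crQ] E Q q dQm1] qs dQm1c dQ01 by blast
 note sc = hom_closed[OF s]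
 have dQm2: "dQ (-2) \<in> module_hom R (Q (-2)) (Q (-1))" using cr_hom[OF crQ, of "-2"] by simp
 \<comment> \<open>On \<open>Q (-2)\<close> the composite of s with the differential lands in the
   image of i; t is the resulting map to M followed by the embedding of M. It vanishes on boundaries
   and so extends to a map g on \<open>Q (-1)\<close>, which prescribes the values of a on the image
   of s.\<close>
 define t where "t x = fM (THE m. m \<in> carrier M \<and> s (dQ (-2) x) = i m)" for x
 have sm: "\<exists>m\<in>carrier M. s (dQ (-2) x) = i m" if "x \<in> carrier (Q (-2))" for x
  using qk[OF sc[OF dQm2c[OF that]]] qs'[OF dQm2c[OF that]] dQ12[OF that] by auto
 have tI: "t x = fM m" if "s (dQ (-2) x) = i m" "m \<in> carrier M" for x m
 proof -
  have "(THE m. m \<in> carrier M \<and> s (dQ (-2) x) = i m) = m"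
   using that iD by (intro the_equality) auto
  then show ?thesis by (simp add: t_def)
 qed
 have t: "t \<in> module_hom R (Q (-2)) (P 0)"
 proof (rule module_homI)
  fix x assume x: "x \<in> carrier (Q (-2))"
  then obtain m where m: "m \<in> carrier M" "s (dQ (-2) x) = i m" using sm by blast
  show "t x \<in> carrier (P 0)" using m fMc by (simp add: tI)
  show "t (r \<odot>\<^bsub>Q (-2)\<^esub> x) = r \<odot>\<^bsub>P 0\<^esub> t x" if r: "r \<in> carrier R" for r
  proof -
   have "s (dQ (-2) (r \<odot>\<^bsub>Q (-2)\<^esub> x)) = i (r \<odot>\<^sub>M m)"
    using m x r by (simp add: hom_smult[OF dQm2] hom_smult[OF s] hom_smult[OF i(1)] dQm2c)
   from tI[OF this] show ?thesis using m r by (simp add: tI hom_smult[OF fMh])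
  qed
  fix y assume y: "y \<in> carrier (Q (-2))"
  then obtain m' where m': "m' \<in> carrier M" "s (dQ (-2) y) = i m'" using sm by blast
  have "s (dQ (-2) (x \<oplus>\<^bsub>Q (-2)\<^esub> y)) = i (m \<oplus>\<^sub>M m')"
   using m m' x y by (simp add: hom_add[OF dQm2] hom_add[OF s] hom_add[OF i(1)] dQm2c)
  from tI[OF this] show "t (x \<oplus>\<^bsub>Q (-2)\<^esub> y) = t x \<oplus>\<^bsub>P 0\<^esub> t y"
   using m m' by (simp add: tI hom_add[OF fMh])
 qed
 have "t (dQ (-3) x) = \<zero>\<^bsub>P 0\<^esub>" if x: "x \<in> carrier (Q (-3))" for x
 proof -
  have "s (dQ (-2) (dQ (-3) x)) = i \<zero>\<^sub>M"
   using dQ23[OF x] hom_zero[OF Q E s] hom_zero[OF M' E i(1)] by simp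
  from tI[OF this] show ?thesis using hom_zero[OF M' P fMh] by simp
 qed
 then obtain g where g: "g \<in> module_hom R (Q (-1)) (P 0)"
  and gt: "\<And>x. x \<in> carrier (Q (-2)) \<Longrightarrow> t x = g (dQ (-2) x)"
  using cr_hom_extend[OF crQ cr_fgp[OF crP, of 0], of t "-3"] t by auto
 note gc = hom_closed[OF g]
 \<comment> \<open>The graph of a. If a decomposition represents zero, its x is a boundary from
   \<open>Q (-2)\<close>, and the two contributions to v cancel by the choice of g.\<close>
 define A where "A e v \<longleftrightarrow> (\<exists>x\<in>carrier (Q (-1)). \<exists>m\<in>carrier M. e = i m \<oplus>\<^sub>E s x \<and> v = fM m \<oplus>\<^bsub>P 0\<^esub> g x)" for e v
 have split: "\<exists>x\<in>carrier (Q (-1)). \<exists>m\<in>carrier M. e = i m \<oplus>\<^sub>E s x" if e: "e \<in> carrier E" for e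
 proof -
  obtain x where x: "x \<in> carrier (Q (-1))" "q e = dQ (-1) x" using exQ0 qc[OF e] qd[OF e] by blast
  have "q (e \<ominus>\<^sub>E s x) = q e \<ominus>\<^bsub>Q 0\<^esub> q (s x)" using e x sc by (intro hom_diff[OF E Q q]) auto
  also have "\<dots> = \<zero>\<^bsub>Q 0\<^esub>" using x qs' qc[OF e] by (simp add: Q.M.minus_eq_zero_iff)
  finally obtain m where "m \<in> carrier M" "e \<ominus>\<^sub>E s x = i m" using qk e x sc by blast
  then show ?thesis using x e sc E.M.minus_add_cancel[of e "s x"] by metis
 qed
 have "\<exists>a\<in>module_hom R E (P 0). \<forall>e v. A e v \<longleftrightarrow> e \<in> carrier E \<and> v = a e"
 proof (rule rel_hom[OF E P])
  show "e \<in> carrier E \<and> v \<in> carrier (P 0)" if "A e v" for e v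
   using that ic sc fMc gc unfolding A_def by auto
  show "\<exists>v. A e v" if "e \<in> carrier E" for e using split[OF that] unfolding A_def by blast
 next
  fix e e' v v' assume "A e v" "A e' v'"
  then obtain x m x' m' where xm: "x \<in> carrier (Q (-1))" "m \<in> carrier M" "x' \<in> carrier (Q (-1))" "m' \<in> carrier M"
   and eq: "e = i m \<oplus>\<^sub>E s x" "v = fM m \<oplus>\<^bsub>P 0\<^esub> g x" "e' = i m' \<oplus>\<^sub>E s x'" "v' = fM m' \<oplus>\<^bsub>P 0\<^esub> g x'"
   unfolding A_def by blast
  show "A (e \<oplus>\<^sub>E e') (v \<oplus>\<^bsub>P 0\<^esub> v')"
   unfolding A_def eq
  proof (intro bexI conjI)
   show "i m \<oplus>\<^sub>E s x \<oplus>\<^sub>E (i m' \<oplus>\<^sub>E s x') = i (m \<oplus>\<^sub>M m') \<oplus>\<^sub>E s (x \<oplus>\<^bsub>Q (-1)\<^esub> x')"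
    using xm ic sc by (simp add: hom_add[OF i(1)] hom_add[OF s] E.M.add.m_ac)
   show "fM m \<oplus>\<^bsub>P 0\<^esub> g x \<oplus>\<^bsub>P 0\<^esub> (fM m' \<oplus>\<^bsub>P 0\<^esub> g x') = fM (m \<oplus>\<^sub>M m') \<oplus>\<^bsub>P 0\<^esub> g (x \<oplus>\<^bsub>Q (-1)\<^esub> x')"
    using xm fMc gc by (simp add: hom_add[OF fMh] hom_add[OF g] P.M.add.m_ac)
  qed (use xm in auto)
 next
  fix r e v assume r: "r \<in> carrier R" and "A e v"
  then obtain x m where xm: "x \<in> carrier (Q (-1))" "m \<in> carrier M"
   and eq: "e = i m \<oplus>\<^sub>E s x" "v = fM m \<oplus>\<^bsub>P 0\<^esub> g x"
   unfolding A_def by blast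
  show "A (r \<odot>\<^sub>E e) (r \<odot>\<^bsub>P 0\<^esub> v)"
   unfolding A_def eq
  proof (intro bexI conjI)
   show "r \<odot>\<^sub>E (i m \<oplus>\<^sub>E s x) = i (r \<odot>\<^sub>M m) \<oplus>\<^sub>E s (r \<odot>\<^bsub>Q (-1)\<^esub> x)"
    using xm ic sc r by (simp add: hom_smult[OF i(1)] hom_smult[OF s] E.smult_r_distr)
   show "r \<odot>\<^bsub>P 0\<^esub> (fM m \<oplus>\<^bsub>P 0\<^esub> g x) = fM (r \<odot>\<^sub>M m) \<oplus>\<^bsub>P 0\<^esub> g (r \<odot>\<^bsub>Q (-1)\<^esub> x)"
    using xm fMc gc r by (simp add: hom_smult[OF fMh] hom_smult[OF g] P.smult_r_distr)
  qed (use xm r in auto)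
 next
  fix v assume "A \<zero>\<^sub>E v"
  then obtain x m where xm: "x \<in> carrier (Q (-1))" "m \<in> carrier M"
   and eq: "\<zero>\<^sub>E = i m \<oplus>\<^sub>E s x" "v = fM m \<oplus>\<^bsub>P 0\<^esub> g x"
   unfolding A_def by blast
  have "q (i m \<oplus>\<^sub>E s x) = \<zero>\<^bsub>Q 0\<^esub>" using hom_zero[OF E Q q] eq by simp
  then have "dQ (-1) x = \<zero>\<^bsub>Q 0\<^esub>"
   using xm ic sc qi qs' dQm1c by (simp add: hom_add[OF q])
  then obtain y where y: "y \<in> carrier (Q (-2))" "x = dQ (-2) y" using exQ1 xm by blast
  have "s x = \<ominus>\<^sub>E i m" using eq(1) xm ic sc by (metis E.M.minus_equality E.M.minus_minus)
  then have "s (dQ (-2) y) = i (\<ominus>\<^sub>M m)" using y xm by (simp add: hom_minus[OF M' E i(1)])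
  from tI[OF this] have "g x = \<ominus>\<^bsub>P 0\<^esub> fM m" using gt y xm by (simp add: hom_minus[OF M' P fMh])
  then show "v = \<zero>\<^bsub>P 0\<^esub>" using eq xm fMc by (simp add: P.M.r_neg)
 qed
 then obtain a where a: "a \<in> module_hom R E (P 0)" and aA: "\<And>e v. A e v \<Longrightarrow> v = a e" by blast
 note ac = hom_closed[OF a]
 have ai: "a (i m) = fM m" if m: "m \<in> carrier M" for m
 proof -
  have "A (i m) (fM m)" unfolding A_def
   using m ic fMc hom_zero[OF Q E s] hom_zero[OF Q P g]
   by (intro bexI[of _ "\<zero>\<^bsub>Q (-1)\<^esub>"] bexI[of _ m]) auto
  then show ?thesis using aA by metis
 qed
 have dP0: "dP 0 \<in> module_hom R (P 0) (P 1)" using cr_hom[OF crP, of 0] by simp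
 have dP0c: "dP 0 x \<in> carrier (P 1)" if "x \<in> carrier (P 0)" for x using dPc[OF that] by simp
 \<comment> \<open>On a cycle \<open>q e\<close> the twist is forced to be the negative of
   \<open>dP 0 (a e)\<close>, so that \<open>(a e, q e)\<close> becomes a cycle of the twisted
   complex. The map on \<open>Q (-1)\<close> obtained from s kills boundaries, hence this
   prescription extends over all of \<open>Q 0\<close>.\<close>
 have "\<exists>h\<in>module_hom R (Q 0) (P 1). \<forall>x\<in>carrier (Q (-1)). \<ominus>\<^bsub>P 1\<^esub> dP 0 (a (s x)) = h (dQ (-1) x)"
 proof -
  have "(\<lambda>x. \<ominus>\<^bsub>P 1\<^esub> dP 0 (a (s x))) \<in> module_hom R (Q (-1)) (P 1)"
   by (intro hom_uminus[OF P] hom_comp[OF hom_comp[OF s a] dP0])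
  moreover have "\<ominus>\<^bsub>P 1\<^esub> dP 0 (a (s (dQ (-2) x))) = \<zero>\<^bsub>P 1\<^esub>" if x: "x \<in> carrier (Q (-2))" for x
  proof -
   obtain m where "m \<in> carrier M" "s (dQ (-2) x) = i m" using sm[OF x] by blast
   then show ?thesis by (simp add: ai fMd)
  qed
  ultimately show ?thesis
   using cr_hom_extend[OF crQ cr_fgp[OF crP, of 1], of "\<lambda>x. \<ominus>\<^bsub>P 1\<^esub> dP 0 (a (s x))" "-2"] by auto
 qed
 then obtain h0 where h0: "h0 \<in> module_hom R (Q 0) (P 1)"
  and h0d: "\<And>x. x \<in> carrier (Q (-1)) \<Longrightarrow> h0 (dQ (-1) x) = \<ominus>\<^bsub>P 1\<^esub> dP 0 (a (s x))" by metis
 have h0q: "h0 (q e) = \<ominus>\<^bsub>P 1\<^esub> dP 0 (a e)" if e: "e \<in> carrier E" for e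
 proof -
  obtain x m where xm: "x \<in> carrier (Q (-1))" "m \<in> carrier M" "e = i m \<oplus>\<^sub>E s x" using split[OF e] by blast
  then have "q e = dQ (-1) x" using ic sc by (simp add: hom_add[OF q] qi qs' dQm1c)
  moreover have "dP 0 (a e) = dP 0 (a (s x))"
   using xm ic sc by (simp add: hom_add[OF a] hom_add[OF dP0] ai fMd fMc ac dP0c)
  ultimately show ?thesis using h0d xm by simp
 qed
 \<comment> \<open>S is the anticommutation that makes the twisted differential square to zero. G
   also records that the twist, put between the two differentials, gives zero: going up this permits
   extension by dual exactness of Q, going down it turns values into cycles of P, so that
   projectivity of \<open>Q j\<close> applies.\<close>
 define G where "G j h \<longleftrightarrow> h \<in> module_hom R (Q j) (P (j + 1)) \<and>
  (\<forall>x\<in>carrier (Q (j - 1)). dP (j + 1) (h (dQ (j - 1) x)) = \<zero>\<^bsub>P (j + 2)\<^esub>)" for j h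
 define S where "S j h h' \<longleftrightarrow> (\<forall>x\<in>carrier (Q j). h' (dQ j x) = \<ominus>\<^bsub>P (j + 2)\<^esub> dP (j + 1) (h x))" for j h h'
 have dP1: "dP (j + 1) \<in> module_hom R (P (j + 1)) (P (j + 2))" for j
  using cr_hom[OF crP, of "j + 1"] by (simp add: add.assoc)
 note dP1c = hom_closed[OF dP1]
 have ddP2: "dP (j + 2) (dP (j + 1) x) = \<zero>\<^bsub>P (j + 3)\<^esub>" if "x \<in> carrier (P (j + 1))" for j x
  using cr_dd[OF crP that] by (simp add: add.assoc)
 have "\<exists>H. H 0 = h0 \<and> (\<forall>j. G j (H j)) \<and> (\<forall>j. S j (H j) (H (j + 1)))"
 proof (rule int_chain)
  have "dP 1 (h0 (dQ (-1) x)) = \<zero>\<^bsub>P 2\<^esub>" if x: "x \<in> carrier (Q (-1))" for x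
  proof -
   have "dP 1 (dP 0 (a (s x))) = \<zero>\<^bsub>P 2\<^esub>" using cr_dd[OF crP ac[OF sc[OF x]]] by simp
   moreover have "dP 1 (\<ominus>\<^bsub>P 1\<^esub> dP 0 (a (s x))) = \<ominus>\<^bsub>P 2\<^esub> dP 1 (dP 0 (a (s x)))"
    using dP1[of 0] x by (intro hom_minus[OF P P] dP0c ac sc) auto
   ultimately show ?thesis using h0d[OF x] by simp
  qed
  then show "G 0 h0" using h0 by (simp add: G_def)
 next
  fix j h assume "G j h"
  then have h: "h \<in> module_hom R (Q j) (P (j + 1))"
   and hz: "\<And>x. x \<in> carrier (Q (j - 1)) \<Longrightarrow> dP (j + 1) (h (dQ (j - 1) x)) = \<zero>\<^bsub>P (j + 2)\<^esub>"
   by (auto simp: G_def)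
  note hc = hom_closed[OF h]
  have f: "(\<lambda>x. \<ominus>\<^bsub>P (j + 2)\<^esub> dP (j + 1) (h x)) \<in> module_hom R (Q j) (P (j + 2))"
   by (intro hom_uminus[OF P] hom_comp[OF h dP1])
  then have f': "(\<lambda>x. \<ominus>\<^bsub>P (j + 2)\<^esub> dP (j + 1) (h x)) \<in> module_hom R (Q (j - 1 + 1)) (P (j + 2))" by simp
  have "\<exists>h'\<in>module_hom R (Q (j + 1)) (P (j + 2)). \<forall>x\<in>carrier (Q j). \<ominus>\<^bsub>P (j + 2)\<^esub> dP (j + 1) (h x) = h' (dQ j x)"
   using cr_hom_extend[OF crQ cr_fgp[OF crP, of "j + 2"] f'] hz by (simp add: add.commute[of 1 j])
  then obtain h' where h': "h' \<in> module_hom R (Q (j + 1)) (P (j + 2))"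
   "\<And>x. x \<in> carrier (Q j) \<Longrightarrow> h' (dQ j x) = \<ominus>\<^bsub>P (j + 2)\<^esub> dP (j + 1) (h x)" by metis
  have "dP (j + 2) (h' (dQ j x)) = \<zero>\<^bsub>P (j + 3)\<^esub>" if x: "x \<in> carrier (Q j)" for x
  proof -
   have "dP (j + 2) (\<ominus>\<^bsub>P (j + 2)\<^esub> dP (j + 1) (h x)) = \<ominus>\<^bsub>P (j + 3)\<^esub> dP (j + 2) (dP (j + 1) (h x))"
    using dP1[of "j + 1"] hc[OF x] by (intro hom_minus[OF P P] dP1c) (auto simp: add.assoc)
   then show ?thesis using h'(2)[OF x] ddP2[OF hc[OF x]] by simp
  qed
  then have "G (j + 1) h' \<and> S j h h'" using h' by (auto simp: G_def S_def add.assoc)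
  then show "\<exists>h'. G (j + 1) h' \<and> S j h h'" by blast
 next
  fix j h assume "G (j + 1) h"
  then have h: "h \<in> module_hom R (Q (j + 1)) (P (j + 2))"
   and hz: "\<And>x. x \<in> carrier (Q j) \<Longrightarrow> dP (j + 2) (h (dQ j x)) = \<zero>\<^bsub>P (j + 3)\<^esub>"
   by (auto simp: G_def add.assoc)
  note hc = hom_closed[OF h]
  have f: "(\<lambda>x. \<ominus>\<^bsub>P (j + 2)\<^esub> h (dQ j x)) \<in> module_hom R (Q j) (P (j + 2))"
   by (intro hom_uminus[OF P] hom_comp[OF cr_hom[OF crQ] h])
  have "\<exists>y\<in>carrier (P (j + 1)). \<ominus>\<^bsub>P (j + 2)\<^esub> h (dQ j x) = dP (j + 1) y" if x: "x \<in> carrier (Q j)" for x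
  proof -
   have c: "h (dQ j x) \<in> carrier (P (j + 2))" using hc dQc x by blast
   have "dP (j + 2) (\<ominus>\<^bsub>P (j + 2)\<^esub> h (dQ j x)) = \<ominus>\<^bsub>P (j + 3)\<^esub> dP (j + 2) (h (dQ j x))"
    using dP1[of "j + 1"] c by (intro hom_minus[OF P P]) (auto simp: add.assoc)
   also have "\<dots> = \<zero>\<^bsub>P (j + 3)\<^esub>" using hz[OF x] by simp
   finally show ?thesis using cr_exact[OF crP, of "\<ominus>\<^bsub>P (j + 2)\<^esub> h (dQ j x)" "j + 1"] c
    by (simp add: add.assoc)
  qed
  then obtain h' where h': "h' \<in> module_hom R (Q j) (P (j + 1))"
   "\<And>x. x \<in> carrier (Q j) \<Longrightarrow> dP (j + 1) (h' x) = \<ominus>\<^bsub>P (j + 2)\<^esub> h (dQ j x)"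
   using fgp_lift[OF cr_fgp[OF crQ] P P dP1 f] by blast
  have "dP (j + 1) (h' (dQ (j - 1) x)) = \<zero>\<^bsub>P (j + 2)\<^esub>" if x: "x \<in> carrier (Q (j - 1))" for x
  proof -
   have c: "dQ (j - 1) x \<in> carrier (Q j)" using dQc[OF x] by simp
   have "dQ j (dQ (j - 1) x) = \<zero>\<^bsub>Q (j + 1)\<^esub>" using cr_dd[OF crQ x] by (simp add: add.commute[of 1 j])
   then show ?thesis using h'(2)[OF c] hom_zero[OF Q P h] by simp
  qed
  moreover have "S j h' h"
   unfolding S_def using h' hc dQc by simp
  ultimately have "G j h' \<and> S j h' h" using h' by (auto simp: G_def)
  then show "\<exists>h'. G j h' \<and> S j h' h" by blast
 qed
 then obtain h where hz: "h 0 = h0" and hG: "\<And>j. G j (h j)" and hS: "\<And>j. S j (h j) (h (j + 1))" by blast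
 have h: "h j \<in> module_hom R (Q j) (P (j + 1))" for j using hG unfolding G_def by blast
 note hc = hom_closed[OF h]
 have h1: "h (j + 1) \<in> module_hom R (Q (j + 1)) (P (j + 2))" for j using h[of "j + 1"] by (simp add: add.assoc)
 note hc1 = hom_closed[OF h1]
 have hd: "h (j + 1) (dQ j x) = \<ominus>\<^bsub>P (j + 2)\<^esub> dP (j + 1) (h j x)" if "x \<in> carrier (Q j)" for j x
  using hS that unfolding S_def by blast
 define C where "C j = dsum_module (P j) (Q j)" for j
 define D where "D j u = (dP j (fst u) \<oplus>\<^bsub>P (j + 1)\<^esub> h j (snd u), dQ j (snd u))" for j u
 have C: "left_module R (C j)" for j unfolding C_def by (intro left_module_dsum P Q)
 have p1: "fst \<in> module_hom R (C j) (P j)" for j unfolding C_def by (rule module_homI) auto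
 have p2: "snd \<in> module_hom R (C j) (Q j)" for j unfolding C_def by (rule module_homI) auto
 have i1: "(\<lambda>x. (x, \<zero>\<^bsub>Q j\<^esub>)) \<in> module_hom R (P j) (C j)" for j unfolding C_def by (rule module_homI) auto
 have i2: "(\<lambda>x. (\<zero>\<^bsub>P j\<^esub>, x)) \<in> module_hom R (Q j) (C j)" for j unfolding C_def by (rule module_homI) auto
 have reg: "left_module R (regular_module R)" by (rule left_module_regular) (rule E.R.ring_axioms)
 have D2: "D (j + 1) u = (dP (j + 1) (fst u) \<oplus>\<^bsub>P (j + 2)\<^esub> h (j + 1) (snd u), dQ (j + 1) (snd u))" for j u
  by (simp add: D_def add.assoc)
 have crC: "complete_resolution R C D"
 proof (rule complete_resolutionI)
  show "fgp R (C j)" for j unfolding C_def by (intro fgp_dsum cr_fgp[OF crP] cr_fgp[OF crQ])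
  show "D j \<in> module_hom R (C j) (C (j + 1))" for j
  proof -
   have 1: "(\<lambda>u. dP j (fst u) \<oplus>\<^bsub>P (j + 1)\<^esub> h j (snd u)) \<in> module_hom R (C j) (P (j + 1))"
    by (intro hom_plus[OF P] hom_comp[OF p1 cr_hom[OF crP]] hom_comp[OF p2 h])
   have 2: "(\<lambda>u. dQ j (snd u)) \<in> module_hom R (C j) (Q (j + 1))"
    by (intro hom_comp[OF p2 cr_hom[OF crQ]])
   show ?thesis
    using hom_closed[OF 1] hom_closed[OF 2] hom_add[OF 1] hom_add[OF 2] hom_smult[OF 1] hom_smult[OF 2]
    by (intro module_homI) (auto simp: C_def D_def)
  qed
  fix j
  show "D (j + 1) (D j u) = \<zero>\<^bsub>C (j + 2)\<^esub>" if u: "u \<in> carrier (C j)" for u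
  proof -
   obtain x y where xy: "u = (x, y)" "x \<in> carrier (P j)" "y \<in> carrier (Q j)" using u by (auto simp: C_def)
   have "dP (j + 1) (dP j x \<oplus>\<^bsub>P (j + 1)\<^esub> h j y) = dP (j + 1) (h j y)"
    using xy dPc hc dP1c cr_dd[OF crP] by (simp add: hom_add[OF dP1])
   then show ?thesis
    using xy hc dP1c hd cr_dd[OF crQ] by (simp add: D2) (simp add: D_def C_def P.M.r_neg)
  qed
  show "\<exists>v\<in>carrier (C j). u = D j v" if u: "u \<in> carrier (C (j + 1))" and Du: "D (j + 1) u = \<zero>\<^bsub>C (j + 2)\<^esub>" for u
  proof -
   obtain x y where xy: "u = (x, y)" "x \<in> carrier (P (j + 1))" "y \<in> carrier (Q (j + 1))" using u by (auto simp: C_def)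
   have 1: "dP (j + 1) x \<oplus>\<^bsub>P (j + 2)\<^esub> h (j + 1) y = \<zero>\<^bsub>P (j + 2)\<^esub>" and 2: "dQ (j + 1) y = \<zero>\<^bsub>Q (j + 2)\<^esub>"
    using Du xy by (auto simp: D2 C_def)
   obtain y' where y': "y' \<in> carrier (Q j)" "y = dQ j y'" using cr_exact[OF crQ xy(3) 2] by blast
   have "dP (j + 1) (x \<ominus>\<^bsub>P (j + 1)\<^esub> h j y') = dP (j + 1) x \<ominus>\<^bsub>P (j + 2)\<^esub> dP (j + 1) (h j y')"
    using xy y' hc by (intro hom_diff[OF P P dP1]) auto
   also have "\<dots> = \<zero>\<^bsub>P (j + 2)\<^esub>" using 1 y' hd by (simp add: a_minus_def)
   finally obtain x' where x': "x' \<in> carrier (P j)" "x \<ominus>\<^bsub>P (j + 1)\<^esub> h j y' = dP j x'"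
    using cr_exact[OF crP] xy y' hc by (meson P.M.minus_closed)
   then have "x = dP j x' \<oplus>\<^bsub>P (j + 1)\<^esub> h j y'"
    using P.M.minus_add_cancel[of x "j + 1" "h j y'"] xy y' hc by simp
   then show ?thesis using xy x' y' by (intro bexI[of _ "(x', y')"]) (auto simp: D_def C_def)
  qed
  show "\<exists>g\<in>dual R (C (j + 2)). \<forall>u\<in>carrier (C (j + 1)). f u = g (D (j + 1) u)"
   if f: "f \<in> dual R (C (j + 1))"
    and fz: "\<And>u. u \<in> carrier (C j) \<Longrightarrow> f (D j u) = \<zero>\<^sub>R" for f
  proof -
   define f1 where "f1 x = f (x, \<zero>\<^bsub>Q (j + 1)\<^esub>)" for x
   define f2 where "f2 y = f (\<zero>\<^bsub>P (j + 1)\<^esub>, y)" for y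
   have f1: "f1 \<in> dual R (P (j + 1))" unfolding f1_def by (rule hom_comp[OF i1 f])
   have f2: "f2 \<in> dual R (Q (j + 1))" unfolding f2_def by (rule hom_comp[OF i2 f])
   note f1c = dual_closed[OF f1]
   note f2c = dual_closed[OF f2]
   have f12: "f (x, y) = f1 x \<oplus>\<^sub>R f2 y" if "x \<in> carrier (P (j + 1))" "y \<in> carrier (Q (j + 1))" for x y
    using hom_add[OF f, of "(x, \<zero>\<^bsub>Q (j + 1)\<^esub>)" "(\<zero>\<^bsub>P (j + 1)\<^esub>, y)"] that by (simp add: C_def f1_def f2_def)
   have "f1 (dP j x) = \<zero>\<^sub>R" if x: "x \<in> carrier (P j)" for x
    using fz[of "(x, \<zero>\<^bsub>Q j\<^esub>)"] x hom_zero[OF Q P h] hom_zero[OF Q Q cr_hom[OF crQ]] dPc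
    by (simp add: D_def C_def f1_def)
   then obtain g1 where g1: "g1 \<in> dual R (P (j + 2))"
    and g1d: "\<And>x. x \<in> carrier (P (j + 1)) \<Longrightarrow> f1 x = g1 (dP (j + 1) x)"
    using cr_hom_exact[OF crP f1] by blast
   note g1c = dual_closed[OF g1]
   \<comment> \<open>The Q-part of f need not vanish on boundaries; subtracting the pullback of g1
     along the twist removes what g1 already accounts for.\<close>
   define f3 where "f3 y = f2 y \<oplus>\<^bsub>regular_module R\<^esub> \<ominus>\<^bsub>regular_module R\<^esub> g1 (h (j + 1) y)" for y
   have neg: "\<ominus>\<^bsub>regular_module R\<^esub> x = \<ominus>\<^sub>R x" if "x \<in> carrier R" for x
   proof -
    interpret RM: left_module R "regular_module R" by (rule reg)
    show ?thesis
     using that RM.M.l_neg[of x] RM.M.a_inv_closed[of x] by (intro E.R.minus_equality[symmetric]) auto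
   qed
   have f3: "f3 \<in> dual R (Q (j + 1))"
    unfolding f3_def by (intro hom_plus[OF reg f2] hom_uminus[OF reg] hom_comp[OF h1 g1])
   have "f3 (dQ j y) = \<zero>\<^sub>R" if y: "y \<in> carrier (Q j)" for y
   proof -
    have "f (h j y, dQ j y) = \<zero>\<^sub>R"
     using fz[of "(\<zero>\<^bsub>P j\<^esub>, y)"] y hom_zero[OF P P cr_hom[OF crP]] hc by (simp add: D_def C_def)
    then have "f1 (h j y) \<oplus>\<^sub>R f2 (dQ j y) = \<zero>\<^sub>R" using f12 y hc dQc by simp
    moreover have "g1 (h (j + 1) (dQ j y)) = \<ominus>\<^sub>R f1 (h j y)"
     using hd[OF y] g1d[OF hc[OF y]] hom_minus[OF P reg g1 dP1c[OF hc[OF y]]] f1c[OF hc[OF y]] by (simp add: neg)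
    ultimately show ?thesis
     using f1c[OF hc[OF y]] f2c[OF dQc[OF y]] by (simp add: f3_def neg E.R.a_comm)
   qed
   then obtain g2 where g2: "g2 \<in> dual R (Q (j + 2))"
    and g2d: "\<And>x. x \<in> carrier (Q (j + 1)) \<Longrightarrow> f3 x = g2 (dQ (j + 1) x)"
    using cr_hom_exact[OF crQ f3] by blast
   define g where "g u = g1 (fst u) \<oplus>\<^bsub>regular_module R\<^esub> g2 (snd u)" for u
   have g: "g \<in> dual R (C (j + 2))"
    unfolding g_def by (intro hom_plus[OF reg] hom_comp[OF p1 g1] hom_comp[OF p2 g2])
   have "f (x, y) = g (D (j + 1) (x, y))" if "x \<in> carrier (P (j + 1))" "y \<in> carrier (Q (j + 1))" for x y
   proof -
    have c: "g1 (h (j + 1) y) \<in> carrier R" using g1c hc1 that by blast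
    have "g (D (j + 1) (x, y)) = f1 x \<oplus>\<^sub>R g1 (h (j + 1) y) \<oplus>\<^sub>R f3 y"
     using that dP1c hc1 by (simp add: D2 g_def g1d g2d hom_add[OF g1])
    also have "\<dots> = f1 x \<oplus>\<^sub>R f2 y"
     using c f1c f2c that
     by (simp add: f3_def neg E.R.a_assoc) (simp add: E.R.a_lcomm[of "g1 (h (j + 1) y)" "f2 y"] E.R.r_neg)
    finally show ?thesis using f12 that by simp
   qed
   then have "f u = g (D (j + 1) u)" if "u \<in> carrier (C (j + 1))" for u using that by (auto simp: C_def)
   then show ?thesis using g by blast
  qed
 qed
 have F: "(\<lambda>e. (a e, q e)) \<in> module_hom R E (C 0)"
  unfolding C_def using ac qc
  by (intro module_homI) (auto simp: hom_add[OF a] hom_add[OF q] hom_smult[OF a] hom_smult[OF q])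
 have D0: "D 0 u = (dP 0 (fst u) \<oplus>\<^bsub>P 1\<^esub> h0 (snd u), dQ 0 (snd u))" for u by (simp add: D_def hz)
 have "cycle_iso R E C D (\<lambda>e. (a e, q e))"
  unfolding cycle_iso_def
 proof (intro conjI F)
  show "inj_on (\<lambda>e. (a e, q e)) (carrier E)"
  proof (rule inj_on_homI[OF E C F])
   fix e assume e: "e \<in> carrier E" "(a e, q e) = \<zero>\<^bsub>C 0\<^esub>"
   then have *: "a e = \<zero>\<^bsub>P 0\<^esub>" "q e = \<zero>\<^bsub>Q 0\<^esub>" by (auto simp: C_def)
   then obtain m where m: "m \<in> carrier M" "e = i m" using qk e by blast
   then have "fM m = fM \<zero>\<^sub>M" using * ai hom_zero[OF M' P fMh] by simp
   then have "m = \<zero>\<^sub>M" using fM m unfolding cycle_iso_def by (auto dest: inj_onD)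
   then show "e = \<zero>\<^sub>E" using m hom_zero[OF M' E i(1)] by simp
  qed
  show "(\<lambda>e. (a e, q e)) ` carrier E = {u \<in> carrier (C 0). D 0 u = \<zero>\<^bsub>C 1\<^esub>}" (is "?l = ?r")
  proof
   show "?l \<subseteq> ?r"
    using ac qc h0q qd dP0c by (auto simp: C_def D0 P.M.r_neg)
   show "?r \<subseteq> ?l"
   proof
    fix u assume "u \<in> ?r"
    then obtain x y where u: "u = (x, y)" "x \<in> carrier (P 0)" "y \<in> carrier (Q 0)"
     and 1: "dP 0 x \<oplus>\<^bsub>P 1\<^esub> h0 y = \<zero>\<^bsub>P 1\<^esub>" and 2: "dQ 0 y = \<zero>\<^bsub>Q 1\<^esub>" by (auto simp: C_def D0)
    obtain e where e: "e \<in> carrier E" "y = q e" using qs u 2 by blast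
    have "dP 0 (x \<ominus>\<^bsub>P 0\<^esub> a e) = dP 0 x \<ominus>\<^bsub>P 1\<^esub> dP 0 (a e)"
     using u e ac by (intro hom_diff[OF P P dP0]) auto
    also have "\<dots> = \<zero>\<^bsub>P 1\<^esub>" using 1 e h0q by (simp add: a_minus_def)
    finally obtain m where m: "m \<in> carrier M" "x \<ominus>\<^bsub>P 0\<^esub> a e = fM m"
     using fMs u e ac by (meson P.M.minus_closed)
    have "x = fM m \<oplus>\<^bsub>P 0\<^esub> a e" using P.M.minus_add_cancel[of x 0 "a e"] u e ac m by simp
    then have "u = (a (i m \<oplus>\<^sub>E e), q (i m \<oplus>\<^sub>E e))"
     using u e m ic qc by (simp add: hom_add[OF a] hom_add[OF q] ai qi)
    then show "u \<in> ?l" using e m ic by blast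
   qed
  qed
 qed
 then show ?thesis by (rule gorenstein_projectiveI[OF E crC])
qed

section \<open>Algebras with a basis of paths over a ring\<close>

text \<open>Valid for every list of arrows, walk or not, which keeps walk hypotheses out of later
  computations with \<open>path_end\<close>.\<close>

lemma path_end_eq: "path_end Q p = (if snd p = [] then fst p else head Q (last (snd p)))"
proof -
 have "last (pre_digraph.awalk_verts Q u es) = (if es = [] then u else head Q (last es))" for u es
  by (induction es arbitrary: u) (auto simp: pre_digraph.awalk_verts.simps pre_digraph.awalk_verts_non_Nil)
 then show ?thesis by (simp add: path_end_def)
qed

lemma path_end_Nil [simp]: "path_end Q (v, []) = v"
 by (simp add: path_end_eq)

lemma path_comp_simps [simp]: "fst (path_comp p q) = fst q" "snd (path_comp p q) = snd q @ snd p"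
 by (simp_all add: path_comp_def)

lemma path_end_comp [simp]: "path_end Q q = fst p \<Longrightarrow> path_end Q (path_comp p q) = path_end Q p"
 by (auto simp: path_end_eq split: if_splits)

lemma path_comp_assoc: "path_comp (path_comp p q) r = path_comp p (path_comp q r)"
 by (simp add: path_comp_def)

lemma path_comp_Nil [simp]: "path_comp p (fst p, []) = p" "path_comp (v, []) p = p"
 by (simp_all add: path_comp_def)

lemma path_comp_right_cancel: "path_comp p q = path_comp p q' \<longleftrightarrow> q = q'"
 by (auto simp: prod_eq_iff)

lemma path_comp_left_cancel: "fst p = fst p' \<Longrightarrow> path_comp p q = path_comp p' q \<longleftrightarrow> p = p'"
 by (auto simp: prod_eq_iff)

text \<open>Finite sums of elements of G, without index sets. Multiples and negatives come from the
  generating sets in use, which are closed under the scalars of A.\<close>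

inductive_set gspan :: "('r, 'm, 'w) module_scheme \<Rightarrow> 'm set \<Rightarrow> 'm set" for M G where
 zero: "\<zero>\<^sub>M \<in> gspan M G"
| add: "g \<in> G \<Longrightarrow> z \<in> gspan M G \<Longrightarrow> g \<oplus>\<^sub>M z \<in> gspan M G"

lemma gspan_mono: "G \<subseteq> H \<Longrightarrow> gspan M G \<subseteq> gspan M H"
proof
 fix x assume "x \<in> gspan M G" "G \<subseteq> H"
 then show "x \<in> gspan M H" by induction (auto intro: gspan.intros)
qed

lemma gspan_cong_subset:
 assumes "x \<in> gspan M G" "\<zero>\<^sub>M = \<zero>\<^sub>M'" "add M = add M'"
 shows "x \<in> gspan M' G"
 using assms(1)
proof induction
 case zero then show ?case unfolding assms(2) by (rule gspan.zero)
next
 case (add g z)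
 then show ?case unfolding assms(3) by (intro gspan.add)
qed

lemma gspan_cong:
 assumes "\<zero>\<^sub>M = \<zero>\<^sub>M'" "add M = add M'"
 shows "gspan M G = gspan M' G"
 using gspan_cong_subset[OF _ assms] gspan_cong_subset[OF _ assms(1)[symmetric] assms(2)[symmetric]] by blast

lemma gspan_closed:
 assumes "abelian_group M" "G \<subseteq> carrier M" "x \<in> gspan M G" shows "x \<in> carrier M"
proof -
 interpret abelian_group M by fact
 show ?thesis using assms(3) by induction (use assms(2) in auto)
qed

lemma gspan_plus:
 assumes "abelian_group M" "G \<subseteq> carrier M" "x \<in> gspan M G" "y \<in> gspan M G"
 shows "x \<oplus>\<^sub>M y \<in> gspan M G"
proof -
 interpret abelian_group M by fact
 note c = gspan_closed[OF assms(1,2)]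
 show ?thesis using assms(3)
 proof induction
  case (add g z)
  have "g \<oplus>\<^sub>M z \<oplus>\<^sub>M y = g \<oplus>\<^sub>M (z \<oplus>\<^sub>M y)" using add assms c by (intro a_assoc) auto
  then show ?case using add by (simp add: gspan.add)
 qed (use assms c in auto)
qed

lemma gspan_base:
 assumes "abelian_group M" "G \<subseteq> carrier M" "g \<in> G"
 shows "g \<in> gspan M G"
proof -
 interpret abelian_group M by fact
 have "g \<oplus>\<^sub>M \<zero>\<^sub>M \<in> gspan M G" using assms by (intro gspan.intros)
 then show ?thesis using assms by auto
qed

lemma gspan_finsum:
 assumes "abelian_group M" "G \<subseteq> carrier M" "finite S" "\<And>i. i \<in> S \<Longrightarrow> f i \<in> gspan M G"
 shows "(\<Oplus>\<^sub>M i\<in>S. f i) \<in> gspan M G"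
proof -
 interpret abelian_group M by fact
 note c = gspan_closed[OF assms(1,2)]
 show ?thesis using assms(3,4)
  by (induction S rule: finite_induct) (auto simp: gspan.zero c gspan_plus[OF assms(1,2)])
qed

text \<open>\<open>\<iota> a\<close> is \<open>a \<otimes> 1\<close>, \<open>E p\<close> is \<open>1 \<otimes> p\<close>, \<open>co p\<close> is the coordinate of the free left \<open>A\<close>-module \<open>L\<close> at the
 basis element \<open>E p\<close>, and the height \<open>ht\<close> witnesses acyclicity.\<close>

locale monomial_algebra = A: ring A + L: ring L
 for A :: "('a, 's) ring_scheme" and L :: "('l, 't) ring_scheme" +
 fixes Q :: "('v, 'e) pre_digraph" and N :: "('v, 'e) path set"
  and \<iota> :: "'a \<Rightarrow> 'l" and E :: "('v, 'e) path \<Rightarrow> 'l" and co :: "('v, 'e) path \<Rightarrow> 'l \<Rightarrow> 'a"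
  and ht :: "'v \<Rightarrow> nat"
 assumes finite_N: "finite N"
  and N_verts: "\<And>p. p \<in> N \<Longrightarrow> fst p \<in> verts Q" "\<And>p. p \<in> N \<Longrightarrow> path_end Q p \<in> verts Q"
  and N_trivial: "\<And>v. v \<in> verts Q \<Longrightarrow> (v, []) \<in> N"
  and N_factors: "\<And>u xs ys. (u, xs @ ys) \<in> N \<Longrightarrow> (u, xs) \<in> N"
   "\<And>u xs ys. (u, xs @ ys) \<in> N \<Longrightarrow> (path_end Q (u, xs), ys) \<in> N"
  and N_arrow: "\<And>u \<alpha>. (u, [\<alpha>]) \<in> N \<longleftrightarrow> \<alpha> \<in> arcs Q \<and> u = tail Q \<alpha>"
  and ht_arrow: "\<And>\<alpha>. \<alpha> \<in> arcs Q \<Longrightarrow> ht (tail Q \<alpha>) < ht (head Q \<alpha>)"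
  and \<iota>_hom: "\<iota> \<in> ring_hom A L"
  and E_closed: "\<And>p. p \<in> N \<Longrightarrow> E p \<in> carrier L"
  and \<iota>_E: "\<And>a p. a \<in> carrier A \<Longrightarrow> p \<in> N \<Longrightarrow> E p \<otimes>\<^sub>L \<iota> a = \<iota> a \<otimes>\<^sub>L E p"
  and E_mult: "\<And>p q. p \<in> N \<Longrightarrow> q \<in> N \<Longrightarrow> E p \<otimes>\<^sub>L E q =
   (if path_end Q q = fst p \<and> path_comp p q \<in> N then E (path_comp p q) else \<zero>\<^sub>L)"
  and co_closed: "\<And>p l. p \<in> N \<Longrightarrow> l \<in> carrier L \<Longrightarrow> co p l \<in> carrier A"
  and co_add: "\<And>p l m. p \<in> N \<Longrightarrow> l \<in> carrier L \<Longrightarrow> m \<in> carrier L \<Longrightarrow> co p (l \<oplus>\<^sub>L m) = co p l \<oplus>\<^sub>A co p m"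
  and co_\<iota>: "\<And>p a l. p \<in> N \<Longrightarrow> a \<in> carrier A \<Longrightarrow> l \<in> carrier L \<Longrightarrow> co p (\<iota> a \<otimes>\<^sub>L l) = a \<otimes>\<^sub>A co p l"
  and co_E: "\<And>p q. p \<in> N \<Longrightarrow> q \<in> N \<Longrightarrow> co p (E q) = (if p = q then \<one>\<^sub>A else \<zero>\<^sub>A)"
  and L_induct: "\<And>P l. l \<in> carrier L \<Longrightarrow> P \<zero>\<^sub>L \<Longrightarrow>
   (\<And>a p m. a \<in> carrier A \<Longrightarrow> p \<in> N \<Longrightarrow> m \<in> carrier L \<Longrightarrow> P m \<Longrightarrow> P ((\<iota> a \<otimes>\<^sub>L E p) \<oplus>\<^sub>L m)) \<Longrightarrow> P l"
begin

lemmas L_ind = L_induct[consumes 1, case_names zero add]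

lemma \<iota>_closed [simp]: "a \<in> carrier A \<Longrightarrow> \<iota> a \<in> carrier L"
 and \<iota>_add: "a \<in> carrier A \<Longrightarrow> b \<in> carrier A \<Longrightarrow> \<iota> (a \<oplus>\<^sub>A b) = \<iota> a \<oplus>\<^sub>L \<iota> b"
 and \<iota>_mult: "a \<in> carrier A \<Longrightarrow> b \<in> carrier A \<Longrightarrow> \<iota> (a \<otimes>\<^sub>A b) = \<iota> a \<otimes>\<^sub>L \<iota> b"
 and \<iota>_one [simp]: "\<iota> \<one>\<^sub>A = \<one>\<^sub>L"
 using \<iota>_hom by (auto simp: ring_hom_def)

lemma \<iota>_zero [simp]: "\<iota> \<zero>\<^sub>A = \<zero>\<^sub>L"
proof -
 have "\<iota> \<zero>\<^sub>A \<oplus>\<^sub>L \<iota> \<zero>\<^sub>A = \<iota> \<zero>\<^sub>A \<oplus>\<^sub>L \<zero>\<^sub>L" using \<iota>_add[of "\<zero>\<^sub>A" "\<zero>\<^sub>A"] by simp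
 then show ?thesis by (simp del: L.r_zero)
qed

lemma co_zero [simp]: "p \<in> N \<Longrightarrow> co p \<zero>\<^sub>L = \<zero>\<^sub>A"
 using co_\<iota>[of p "\<zero>\<^sub>A" "\<zero>\<^sub>L"] co_closed[of p "\<zero>\<^sub>L"] by simp

lemma co_neg: "r \<in> N \<Longrightarrow> l \<in> carrier L \<Longrightarrow> co r (\<ominus>\<^sub>L l) = \<ominus>\<^sub>A co r l"
 using co_add[of r "\<ominus>\<^sub>L l" l] by (simp add: L.l_neg A.minus_equality co_closed)

lemma co_\<iota>E: "p \<in> N \<Longrightarrow> q \<in> N \<Longrightarrow> a \<in> carrier A \<Longrightarrow> co p (\<iota> a \<otimes>\<^sub>L E q) = (if p = q then a else \<zero>\<^sub>A)"
 by (simp add: co_\<iota> E_closed co_E)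

lemma co_finsum: "finite S \<Longrightarrow> p \<in> N \<Longrightarrow> f \<in> S \<rightarrow> carrier L \<Longrightarrow>
  co p (\<Oplus>\<^sub>L i\<in>S. f i) = (\<Oplus>\<^sub>A i\<in>S. co p (f i))"
proof (induction S rule: finite_induct)
 case (insert x F)
 then show ?case by (auto simp: co_add co_closed Pi_iff)
qed simp

lemma finsum_\<iota>E_closed: "c \<in> N \<rightarrow> carrier A \<Longrightarrow> (\<Oplus>\<^sub>L p\<in>N. \<iota> (c p) \<otimes>\<^sub>L E p) \<in> carrier L"
 by (auto simp: E_closed Pi_iff)

lemma co_finsum_\<iota>E: "c \<in> N \<rightarrow> carrier A \<Longrightarrow> q \<in> N \<Longrightarrow> co q (\<Oplus>\<^sub>L p\<in>N. \<iota> (c p) \<otimes>\<^sub>L E p) = c q"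
proof -
 assume c: "c \<in> N \<rightarrow> carrier A" and q: "q \<in> N"
 have "co q (\<Oplus>\<^sub>L p\<in>N. \<iota> (c p) \<otimes>\<^sub>L E p) = (\<Oplus>\<^sub>A p\<in>N. co q (\<iota> (c p) \<otimes>\<^sub>L E p))"
  using c q by (intro co_finsum finite_N) (auto simp: E_closed Pi_iff)
 also have "\<dots> = (\<Oplus>\<^sub>A p\<in>N. if q = p then c p else \<zero>\<^sub>A)"
  using c q by (intro A.finsum_cong') (auto simp: co_\<iota>E Pi_iff)
 also have "\<dots> = c q" using A.finsum_singleton[OF q finite_N, of c] c by auto
 finally show ?thesis .
qed

text \<open>Both sides are additive, and they agree on the generators by the formula for
  \<open>co\<close> on a path. Together with \<open>co_finsum_\<iota>E\<close> this makes the paths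
  in N a basis, so elements can be compared by coordinates.\<close>

lemma expansion: "l \<in> carrier L \<Longrightarrow> l = (\<Oplus>\<^sub>L p\<in>N. \<iota> (co p l) \<otimes>\<^sub>L E p)"
proof (induction l rule: L_ind)
 case zero
 have "(\<Oplus>\<^sub>L p\<in>N. \<iota> (co p \<zero>\<^sub>L) \<otimes>\<^sub>L E p) = \<zero>\<^sub>L" by (intro L.add.finprod_one_eqI) (simp add: E_closed)
 then show ?case by simp
next
 case (add a q m)
 have "(\<Oplus>\<^sub>L p\<in>N. \<iota> (co p (\<iota> a \<otimes>\<^sub>L E q \<oplus>\<^sub>L m)) \<otimes>\<^sub>L E p)
   = (\<Oplus>\<^sub>L p\<in>N. (if q = p then \<iota> a \<otimes>\<^sub>L E p else \<zero>\<^sub>L) \<oplus>\<^sub>L \<iota> (co p m) \<otimes>\<^sub>L E p)"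
  using add by (intro L.finsum_cong') (auto simp: co_add co_\<iota>E E_closed co_closed \<iota>_add L.l_distr)
 also have "\<dots> = (\<Oplus>\<^sub>L p\<in>N. if q = p then \<iota> a \<otimes>\<^sub>L E p else \<zero>\<^sub>L) \<oplus>\<^sub>L (\<Oplus>\<^sub>L p\<in>N. \<iota> (co p m) \<otimes>\<^sub>L E p)"
  using add by (intro L.finsum_addf) (auto simp: E_closed co_closed)
 also have "(\<Oplus>\<^sub>L p\<in>N. if q = p then \<iota> a \<otimes>\<^sub>L E p else \<zero>\<^sub>L) = \<iota> a \<otimes>\<^sub>L E q"
  using add by (intro L.finsum_singleton[OF _ finite_N]) (auto simp: E_closed)
 finally show ?case using add.IH by simp
qed

lemma co_ext: "l \<in> carrier L \<Longrightarrow> m \<in> carrier L \<Longrightarrow> (\<And>p. p \<in> N \<Longrightarrow> co p l = co p m) \<Longrightarrow> l = m"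
proof -
 assume a: "l \<in> carrier L" "m \<in> carrier L" "\<And>p. p \<in> N \<Longrightarrow> co p l = co p m"
 have "(\<Oplus>\<^sub>L p\<in>N. \<iota> (co p l) \<otimes>\<^sub>L E p) = (\<Oplus>\<^sub>L p\<in>N. \<iota> (co p m) \<otimes>\<^sub>L E p)"
  using a by (intro L.finsum_cong') (auto simp: E_closed co_closed)
 then show "l = m" using expansion a by metis
qed

lemma N_comp:
 assumes "path_comp p q \<in> N" "path_end Q q = fst p"
 shows "p \<in> N" "q \<in> N"
 using assms N_factors[of "fst q" "snd q" "snd p"] by (auto simp: path_comp_def)

text \<open>A path and its left factor p determine the right factor, so a single term in the
  expansion of l contributes. The companion lemmas treat paths not divisible by p and division from
  the other side.\<close>

lemma co_left:
 assumes "path_end Q q = fst p" "path_comp p q \<in> N" "l \<in> carrier L"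
 shows "co (path_comp p q) (E p \<otimes>\<^sub>L l) = co q l"
 using assms(3)
proof (induction l rule: L_ind)
 case zero then show ?case using assms N_comp[OF assms(2,1)] by (simp add: E_closed)
next
 case (add a r m)
 note N = N_comp[OF assms(2,1)]
 have "E p \<otimes>\<^sub>L (\<iota> a \<otimes>\<^sub>L E r \<oplus>\<^sub>L m) = \<iota> a \<otimes>\<^sub>L (E p \<otimes>\<^sub>L E r) \<oplus>\<^sub>L E p \<otimes>\<^sub>L m"
  using add N by (simp add: L.r_distr E_closed L.m_assoc[symmetric] \<iota>_E)
 moreover have "co (path_comp p q) (\<iota> a \<otimes>\<^sub>L (E p \<otimes>\<^sub>L E r)) = (if q = r then a else \<zero>\<^sub>A)"
  using add N assms by (auto simp: E_mult co_\<iota>E path_comp_right_cancel)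
 ultimately show ?case using add N assms by (simp add: co_add E_closed co_\<iota>E)
qed

lemma co_left_0:
 assumes "r \<in> N" "p \<in> N" "\<And>q. path_end Q q = fst p \<Longrightarrow> r \<noteq> path_comp p q" "l \<in> carrier L"
 shows "co r (E p \<otimes>\<^sub>L l) = \<zero>\<^sub>A"
 using assms(4)
proof (induction l rule: L_ind)
 case zero then show ?case using assms by (simp add: E_closed)
next
 case (add a q m)
 have "E p \<otimes>\<^sub>L (\<iota> a \<otimes>\<^sub>L E q \<oplus>\<^sub>L m) = \<iota> a \<otimes>\<^sub>L (E p \<otimes>\<^sub>L E q) \<oplus>\<^sub>L E p \<otimes>\<^sub>L m"
  using add assms by (simp add: L.r_distr E_closed L.m_assoc[symmetric] \<iota>_E)
 moreover have "co r (\<iota> a \<otimes>\<^sub>L (E p \<otimes>\<^sub>L E q)) = \<zero>\<^sub>A"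
  using add assms by (auto simp: E_mult co_\<iota>E)
 ultimately show ?case using add assms by (simp add: co_add E_closed)
qed

lemma co_right:
 assumes "path_end Q q = fst p" "path_comp p q \<in> N" "l \<in> carrier L"
 shows "co (path_comp p q) (l \<otimes>\<^sub>L E q) = co p l"
 using assms(3)
proof (induction l rule: L_ind)
 case zero then show ?case using assms N_comp[OF assms(2,1)] by (simp add: E_closed)
next
 case (add a r m)
 note N = N_comp[OF assms(2,1)]
 have "(\<iota> a \<otimes>\<^sub>L E r \<oplus>\<^sub>L m) \<otimes>\<^sub>L E q = \<iota> a \<otimes>\<^sub>L (E r \<otimes>\<^sub>L E q) \<oplus>\<^sub>L m \<otimes>\<^sub>L E q"
  using add N by (simp add: L.l_distr E_closed L.m_assoc)
 moreover have "co (path_comp p q) (\<iota> a \<otimes>\<^sub>L (E r \<otimes>\<^sub>L E q)) = (if p = r then a else \<zero>\<^sub>A)"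
  using add N assms by (auto simp: E_mult co_\<iota>E path_comp_left_cancel)
 ultimately show ?case using add N assms by (simp add: co_add E_closed co_\<iota>E)
qed

lemma co_right_0:
 assumes "r \<in> N" "q \<in> N" "\<And>p. path_end Q q = fst p \<Longrightarrow> r \<noteq> path_comp p q" "l \<in> carrier L"
 shows "co r (l \<otimes>\<^sub>L E q) = \<zero>\<^sub>A"
 using assms(4)
proof (induction l rule: L_ind)
 case zero then show ?case using assms by (simp add: E_closed)
next
 case (add a p m)
 have "(\<iota> a \<otimes>\<^sub>L E p \<oplus>\<^sub>L m) \<otimes>\<^sub>L E q = \<iota> a \<otimes>\<^sub>L (E p \<otimes>\<^sub>L E q) \<oplus>\<^sub>L m \<otimes>\<^sub>L E q"
  using add assms by (simp add: L.l_distr E_closed L.m_assoc)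
 moreover have "co r (\<iota> a \<otimes>\<^sub>L (E p \<otimes>\<^sub>L E q)) = \<zero>\<^sub>A"
  using add assms by (auto simp: E_mult co_\<iota>E)
 ultimately show ?case using add assms by (simp add: co_add E_closed)
qed

lemma co_\<iota>_right:
 assumes "p \<in> N" "a \<in> carrier A" "l \<in> carrier L"
 shows "co p (l \<otimes>\<^sub>L \<iota> a) = co p l \<otimes>\<^sub>A a"
 using assms(3)
proof (induction l rule: L_ind)
 case zero then show ?case using assms by simp
next
 case (add b q m)
 have "(\<iota> b \<otimes>\<^sub>L E q \<oplus>\<^sub>L m) \<otimes>\<^sub>L \<iota> a = \<iota> (b \<otimes>\<^sub>A a) \<otimes>\<^sub>L E q \<oplus>\<^sub>L m \<otimes>\<^sub>L \<iota> a"
  using add assms by (simp add: L.l_distr E_closed L.m_assoc \<iota>_E \<iota>_mult)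
 then show ?case using add assms by (auto simp: co_add E_closed co_\<iota>E A.l_distr co_closed)
qed

text \<open>Each arrow raises the height by at least one, so a nontrivial path ends strictly higher
  than it starts. This is what drives the inductions over vertices.\<close>

lemma ht_le:
 assumes "p \<in> N" shows "ht (fst p) + length (snd p) \<le> ht (path_end Q p)"
proof -
 have "(u, es) \<in> N \<Longrightarrow> ht u + length es \<le> ht (path_end Q (u, es))" for u es
 proof (induction es rule: rev_induct)
  case (snoc x xs)
  have x: "x \<in> arcs Q" "path_end Q (u, xs) = tail Q x" using N_factors(2)[OF snoc.prems] N_arrow by auto
  have "ht u + length xs \<le> ht (tail Q x)" using snoc.IH[OF N_factors(1)[OF snoc.prems]] x by simp
  then show ?case using ht_arrow[OF x(1)] by (simp add: path_end_eq)
 qed simp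
 from this[of "fst p" "snd p"] show ?thesis using assms by simp
qed

end

section \<open>Monomial flatness\<close>

lemma finsum_record:
 assumes "carrier M = carrier M'" "\<zero>\<^sub>M = \<zero>\<^sub>M'" "add M = add M'"
 shows "finsum M f S = finsum M' f S"
 using assms by (simp add: finsum_def finprod_def)

context monomial_algebra
begin

definition restr :: "('l, 'm, 'w) module_scheme \<Rightarrow> ('a, 'm) module" where
 "restr M = \<lparr>carrier = carrier M, mult = mult M, one = one M, ring.zero = ring.zero M, add = add M,
   smult = (\<lambda>a x. \<iota> a \<odot>\<^sub>M x)\<rparr>"

text \<open>All fields agree with those of the vertex spaces in \<open>rep_of_module\<close>,
  including the ones without meaning for modules, so that the final identification is an equality of
  records.\<close>

definition vert :: "('l, 'm, 'w) module_scheme \<Rightarrow> 'v \<Rightarrow> ('a, 'm) module" where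
 "vert M v = \<lparr>carrier = (\<lambda>x. E (v, []) \<odot>\<^sub>M x) ` carrier M, mult = mult M, one = one M,
   ring.zero = ring.zero M, add = add M, smult = (\<lambda>a x. \<iota> a \<odot>\<^sub>M x)\<rparr>"

text \<open>\<open>path_sub M J\<close> is \<open>J M\<close> for the set \<open>J\<close> of paths; if \<open>J\<close> is a right ideal of paths, then it is the
 image of \<open>J \<otimes> M \<rightarrow> M\<close>, and flatness says that this map is injective for all right ideals of paths.\<close>

definition path_sub :: "('l, 'm, 'w) module_scheme \<Rightarrow> ('v, 'e) path set \<Rightarrow> 'm set" where
 "path_sub M J = gspan M {E p \<odot>\<^sub>M y | p y. p \<in> J \<and> y \<in> carrier M}"

definition right_ideal :: "('v, 'e) path set \<Rightarrow> bool" where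
 "right_ideal J \<longleftrightarrow> J \<subseteq> N \<and>
  (\<forall>p\<in>J. \<forall>q. path_end Q q = fst p \<longrightarrow> path_comp p q \<in> N \<longrightarrow> path_comp p q \<in> J)"

text \<open>A path r for which p r is zero belongs to (J : p), since zero lies in every ideal; this
  is the reason for the implication.\<close>

definition colon :: "('v, 'e) path set \<Rightarrow> ('v, 'e) path \<Rightarrow> ('v, 'e) path set" where
 "colon J p = {r \<in> N. path_end Q r = fst p \<and> (path_comp p r \<in> N \<longrightarrow> path_comp p r \<in> J)}"

definition rad :: "'v \<Rightarrow> ('v, 'e) path set" where
 "rad v = {r \<in> N. path_end Q r = v \<and> snd r \<noteq> []}"

text \<open>A path p sees only the component of x at its starting vertex, hence the idempotent in
  the conclusion. For empty J the condition describes the kernel of p; for J the paths through the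
  other arrows into the end of an arrow p, it yields directness of the sum of images.\<close>

definition flat :: "('l, 'm, 'w) module_scheme \<Rightarrow> bool" where
 "flat M \<longleftrightarrow> (\<forall>p\<in>N. \<forall>J. right_ideal J \<longrightarrow>
  (\<forall>x\<in>carrier M. E p \<odot>\<^sub>M x \<in> path_sub M J \<longrightarrow> E (fst p, []) \<odot>\<^sub>M x \<in> path_sub M (colon J p)))"

lemma restr_simps [simp]:
 "carrier (restr M) = carrier M" "\<zero>\<^bsub>restr M\<^esub> = \<zero>\<^sub>M" "x \<oplus>\<^bsub>restr M\<^esub> y = x \<oplus>\<^sub>M y"
 "a \<odot>\<^bsub>restr M\<^esub> x = \<iota> a \<odot>\<^sub>M x"
 by (simp_all add: restr_def)

lemma vert_simps [simp]:
 "\<zero>\<^bsub>vert M v\<^esub> = \<zero>\<^sub>M" "x \<oplus>\<^bsub>vert M v\<^esub> y = x \<oplus>\<^sub>M y" "a \<odot>\<^bsub>vert M v\<^esub> x = \<iota> a \<odot>\<^sub>M x"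
 by (simp_all add: vert_def)

lemma carrier_vert: "carrier (vert M v) = (\<lambda>x. E (v, []) \<odot>\<^sub>M x) ` carrier M"
 by (simp add: vert_def)

lemma right_idealD:
 "right_ideal J \<Longrightarrow> J \<subseteq> N"
 "right_ideal J \<Longrightarrow> p \<in> J \<Longrightarrow> path_end Q q = fst p \<Longrightarrow> path_comp p q \<in> N \<Longrightarrow> path_comp p q \<in> J"
 unfolding right_ideal_def by blast+

text \<open>If p were a right multiple of some p' in J, minimality of its length would make the
  factor trivial and p' equal to p.\<close>

lemma right_ideal_remove:
 assumes J: "right_ideal J" and p: "p \<in> J" and min: "\<And>q. q \<in> J \<Longrightarrow> length (snd p) \<le> length (snd q)"
 shows "right_ideal (J - {p})"
 unfolding right_ideal_def
proof (intro conjI ballI allI impI)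
 show "J - {p} \<subseteq> N" using right_idealD(1)[OF J] by blast
 fix p' q assume p': "p' \<in> J - {p}" and q: "path_end Q q = fst p'" and N: "path_comp p' q \<in> N"
 have "path_comp p' q \<noteq> p"
 proof
  assume eq: "path_comp p' q = p"
  then have "snd p = snd q @ snd p'" by auto
  then have "snd q = []" using min[of p'] p' by simp
  then have "path_comp p' q = p'" using q by (simp add: path_comp_def path_end_eq)
  then show False using p' eq by simp
 qed
 then show "path_comp p' q \<in> J - {p}" using right_idealD(2)[OF J _ q N] p' by blast
qed

lemma right_ideal_colon: "right_ideal (J :: ('v, 'e) path set) \<Longrightarrow> p \<in> N \<Longrightarrow> right_ideal (colon J p)"
 unfolding right_ideal_def
proof (intro conjI ballI allI impI)
 assume J: "J \<subseteq> N \<and> (\<forall>p\<in>J. \<forall>q. path_end Q q = fst p \<longrightarrow> path_comp p q \<in> N \<longrightarrow> path_comp p q \<in> J)"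
  and p: "p \<in> N"
 show "colon J p \<subseteq> N" by (auto simp: colon_def)
 fix r q assume r: "r \<in> colon J p" and q: "path_end Q q = fst r" "path_comp r q \<in> N"
 have "path_comp (path_comp p r) q \<in> J" if c: "path_comp p (path_comp r q) \<in> N"
 proof -
  have c': "path_comp (path_comp p r) q \<in> N" using c by (simp add: path_comp_assoc)
  then have "path_comp p r \<in> N" using N_comp(1)[of "path_comp p r" q] q by simp
  then have "path_comp p r \<in> J" using r by (simp add: colon_def)
  then show ?thesis using J c' q by (metis path_comp_simps(1))
 qed
 then show "path_comp r q \<in> colon J p" using r q by (simp add: colon_def path_comp_assoc)
qed

lemma right_ideal_rad: "right_ideal (rad v)"
 by (auto simp: right_ideal_def rad_def)

text \<open>The trivial path at the start of p belongs to (J : p) precisely when p belongs to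
  J.\<close>

lemma colon_subset_rad:
 assumes "p \<in> N" "p \<notin> J" shows "colon J p \<subseteq> rad (fst p)"
proof
 fix r assume r: "r \<in> colon J p"
 have "snd r \<noteq> []"
 proof
  assume "snd r = []"
  then have "r = (fst p, [])" using r by (simp add: colon_def path_end_eq prod_eq_iff)
  then show False using r assms by (simp add: colon_def)
 qed
 then show "r \<in> rad (fst p)" using r by (simp add: colon_def rad_def)
qed

lemma triv_N: "p \<in> N \<Longrightarrow> (fst p, []) \<in> N"
 using N_verts(1) N_trivial by blast

lemma triv_end_N: "p \<in> N \<Longrightarrow> (path_end Q p, []) \<in> N"
 using N_verts(2) N_trivial by blast

lemma E_fst: "p \<in> N \<Longrightarrow> E p \<otimes>\<^sub>L E (fst p, []) = E p"
 using E_mult[OF _ triv_N] by simp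

lemma E_end: "p \<in> N \<Longrightarrow> E (path_end Q p, []) \<otimes>\<^sub>L E p = E p"
 using E_mult[OF triv_end_N] by simp

lemma \<iota>_minus_one: "\<iota> (\<ominus>\<^sub>A \<one>\<^sub>A) = \<ominus>\<^sub>L \<one>\<^sub>L"
proof -
 have "\<iota> (\<ominus>\<^sub>A \<one>\<^sub>A) \<oplus>\<^sub>L \<one>\<^sub>L = \<zero>\<^sub>L" using \<iota>_add[of "\<ominus>\<^sub>A \<one>\<^sub>A" "\<one>\<^sub>A"] by (simp add: A.l_neg)
 then show ?thesis by (simp add: L.minus_equality)
qed

lemma hom_E:
 assumes "f \<in> module_hom L M M'" "p \<in> N" "x \<in> carrier M"
 shows "f (E p \<odot>\<^sub>M x) = E p \<odot>\<^sub>M' f x"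
 using hom_smult[OF assms(1) E_closed[OF assms(2)] assms(3)] .

lemma left_module_restr:
 assumes "left_module L M" shows "left_module A (restr M)"
proof -
 interpret M: left_module L M by fact
 show ?thesis
  by (rule left_moduleI)
   (auto simp: A.ring_axioms M.M.add.m_ac \<iota>_add \<iota>_mult M.smult_l_distr M.smult_r_distr M.smult_assoc1)
qed

lemma vert_restr: "vert M v = (restr M)\<lparr>carrier := carrier (vert M v)\<rparr>"
 by (simp add: vert_def restr_def)

end

locale monomial_module = monomial_algebra A L Q N \<iota> E co ht + M: left_module L M
 for A :: "('a, 's) ring_scheme" and L :: "('l, 't) ring_scheme"
  and Q :: "('v, 'e) pre_digraph" and N :: "('v, 'e) path set"
  and \<iota> :: "'a \<Rightarrow> 'l" and E :: "('v, 'e) path \<Rightarrow> 'l" and co :: "('v, 'e) path \<Rightarrow> 'l \<Rightarrow> 'a"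
  and ht :: "'v \<Rightarrow> nat" and M :: "('l, 'm, 'w) module_scheme" (structure)
begin

lemma E_smult_closed [simp]: "p \<in> N \<Longrightarrow> x \<in> carrier M \<Longrightarrow> E p \<odot> x \<in> carrier M"
 by (simp add: E_closed)

lemma E_smult_add: "p \<in> N \<Longrightarrow> x \<in> carrier M \<Longrightarrow> y \<in> carrier M \<Longrightarrow>
  E p \<odot> (x \<oplus> y) = E p \<odot> x \<oplus> E p \<odot> y"
 by (simp add: E_closed M.smult_r_distr)

lemma smult_minus: "l \<in> carrier L \<Longrightarrow> x \<in> carrier M \<Longrightarrow> l \<odot> (\<ominus> x) = \<ominus> (l \<odot> x)"
proof -
 assume a: "l \<in> carrier L" "x \<in> carrier M"
 have "l \<odot> (\<ominus> x) \<oplus> l \<odot> x = \<zero>"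
  using a M.smult_r_distr[of l "\<ominus> x" x] by (simp add: M.M.l_neg)
 then show ?thesis using a by (simp add: M.M.minus_equality)
qed

lemma E_smult_diff: "p \<in> N \<Longrightarrow> x \<in> carrier M \<Longrightarrow> y \<in> carrier M \<Longrightarrow>
  E p \<odot> (x \<ominus> y) = E p \<odot> x \<ominus> E p \<odot> y"
 by (simp add: a_minus_def E_smult_add smult_minus E_closed)

lemma E_smult_comp: "p \<in> N \<Longrightarrow> q \<in> N \<Longrightarrow> x \<in> carrier M \<Longrightarrow> E p \<odot> (E q \<odot> x) =
  (if path_end Q q = fst p \<and> path_comp p q \<in> N then E (path_comp p q) \<odot> x else \<zero>)"
 by (simp add: M.smult_assoc1[symmetric] E_closed E_mult)

lemma E_smult_fst: "p \<in> N \<Longrightarrow> x \<in> carrier M \<Longrightarrow> E p \<odot> (E (fst p, []) \<odot> x) = E p \<odot> x"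
 by (simp add: M.smult_assoc1[symmetric] E_closed E_fst triv_N)

lemma E_smult_end: "p \<in> N \<Longrightarrow> x \<in> carrier M \<Longrightarrow> E (path_end Q p, []) \<odot> (E p \<odot> x) = E p \<odot> x"
 by (simp add: M.smult_assoc1[symmetric] E_closed E_end triv_end_N)

lemma E_smult_idem: "v \<in> verts Q \<Longrightarrow> x \<in> carrier M \<Longrightarrow> E (v, []) \<odot> (E (v, []) \<odot> x) = E (v, []) \<odot> x"
 using E_smult_fst[OF N_trivial] by simp

lemma \<iota>_E_smult: "p \<in> N \<Longrightarrow> a \<in> carrier A \<Longrightarrow> x \<in> carrier M \<Longrightarrow> E p \<odot> (\<iota> a \<odot> x) = \<iota> a \<odot> (E p \<odot> x)"
 by (simp add: M.smult_assoc1[symmetric] E_closed \<iota>_E)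

lemma vert_iff: "v \<in> verts Q \<Longrightarrow> x \<in> carrier (vert M v) \<longleftrightarrow> x \<in> carrier M \<and> E (v, []) \<odot> x = x"
 by (auto simp: carrier_vert E_smult_idem N_trivial) (metis image_eqI)

lemma submod_vert:
 assumes "v \<in> verts Q" shows "submod A (restr M) (carrier (vert M v))"
 unfolding submod_def
 by (auto simp: vert_iff[OF assms] E_smult_add \<iota>_E_smult N_trivial[OF assms] E_closed)

lemma left_module_vert: "v \<in> verts Q \<Longrightarrow> left_module A (vert M v)"
 by (subst vert_restr, rule left_module_submod[OF left_module_restr[OF M.left_module_axioms] submod_vert])

lemma gens: "J \<subseteq> N \<Longrightarrow> {E p \<odot> y | p y. p \<in> J \<and> y \<in> carrier M} \<subseteq> carrier M"
 by auto

lemma path_sub_closed: "J \<subseteq> N \<Longrightarrow> x \<in> path_sub M J \<Longrightarrow> x \<in> carrier M"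
 unfolding path_sub_def using gspan_closed[OF M.M.abelian_group_axioms gens] by blast

lemma path_sub_zero: "\<zero> \<in> path_sub M J"
 unfolding path_sub_def by (rule gspan.zero)

lemma path_sub_plus: "J \<subseteq> N \<Longrightarrow> x \<in> path_sub M J \<Longrightarrow> y \<in> path_sub M J \<Longrightarrow> x \<oplus> y \<in> path_sub M J"
 unfolding path_sub_def by (rule gspan_plus[OF M.M.abelian_group_axioms gens])

lemma path_sub_base: "J \<subseteq> N \<Longrightarrow> p \<in> J \<Longrightarrow> y \<in> carrier M \<Longrightarrow> E p \<odot> y \<in> path_sub M J"
 unfolding path_sub_def by (rule gspan_base[OF M.M.abelian_group_axioms gens]) blast+

lemma path_sub_mono: "J \<subseteq> K \<Longrightarrow> path_sub M J \<subseteq> path_sub M K"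
 unfolding path_sub_def by (rule gspan_mono) blast

lemma path_sub_induct [consumes 2, case_names zero add]:
 assumes "J \<subseteq> N" "x \<in> path_sub M J" "P \<zero>"
  and "\<And>p y z. p \<in> J \<Longrightarrow> p \<in> N \<Longrightarrow> y \<in> carrier M \<Longrightarrow> z \<in> path_sub M J \<Longrightarrow> z \<in> carrier M \<Longrightarrow> P z \<Longrightarrow> P (E p \<odot> y \<oplus> z)"
 shows "P x"
proof -
 have "P x" if "x \<in> gspan M {E p \<odot> y | p y. p \<in> J \<and> y \<in> carrier M}" for x
  using that
 proof induction
  case (add g z)
  obtain p y where g: "g = E p \<odot> y" "p \<in> J" "y \<in> carrier M" using add(1) by blast
  have z: "z \<in> path_sub M J" using add(2) by (simp add: path_sub_def)
  show ?case unfolding g(1)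
   by (rule assms(4)[OF g(2) _ g(3) z path_sub_closed[OF assms(1) z] add(3)]) (use assms(1) g in blast)
 qed (rule assms(3))
 then show ?thesis using assms(2) by (simp add: path_sub_def)
qed

lemma path_sub_finsum:
 "J \<subseteq> N \<Longrightarrow> finite S \<Longrightarrow> (\<And>i. i \<in> S \<Longrightarrow> f i \<in> path_sub M J) \<Longrightarrow> (\<Oplus>i\<in>S. f i) \<in> path_sub M J"
 unfolding path_sub_def by (rule gspan_finsum[OF M.M.abelian_group_axioms gens])

lemma path_sub_\<iota>:
 assumes J: "J \<subseteq> N" and "x \<in> path_sub M J" and a: "a \<in> carrier A"
 shows "\<iota> a \<odot> x \<in> path_sub M J"
 using assms(1,2)
proof (induction x rule: path_sub_induct)
 case (add p y z)
 have "E p \<odot> (\<iota> a \<odot> y) \<in> path_sub M J" using add a by (intro path_sub_base[OF J]) auto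
 then show ?case
  using add a J by (simp add: M.smult_r_distr \<iota>_E_smult path_sub_plus)
qed (simp add: path_sub_zero a)

lemma path_sub_minus: "J \<subseteq> N \<Longrightarrow> x \<in> path_sub M J \<Longrightarrow> \<ominus> x \<in> path_sub M J"
 using path_sub_\<iota>[of J x "\<ominus>\<^sub>A \<one>\<^sub>A"] path_sub_closed[of J x] by (simp add: \<iota>_minus_one M.smult_minus_one)

lemma path_sub_diff: "J \<subseteq> N \<Longrightarrow> x \<in> path_sub M J \<Longrightarrow> y \<in> path_sub M J \<Longrightarrow> x \<ominus> y \<in> path_sub M J"
 by (simp add: a_minus_def path_sub_plus path_sub_minus)

lemma path_sub_path:
 assumes "J \<subseteq> N" "K \<subseteq> N" "q \<in> N" "x \<in> path_sub M J"
  and "\<And>p. p \<in> J \<Longrightarrow> path_end Q p = fst q \<Longrightarrow> path_comp q p \<in> N \<Longrightarrow> path_comp q p \<in> K"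
 shows "E q \<odot> x \<in> path_sub M K"
 using assms(1,4)
proof (induction x rule: path_sub_induct)
 case (add p y z)
 have "E (path_comp q p) \<odot> y \<in> path_sub M K" if "path_end Q p = fst q" "path_comp q p \<in> N"
  using path_sub_base[OF assms(2) assms(5)[OF add(1) that] add(3)] .
 then have "E q \<odot> (E p \<odot> y) \<in> path_sub M K"
  using add assms(3) by (simp add: E_smult_comp path_sub_zero)
 then show ?case using add assms by (simp add: E_smult_add path_sub_plus)
qed (simp add: path_sub_zero assms E_closed)

lemma path_sub_split:
 assumes "J \<subseteq> N" "p \<in> J" "x \<in> path_sub M J"
 shows "\<exists>y\<in>carrier M. \<exists>z\<in>path_sub M (J - {p}). x = E p \<odot> y \<oplus> z"
 using assms(1,3)
proof (induction x rule: path_sub_induct)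
 case zero
 have "p \<in> N" using assms by blast
 then show ?case by (intro bexI[of _ "\<zero>"]) (simp_all add: path_sub_zero E_closed)
next
 case (add q y x)
 then obtain y' z where *: "y' \<in> carrier M" "z \<in> path_sub M (J - {p})" "x = E p \<odot> y' \<oplus> z" by blast
 have J: "J - {p} \<subseteq> N" and p: "p \<in> N" using assms by auto
 note zc = path_sub_closed[OF J *(2)]
 show ?case
 proof (cases "q = p")
  case True
  then show ?thesis using add * p zc
   by (intro bexI[of _ "y \<oplus> y'"] bexI[of _ z]) (auto simp: E_smult_add M.M.a_assoc)
 next
  case False
  have "E q \<odot> y \<in> path_sub M (J - {p})" using add False J by (intro path_sub_base) auto
  then show ?thesis using add * p zc J
   by (intro bexI[of _ y'] bexI[of _ "E q \<odot> y \<oplus> z"]) (auto simp: M.M.a_lcomm path_sub_plus)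
 qed
qed

lemma path_sub_empty: "x \<in> path_sub M {} \<Longrightarrow> x = \<zero>"
proof -
 assume "x \<in> path_sub M {}"
 with empty_subsetI show ?thesis by (induction x rule: path_sub_induct) auto
qed

lemma path_sub_end:
 assumes "J \<subseteq> N" "v \<in> verts Q" "\<And>p. p \<in> J \<Longrightarrow> path_end Q p = v" "x \<in> path_sub M J"
 shows "E (v, []) \<odot> x = x"
 using assms(1,4)
proof (induction x rule: path_sub_induct)
 case zero then show ?case using N_trivial[OF assms(2)] by (simp add: E_closed)
next
 case (add p y z)
 then show ?case using assms(3)[OF add(1)] E_smult_end[of p y] N_trivial[OF assms(2)] by (simp add: E_smult_add)
qed

lemma path_sub_vert:
 assumes "J \<subseteq> N" "v \<in> verts Q" "\<And>p. p \<in> J \<Longrightarrow> path_end Q p = v"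
 shows "path_sub M J \<subseteq> carrier (vert M v)"
 using path_sub_end[OF assms] path_sub_closed[OF assms(1)] vert_iff[OF assms(2)] by blast

lemma flatD:
 "flat M \<Longrightarrow> p \<in> N \<Longrightarrow> right_ideal J \<Longrightarrow> x \<in> carrier M \<Longrightarrow> E p \<odot> x \<in> path_sub M J \<Longrightarrow>
  E (fst p, []) \<odot> x \<in> path_sub M (colon J p)"
 by (auto simp: flat_def)

text \<open>The form in which flatness enters filtrations. When p has been deleted from J, p x can
  be rewritten by the remaining paths only if x is in the radical at the start of p.\<close>

lemma flat_rad:
 "flat M \<Longrightarrow> p \<in> N \<Longrightarrow> right_ideal J \<Longrightarrow> p \<notin> J \<Longrightarrow> x \<in> carrier M \<Longrightarrow> E p \<odot> x \<in> path_sub M J \<Longrightarrow>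
  E (fst p, []) \<odot> x \<in> path_sub M (rad (fst p))"
 using flatD path_sub_mono[OF colon_subset_rad] by blast

end

section \<open>Flatness of projective modules and of cycles\<close>

context monomial_algebra
begin

lemma module_locale: "left_module L M \<Longrightarrow> monomial_module A L Q N \<iota> E co ht M"
 by (intro monomial_module.intro monomial_algebra_axioms)

lemma path_sub_hom:
 assumes "left_module L M" "left_module L M'" "f \<in> module_hom L M M'" "J \<subseteq> N" "x \<in> path_sub M J"
 shows "f x \<in> path_sub M' J"
proof -
 interpret M: monomial_module A L Q N \<iota> E co ht M by (rule module_locale) fact
 interpret M': monomial_module A L Q N \<iota> E co ht M' by (rule module_locale) fact
 show ?thesis using assms(4,5)
 proof (induction x rule: M.path_sub_induct)
  case zero then show ?case by (simp add: hom_zero[OF assms(1-3)] M'.path_sub_zero)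
 next
  case (add p y z)
  then show ?case using hom_closed[OF assms(3)] assms(4)
   by (simp add: hom_add[OF assms(3)] hom_E[OF assms(3)] M'.path_sub_plus M'.path_sub_base)
 qed
qed

text \<open>A product of a path of J with anything on the right has its coordinates in J, because J
  is a right ideal. Conversely, the expansion of l involves only paths of J, and coefficients from A
  commute with paths.\<close>

lemma path_sub_regular:
 assumes J: "right_ideal J" and l: "l \<in> carrier L"
 shows "l \<in> path_sub (regular_module L) J \<longleftrightarrow> (\<forall>r\<in>N - J. co r l = \<zero>\<^sub>A)"
proof -
 interpret M: monomial_module A L Q N \<iota> E co ht "regular_module L"
  by (intro module_locale left_module_regular L.ring_axioms)
 note JN = right_idealD(1)[OF J]
 show ?thesis
 proof
  assume "l \<in> path_sub (regular_module L) J"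
  with JN show "\<forall>r\<in>N - J. co r l = \<zero>\<^sub>A"
  proof (induction l rule: M.path_sub_induct)
   case (add p y z)
   have "co r (E p \<otimes>\<^sub>L y) = \<zero>\<^sub>A" if r: "r \<in> N - J" for r
    using add r right_idealD(2)[OF J add(1)] by (intro co_left_0) auto
   then show ?case using add by (simp add: co_add E_closed)
  qed simp
 next
  assume z: "\<forall>r\<in>N - J. co r l = \<zero>\<^sub>A"
  have "(\<Oplus>\<^bsub>regular_module L\<^esub>p\<in>N. \<iota> (co p l) \<otimes>\<^sub>L E p) \<in> path_sub (regular_module L) J"
  proof (rule M.path_sub_finsum[OF JN finite_N])
   fix p assume p: "p \<in> N"
   show "\<iota> (co p l) \<otimes>\<^sub>L E p \<in> path_sub (regular_module L) J"
   proof (cases "p \<in> J")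
    case True
    then show ?thesis using M.path_sub_base[OF JN True, of "\<iota> (co p l)"] p l by (simp add: \<iota>_E co_closed)
   next
    case False
    then show ?thesis using z p M.path_sub_zero by (simp add: E_closed)
   qed
  qed
  moreover have "(\<Oplus>\<^bsub>regular_module L\<^esub>p\<in>N. \<iota> (co p l) \<otimes>\<^sub>L E p) = l"
   by (subst finsum_record[of "regular_module L" L]) (simp_all add: regular_module_def expansion[OF l, symmetric])
  ultimately show "l \<in> path_sub (regular_module L) J" by simp
 qed
qed

text \<open>The coordinate of p l at p r equals that of l at r. A nonzero path r ending at the start
  of p lies outside (J : p) exactly when p r is nonzero and outside J, so vanishing outside J
  transfers to vanishing outside (J : p).\<close>

lemma flat_regular: "flat (regular_module L)"
 unfolding flat_def
proof (intro ballI allI impI)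
 fix p J l assume p: "p \<in> N" and J: "right_ideal J" and "l \<in> carrier (regular_module L)"
  and m: "E p \<odot>\<^bsub>regular_module L\<^esub> l \<in> path_sub (regular_module L) J"
 then have l: "l \<in> carrier L" and z: "\<And>r. r \<in> N - J \<Longrightarrow> co r (E p \<otimes>\<^sub>L l) = \<zero>\<^sub>A"
  using path_sub_regular[OF J] by (auto simp: E_closed)
 have "co r (E (fst p, []) \<otimes>\<^sub>L l) = \<zero>\<^sub>A" if r: "r \<in> N - colon J p" for r
 proof (cases "path_end Q r = fst p")
  case True
  then have c: "path_comp p r \<in> N - J" using r by (auto simp: colon_def)
  then have "co r l = \<zero>\<^sub>A" using z[OF c] co_left[OF True _ l] by simp
  then show ?thesis using co_left[of r "(fst p, [])" l] True r l by simp
 next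
  case False
  then show ?thesis using r l triv_N[OF p] by (intro co_left_0) auto
 qed
 then show "E (fst p, []) \<odot>\<^bsub>regular_module L\<^esub> l \<in> path_sub (regular_module L) (colon J p)"
  using path_sub_regular[OF right_ideal_colon[OF J p]] l triv_N[OF p] by (simp add: E_closed)
qed

text \<open>Each functional of a dual basis carries the hypothesis to \<Lambda>, where it is a
  statement on coordinates; multiplication by the basis elements brings the conclusion back to
  P.\<close>

lemma flat_fgp:
 assumes "fgp L P" shows "flat P"
 unfolding flat_def
proof (intro ballI allI impI)
 from assms obtain n :: nat and x c where x: "\<And>i. i < n \<Longrightarrow> x i \<in> carrier P"
  and c: "\<And>i. i < n \<Longrightarrow> c i \<in> dual L P"
  and sum: "\<And>y. y \<in> carrier P \<Longrightarrow> y = (\<Oplus>\<^sub>P i\<in>{..<n}. c i y \<odot>\<^sub>P x i)" by (rule fgpE) blast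
 note P = fgp_left_module[OF assms] and reg = left_module_regular[OF L.ring_axioms]
 interpret P: monomial_module A L Q N \<iota> E co ht P by (rule module_locale) fact
 interpret R: monomial_module A L Q N \<iota> E co ht "regular_module L" by (rule module_locale) (rule reg)
 fix p J y assume p: "p \<in> N" and J: "right_ideal J" and y: "y \<in> carrier P" and m: "E p \<odot>\<^sub>P y \<in> path_sub P J"
 note JN = right_idealD(1)[OF J] and CN = right_idealD(1)[OF right_ideal_colon[OF J p]]
 have t: "(fst p, []) \<in> N" using triv_N p .
 have "c i (E (fst p, []) \<odot>\<^sub>P y) \<odot>\<^sub>P x i \<in> path_sub P (colon J p)" if i: "i < n" for i
 proof -
  have cy: "c i y \<in> carrier L" using hom_closed[OF c[OF i] y] by simp
  have "E p \<odot>\<^bsub>regular_module L\<^esub> c i y \<in> path_sub (regular_module L) J"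
   using path_sub_hom[OF P reg c[OF i] JN m] hom_E[OF c[OF i] p y] by simp
  then have "E (fst p, []) \<otimes>\<^sub>L c i y \<in> path_sub (regular_module L) (colon J p)"
   using R.flatD[OF flat_regular p J] cy by simp
  then have "c i (E (fst p, []) \<odot>\<^sub>P y) \<in> path_sub (regular_module L) (colon J p)"
   using hom_E[OF c[OF i] t y] by simp
  moreover have "(\<lambda>l. l \<odot>\<^sub>P x i) \<in> module_hom L (regular_module L) P"
   using x[OF i] by (intro module_homI) (auto simp: P.M.smult_l_distr P.M.smult_assoc1)
  ultimately show ?thesis using path_sub_hom[OF reg P _ CN] by blast
 qed
 then have "(\<Oplus>\<^sub>P i\<in>{..<n}. c i (E (fst p, []) \<odot>\<^sub>P y) \<odot>\<^sub>P x i) \<in> path_sub P (colon J p)"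
  by (intro P.path_sub_finsum[OF CN]) auto
 then show "E (fst p, []) \<odot>\<^sub>P y \<in> path_sub P (colon J p)"
  using sum[OF P.E_smult_closed[OF t y]] by simp
qed

text \<open>A shortest path p is deleted from J, and z = p y + j with j in the part without p. Since
  d z = 0, also p (d y) lies in the part without p, and flatness of P' puts d y, at the start of p,
  into the radical. By the hypothesis on lower vertices y is then a cycle up to a radical element,
  and p times the radical falls into the part without p, where induction applies. Two uses are
  intended: M a term of the resolution, and M its module of cycles.\<close>

lemma path_sub_exact_step:
 assumes M: "left_module L M" and P: "left_module L P" and P': "left_module L P'"
  and f: "f \<in> module_hom L M P" and d: "d \<in> module_hom L P P'" and flat: "flat P'"
  and ex: "\<And>z. z \<in> carrier P \<Longrightarrow> d z = \<zero>\<^sub>P' \<Longrightarrow> \<exists>m\<in>carrier M. z = f m"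
  and df: "\<And>m. m \<in> carrier M \<Longrightarrow> d (f m) = \<zero>\<^sub>P'"
  and v: "v \<in> verts Q"
  and ih: "\<And>s w. s \<in> verts Q \<Longrightarrow> ht s < ht v \<Longrightarrow> w \<in> carrier P \<Longrightarrow> d w \<in> path_sub P' (rad s) \<Longrightarrow>
   \<exists>r\<in>path_sub P (rad s). d w = d r"
  and J: "right_ideal J" "\<And>p. p \<in> J \<Longrightarrow> path_end Q p = v"
  and z: "z \<in> path_sub P J" "d z = \<zero>\<^sub>P'"
 shows "\<exists>x\<in>path_sub M J. z = f x"
proof -
 interpret M: monomial_module A L Q N \<iota> E co ht M by (rule module_locale) fact
 interpret P: monomial_module A L Q N \<iota> E co ht P by (rule module_locale) fact
 interpret P': monomial_module A L Q N \<iota> E co ht P' by (rule module_locale) fact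
 have "finite J" using J(1) finite_N by (auto simp: right_ideal_def intro: finite_subset)
 then show ?thesis using J z
 proof (induction J arbitrary: z rule: finite_psubset_induct)
  case (psubset J)
  note JN = right_idealD(1)[OF psubset.prems(1)]
  note zc = P.path_sub_closed[OF JN psubset.prems(3)]
  consider (empty) "J = {}" | (triv) "(v, []) \<in> J" | (ne) "J \<noteq> {}" "(v, []) \<notin> J" by blast
  then show ?case
  proof cases
   case empty
   then have "z = \<zero>\<^sub>P" using psubset.prems(3) P.path_sub_empty by simp
   then show ?thesis using hom_zero[OF M P f] M.path_sub_zero by metis
  next
   \<comment> \<open>Here J P is the whole vertex space of P at v, so plain exactness
     suffices.\<close>
   case triv
   obtain m where m: "m \<in> carrier M" "z = f m" using ex zc psubset.prems(4) by blast
   have "z = E (v, []) \<odot>\<^sub>P z" using P.path_sub_end[OF JN v psubset.prems(2,3)] by simp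
   also have "\<dots> = f (E (v, []) \<odot>\<^sub>M m)" using m hom_E[OF f N_trivial[OF v]] by simp
   finally show ?thesis using M.path_sub_base[OF JN triv m(1)] by blast
  next
   case ne
   define p where "p = (ARG_MIN (\<lambda>p. length (snd p)) p. p \<in> J)"
   have pJ: "p \<in> J" and min: "\<And>q. q \<in> J \<Longrightarrow> length (snd p) \<le> length (snd q)"
    using arg_min_nat_lemma[of "\<lambda>p. p \<in> J" _ "\<lambda>p. length (snd p)"] ne unfolding p_def by auto
   note J' = right_ideal_remove[OF psubset.prems(1) pJ min]
   note J'N = right_idealD(1)[OF J']
   have pN: "p \<in> N" using pJ JN by blast
   define s where "s = fst p"
   have s: "s \<in> verts Q" using N_verts(1)[OF pN] by (simp add: s_def)
   note sN = N_trivial[OF s]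
   have "snd p \<noteq> []"
   proof
    assume "snd p = []"
    then have "p = (v, [])" using psubset.prems(2)[OF pJ] by (simp add: path_end_eq prod_eq_iff)
    then show False using ne pJ by simp
   qed
   then have hs: "ht s < ht v" using ht_le[OF pN] psubset.prems(2)[OF pJ] unfolding s_def
    by (metis add_le_same_cancel1 length_greater_0_conv linorder_not_less order_less_le_trans)
   obtain y j where y: "y \<in> carrier P" and j: "j \<in> path_sub P (J - {p})" and zy: "z = E p \<odot>\<^sub>P y \<oplus>\<^sub>P j"
    using P.path_sub_split[OF JN pJ psubset.prems(3)] by blast
   note jc = P.path_sub_closed[OF J'N j]
   define w where "w = E (s, []) \<odot>\<^sub>P y"
   have wc: "w \<in> carrier P" using y sN by (simp add: w_def)
   have pw: "E p \<odot>\<^sub>P w = E p \<odot>\<^sub>P y" using P.E_smult_fst[OF pN y] by (simp add: w_def s_def)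
   have djc: "d j \<in> carrier P'" and dyc: "d y \<in> carrier P'" and dwc: "d w \<in> carrier P'"
    using hom_closed[OF d] jc y wc by auto
   have "E p \<odot>\<^sub>P' d y \<oplus>\<^sub>P' d j = \<zero>\<^sub>P'"
    using psubset.prems(4) y jc pN by (simp add: zy hom_add[OF d] hom_E[OF d])
   then have "E p \<odot>\<^sub>P' d y = \<ominus>\<^sub>P' d j" using P'.M.M.minus_equality[of "E p \<odot>\<^sub>P' d y" "d j"] djc dyc pN by simp
   also have "\<dots> \<in> path_sub P' (J - {p})"
    by (intro P'.path_sub_minus[OF J'N] path_sub_hom[OF P P' d J'N j])
   finally have "E (s, []) \<odot>\<^sub>P' d y \<in> path_sub P' (rad s)"
    unfolding s_def using P'.flat_rad[OF flat pN J' _ dyc] by blast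
   then have "d w \<in> path_sub P' (rad s)" using hom_E[OF d sN y] by (simp add: w_def)
   then obtain r where r: "r \<in> path_sub P (rad s)" "d w = d r" using ih[OF s hs wc] by blast
   note radN = right_idealD(1)[OF right_ideal_rad]
   note rc = P.path_sub_closed[OF radN r(1)]
   have "d (w \<ominus>\<^sub>P r) = d w \<ominus>\<^sub>P' d r" using wc rc by (intro hom_diff[OF P P' d])
   then have "d (w \<ominus>\<^sub>P r) = \<zero>\<^sub>P'" using r(2) dwc by (simp add: P'.M.M.minus_eq_zero_iff)
   then obtain m where m: "m \<in> carrier M" "w \<ominus>\<^sub>P r = f m" using ex wc rc by blast
   note fmc = hom_closed[OF f m(1)]
   have weq: "w = f m \<oplus>\<^sub>P r" using P.M.M.minus_add_cancel[OF wc rc] m(2) by simp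
   \<comment> \<open>Nontrivial right multiples of p stay in J and differ from p, so the radical
     error is absorbed by \<open>J - {p}\<close>.\<close>
   have pr: "E p \<odot>\<^sub>P r \<in> path_sub P (J - {p})"
   proof (rule P.path_sub_path[OF radN J'N pN r(1)])
    fix q assume q: "q \<in> rad s" "path_end Q q = fst p" "path_comp p q \<in> N"
    then have "path_comp p q \<in> J" using right_idealD(2)[OF psubset.prems(1) pJ] by blast
    moreover have "snd (path_comp p q) \<noteq> snd p" using q(1) by (simp add: rad_def)
    ultimately show "path_comp p q \<in> J - {p}" by (metis DiffI singletonD)
   qed
   then have prc: "E p \<odot>\<^sub>P r \<in> carrier P" using P.path_sub_closed[OF J'N] by blast
   define z' where "z' = E p \<odot>\<^sub>P r \<oplus>\<^sub>P j"
   have z': "z' \<in> path_sub P (J - {p})" unfolding z'_def by (rule P.path_sub_plus[OF J'N pr j])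
   note z'c = P.path_sub_closed[OF J'N z']
   have zeq: "z = f (E p \<odot>\<^sub>M m) \<oplus>\<^sub>P z'"
   proof -
    have "E p \<odot>\<^sub>P y = f (E p \<odot>\<^sub>M m) \<oplus>\<^sub>P E p \<odot>\<^sub>P r"
     unfolding pw[symmetric] weq using m(1) pN fmc rc by (simp add: P.E_smult_add hom_E[OF f])
    then show ?thesis
     using m(1) pN prc jc hom_closed[OF f] by (simp add: zy z'_def P.M.M.a_assoc)
   qed
   have "d z = d (f (E p \<odot>\<^sub>M m)) \<oplus>\<^sub>P' d z'"
    unfolding zeq using m pN z'c hom_closed[OF f] by (intro hom_add[OF d]) auto
   then have "d z' = \<zero>\<^sub>P'" using psubset.prems(4) df m pN hom_closed[OF d z'c] by simp
   then obtain x where x: "x \<in> path_sub M (J - {p})" "z' = f x"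
    using psubset.IH[OF _ J' _ z'] pJ psubset.prems(2) by blast
   have xJ: "x \<in> path_sub M J" using x M.path_sub_mono[of "J - {p}" J] by blast
   note xc = M.path_sub_closed[OF JN xJ]
   have "z = f (E p \<odot>\<^sub>M m \<oplus>\<^sub>M x)" using zeq x m pN xc by (simp add: hom_add[OF f])
   moreover have "E p \<odot>\<^sub>M m \<oplus>\<^sub>M x \<in> path_sub M J"
    by (rule M.path_sub_plus[OF JN M.path_sub_base[OF JN pJ m(1)] xJ])
   ultimately show ?thesis by blast
  qed
 qed
qed

lemma path_sub_exact:
 assumes cr: "complete_resolution L P d" and v: "v \<in> verts Q"
  and J: "right_ideal J" "\<And>p. p \<in> J \<Longrightarrow> path_end Q p = v"
  and z: "z \<in> path_sub (P (i + 1)) J" "d (i + 1) z = \<zero>\<^bsub>P (i + 2)\<^esub>"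
 shows "\<exists>x\<in>path_sub (P i) J. z = d i x"
 using v J z
proof (induction "ht v" arbitrary: v J z i rule: less_induct)
 case less
 have d1: "d (i + 1) \<in> module_hom L (P (i + 1)) (P (i + 2))" for i
  using cr_hom[OF cr, of "i + 1"] by (simp add: add.assoc)
 show ?case
 proof (rule path_sub_exact_step[OF cr_left_module[OF cr] cr_left_module[OF cr] cr_left_module[OF cr]
    cr_hom[OF cr] d1 flat_fgp[OF cr_fgp[OF cr]] cr_exact[OF cr] cr_dd[OF cr] less.prems(1) _ less.prems(2-5)])
  fix s w assume s: "s \<in> verts Q" "ht s < ht v" and w: "w \<in> carrier (P (i + 1))"
   and dw: "d (i + 1) w \<in> path_sub (P (i + 2)) (rad s)"
  \<comment> \<open>The induction hypothesis is used one degree higher: d w is a cycle in degree i +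
    2 inside the radical at the lower vertex s. For this reason the induction generalises over
    i.\<close>
  have dw': "d (i + 1) w \<in> path_sub (P (i + 1 + 1)) (rad s)" using dw by (simp add: add.assoc)
  note dd = cr_dd[OF cr w]
  show "\<exists>r\<in>path_sub (P (i + 1)) (rad s). d (i + 1) w = d (i + 1) r"
  proof (rule less.hyps[OF s(2,1) right_ideal_rad _ dw' dd])
   show "path_end Q p = s" if "p \<in> rad s" for p using that by (simp add: rad_def)
  qed
 qed
qed

text \<open>The exact step, applied to the embedding of the cycles, gives an element of J M with the
  same image, and injectivity identifies it with x. So J M is the part of M that lies in J
  P.\<close>

lemma path_sub_cycles:
 assumes cr: "complete_resolution L P d" and M: "left_module L M" and f: "cycle_iso L M P d f"
  and v: "v \<in> verts Q" and J: "right_ideal J" "\<And>p. p \<in> J \<Longrightarrow> path_end Q p = v"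
  and x: "x \<in> carrier M" "f x \<in> path_sub (P 0) J"
 shows "x \<in> path_sub M J"
proof -
 have fh: "f \<in> module_hom L M (P 0)" and inj: "inj_on f (carrier M)"
  and im: "f ` carrier M = {x \<in> carrier (P 0). d 0 x = \<zero>\<^bsub>P 1\<^esub>}" using f by (auto simp: cycle_iso_def)
 have d0: "d 0 \<in> module_hom L (P 0) (P 1)" using cr_hom[OF cr, of 0] by simp
 interpret M: monomial_module A L Q N \<iota> E co ht M by (rule module_locale) fact
 have df: "d 0 (f m) = \<zero>\<^bsub>P 1\<^esub>" if "m \<in> carrier M" for m using im that by blast
 have "\<exists>y\<in>path_sub M J. f x = f y"
 proof (rule path_sub_exact_step[OF M cr_left_module[OF cr] cr_left_module[OF cr] fh d0
    flat_fgp[OF cr_fgp[OF cr]] _ df v _ J x(2) df[OF x(1)]])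
  show "\<exists>m\<in>carrier M. z = f m" if "z \<in> carrier (P 0)" "d 0 z = \<zero>\<^bsub>P 1\<^esub>" for z
  proof -
   have "z \<in> f ` carrier M" using that im by simp
   then show ?thesis by blast
  qed
  fix s w assume s: "s \<in> verts Q" and w: "w \<in> carrier (P 0)" and dw: "d 0 w \<in> path_sub (P 1) (rad s)"
  show "\<exists>r\<in>path_sub (P 0) (rad s). d 0 w = d 0 r"
   using path_sub_exact[OF cr s right_ideal_rad, of s "d 0 w" 0] dw cr_dd[OF cr w] by (simp add: rad_def)
 qed
 then obtain y where y: "y \<in> path_sub M J" "f x = f y" by blast
 then have "x = y" using inj x(1) M.path_sub_closed[OF right_idealD(1)[OF J(1)]] by (auto dest: inj_onD)
 then show ?thesis using y by simp
qed

text \<open>The hypothesis of flatness maps forward into \<open>P 0\<close>, which is flat; the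
  conclusion is pulled back by \<open>path_sub_cycles\<close>.\<close>

lemma flat_cycles:
 assumes cr: "complete_resolution L P d" and M: "left_module L M" and f: "cycle_iso L M P d f"
 shows "flat M"
 unfolding flat_def
proof (intro ballI allI impI)
 fix p J x assume p: "p \<in> N" and J: "right_ideal J" and x: "x \<in> carrier M" and m: "E p \<odot>\<^sub>M x \<in> path_sub M J"
 have fh: "f \<in> module_hom L M (P 0)" using f by (simp add: cycle_iso_def)
 interpret M: monomial_module A L Q N \<iota> E co ht M by (rule module_locale) fact
 interpret P: monomial_module A L Q N \<iota> E co ht "P 0" by (rule module_locale) (rule cr_left_module[OF cr])
 have "E p \<odot>\<^bsub>P 0\<^esub> f x \<in> path_sub (P 0) J"
  using path_sub_hom[OF M cr_left_module[OF cr] fh right_idealD(1)[OF J] m] hom_E[OF fh p x] by simp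
 then have "f (E (fst p, []) \<odot>\<^sub>M x) \<in> path_sub (P 0) (colon J p)"
  using P.flatD[OF flat_fgp[OF cr_fgp[OF cr]] p J hom_closed[OF fh x]] hom_E[OF fh triv_N[OF p] x] by simp
 then show "E (fst p, []) \<odot>\<^sub>M x \<in> path_sub M (colon J p)"
  using x triv_N[OF p] N_verts(1)[OF p]
  by (intro path_sub_cycles[OF assms _ right_ideal_colon[OF J p]]) (auto simp: colon_def)
qed

end

section \<open>Tops of Gorenstein-projective modules\<close>

text \<open>Scalar multiplication of cosets is a union over representatives, all of which give the
  same coset. After that, the module structure is carried along the projection.\<close>

lemma quot_module_facts:
 assumes X: "left_module R X" and H: "submod R X H"
 shows left_module_quot: "left_module R (quot_module X H)"
  and quot_hom: "(\<lambda>x. H +>\<^bsub>X\<^esub> x) \<in> module_hom R X (quot_module X H)"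
  and quot_surj: "carrier (quot_module X H) = (\<lambda>x. H +>\<^bsub>X\<^esub> x) ` carrier X"
  and quot_ker: "x \<in> carrier X \<Longrightarrow> H +>\<^bsub>X\<^esub> x = \<zero>\<^bsub>quot_module X H\<^esub> \<longleftrightarrow> x \<in> H"
proof -
 interpret X: left_module R X by fact
 have "additive_subgroup H X"
 proof (rule additive_subgroup.intro, rule subgroup.intro)
  show "H \<subseteq> carrier (add_monoid X)" "\<one>\<^bsub>add_monoid X\<^esub> \<in> H"
   "\<And>x y. x \<in> H \<Longrightarrow> y \<in> H \<Longrightarrow> x \<otimes>\<^bsub>add_monoid X\<^esub> y \<in> H"
   using H by (auto simp: submod_def)
  show "inv\<^bsub>add_monoid X\<^esub> x \<in> H" if "x \<in> H" for x
   using submod_minus[OF X H that] by (simp add: a_inv_def)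
 qed
 then interpret abelian_subgroup H X by (rule abelian_subgroupI3[OF _ X.M.abelian_group_axioms])
 have Hc: "h \<in> carrier X" if "h \<in> H" for h using that by auto
 have sm: "(\<Union>y\<in>H +>\<^bsub>X\<^esub> x. H +>\<^bsub>X\<^esub> (r \<odot>\<^sub>X y)) = H +>\<^bsub>X\<^esub> (r \<odot>\<^sub>X x)"
  if r: "r \<in> carrier R" and x: "x \<in> carrier X" for r x
 proof -
  have "H +>\<^bsub>X\<^esub> (r \<odot>\<^sub>X y) = H +>\<^bsub>X\<^esub> (r \<odot>\<^sub>X x)" if y: "y \<in> H +>\<^bsub>X\<^esub> x" for y
  proof -
   obtain h where h: "h \<in> H" "y = h \<oplus>\<^sub>X x" using y by (auto simp: a_r_coset_def')
   have rh: "r \<odot>\<^sub>X h \<in> H" using H r h by (simp add: submod_def)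
   have "r \<odot>\<^sub>X y = r \<odot>\<^sub>X h \<oplus>\<^sub>X r \<odot>\<^sub>X x" using h r x by (simp add: X.smult_r_distr)
   then have "r \<odot>\<^sub>X y \<in> H +>\<^bsub>X\<^esub> (r \<odot>\<^sub>X x)" using rh by (auto simp: a_r_coset_def')
   then show ?thesis using X.M.a_repr_independence[OF _ _ a_subgroup] r x by simp
  qed
  moreover have "H +>\<^bsub>X\<^esub> x \<noteq> {}" using a_rcos_self[OF x] by blast
  ultimately show ?thesis by blast
 qed
 show surj: "carrier (quot_module X H) = (\<lambda>x. H +>\<^bsub>X\<^esub> x) ` carrier X"
  by (auto simp: quot_module_def FactRing_simps)
 have ad: "H +>\<^bsub>X\<^esub> (x \<oplus>\<^sub>X y) = (H +>\<^bsub>X\<^esub> x) \<oplus>\<^bsub>quot_module X H\<^esub> (H +>\<^bsub>X\<^esub> y)"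
  if "x \<in> carrier X" "y \<in> carrier X" for x y
  using a_rcos_sum[OF that] by (simp add: quot_module_def FactRing_def)
 have sm': "H +>\<^bsub>X\<^esub> (r \<odot>\<^sub>X x) = r \<odot>\<^bsub>quot_module X H\<^esub> (H +>\<^bsub>X\<^esub> x)"
  if "r \<in> carrier R" "x \<in> carrier X" for r x
  using sm[OF that] by (simp add: quot_module_def)
 have z: "\<zero>\<^bsub>quot_module X H\<^esub> = H" by (simp add: quot_module_def FactRing_def)
 have z': "H +>\<^bsub>X\<^esub> \<zero>\<^sub>X = H" using Hc by (intro X.M.a_coset_add_zero) auto
 show "left_module R (quot_module X H)"
  by (rule surj_left_module[OF X, of "\<lambda>x. H +>\<^bsub>X\<^esub> x"]) (simp_all add: surj ad sm' z z')
 show "(\<lambda>x. H +>\<^bsub>X\<^esub> x) \<in> module_hom R X (quot_module X H)"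
  by (rule module_homI) (simp_all add: surj ad sm')
 show "x \<in> carrier X \<Longrightarrow> H +>\<^bsub>X\<^esub> x = \<zero>\<^bsub>quot_module X H\<^esub> \<longleftrightarrow> x \<in> H"
  unfolding z using a_rcos_self X.M.a_coset_join2[OF _ a_subgroup] by metis
qed

lemma hom_factor:
 assumes X: "left_module R X" and T: "left_module R T" and Y: "left_module R Y"
  and p: "p \<in> module_hom R X T" "carrier T = p ` carrier X" and f: "f \<in> module_hom R X Y"
  and ker: "\<And>x. x \<in> carrier X \<Longrightarrow> p x = \<zero>\<^sub>T \<Longrightarrow> f x = \<zero>\<^sub>Y"
 shows "\<exists>g\<in>module_hom R T Y. \<forall>x\<in>carrier X. g (p x) = f x"
proof -
 interpret X: left_module R X by fact
 interpret T: left_module R T by fact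
 define S where "S t y \<longleftrightarrow> (\<exists>x\<in>carrier X. t = p x \<and> y = f x)" for t y
 have "\<exists>g\<in>module_hom R T Y. \<forall>t y. S t y \<longleftrightarrow> t \<in> carrier T \<and> y = g t"
 proof (rule rel_hom[OF T Y])
  show "t \<in> carrier T \<and> y \<in> carrier Y" if "S t y" for t y
   using that hom_closed[OF p(1)] hom_closed[OF f] by (auto simp: S_def)
  show "\<exists>y. S t y" if "t \<in> carrier T" for t using that p(2) by (auto simp: S_def)
  show "S (t \<oplus>\<^sub>T t') (y \<oplus>\<^sub>Y y')" if "S t y" "S t' y'" for t t' y y'
  proof -
   obtain x x' where x: "x \<in> carrier X" "t = p x" "y = f x" "x' \<in> carrier X" "t' = p x'" "y' = f x'"
    using \<open>S t y\<close> \<open>S t' y'\<close> unfolding S_def by blast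
   then show ?thesis unfolding S_def
    by (intro bexI[of _ "x \<oplus>\<^sub>X x'"]) (simp_all add: hom_add[OF p(1)] hom_add[OF f])
  qed
  show "S (r \<odot>\<^sub>T t) (r \<odot>\<^sub>Y y)" if "r \<in> carrier R" "S t y" for r t y
  proof -
   obtain x where x: "x \<in> carrier X" "t = p x" "y = f x"
    using \<open>S t y\<close> unfolding S_def by blast
   then show ?thesis unfolding S_def using \<open>r \<in> carrier R\<close>
    by (intro bexI[of _ "r \<odot>\<^sub>X x"]) (simp_all add: hom_smult[OF p(1)] hom_smult[OF f])
  qed
  show "y = \<zero>\<^sub>Y" if "S \<zero>\<^sub>T y" for y using that ker by (auto simp: S_def)
 qed
 then obtain g where g: "g \<in> module_hom R T Y" "\<And>t y. S t y \<longleftrightarrow> t \<in> carrier T \<and> y = g t" by blast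
 have "g (p x) = f x" if "x \<in> carrier X" for x
 proof -
  have "S (p x) (f x)" using that by (auto simp: S_def)
  then show ?thesis using g(2) by simp
 qed
 then show ?thesis using g(1) by blast
qed

lemma regular_uminus [simp]: "\<ominus>\<^bsub>regular_module R\<^esub> x = \<ominus>\<^sub>R x"
 by (simp add: a_inv_def m_inv_def)

lemma finsum_submod:
 assumes "left_module R M" "submod R M H" "finite S" "f \<in> S \<rightarrow> H"
 shows "finsum (M\<lparr>carrier := H\<rparr>) f S = finsum M f S"
proof -
 interpret M: left_module R M by fact
 interpret S: left_module R "M\<lparr>carrier := H\<rparr>" by (rule left_module_submod[OF assms(1,2)])
 have H: "H \<subseteq> carrier M" using assms(2) by (simp add: submod_def)
 show ?thesis using assms(3,4)
 proof (induction S rule: finite_induct)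
  case empty
  show ?case by simp
 next
  case (insert x F)
  have fx: "f x \<in> H" and fF: "f \<in> F \<rightarrow> H" using insert.prems by auto
  have "finsum (M\<lparr>carrier := H\<rparr>) f (insert x F) = f x \<oplus>\<^bsub>M\<lparr>carrier := H\<rparr>\<^esub> finsum (M\<lparr>carrier := H\<rparr>) f F"
   using insert.hyps fx fF by (intro S.M.finsum_insert) auto
  also have "\<dots> = f x \<oplus>\<^sub>M finsum M f F" using insert.IH[OF fF] by simp
  also have "\<dots> = finsum M f (insert x F)"
   using insert.hyps fx fF H by (intro M.M.finsum_insert[symmetric]) auto
  finally show ?case .
 qed
qed

context monomial_algebra
begin

text \<open>Of the same shape as the quotient in the theorem, so that only the two submodules have
  to be compared later.\<close>

definition top_module :: "('l, 'm, 'w) module_scheme \<Rightarrow> 'v \<Rightarrow> ('a, 'm set) module" where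
 "top_module M v = quot_module (vert M v) (path_sub M (rad v))"

definition top_proj :: "('l, 'm, 'w) module_scheme \<Rightarrow> 'v \<Rightarrow> 'm \<Rightarrow> 'm set" where
 "top_proj M v x = path_sub M (rad v) +>\<^bsub>vert M v\<^esub> x"

lemma hom_vert:
 assumes "left_module L M" "left_module L M'" "f \<in> module_hom L M M'" "v \<in> verts Q"
 shows "f \<in> module_hom A (vert M v) (vert M' v)"
proof -
 interpret M: monomial_module A L Q N \<iota> E co ht M by (rule module_locale) fact
 interpret M': monomial_module A L Q N \<iota> E co ht M' by (rule module_locale) fact
 have e: "(v, []) \<in> N" using N_trivial assms(4) .
 have c: "x \<in> carrier M \<and> E (v, []) \<odot>\<^sub>M x = x" if "x \<in> carrier (vert M v)" for x
  using that M.vert_iff[OF assms(4)] by simp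
 show ?thesis
 proof (rule module_homI)
  fix x assume x: "x \<in> carrier (vert M v)"
  then show "f x \<in> carrier (vert M' v)"
   using c[OF x] hom_closed[OF assms(3)] hom_E[OF assms(3) e, of x] M'.vert_iff[OF assms(4)] by simp
 qed (use c hom_add[OF assms(3)] hom_smult[OF assms(3)] in auto)
qed

end

context monomial_module
begin

lemma submod_path_sub:
 assumes "v \<in> verts Q" "J \<subseteq> N" "\<And>p. p \<in> J \<Longrightarrow> path_end Q p = v"
 shows "submod A (vert M v) (path_sub M J)"
 unfolding submod_def
 using path_sub_vert[OF assms(2,1,3)] path_sub_zero path_sub_plus[OF assms(2)] path_sub_\<iota>[OF assms(2)]
 by simp

lemma rad_N: "rad v \<subseteq> N" and rad_end: "p \<in> rad v \<Longrightarrow> path_end Q p = v"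
 by (auto simp: rad_def)

lemma submod_rad: "v \<in> verts Q \<Longrightarrow> submod A (vert M v) (path_sub M (rad v))"
 by (intro submod_path_sub rad_N rad_end)

lemma left_module_top: "v \<in> verts Q \<Longrightarrow> left_module A (top_module M v)"
 unfolding top_module_def by (intro left_module_quot left_module_vert submod_rad)

lemma top_proj_hom: "v \<in> verts Q \<Longrightarrow> top_proj M v \<in> module_hom A (vert M v) (top_module M v)"
 unfolding top_module_def top_proj_def by (intro quot_hom left_module_vert submod_rad)

lemma top_proj_surj: "v \<in> verts Q \<Longrightarrow> carrier (top_module M v) = top_proj M v ` carrier (vert M v)"
 unfolding top_module_def top_proj_def by (intro quot_surj[of A] left_module_vert submod_rad)

lemma top_proj_ker:
 "v \<in> verts Q \<Longrightarrow> x \<in> carrier (vert M v) \<Longrightarrow> top_proj M v x = \<zero>\<^bsub>top_module M v\<^esub> \<longleftrightarrow> x \<in> path_sub M (rad v)"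
 unfolding top_module_def top_proj_def by (intro quot_ker[of A] left_module_vert submod_rad)

lemma top_factor:
 assumes v: "v \<in> verts Q" and Y: "left_module A Y" and f: "f \<in> module_hom A (vert M v) Y"
  and ker: "\<And>x. x \<in> path_sub M (rad v) \<Longrightarrow> f x = \<zero>\<^sub>Y"
 shows "\<exists>g\<in>module_hom A (top_module M v) Y. \<forall>x\<in>carrier (vert M v). g (top_proj M v x) = f x"
 using top_proj_ker[OF v] ker
 by (intro hom_factor[OF left_module_vert[OF v] left_module_top[OF v] Y top_proj_hom[OF v] top_proj_surj[OF v] f]) auto

lemma finsum_vert:
 assumes "v \<in> verts Q" "finite S" "f \<in> S \<rightarrow> carrier (vert M v)"
 shows "finsum (vert M v) f S = finsum M f S"
proof -
 have "finsum (vert M v) f S = finsum (restr M) f S"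
  using finsum_submod[OF left_module_restr[OF M.left_module_axioms] submod_vert[OF assms(1)] assms(2,3)]
  by (subst vert_restr)
 also have "\<dots> = finsum M f S" by (rule finsum_record) (simp_all add: restr_def)
 finally show ?thesis .
qed

end

section \<open>Tops of projective modules and their duals over A\<close>

context monomial_algebra
begin

text \<open>Among the nonzero paths ending at v only the trivial one lies outside
  \<open>rad v\<close>, so subtracting its term leaves an element with no coordinates outside the
  radical.\<close>

lemma rad_part:
 assumes v: "v \<in> verts Q" and l: "l \<in> carrier L"
 shows "\<exists>r\<in>path_sub (regular_module L) (rad v). r \<in> carrier L \<and>
  E (v, []) \<otimes>\<^sub>L l = \<iota> (co (v, []) l) \<otimes>\<^sub>L E (v, []) \<oplus>\<^sub>L r"
proof -
 note e = N_trivial[OF v]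
 define a where "a = E (v, []) \<otimes>\<^sub>L l"
 define b where "b = \<iota> (co (v, []) l) \<otimes>\<^sub>L E (v, [])"
 have ab: "a \<in> carrier L" "b \<in> carrier L" using e l by (auto simp: a_def b_def E_closed co_closed)
 have "co r (a \<oplus>\<^sub>L \<iota> (\<ominus>\<^sub>A co (v, []) l) \<otimes>\<^sub>L E (v, [])) = \<zero>\<^sub>A" if r: "r \<in> N - rad v" for r
 proof -
  have *: "co r (a \<oplus>\<^sub>L \<iota> (\<ominus>\<^sub>A co (v, []) l) \<otimes>\<^sub>L E (v, []))
    = co r a \<oplus>\<^sub>A (if r = (v, []) then \<ominus>\<^sub>A co (v, []) l else \<zero>\<^sub>A)"
   using r ab e l by (auto simp: co_add co_\<iota>E E_closed co_closed)
  show ?thesis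
  proof (cases "r = (v, [])")
   case True
   have "co r a = co r l" using co_left[of r "(v, [])" l] r l True by (simp add: a_def)
   then show ?thesis using * True l e by (simp add: A.r_neg co_closed)
  next
   case False
   have ne: "path_end Q r \<noteq> v"
   proof
    assume ev: "path_end Q r = v"
    then have "snd r \<noteq> []" using False by (auto simp: path_end_eq prod_eq_iff)
    then show False using r ev by (simp add: rad_def)
   qed
   have "co r a = \<zero>\<^sub>A" unfolding a_def using r e l ne by (intro co_left_0) auto
   then show ?thesis using * False by simp
  qed
 qed
 moreover have "\<iota> (\<ominus>\<^sub>A co (v, []) l) \<otimes>\<^sub>L E (v, []) \<in> carrier L" using e l by (simp add: E_closed co_closed)
 ultimately have r: "a \<oplus>\<^sub>L \<iota> (\<ominus>\<^sub>A co (v, []) l) \<otimes>\<^sub>L E (v, []) \<in> path_sub (regular_module L) (rad v)"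
  using path_sub_regular[OF right_ideal_rad] ab by auto
 have "b \<oplus>\<^sub>L \<iota> (\<ominus>\<^sub>A co (v, []) l) \<otimes>\<^sub>L E (v, [])
   = \<iota> (co (v, []) l \<oplus>\<^sub>A \<ominus>\<^sub>A co (v, []) l) \<otimes>\<^sub>L E (v, [])"
  using e l by (simp add: b_def \<iota>_add co_closed L.l_distr E_closed)
 also have "\<dots> = \<zero>\<^sub>L" using e l by (simp add: A.r_neg co_closed E_closed)
 finally have "a = b \<oplus>\<^sub>L (a \<oplus>\<^sub>L \<iota> (\<ominus>\<^sub>A co (v, []) l) \<otimes>\<^sub>L E (v, []))"
  using ab e l by (simp add: L.a_lcomm[of b a] E_closed co_closed)
 then show ?thesis using r ab e l unfolding a_def b_def
  by (intro bexI[OF _ r]) (simp_all add: a_def E_closed co_closed)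
qed

text \<open>Modulo the radical an expansion keeps only the coefficients at the trivial path, since
  the rest of each coefficient multiplies into the radical. This yields dual bases of tops as well
  as formulas for functionals on them.\<close>

lemma top_expansion:
 assumes P: "left_module L P" and v: "v \<in> verts Q" and x: "\<And>i. i < (n::nat) \<Longrightarrow> x i \<in> carrier P"
  and c: "\<And>i. i < n \<Longrightarrow> c i \<in> dual L P"
  and sum: "\<And>y. y \<in> carrier P \<Longrightarrow> y = (\<Oplus>\<^sub>P i\<in>{..<n}. c i y \<odot>\<^sub>P x i)" and y: "y \<in> carrier P"
 shows "\<exists>\<rho>\<in>path_sub P (rad v). E (v, []) \<odot>\<^sub>P y =
  (\<Oplus>\<^bsub>vert P v\<^esub>i\<in>{..<n}. \<iota> (co (v, []) (c i y)) \<odot>\<^sub>P (E (v, []) \<odot>\<^sub>P x i)) \<oplus>\<^sub>P \<rho>"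
proof -
 interpret P: monomial_module A L Q N \<iota> E co ht P by (rule module_locale) fact
 note reg = left_module_regular[OF L.ring_axioms]
 note e = N_trivial[OF v]
 note cc = dual_closed[OF c y]
 note cv = co_closed[OF e cc]
 have "\<exists>\<rho>\<in>path_sub P (rad v). E (v, []) \<odot>\<^sub>P (c i y \<odot>\<^sub>P x i) = \<iota> (co (v, []) (c i y)) \<odot>\<^sub>P (E (v, []) \<odot>\<^sub>P x i) \<oplus>\<^sub>P \<rho>"
  if i: "i < n" for i
 proof -
  obtain r where r: "r \<in> path_sub (regular_module L) (rad v)" "r \<in> carrier L"
   and eq: "E (v, []) \<otimes>\<^sub>L c i y = \<iota> (co (v, []) (c i y)) \<otimes>\<^sub>L E (v, []) \<oplus>\<^sub>L r"
   using rad_part[OF v cc[OF i]] by blast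
  have "(\<lambda>l. l \<odot>\<^sub>P x i) \<in> module_hom L (regular_module L) P"
   using x[OF i] by (intro module_homI) (auto simp: P.M.smult_l_distr P.M.smult_assoc1)
  then have "r \<odot>\<^sub>P x i \<in> path_sub P (rad v)" using path_sub_hom[OF reg P _ P.rad_N r(1)] by blast
  moreover have "E (v, []) \<odot>\<^sub>P (c i y \<odot>\<^sub>P x i) = \<iota> (co (v, []) (c i y)) \<odot>\<^sub>P (E (v, []) \<odot>\<^sub>P x i) \<oplus>\<^sub>P r \<odot>\<^sub>P x i"
   using e x[OF i] cc[OF i] cv[OF i] r(2) eq
   by (simp add: P.M.smult_assoc1[symmetric] E_closed P.M.smult_l_distr[symmetric])
  ultimately show ?thesis by blast
 qed
 then obtain \<rho> where \<rho>: "\<And>i. i < n \<Longrightarrow> \<rho> i \<in> path_sub P (rad v)"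
  and eq: "\<And>i. i < n \<Longrightarrow> E (v, []) \<odot>\<^sub>P (c i y \<odot>\<^sub>P x i) = \<iota> (co (v, []) (c i y)) \<odot>\<^sub>P (E (v, []) \<odot>\<^sub>P x i) \<oplus>\<^sub>P \<rho> i"
  by metis
 note \<rho>c = P.path_sub_closed[OF P.rad_N \<rho>]
 let ?g = "\<lambda>i. \<iota> (co (v, []) (c i y)) \<odot>\<^sub>P (E (v, []) \<odot>\<^sub>P x i)"
 have gc: "?g i \<in> carrier (vert P v)" if "i < n" for i
  using cv[OF that] x[OF that] P.vert_iff[OF v] P.E_smult_idem[OF v] e by (simp add: P.\<iota>_E_smult)
 then have gP: "?g i \<in> carrier P" if "i < n" for i using that P.vert_iff[OF v] by blast
 have "E (v, []) \<odot>\<^sub>P y = E (v, []) \<odot>\<^sub>P (\<Oplus>\<^sub>P i\<in>{..<n}. c i y \<odot>\<^sub>P x i)" using sum[OF y] by simp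
 also have "\<dots> = (\<Oplus>\<^sub>P i\<in>{..<n}. E (v, []) \<odot>\<^sub>P (c i y \<odot>\<^sub>P x i))"
  using e cc x by (intro P.M.smult_finsum) (auto simp: E_closed)
 also have "\<dots> = (\<Oplus>\<^sub>P i\<in>{..<n}. ?g i \<oplus>\<^sub>P \<rho> i)"
  using gP \<rho>c eq by (intro P.M.M.finsum_cong') auto
 also have "\<dots> = (\<Oplus>\<^sub>P i\<in>{..<n}. ?g i) \<oplus>\<^sub>P (\<Oplus>\<^sub>P i\<in>{..<n}. \<rho> i)"
  using gP \<rho>c by (intro P.M.M.finsum_addf) auto
 also have "(\<Oplus>\<^sub>P i\<in>{..<n}. ?g i) = (\<Oplus>\<^bsub>vert P v\<^esub>i\<in>{..<n}. ?g i)"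
  using gc by (intro P.finsum_vert[OF v, symmetric]) auto
 finally show ?thesis using P.path_sub_finsum[OF P.rad_N, of "{..<n}" \<rho>] \<rho> by auto
qed

text \<open>Taking the coefficient at the trivial path turns a functional over \<Lambda> into a
  functional over A on the top at v; \<open>top_functional_lift\<close> goes back.\<close>

lemma co_hom_rad:
 assumes P: "left_module L P" and v: "v \<in> verts Q" and f: "f \<in> dual L P"
 shows "(\<lambda>x. co (v, []) (f x)) \<in> dual A (vert P v)"
  and "x \<in> path_sub P (rad v) \<Longrightarrow> co (v, []) (f x) = \<zero>\<^sub>A"
proof -
 interpret P: monomial_module A L Q N \<iota> E co ht P by (rule module_locale) fact
 note reg = left_module_regular[OF L.ring_axioms]
 note e = N_trivial[OF v]
 note fc = dual_closed[OF f]
 show "(\<lambda>x. co (v, []) (f x)) \<in> dual A (vert P v)"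
  using fc e by (intro module_homI)
   (auto simp: P.vert_iff[OF v] co_closed hom_add[OF f] hom_smult[OF f] co_add co_\<iota>)
 assume "x \<in> path_sub P (rad v)"
 then have m: "f x \<in> path_sub (regular_module L) (rad v)" and x: "x \<in> carrier P"
  using path_sub_hom[OF P reg f P.rad_N] P.path_sub_closed[OF P.rad_N] by auto
 then show "co (v, []) (f x) = \<zero>\<^sub>A"
  using path_sub_regular[OF right_ideal_rad fc[OF x], of v] e by (simp add: rad_def)
qed

text \<open>A dual basis of P reduces to one of the top: functionals by their coefficient at the
  trivial path, elements by their class at v.\<close>

lemma fgp_top:
 assumes P: "fgp L P" and v: "v \<in> verts Q" shows "fgp A (top_module P v)"
proof -
 from P obtain n :: nat and x c where x: "\<And>i. i < n \<Longrightarrow> x i \<in> carrier P"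
  and c: "\<And>i. i < n \<Longrightarrow> c i \<in> dual L P"
  and sum: "\<And>y. y \<in> carrier P \<Longrightarrow> y = (\<Oplus>\<^sub>P i\<in>{..<n}. c i y \<odot>\<^sub>P x i)" by (rule fgpE) blast
 note lm = fgp_left_module[OF P]
 interpret P: monomial_module A L Q N \<iota> E co ht P by (rule module_locale) fact
 let ?T = "top_module P v" and ?\<pi> = "top_proj P v"
 note T = P.left_module_top[OF v] and \<pi> = P.top_proj_hom[OF v]
 interpret T: left_module A ?T by (rule T)
 note e = N_trivial[OF v]
 have "\<exists>g\<in>module_hom A ?T (regular_module A). \<forall>y\<in>carrier (vert P v). g (?\<pi> y) = co (v, []) (c i y)"
  if i: "i < n" for i
  using co_hom_rad[OF lm v c[OF i]]
  by (intro P.top_factor[OF v left_module_regular[OF A.ring_axioms]]) auto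
 then obtain g where g: "\<And>i. i < n \<Longrightarrow> g i \<in> module_hom A ?T (regular_module A)"
  and g\<pi>: "\<And>i y. i < n \<Longrightarrow> y \<in> carrier (vert P v) \<Longrightarrow> g i (?\<pi> y) = co (v, []) (c i y)" by metis
 have xv: "E (v, []) \<odot>\<^sub>P x i \<in> carrier (vert P v)" if "i < n" for i using x[OF that] by (simp add: carrier_vert)
 show ?thesis
 proof (rule fgpI[OF T, of n "\<lambda>i. ?\<pi> (E (v, []) \<odot>\<^sub>P x i)" g])
  show "?\<pi> (E (v, []) \<odot>\<^sub>P x i) \<in> carrier ?T" if "i < n" for i using hom_closed[OF \<pi> xv[OF that]] .
  fix t assume "t \<in> carrier ?T"
  then obtain y where y: "y \<in> carrier (vert P v)" "t = ?\<pi> y" using P.top_proj_surj[OF v] by auto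
  then have yP: "y \<in> carrier P" "E (v, []) \<odot>\<^sub>P y = y" using P.vert_iff[OF v] by auto
  let ?h = "\<lambda>i. \<iota> (co (v, []) (c i y)) \<odot>\<^sub>P (E (v, []) \<odot>\<^sub>P x i)"
  obtain \<rho> where \<rho>: "\<rho> \<in> path_sub P (rad v)" and eq: "y = (\<Oplus>\<^bsub>vert P v\<^esub>i\<in>{..<n}. ?h i) \<oplus>\<^sub>P \<rho>"
   using top_expansion[OF lm v x c sum yP(1)] yP(2) by auto
  have cc: "co (v, []) (c i y) \<in> carrier A" if "i < n" for i
   using hom_closed[OF c[OF that] yP(1)] co_closed[OF e] by simp
  interpret V: left_module A "vert P v" by (rule P.left_module_vert[OF v])
  have hc: "?h i \<in> carrier (vert P v)" if "i < n" for i
   using V.smult_closed[OF cc[OF that] xv[OF that]] by simp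
  have \<rho>v: "\<rho> \<in> carrier (vert P v)" using \<rho> P.path_sub_vert[OF P.rad_N v P.rad_end] by blast
  have sc: "(\<Oplus>\<^bsub>vert P v\<^esub>i\<in>{..<n}. ?h i) \<in> carrier (vert P v)" using hc by (intro V.M.finsum_closed) auto
  have "?\<pi> y = ?\<pi> (\<Oplus>\<^bsub>vert P v\<^esub>i\<in>{..<n}. ?h i) \<oplus>\<^bsub>?T\<^esub> ?\<pi> \<rho>"
   by (subst eq) (use hom_add[OF \<pi> sc \<rho>v] in simp)
  also have "?\<pi> \<rho> = \<zero>\<^bsub>?T\<^esub>" using P.top_proj_ker[OF v \<rho>v] \<rho> by simp
  also have "?\<pi> (\<Oplus>\<^bsub>vert P v\<^esub>i\<in>{..<n}. ?h i) = (\<Oplus>\<^bsub>?T\<^esub>i\<in>{..<n}. ?\<pi> (?h i))"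
   using hc by (intro hom_finsum[OF P.left_module_vert[OF v] T \<pi>]) auto
  also have "\<dots> = (\<Oplus>\<^bsub>?T\<^esub>i\<in>{..<n}. g i t \<odot>\<^bsub>?T\<^esub> ?\<pi> (E (v, []) \<odot>\<^sub>P x i))"
   using hom_smult[OF \<pi> cc xv] y g\<pi> cc hom_closed[OF \<pi> xv] hom_closed[OF \<pi> hc]
   by (intro T.M.finsum_cong') auto
  finally show "t = (\<Oplus>\<^bsub>?T\<^esub>i\<in>{..<n}. g i t \<odot>\<^bsub>?T\<^esub> ?\<pi> (E (v, []) \<odot>\<^sub>P x i))"
   using y cc hom_closed[OF \<pi> xv] g\<pi> by (subst (asm) T.M.r_zero) auto
 qed (rule g)
qed

text \<open>With b_i the value of \<phi> at the v-component of the i-th generator, the lift sends y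
  to the sum of the c_i(y) b_i e_v. Its values lie in \<Lambda> e_v, so coordinates at paths not
  starting at v vanish; this confines the error term in the proof of
  \<open>top_exact\<close>.\<close>

lemma top_functional_lift:
 assumes P: "fgp L P" and v: "v \<in> verts Q" and \<phi>: "\<phi> \<in> dual A (vert P v)"
  and \<phi>0: "\<And>x. x \<in> path_sub P (rad v) \<Longrightarrow> \<phi> x = \<zero>\<^sub>A"
 shows "\<exists>F\<in>dual L P. \<forall>x\<in>carrier P.
  co (v, []) (F x) = \<phi> (E (v, []) \<odot>\<^sub>P x) \<and> F x \<otimes>\<^sub>L E (v, []) = F x"
proof -
 from P obtain n :: nat and x c where x: "\<And>i. i < n \<Longrightarrow> x i \<in> carrier P"
  and c: "\<And>i. i < n \<Longrightarrow> c i \<in> dual L P"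
  and sum: "\<And>y. y \<in> carrier P \<Longrightarrow> y = (\<Oplus>\<^sub>P i\<in>{..<n}. c i y \<odot>\<^sub>P x i)" by (rule fgpE) blast
 note lm = fgp_left_module[OF P] and regL = left_module_regular[OF L.ring_axioms]
  and regA = left_module_regular[OF A.ring_axioms]
 interpret P: monomial_module A L Q N \<iota> E co ht P by (rule module_locale) fact
 interpret V: left_module A "vert P v" by (rule P.left_module_vert[OF v])
 note e = N_trivial[OF v]
 have ee: "E (v, []) \<otimes>\<^sub>L E (v, []) = E (v, [])" using E_fst[OF e] by simp
 have xv: "E (v, []) \<odot>\<^sub>P x i \<in> carrier (vert P v)" if "i < n" for i using x[OF that] by (simp add: carrier_vert)
 define b where "b i = \<phi> (E (v, []) \<odot>\<^sub>P x i)" for i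
 have b: "b i \<in> carrier A" if "i < n" for i using hom_closed[OF \<phi> xv[OF that]] by (simp add: b_def)
 define F where "F y = (\<Oplus>\<^bsub>regular_module L\<^esub>i\<in>{..<n}. c i y \<odot>\<^bsub>regular_module L\<^esub> (\<iota> (b i) \<otimes>\<^sub>L E (v, [])))" for y
 have F: "F \<in> dual L P"
  unfolding F_def using b e by (intro hom_lincomb regL c) (auto simp: E_closed)
 have FL: "F y = (\<Oplus>\<^sub>L i\<in>{..<n}. c i y \<otimes>\<^sub>L (\<iota> (b i) \<otimes>\<^sub>L E (v, [])))" for y
  unfolding F_def by (subst finsum_record[of "regular_module L" L]) (simp_all add: regular_module_def)
 have "co (v, []) (F y) = \<phi> (E (v, []) \<odot>\<^sub>P y) \<and> F y \<otimes>\<^sub>L E (v, []) = F y" if y: "y \<in> carrier P" for y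
 proof
  note cL = dual_closed[OF c y]
  have cc: "co (v, []) (c i y) \<in> carrier A" if "i < n" for i using cL[OF that] co_closed[OF e] by simp
  have trm: "co (v, []) (c i y \<otimes>\<^sub>L (\<iota> (b i) \<otimes>\<^sub>L E (v, []))) = co (v, []) (c i y) \<otimes>\<^sub>A b i" if i: "i < n" for i
   using co_right[of "(v, [])" "(v, [])" "c i y \<otimes>\<^sub>L \<iota> (b i)"] cL[OF i] b[OF i] e
   by (simp add: L.m_assoc[symmetric] E_closed co_\<iota>_right)
  have "co (v, []) (F y) = (\<Oplus>\<^sub>A i\<in>{..<n}. co (v, []) (c i y \<otimes>\<^sub>L (\<iota> (b i) \<otimes>\<^sub>L E (v, []))))"
   unfolding FL using cL b e by (intro co_finsum) (auto simp: E_closed)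
  also have "\<dots> = (\<Oplus>\<^sub>A i\<in>{..<n}. co (v, []) (c i y) \<otimes>\<^sub>A b i)"
   using trm cc b by (intro A.finsum_cong') auto
  finally have 1: "co (v, []) (F y) = (\<Oplus>\<^sub>A i\<in>{..<n}. co (v, []) (c i y) \<otimes>\<^sub>A b i)" .
  let ?h = "\<lambda>i. \<iota> (co (v, []) (c i y)) \<odot>\<^sub>P (E (v, []) \<odot>\<^sub>P x i)"
  obtain \<rho> where \<rho>: "\<rho> \<in> path_sub P (rad v)" and eq: "E (v, []) \<odot>\<^sub>P y = (\<Oplus>\<^bsub>vert P v\<^esub>i\<in>{..<n}. ?h i) \<oplus>\<^sub>P \<rho>"
   using top_expansion[OF lm v x c sum y] by auto
  have hc: "?h i \<in> carrier (vert P v)" if "i < n" for i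
   using V.smult_closed[OF cc[OF that] xv[OF that]] by simp
  have \<rho>v: "\<rho> \<in> carrier (vert P v)" using \<rho> P.path_sub_vert[OF P.rad_N v P.rad_end] by blast
  have sc: "(\<Oplus>\<^bsub>vert P v\<^esub>i\<in>{..<n}. ?h i) \<in> carrier (vert P v)" using hc by (intro V.M.finsum_closed) auto
  have "\<phi> (E (v, []) \<odot>\<^sub>P y) = \<phi> (\<Oplus>\<^bsub>vert P v\<^esub>i\<in>{..<n}. ?h i)"
   using hom_add[OF \<phi> sc \<rho>v] \<phi>0[OF \<rho>] hom_closed[OF \<phi> sc] by (simp add: eq)
  also have "\<dots> = (\<Oplus>\<^bsub>regular_module A\<^esub>i\<in>{..<n}. \<phi> (?h i))"
   using hc by (intro hom_finsum[OF P.left_module_vert[OF v] regA \<phi>]) auto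
  also have "\<dots> = (\<Oplus>\<^sub>A i\<in>{..<n}. \<phi> (?h i))"
   by (rule finsum_record) (simp_all add: regular_module_def)
  also have "\<dots> = (\<Oplus>\<^sub>A i\<in>{..<n}. co (v, []) (c i y) \<otimes>\<^sub>A b i)"
   using cc b hom_smult[OF \<phi> cc xv] by (intro A.finsum_cong') (auto simp: b_def)
  finally show "co (v, []) (F y) = \<phi> (E (v, []) \<odot>\<^sub>P y)" using 1 by simp
  have "F y \<otimes>\<^sub>L E (v, []) = (\<Oplus>\<^sub>L i\<in>{..<n}. c i y \<otimes>\<^sub>L (\<iota> (b i) \<otimes>\<^sub>L E (v, [])) \<otimes>\<^sub>L E (v, []))"
   unfolding FL using cL b e by (intro L.finsum_ldistr) (auto simp: E_closed)
  also have "\<dots> = F y"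
   unfolding FL using cL b e by (intro L.finsum_cong') (auto simp: E_closed L.m_assoc ee)
  finally show "F y \<otimes>\<^sub>L E (v, []) = F y" .
 qed
 then show ?thesis using F by blast
qed

text \<open>The elements of \<Lambda> with coordinates only in such a set form a left submodule, so
  functionals on a \<Lambda>-module can be confined to it.\<close>

definition left_ideal_paths :: "('v, 'e) path set \<Rightarrow> bool" where
 "left_ideal_paths K \<longleftrightarrow> K \<subseteq> N \<and>
  (\<forall>p\<in>K. \<forall>q. path_end Q p = fst q \<longrightarrow> path_comp q p \<in> N \<longrightarrow> path_comp q p \<in> K)"

text \<open>Exactness of the A-dual of the complex of tops at v, phrased by functionals on vertex
  spaces that kill the radical, so that no cosets are involved.\<close>

definition top_exact :: "(int \<Rightarrow> ('l, 'p, 'w) module_scheme) \<Rightarrow> (int \<Rightarrow> 'p \<Rightarrow> 'p) \<Rightarrow> 'v \<Rightarrow> bool" where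
 "top_exact P d v \<longleftrightarrow> (\<forall>i. \<forall>\<phi>\<in>dual A (vert (P (i + 1)) v).
  (\<forall>x\<in>path_sub (P (i + 1)) (rad v). \<phi> x = \<zero>\<^sub>A) \<longrightarrow> (\<forall>x\<in>carrier (vert (P i) v). \<phi> (d i x) = \<zero>\<^sub>A) \<longrightarrow>
  (\<exists>\<psi>\<in>dual A (vert (P (i + 2)) v). (\<forall>x\<in>path_sub (P (i + 2)) (rad v). \<psi> x = \<zero>\<^sub>A) \<and>
   (\<forall>x\<in>carrier (vert (P (i + 1)) v). \<phi> x = \<psi> (d (i + 1) x))))"

text \<open>Deleting a shortest path p from K leaves a left ideal. The coefficient at p of a
  functional with values in K is an A-functional on the top at the end u of p, and u is higher than
  v because p is nontrivial. There an extension exists by hypothesis; lifted to \<Lambda> and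
  multiplied by p on the right, it can be subtracted, and the remaining functional has its values in
  \<open>K - {p}\<close>.\<close>

lemma left_ideal_hom_exact:
 assumes cr: "complete_resolution L P d"
  and top: "\<And>u. u \<in> verts Q \<Longrightarrow> ht v < ht u \<Longrightarrow> top_exact P d u"
  and K: "left_ideal_paths K" "\<And>p. p \<in> K \<Longrightarrow> fst p = v \<and> snd p \<noteq> []"
  and f: "f \<in> dual L (P (i + 1))"
  and fK: "\<And>x r. x \<in> carrier (P (i + 1)) \<Longrightarrow> r \<in> N - K \<Longrightarrow> co r (f x) = \<zero>\<^sub>A"
  and fd: "\<And>x. x \<in> carrier (P i) \<Longrightarrow> f (d i x) = \<zero>\<^sub>L"
 shows "\<exists>g\<in>dual L (P (i + 2)). (\<forall>x\<in>carrier (P (i + 2)). \<forall>r\<in>N - K. co r (g x) = \<zero>\<^sub>A) \<and>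
  (\<forall>x\<in>carrier (P (i + 1)). f x = g (d (i + 1) x))"
proof -
 note lm = cr_left_module[OF cr] and regL = left_module_regular[OF L.ring_axioms]
 interpret P: monomial_module A L Q N \<iota> E co ht "P j" for j by (rule module_locale) (rule lm)
 have d1: "d (i + 1) \<in> module_hom L (P (i + 1)) (P (i + 2))"
  using cr_hom[OF cr, of "i + 1"] by (simp add: add.assoc)
 note d1c = hom_closed[OF d1]
 have "finite K" using K(1) finite_N by (auto simp: left_ideal_paths_def intro: finite_subset)
 then show ?thesis using K f fK fd
 proof (induction K arbitrary: f rule: finite_psubset_induct)
  case (psubset K)
  note f = psubset.prems(3)
  have KN: "K \<subseteq> N" and Kc: "\<And>p q. p \<in> K \<Longrightarrow> path_end Q p = fst q \<Longrightarrow> path_comp q p \<in> N \<Longrightarrow> path_comp q p \<in> K"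
   using psubset.prems(1) unfolding left_ideal_paths_def by blast+
  note fc = dual_closed[OF f]
  show ?case
  proof (cases "K = {}")
   case True
   have "f x = \<zero>\<^sub>L" if "x \<in> carrier (P (i + 1))" for x
    using psubset.prems(4)[OF that] True fc[OF that] by (intro co_ext) auto
   then show ?thesis
    using hom_zero_map[OF regL, of "P (i + 2)"] by (intro bexI[of _ "\<lambda>x. \<zero>\<^sub>L"]) auto
  next
   case False
   define p where "p = (ARG_MIN (\<lambda>p. length (snd p)) p. p \<in> K)"
   have pK: "p \<in> K" and min: "\<And>q. q \<in> K \<Longrightarrow> length (snd p) \<le> length (snd q)"
    using arg_min_nat_lemma[of "\<lambda>p. p \<in> K" _ "\<lambda>p. length (snd p)"] False unfolding p_def by auto
   have pN: "p \<in> N" using pK KN by blast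
   define u where "u = path_end Q p"
   have u: "u \<in> verts Q" using N_verts(2)[OF pN] by (simp add: u_def)
   note uN = N_trivial[OF u]
   have hu: "ht v < ht u"
    using ht_le[OF pN] psubset.prems(2)[OF pK] unfolding u_def by (cases "snd p") auto
   have K': "left_ideal_paths (K - {p})"
    unfolding left_ideal_paths_def
   proof (intro conjI ballI allI impI)
    show "K - {p} \<subseteq> N" using KN by blast
    fix p' q assume p': "p' \<in> K - {p}" and q: "path_end Q p' = fst q" and c: "path_comp q p' \<in> N"
    have "path_comp q p' \<noteq> p"
    proof
     assume eq: "path_comp q p' = p"
     then have "snd p = snd p' @ snd q" "fst p = fst p'" by auto
     moreover have "length (snd p) \<le> length (snd p')" using min p' by blast
     ultimately have "p' = p" by (simp add: prod_eq_iff)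
     then show False using p' by blast
    qed
    then show "path_comp q p' \<in> K - {p}" using Kc[OF _ q c] p' by blast
   qed
   define \<phi> where "\<phi> x = co p (f x)" for x
   have \<phi>h: "\<phi> \<in> dual A (vert (P (i + 1)) u)"
    unfolding \<phi>_def using fc pN
    by (intro module_homI)
     (auto simp: P.vert_iff[OF u] co_closed hom_add[OF f] hom_smult[OF f] co_add co_\<iota>)
   have \<phi>0: "\<phi> x = \<zero>\<^sub>A" if "x \<in> path_sub (P (i + 1)) (rad u)" for x
    using P.rad_N that
   proof (induction x rule: P.path_sub_induct)
    case zero then show ?case using hom_zero[OF lm regL f] pN by (simp add: \<phi>_def)
   next
    case (add q y z)
    \<comment> \<open>If p = q q' with q nontrivial, then q' is shorter than every path in K, so f
      has no coordinate at q'.\<close>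
    have "co p (E q \<otimes>\<^sub>L f y) = \<zero>\<^sub>A"
    proof (cases "\<exists>q'. path_end Q q' = fst q \<and> p = path_comp q q'")
     case True
     then obtain q' where q': "path_end Q q' = fst q" "p = path_comp q q'" by blast
     have q'N: "q' \<in> N" using N_comp(2)[of q q'] q' pN by simp
     have "length (snd q') < length (snd p)" using add(1) q'(2) by (auto simp: rad_def)
     then have "q' \<notin> K" using min[of q'] by linarith
     then have "co q' (f y) = \<zero>\<^sub>A" using psubset.prems(4)[OF add(3)] q'N by blast
     then show ?thesis using co_left[OF q'(1) _ fc[OF add(3)]] q'(2) pN by simp
    next
     case False
     then show ?thesis using co_left_0[OF pN add(2) _ fc[OF add(3)]] by blast
    qed
    then show ?case
     using add pN fc by (simp add: \<phi>_def hom_add[OF f] hom_E[OF f] co_add E_closed)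
   qed
   have \<phi>d: "\<phi> (d i x) = \<zero>\<^sub>A" if "x \<in> carrier (vert (P i) u)" for x
    using psubset.prems(5)[of x] that pN P.vert_iff[OF u, of x i] by (simp add: \<phi>_def)
   obtain \<psi> where \<psi>: "\<psi> \<in> dual A (vert (P (i + 2)) u)"
    and \<psi>0: "\<And>x. x \<in> path_sub (P (i + 2)) (rad u) \<Longrightarrow> \<psi> x = \<zero>\<^sub>A"
    and \<psi>d: "\<And>x. x \<in> carrier (vert (P (i + 1)) u) \<Longrightarrow> \<phi> x = \<psi> (d (i + 1) x)"
    using top[OF u hu, unfolded top_exact_def] \<phi>h \<phi>0 \<phi>d by blast
   obtain F where F: "F \<in> dual L (P (i + 2))"
    and Fco: "\<And>x. x \<in> carrier (P (i + 2)) \<Longrightarrow> co (u, []) (F x) = \<psi> (E (u, []) \<odot>\<^bsub>P (i + 2)\<^esub> x)"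
    using top_functional_lift[OF cr_fgp[OF cr] u \<psi> \<psi>0] by blast
   note Fc = dual_closed[OF F]
   \<comment> \<open>The coordinate of F x at the trivial path at u becomes the coordinate of the
     product at p. All coordinates of the product lie at left multiples of p, hence in K.\<close>
   define g0 where "g0 x = F x \<otimes>\<^sub>L E p" for x
   have g0: "g0 \<in> dual L (P (i + 2))"
    using hom_mult_elem[OF regL F, of "E p"] pN by (simp add: g0_def[abs_def] E_closed)
   note g0c = dual_closed[OF g0]
   have g0K: "co r (g0 x) = \<zero>\<^sub>A" if r: "r \<in> N - K" and x: "x \<in> carrier (P (i + 2))" for r x
   proof -
    have "r \<noteq> path_comp q p" if "path_end Q p = fst q" for q using Kc[OF pK that] r by blast
    then show ?thesis unfolding g0_def using r pN Fc[OF x] by (intro co_right_0) auto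
   qed
   have g0p: "co p (g0 (d (i + 1) x)) = co p (f x)" if x: "x \<in> carrier (P (i + 1))" for x
   proof -
    note dx = d1c[OF x]
    have xu: "E (u, []) \<odot>\<^bsub>P (i + 1)\<^esub> x \<in> carrier (vert (P (i + 1)) u)" using x by (simp add: carrier_vert)
    have "co p (g0 (d (i + 1) x)) = co (u, []) (F (d (i + 1) x))"
     using co_right[of p "(u, [])" "F (d (i + 1) x)"] pN Fc[OF dx] by (simp add: g0_def u_def)
    also have "\<dots> = \<psi> (d (i + 1) (E (u, []) \<odot>\<^bsub>P (i + 1)\<^esub> x))"
     using Fco[OF dx] hom_E[OF d1 uN x] by simp
    also have "\<dots> = co p (E (u, []) \<otimes>\<^sub>L f x)"
     using \<psi>d[OF xu] hom_E[OF f uN x] by (simp add: \<phi>_def)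
    also have "\<dots> = co p (f x)" using co_left[of p "(u, [])" "f x"] pN fc[OF x] by (simp add: u_def)
    finally show ?thesis .
   qed
   define f' where "f' x = f x \<oplus>\<^bsub>regular_module L\<^esub> \<ominus>\<^bsub>regular_module L\<^esub> g0 (d (i + 1) x)" for x
   have f': "f' \<in> dual L (P (i + 1))"
    unfolding f'_def by (intro hom_plus[OF regL f] hom_uminus[OF regL] hom_comp[OF d1 g0])
   have f'K: "co r (f' x) = \<zero>\<^sub>A" if x: "x \<in> carrier (P (i + 1))" and r: "r \<in> N - (K - {p})" for x r
   proof -
    note dx = d1c[OF x]
    have *: "co r (f' x) = co r (f x) \<oplus>\<^sub>A \<ominus>\<^sub>A co r (g0 (d (i + 1) x))"
     using r fc[OF x] g0c[OF dx] by (simp add: f'_def co_add co_neg)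
    show ?thesis
    proof (cases "r = p")
     case True
     then show ?thesis using * g0p[OF x] r fc[OF x] by (simp add: A.r_neg co_closed)
    next
     case False
     then have "r \<in> N - K" using r by blast
     then show ?thesis using * psubset.prems(4)[OF x] g0K[OF _ dx] by simp
    qed
   qed
   have f'd: "f' (d i x) = \<zero>\<^sub>L" if x: "x \<in> carrier (P i)" for x
    using psubset.prems(5)[OF x] cr_dd[OF cr x] hom_zero[OF lm regL g0] by (simp add: f'_def)
   obtain g' where g': "g' \<in> dual L (P (i + 2))"
    and g'K: "\<And>x r. x \<in> carrier (P (i + 2)) \<Longrightarrow> r \<in> N - (K - {p}) \<Longrightarrow> co r (g' x) = \<zero>\<^sub>A"
    and g'd: "\<And>x. x \<in> carrier (P (i + 1)) \<Longrightarrow> f' x = g' (d (i + 1) x)"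
    using psubset.IH[OF _ K' _ f' f'K f'd] pK psubset.prems(2) by blast
   note g'c = dual_closed[OF g']
   define g where "g x = g' x \<oplus>\<^bsub>regular_module L\<^esub> g0 x" for x
   have g: "g \<in> dual L (P (i + 2))"
    unfolding g_def by (intro hom_plus[OF regL] g' g0)
   have "co r (g x) = \<zero>\<^sub>A" if "x \<in> carrier (P (i + 2))" "r \<in> N - K" for x r
    using that g'K[OF that(1), of r] g0K[OF that(2,1)] g'c g0c by (simp add: g_def co_add)
   moreover have "f x = g (d (i + 1) x)" if x: "x \<in> carrier (P (i + 1))" for x
    using g'd[OF x, symmetric] fc[OF x] g0c[OF d1c[OF x]] by (simp add: g_def f'_def L.a_assoc L.l_neg)
   ultimately show ?thesis using g by blast
  qed
 qed
qed

text \<open>A lift F of \<phi> need not vanish on boundaries, but F d has no coefficient at the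
  trivial path and takes values in \<Lambda> e_v, that is, in the left ideal of nontrivial paths
  from v. One degree earlier this error is of the form h d with h confined to the same left ideal.
  So F - h kills boundaries and still has \<phi> as its coefficient at the trivial path. Only higher
  vertices are involved in finding h, which makes the induction descend.\<close>

lemma top_exact:
 assumes cr: "complete_resolution L P d" and v: "v \<in> verts Q"
 shows "top_exact P d v"
proof -
 have fin: "finite (verts Q)"
  using finite_subset[of "verts Q" "fst ` N"] finite_N N_trivial by force
 \<comment> \<open>A bound on the heights turns descending induction on height into
   \<open>less_induct\<close>.\<close>
 define B where "B = Max (ht ` verts Q)"
 have B: "ht u \<le> B" if "u \<in> verts Q" for u using that fin by (simp add: B_def)
 show ?thesis using v
 proof (induction "B - ht v" arbitrary: v rule: less_induct)
  case less
  note v = less.prems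
  have top: "top_exact P d u" if "u \<in> verts Q" "ht v < ht u" for u
   using less.hyps[of u] that B[of u] by simp
  note lm = cr_left_module[OF cr] and regL = left_module_regular[OF L.ring_axioms]
  interpret P: monomial_module A L Q N \<iota> E co ht "P j" for j by (rule module_locale) (rule lm)
  note e = N_trivial[OF v]
  show "top_exact P d v"
   unfolding top_exact_def
  proof (intro allI ballI impI)
   fix i \<phi> assume \<phi>: "\<phi> \<in> dual A (vert (P (i + 1)) v)"
    and \<phi>0: "\<forall>x\<in>path_sub (P (i + 1)) (rad v). \<phi> x = \<zero>\<^sub>A"
    and \<phi>d: "\<forall>x\<in>carrier (vert (P i) v). \<phi> (d i x) = \<zero>\<^sub>A"
   note d0 = cr_hom[OF cr]
   note dc = hom_closed[OF d0]
   obtain F where F: "F \<in> dual L (P (i + 1))"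
    and Fco: "\<And>x. x \<in> carrier (P (i + 1)) \<Longrightarrow> co (v, []) (F x) = \<phi> (E (v, []) \<odot>\<^bsub>P (i + 1)\<^esub> x)"
    and FE: "\<And>x. x \<in> carrier (P (i + 1)) \<Longrightarrow> F x \<otimes>\<^sub>L E (v, []) = F x"
    using top_functional_lift[OF cr_fgp[OF cr] v \<phi>] \<phi>0 by blast
   note Fc = dual_closed[OF F]
   define K where "K = {p \<in> N. fst p = v \<and> snd p \<noteq> []}"
   have K: "left_ideal_paths K" by (auto simp: left_ideal_paths_def K_def)
   define F1 where "F1 x = F (d i x)" for x
   have F1: "F1 \<in> dual L (P (i - 1 + 1))"
    unfolding F1_def using hom_comp[OF d0 F] by simp
   have F1K: "co r (F1 x) = \<zero>\<^sub>A" if x: "x \<in> carrier (P (i - 1 + 1))" and r: "r \<in> N - K" for x r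
   proof -
    have x': "x \<in> carrier (P i)" using x by simp
    show ?thesis
    proof (cases "r = (v, [])")
     case True
     have "\<phi> (E (v, []) \<odot>\<^bsub>P (i + 1)\<^esub> d i x) = \<zero>\<^sub>A"
      using \<phi>d x' unfolding hom_E[OF d0 e x', symmetric] by (simp add: carrier_vert)
     then show ?thesis using True Fco[OF dc[OF x']] by (simp add: F1_def)
    next
     case False
     have "r \<noteq> path_comp q (v, [])" if "path_end Q (v, []) = fst q" for q
      using r False by (auto simp: K_def path_comp_def)
     then have "co r (F (d i x) \<otimes>\<^sub>L E (v, [])) = \<zero>\<^sub>A"
      using r e Fc[OF dc[OF x']] by (intro co_right_0) auto
     then show ?thesis using FE[OF dc[OF x']] by (simp add: F1_def)
    qed
   qed
   have F1d: "F1 (d (i - 1) x) = \<zero>\<^sub>L" if x: "x \<in> carrier (P (i - 1))" for x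
    using cr_dd[OF cr x] hom_zero[OF lm regL F] by (simp add: F1_def add.commute[of 1 i])
   \<comment> \<open>The left ideal lemma is used in degree i - 1: F1 is a functional on
     \<open>P i\<close> that kills boundaries, and h is a functional on
     \<open>P (i + 1)\<close>.\<close>
   have i2: "i - 1 + 2 = i + 1" "i - 1 + 1 = i" by auto
   obtain h where h: "h \<in> dual L (P (i + 1))"
    and hK: "\<And>x r. x \<in> carrier (P (i + 1)) \<Longrightarrow> r \<in> N - K \<Longrightarrow> co r (h x) = \<zero>\<^sub>A"
    and hd: "\<And>x. x \<in> carrier (P i) \<Longrightarrow> F1 x = h (d i x)"
   proof -
    have "fst p = v \<and> snd p \<noteq> []" if "p \<in> K" for p using that by (simp add: K_def)
    from left_ideal_hom_exact[OF cr top K this F1 F1K F1d]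
    show ?thesis using that unfolding i2 by blast
   qed
   note hc = dual_closed[OF h]
   define F2 where "F2 x = F x \<oplus>\<^bsub>regular_module L\<^esub> \<ominus>\<^bsub>regular_module L\<^esub> h x" for x
   have F2: "F2 \<in> dual L (P (i + 1))"
    unfolding F2_def by (intro hom_plus[OF regL F] hom_uminus[OF regL h])
   have "F2 (d i x) = \<zero>\<^sub>L" if x: "x \<in> carrier (P i)" for x
    using hd[OF x, symmetric] Fc[OF dc[OF x]] by (simp add: F2_def F1_def L.r_neg)
   then obtain g where g: "g \<in> dual L (P (i + 2))"
    and gd: "\<And>x. x \<in> carrier (P (i + 1)) \<Longrightarrow> F2 x = g (d (i + 1) x)"
    using cr_hom_exact[OF cr F2] by blast
   have "\<phi> x = co (v, []) (g (d (i + 1) x))" if x: "x \<in> carrier (vert (P (i + 1)) v)" for x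
   proof -
    have x': "x \<in> carrier (P (i + 1))" "E (v, []) \<odot>\<^bsub>P (i + 1)\<^esub> x = x" using x P.vert_iff[OF v] by auto
    have "co (v, []) (h x) = \<zero>\<^sub>A" using hK[OF x'(1), of "(v, [])"] e by (simp add: K_def)
    then have "co (v, []) (F2 x) = co (v, []) (F x)"
     using e Fc[OF x'(1)] hc[OF x'(1)] by (simp add: F2_def co_add co_neg co_closed)
    then show ?thesis using Fco[OF x'(1)] x'(2) gd[OF x'(1)] by simp
   qed
   then show "\<exists>\<psi>\<in>dual A (vert (P (i + 2)) v).
    (\<forall>x\<in>path_sub (P (i + 2)) (rad v). \<psi> x = \<zero>\<^sub>A) \<and> (\<forall>x\<in>carrier (vert (P (i + 1)) v). \<phi> x = \<psi> (d (i + 1) x))"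
    using co_hom_rad[OF lm v g] by (intro bexI[OF _ co_hom_rad(1)[OF lm v g]]) auto
  qed
 qed
qed

end

section \<open>Tops and vertex spaces of Gorenstein-projective modules\<close>

lemma gorenstein_projective_zero:
 fixes R :: "('r, 'q) ring_scheme" and Z :: "('r, 'm, 'w) module_scheme"
 assumes Z: "left_module R Z" "carrier Z = {\<zero>\<^sub>Z}"
 shows "gorenstein_projective R Z"
proof -
 interpret Z: left_module R Z by fact
 interpret reg: left_module R "regular_module R" by (rule left_module_regular[OF Z.R.ring_axioms])
 have fg: "fgp R Z"
  by (rule fgpI[OF Z(1), of 0]) (use Z(2) in auto)
 have hz: "f \<zero>\<^sub>Z = \<zero>\<^sub>R" if "f \<in> dual R Z" for f
  using hom_zero[OF Z(1) reg.left_module_axioms that] by simp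
 have z1: "(\<lambda>x. x) \<in> module_hom R Z Z" by (rule module_homI) auto
 have "complete_resolution R (\<lambda>i. Z) (\<lambda>i x. x)"
  using Z(2) hz by (intro complete_resolutionI fg z1) auto
 moreover have "cycle_iso R Z (\<lambda>i. Z) (\<lambda>i x. x) (\<lambda>x. x)"
  using z1 Z(2) by (auto simp: cycle_iso_def)
 ultimately show ?thesis by (rule gorenstein_projectiveI[OF Z(1)])
qed

context monomial_algebra
begin

text \<open>The given u need not sit at the vertex v. Multiplying it by the idempotent at v does not
  change its image, since x and r sit at v.\<close>

lemma top_proj_lift:
 assumes Y: "left_module L Y" and P: "left_module L P" and v: "v \<in> verts Q" and g: "g \<in> module_hom L Y P"
  and x: "x \<in> carrier (vert P v)" and r: "r \<in> path_sub P (rad v)"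
  and u: "u \<in> carrier Y" "x \<ominus>\<^sub>P r = g u"
 shows "\<exists>u\<in>carrier (vert Y v). top_proj P v x = top_proj P v (g u)"
proof -
 interpret P: monomial_module A L Q N \<iota> E co ht P by (rule module_locale) (rule P)
 interpret Y: monomial_module A L Q N \<iota> E co ht Y by (rule module_locale) (rule Y)
 interpret T: left_module A "top_module P v" by (rule P.left_module_top[OF v])
 note \<pi> = P.top_proj_hom[OF v]
 note e = N_trivial[OF v]
 have rv: "r \<in> carrier (vert P v)" using P.path_sub_vert[OF P.rad_N v P.rad_end] r by blast
 have xP: "x \<in> carrier P" "E (v, []) \<odot>\<^sub>P x = x" and rP: "r \<in> carrier P" "E (v, []) \<odot>\<^sub>P r = r"
  using x rv P.vert_iff[OF v] by auto
 have eq: "g u \<oplus>\<^sub>P r = x" using P.M.M.minus_add_cancel[OF xP(1) rP(1)] u(2) by simp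
 have "E (v, []) \<odot>\<^sub>P (x \<ominus>\<^sub>P r) = x \<ominus>\<^sub>P r"
  using P.E_smult_diff[OF e xP(1) rP(1)] xP(2) rP(2) by simp
 then have gu: "g (E (v, []) \<odot>\<^sub>Y u) = g u" using hom_E[OF g e u(1)] u(2) by simp
 have uv: "E (v, []) \<odot>\<^sub>Y u \<in> carrier (vert Y v)" using u(1) by (simp add: carrier_vert)
 then have guv: "g u \<in> carrier (vert P v)" using hom_closed[OF hom_vert[OF Y P g v] uv] gu by simp
 have "top_proj P v x = top_proj P v (g u) \<oplus>\<^bsub>top_module P v\<^esub> top_proj P v r"
  using hom_add[OF \<pi> guv rv] eq by simp
 also have "top_proj P v r = \<zero>\<^bsub>top_module P v\<^esub>" using P.top_proj_ker[OF v rv] r by simp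
 finally have "top_proj P v x = top_proj P v (g u)" using hom_closed[OF \<pi> guv] by simp
 then show ?thesis using uv gu by metis
qed

text \<open>If d x lies in the radical, \<open>path_sub_exact\<close> provides a radical element r
  with d r = d x, so x agrees with the cycle x - r modulo the radical; this is exactness of tops.
  Dual exactness is \<open>top_exact\<close>, and the top of M embeds because the radical of M is
  the part of M inside the radical of \<open>P 0\<close>.\<close>

lemma gorenstein_projective_top:
 assumes "gorenstein_projective L M" and v: "v \<in> verts Q"
 shows "gorenstein_projective A (top_module M v)"
proof -
 obtain P :: "int \<Rightarrow> ('l, nat \<Rightarrow> 'l) module" and d f where
  cr: "complete_resolution L P d" and f: "cycle_iso L M P d f" and M: "left_module L M"
  using assms(1) unfolding gorenstein_projective_iff by (elim conjE exE)
 note P = cr_left_module[OF cr]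
 interpret M: monomial_module A L Q N \<iota> E co ht M by (rule module_locale) (rule M)
 interpret P: monomial_module A L Q N \<iota> E co ht "P j" for j by (rule module_locale) (rule P)
 have fh: "f \<in> module_hom L M (P 0)"
  and im: "f ` carrier M = {x \<in> carrier (P 0). d 0 x = \<zero>\<^bsub>P 1\<^esub>}" using f by (auto simp: cycle_iso_def)
 define T where "T i = top_module (P i) v" for i
 define \<pi> where "\<pi> i = top_proj (P i) v" for i
 have T: "left_module A (T i)" for i unfolding T_def by (rule P.left_module_top[OF v])
 have \<pi>: "\<pi> i \<in> module_hom A (vert (P i) v) (T i)" for i unfolding T_def \<pi>_def by (rule P.top_proj_hom[OF v])
 have \<pi>s: "carrier (T i) = \<pi> i ` carrier (vert (P i) v)" for i unfolding T_def \<pi>_def by (rule P.top_proj_surj[OF v])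
 have \<pi>k: "\<pi> i x = \<zero>\<^bsub>T i\<^esub> \<longleftrightarrow> x \<in> path_sub (P i) (rad v)" if "x \<in> carrier (vert (P i) v)" for i x
  using P.top_proj_ker[OF v that] by (simp add: T_def \<pi>_def)
 have V: "left_module A (vert (P i) v)" for i by (rule P.left_module_vert[OF v])
 interpret T: left_module A "T i" for i by (rule T)
 interpret V: left_module A "vert (P i) v" for i by (rule V)
 have rv: "x \<in> carrier (vert (P i) v)" if "x \<in> path_sub (P i) (rad v)" for i x
  using P.path_sub_vert[OF P.rad_N v P.rad_end] that by blast
 have vP: "x \<in> carrier (P i)" if "x \<in> carrier (vert (P i) v)" for i x
  using P.vert_iff[OF v] that by auto
 have dv: "d i \<in> module_hom A (vert (P i) v) (vert (P (i + 1)) v)" for i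
  by (rule hom_vert[OF P P cr_hom[OF cr] v])
 have d1: "d (i + 1) \<in> module_hom L (P (i + 1)) (P (i + 2))" for i
  using cr_hom[OF cr, of "i + 1"] by (simp add: add.assoc)
 have dv1: "d (i + 1) \<in> module_hom A (vert (P (i + 1)) v) (vert (P (i + 2)) v)" for i
  by (rule hom_vert[OF P P d1 v])
 have "\<exists>D\<in>module_hom A (T i) (T (i + 1)). \<forall>x\<in>carrier (vert (P i) v). D (\<pi> i x) = \<pi> (i + 1) (d i x)" for i
  unfolding T_def[of i] \<pi>_def[of i]
 proof (rule P.top_factor[OF v T hom_comp[OF dv \<pi>]])
  fix x assume x: "x \<in> path_sub (P i) (rad v)"
  then have "d i x \<in> path_sub (P (i + 1)) (rad v)" by (intro path_sub_hom[OF P P cr_hom[OF cr] P.rad_N])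
  then show "\<pi> (i + 1) (d i x) = \<zero>\<^bsub>T (i + 1)\<^esub>" using \<pi>k rv by blast
 qed
 then obtain D where D: "\<And>i. D i \<in> module_hom A (T i) (T (i + 1))"
  and D\<pi>: "\<And>i x. x \<in> carrier (vert (P i) v) \<Longrightarrow> D i (\<pi> i x) = \<pi> (i + 1) (d i x)" by metis
 have D1: "D (i + 1) (\<pi> (i + 1) x) = \<pi> (i + 2) (d (i + 1) x)" if "x \<in> carrier (vert (P (i + 1)) v)" for i x
  using D\<pi>[OF that] by (simp add: add.assoc)
 have \<pi>0: "\<pi> i \<zero>\<^bsub>P i\<^esub> = \<zero>\<^bsub>T i\<^esub>" for i using hom_zero[OF V T \<pi>, of i] by simp
 have crT: "complete_resolution A T D"
 proof (rule complete_resolutionI)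
  show "fgp A (T i)" for i unfolding T_def by (rule fgp_top[OF cr_fgp[OF cr] v])
  show "D i \<in> module_hom A (T i) (T (i + 1))" for i by (rule D)
  fix i
  show "D (i + 1) (D i t) = \<zero>\<^bsub>T (i + 2)\<^esub>" if t: "t \<in> carrier (T i)" for t
  proof -
   obtain x where x: "x \<in> carrier (vert (P i) v)" "t = \<pi> i x" using t \<pi>s by blast
   show ?thesis using x D\<pi>[OF x(1)] D1[OF hom_closed[OF dv x(1)]] cr_dd[OF cr vP[OF x(1)]] \<pi>0 by simp
  qed
  show "\<exists>s\<in>carrier (T i). t = D i s" if t: "t \<in> carrier (T (i + 1))" "D (i + 1) t = \<zero>\<^bsub>T (i + 2)\<^esub>" for t
  proof -
   obtain x where x: "x \<in> carrier (vert (P (i + 1)) v)" "t = \<pi> (i + 1) x" using t \<pi>s by blast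
   have "\<pi> (i + 2) (d (i + 1) x) = \<zero>\<^bsub>T (i + 2)\<^esub>" using t x D1 by simp
   then have dx: "d (i + 1) x \<in> path_sub (P (i + 1 + 1)) (rad v)"
    using \<pi>k[OF hom_closed[OF dv1 x(1)]] by (simp add: add.assoc)
   obtain r where r: "r \<in> path_sub (P (i + 1)) (rad v)" "d (i + 1) x = d (i + 1) r"
    using path_sub_exact[OF cr v right_ideal_rad P.rad_end dx] cr_dd[OF cr vP[OF x(1)]] by blast
   have rP: "r \<in> carrier (P (i + 1))" using P.path_sub_closed[OF P.rad_N r(1)] .
   have "d (i + 1) (x \<ominus>\<^bsub>P (i + 1)\<^esub> r) = d (i + 1) x \<ominus>\<^bsub>P (i + 2)\<^esub> d (i + 1) r"
    using vP[OF x(1)] rP by (intro hom_diff[OF P P d1])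
   then have "d (i + 1) (x \<ominus>\<^bsub>P (i + 1)\<^esub> r) = \<zero>\<^bsub>P (i + 2)\<^esub>"
    using r(2) hom_closed[OF d1 vP[OF x(1)]] by (simp add: P.M.M.minus_eq_zero_iff)
   then obtain u where u: "u \<in> carrier (P i)" "x \<ominus>\<^bsub>P (i + 1)\<^esub> r = d i u"
    using cr_exact[OF cr] vP[OF x(1)] rP by blast
   obtain u' where u': "u' \<in> carrier (vert (P i) v)" "\<pi> (i + 1) x = \<pi> (i + 1) (d i u')"
    using top_proj_lift[of "P i" "P (i + 1)" v "d i" x r u, OF P P v cr_hom[OF cr] x(1) r(1) u] unfolding \<pi>_def by blast
   show ?thesis using D\<pi>[OF u'(1)] u'(2) x(2) hom_closed[OF \<pi> u'(1)] by (intro bexI[of _ "\<pi> i u'"]) simp_all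
  qed
  show "\<exists>h\<in>dual A (T (i + 2)). \<forall>t\<in>carrier (T (i + 1)). g t = h (D (i + 1) t)"
   if g: "g \<in> dual A (T (i + 1))"
    and gz: "\<And>t. t \<in> carrier (T i) \<Longrightarrow> g (D i t) = \<zero>\<^sub>A" for g
  proof -
   note regA = left_module_regular[OF A.ring_axioms]
   define \<phi> where "\<phi> x = g (\<pi> (i + 1) x)" for x
   have \<phi>: "\<phi> \<in> dual A (vert (P (i + 1)) v)"
    unfolding \<phi>_def by (rule hom_comp[OF \<pi> g])
   have 1: "\<forall>x\<in>path_sub (P (i + 1)) (rad v). \<phi> x = \<zero>\<^sub>A"
    using \<pi>k[OF rv] hom_zero[OF T regA g] by (simp add: \<phi>_def)
   have 2: "\<forall>x\<in>carrier (vert (P i) v). \<phi> (d i x) = \<zero>\<^sub>A"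
    using gz hom_closed[OF \<pi>] D\<pi> by (metis \<phi>_def)
   obtain \<psi> where \<psi>: "\<psi> \<in> dual A (vert (P (i + 2)) v)"
    and \<psi>0: "\<And>x. x \<in> path_sub (P (i + 2)) (rad v) \<Longrightarrow> \<psi> x = \<zero>\<^sub>A"
    and \<psi>d: "\<And>x. x \<in> carrier (vert (P (i + 1)) v) \<Longrightarrow> \<phi> x = \<psi> (d (i + 1) x)"
    using top_exact[OF cr v, unfolded top_exact_def, THEN spec, THEN bspec, OF \<phi>, THEN mp, OF 1, THEN mp, OF 2]
    by blast
   obtain h where h: "h \<in> dual A (T (i + 2))"
    and h\<pi>: "\<And>x. x \<in> carrier (vert (P (i + 2)) v) \<Longrightarrow> h (\<pi> (i + 2) x) = \<psi> x"
    using P.top_factor[OF v regA \<psi>] \<psi>0 unfolding T_def \<pi>_def by auto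
   have "g t = h (D (i + 1) t)" if t: "t \<in> carrier (T (i + 1))" for t
   proof -
    obtain x where x: "x \<in> carrier (vert (P (i + 1)) v)" "t = \<pi> (i + 1) x" using t \<pi>s by blast
    show ?thesis using D1[OF x(1)] h\<pi>[OF hom_closed[OF dv1 x(1)]] \<psi>d[OF x(1)] by (simp add: x(2) \<phi>_def)
   qed
   then show ?thesis using h by blast
  qed
 qed
 let ?TM = "top_module M v" and ?\<pi>M = "top_proj M v"
 note TM = M.left_module_top[OF v]
 interpret TM: left_module A ?TM by (rule TM)
 have fv: "f \<in> module_hom A (vert M v) (vert (P 0) v)" by (rule hom_vert[OF M P fh v])
 have "\<exists>F\<in>module_hom A ?TM (T 0). \<forall>x\<in>carrier (vert M v). F (?\<pi>M x) = \<pi> 0 (f x)"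
 proof (rule M.top_factor[OF v T hom_comp[OF fv \<pi>]])
  fix x assume x: "x \<in> path_sub M (rad v)"
  then have "f x \<in> path_sub (P 0) (rad v)" by (intro path_sub_hom[OF M P fh M.rad_N])
  then show "\<pi> 0 (f x) = \<zero>\<^bsub>T 0\<^esub>" using \<pi>k rv by blast
 qed
 then obtain F where F: "F \<in> module_hom A ?TM (T 0)"
  and F\<pi>: "\<And>x. x \<in> carrier (vert M v) \<Longrightarrow> F (?\<pi>M x) = \<pi> 0 (f x)" by blast
 have d0: "d 0 \<in> module_hom L (P 0) (P 1)" using cr_hom[OF cr, of 0] by simp
 have dv0: "d 0 \<in> module_hom A (vert (P 0) v) (vert (P 1) v)" using dv[of 0] by simp
 have D0: "D 0 (\<pi> 0 x) = \<pi> 1 (d 0 x)" if "x \<in> carrier (vert (P 0) v)" for x using D\<pi>[OF that] by simp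
 have MV: "x \<in> carrier M" if "x \<in> carrier (vert M v)" for x using that M.vert_iff[OF v] by simp
 have "cycle_iso A ?TM T D F"
  unfolding cycle_iso_def
 proof (intro conjI F)
  show "inj_on F (carrier ?TM)"
  proof (rule inj_on_homI[OF TM T F])
   fix t assume t: "t \<in> carrier ?TM" "F t = \<zero>\<^bsub>T 0\<^esub>"
   obtain x where x: "x \<in> carrier (vert M v)" "t = ?\<pi>M x" using t M.top_proj_surj[OF v] by blast
   have "f x \<in> path_sub (P 0) (rad v)" using t x F\<pi>[OF x(1)] \<pi>k[OF hom_closed[OF fv x(1)]] by simp
   then have "x \<in> path_sub M (rad v)"
    using MV[OF x(1)] by (intro path_sub_cycles[OF cr M f v right_ideal_rad P.rad_end])
   then show "t = \<zero>\<^bsub>?TM\<^esub>" using M.top_proj_ker[OF v x(1)] x(2) by simp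
  qed
  show "F ` carrier ?TM = {t \<in> carrier (T 0). D 0 t = \<zero>\<^bsub>T 1\<^esub>}" (is "?l = ?r")
  proof
   show "?l \<subseteq> ?r"
   proof
    fix s assume "s \<in> ?l"
    then obtain x where x: "x \<in> carrier (vert M v)" "s = \<pi> 0 (f x)"
     using M.top_proj_surj[OF v] F\<pi> by auto
    have fx: "f x \<in> carrier (vert (P 0) v)" using hom_closed[OF fv x(1)] .
    have "d 0 (f x) = \<zero>\<^bsub>P 1\<^esub>" using im MV[OF x(1)] by blast
    then show "s \<in> ?r" using x(2) D0[OF fx] \<pi>0 hom_closed[OF \<pi> fx] by simp
   qed
   show "?r \<subseteq> ?l"
   proof
    fix s assume s: "s \<in> ?r"
    then obtain x where x: "x \<in> carrier (vert (P 0) v)" "s = \<pi> 0 x" using \<pi>s by blast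
    then have "\<pi> 1 (d 0 x) = \<zero>\<^bsub>T 1\<^esub>" using s D0 by simp
    then have dx: "d 0 x \<in> path_sub (P 1) (rad v)" using \<pi>k[OF hom_closed[OF dv0 x(1)]] by simp
    obtain r where r: "r \<in> path_sub (P 0) (rad v)" "d 0 x = d 0 r"
     using path_sub_exact[where z = "d 0 x" and i = 0, OF cr v right_ideal_rad P.rad_end] dx cr_dd[OF cr vP[OF x(1)]] by auto
    have rP: "r \<in> carrier (P 0)" using P.path_sub_closed[OF P.rad_N r(1)] .
    have "d 0 (x \<ominus>\<^bsub>P 0\<^esub> r) = d 0 x \<ominus>\<^bsub>P 1\<^esub> d 0 r"
     using vP[OF x(1)] rP by (intro hom_diff[OF P P d0])
    then have "d 0 (x \<ominus>\<^bsub>P 0\<^esub> r) = \<zero>\<^bsub>P 1\<^esub>"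
     using r(2) hom_closed[OF d0 vP[OF x(1)]] by (simp add: P.M.M.minus_eq_zero_iff)
    then have "x \<ominus>\<^bsub>P 0\<^esub> r \<in> f ` carrier M" using vP[OF x(1)] rP im by simp
    then obtain m where m: "m \<in> carrier M" "x \<ominus>\<^bsub>P 0\<^esub> r = f m" by blast
    obtain m' where "m' \<in> carrier (vert M v)" "\<pi> 0 x = \<pi> 0 (f m')"
     using top_proj_lift[of M "P 0" v f x r m, OF M P v fh x(1) r(1) m] unfolding \<pi>_def by blast
    then show "s \<in> ?l" using x(2) F\<pi> M.top_proj_surj[OF v] by (metis image_eqI)
   qed
  qed
 qed
 then show ?thesis by (rule gorenstein_projectiveI[OF TM crT])
qed

text \<open>Deleting a shortest path p from J exhibits J M as an extension of the top at the start
  of p by the smaller module: p y + z goes to the class of y. Flatness makes this class independent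
  of the decomposition, and the kernel is the smaller module because p times the radical falls into
  it.\<close>

lemma gorenstein_projective_path_sub:
 assumes M: "left_module L M" and flat: "flat M"
  and top: "\<And>s. s \<in> verts Q \<Longrightarrow> gorenstein_projective A (top_module M s)"
  and v: "v \<in> verts Q" and J: "right_ideal J" "\<And>p. p \<in> J \<Longrightarrow> path_end Q p = v"
 shows "gorenstein_projective A ((vert M v)\<lparr>carrier := path_sub M J\<rparr>)"
proof -
 interpret M: monomial_module A L Q N \<iota> E co ht M by (rule module_locale) (rule M)
 have sub: "left_module A ((vert M v)\<lparr>carrier := path_sub M J\<rparr>)"
  if "right_ideal J" "\<And>p. p \<in> J \<Longrightarrow> path_end Q p = v" for J
  by (intro left_module_submod[OF M.left_module_vert[OF v]] M.submod_path_sub[OF v] that right_idealD(1))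
 have "finite J" using J(1) finite_N by (auto simp: right_ideal_def intro: finite_subset)
 then show ?thesis using J
 proof (induction J rule: finite_psubset_induct)
  case (psubset J)
  note JN = right_idealD(1)[OF psubset.prems(1)] and lJ = sub[OF psubset.prems]
  show ?case
  proof (cases "J = {}")
   case True
   have "path_sub M {} = {\<zero>\<^sub>M}" using M.path_sub_empty M.path_sub_zero by blast
   then show ?thesis using True lJ by (intro gorenstein_projective_zero) auto
  next
   case False
   define p where "p = (ARG_MIN (\<lambda>p. length (snd p)) p. p \<in> J)"
   have pJ: "p \<in> J" and min: "\<And>q. q \<in> J \<Longrightarrow> length (snd p) \<le> length (snd q)"
    using arg_min_nat_lemma[of "\<lambda>p. p \<in> J" _ "\<lambda>p. length (snd p)"] False unfolding p_def by auto
   note J' = right_ideal_remove[OF psubset.prems(1) pJ min]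
   note J'N = right_idealD(1)[OF J']
   have pN: "p \<in> N" using pJ JN by blast
   define s where "s = fst p"
   have s: "s \<in> verts Q" using N_verts(1)[OF pN] by (simp add: s_def)
   let ?J' = "J - {p}"
   have gJ': "gorenstein_projective A ((vert M v)\<lparr>carrier := path_sub M ?J'\<rparr>)"
    using psubset.IH[OF _ J'] pJ psubset.prems(2) by blast
   let ?E = "(vert M v)\<lparr>carrier := path_sub M J\<rparr>"
   note top_s = M.top_proj_hom[OF s]
   have Vs: "y \<in> carrier M \<and> E (s, []) \<odot>\<^sub>M y = y" if "y \<in> carrier (vert M s)" for y
    using that M.vert_iff[OF s] by simp
   interpret Vs: left_module A "vert M s" by (rule M.left_module_vert[OF s])
   define R where "R e t \<longleftrightarrow> (\<exists>y\<in>carrier (vert M s). \<exists>z\<in>path_sub M ?J'. e = E p \<odot>\<^sub>M y \<oplus>\<^sub>M z \<and> t = top_proj M s y)" for e t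
   have J'J: "path_sub M ?J' \<subseteq> path_sub M J" by (rule M.path_sub_mono) auto
   have zc: "z \<in> carrier M" if "z \<in> path_sub M ?J'" for z using M.path_sub_closed[OF J'N that] .
   \<comment> \<open>One equivalence covers both needs: well-definedness over zero, and the kernel
     of the resulting map.\<close>
   have key: "t = \<zero>\<^bsub>top_module M s\<^esub> \<longleftrightarrow> e \<in> path_sub M ?J'" if Ret: "R e t" for e t
   proof -
    obtain y z where yz: "y \<in> carrier (vert M s)" "z \<in> path_sub M ?J'" "e = E p \<odot>\<^sub>M y \<oplus>\<^sub>M z" "t = top_proj M s y"
     using Ret unfolding R_def by blast
    have t: "t = \<zero>\<^bsub>top_module M s\<^esub> \<longleftrightarrow> y \<in> path_sub M (rad s)" using M.top_proj_ker[OF s yz(1)] yz(4) by simp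
    have py: "E p \<odot>\<^sub>M y \<in> carrier M" using Vs[OF yz(1)] pN by simp
    show ?thesis
    proof
     assume "t = \<zero>\<^bsub>top_module M s\<^esub>"
     then have yr: "y \<in> path_sub M (rad s)" using t by simp
     have "E p \<odot>\<^sub>M y \<in> path_sub M ?J'"
     proof (rule M.path_sub_path[OF M.rad_N J'N pN yr])
      fix q assume q: "q \<in> rad s" "path_end Q q = fst p" "path_comp p q \<in> N"
      then have "path_comp p q \<in> J" using right_idealD(2)[OF psubset.prems(1) pJ] by blast
      moreover have "snd (path_comp p q) \<noteq> snd p" using q(1) by (simp add: rad_def)
      ultimately show "path_comp p q \<in> J - {p}" by (metis DiffI singletonD)
     qed
     then show "e \<in> path_sub M ?J'" using yz M.path_sub_plus[OF J'N] by simp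
    next
     assume "e \<in> path_sub M ?J'"
     then have "e \<ominus>\<^sub>M z \<in> path_sub M ?J'" using yz(2) M.path_sub_diff[OF J'N] by blast
     moreover have "e \<ominus>\<^sub>M z = E p \<odot>\<^sub>M y"
      using yz(3) py zc[OF yz(2)] by (simp add: a_minus_def M.M.M.a_assoc M.M.M.r_neg)
     ultimately have "E (fst p, []) \<odot>\<^sub>M y \<in> path_sub M (rad (fst p))"
      using M.flat_rad[OF flat pN J'] Vs[OF yz(1)] by simp
     then show "t = \<zero>\<^bsub>top_module M s\<^esub>" using t Vs[OF yz(1)] by (simp add: s_def)
    qed
   qed
   have "\<exists>h\<in>module_hom A ?E (top_module M s). \<forall>e t. R e t \<longleftrightarrow> e \<in> carrier ?E \<and> t = h e"
   proof (rule rel_hom[OF lJ M.left_module_top[OF s]])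
    show "e \<in> carrier ?E \<and> t \<in> carrier (top_module M s)" if "R e t" for e t
     using that hom_closed[OF top_s] Vs J'J unfolding R_def
     by (auto intro!: M.path_sub_plus[OF JN] M.path_sub_base[OF JN pJ])
    show "\<exists>t. R e t" if "e \<in> carrier ?E" for e
    proof -
     have "e \<in> path_sub M J" using \<open>e \<in> carrier ?E\<close> by simp
     then obtain y z where yz: "y \<in> carrier M" "z \<in> path_sub M ?J'" "e = E p \<odot>\<^sub>M y \<oplus>\<^sub>M z"
      using M.path_sub_split[OF JN pJ] by blast
     have "E (s, []) \<odot>\<^sub>M y \<in> carrier (vert M s)" using yz(1) by (simp add: carrier_vert)
     then show ?thesis unfolding R_def
      using yz M.E_smult_fst[OF pN yz(1)] unfolding s_def by metis
    qed
    show "R (e \<oplus>\<^bsub>?E\<^esub> e') (t \<oplus>\<^bsub>top_module M s\<^esub> t')" if "R e t" "R e' t'" for e e' t t'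
    proof -
     obtain y z y' z' where yz: "y \<in> carrier (vert M s)" "z \<in> path_sub M ?J'" "e = E p \<odot>\<^sub>M y \<oplus>\<^sub>M z" "t = top_proj M s y"
      "y' \<in> carrier (vert M s)" "z' \<in> path_sub M ?J'" "e' = E p \<odot>\<^sub>M y' \<oplus>\<^sub>M z'" "t' = top_proj M s y'"
      using \<open>R e t\<close> \<open>R e' t'\<close> unfolding R_def by blast
     have "e \<oplus>\<^sub>M e' = E p \<odot>\<^sub>M (y \<oplus>\<^sub>M y') \<oplus>\<^sub>M (z \<oplus>\<^sub>M z')"
      using yz Vs pN zc by (simp add: M.E_smult_add M.M.M.add.m_ac)
     then show ?thesis
      unfolding R_def using yz hom_add[OF top_s yz(1,5)] Vs.M.a_closed[OF yz(1,5)] M.path_sub_plus[OF J'N yz(2,6)]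
      by (intro bexI[of _ "y \<oplus>\<^sub>M y'"] bexI[of _ "z \<oplus>\<^sub>M z'"]) simp_all
    qed
    show "R (a \<odot>\<^bsub>?E\<^esub> e) (a \<odot>\<^bsub>top_module M s\<^esub> t)" if a: "a \<in> carrier A" and "R e t" for a e t
    proof -
     obtain y z where yz: "y \<in> carrier (vert M s)" "z \<in> path_sub M ?J'" "e = E p \<odot>\<^sub>M y \<oplus>\<^sub>M z" "t = top_proj M s y"
      using \<open>R e t\<close> unfolding R_def by blast
     have "\<iota> a \<odot>\<^sub>M e = E p \<odot>\<^sub>M (\<iota> a \<odot>\<^sub>M y) \<oplus>\<^sub>M \<iota> a \<odot>\<^sub>M z"
      using yz Vs pN zc a by (simp add: M.M.smult_r_distr M.\<iota>_E_smult)
     then show ?thesis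
      unfolding R_def using yz hom_smult[OF top_s a yz(1)] Vs.smult_closed[OF a yz(1)] M.path_sub_\<iota>[OF J'N yz(2) a]
      by (intro bexI[of _ "\<iota> a \<odot>\<^sub>M y"] bexI[of _ "\<iota> a \<odot>\<^sub>M z"]) simp_all
    qed
    show "t = \<zero>\<^bsub>top_module M s\<^esub>" if "R \<zero>\<^bsub>?E\<^esub> t" for t
     using key[OF that] M.path_sub_zero by simp
   qed
   then obtain h where h: "h \<in> module_hom A ?E (top_module M s)"
    and Rh: "\<And>e t. R e t \<longleftrightarrow> e \<in> carrier ?E \<and> t = h e" by blast
   show ?thesis
   proof (rule gorenstein_projective_extension[OF lJ gJ' top[OF s] _ _ h])
    show "(\<lambda>x. x) \<in> module_hom A ((vert M v)\<lparr>carrier := path_sub M ?J'\<rparr>) ?E"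
     using J'J by (intro module_homI) auto
    show "h e = \<zero>\<^bsub>top_module M s\<^esub> \<longleftrightarrow> e \<in> (\<lambda>x. x) ` carrier ((vert M v)\<lparr>carrier := path_sub M ?J'\<rparr>)"
     if "e \<in> carrier ?E" for e
     using key[of e "h e"] Rh that by simp
    show "inj_on (\<lambda>x. x) (carrier ((vert M v)\<lparr>carrier := path_sub M ?J'\<rparr>))" by (rule inj_onI)
    show "h ` carrier ?E = carrier (top_module M s)"
    proof
     show "h ` carrier ?E \<subseteq> carrier (top_module M s)" using hom_closed[OF h] by blast
     show "carrier (top_module M s) \<subseteq> h ` carrier ?E"
     proof
      fix t assume "t \<in> carrier (top_module M s)"
      then obtain y where y: "y \<in> carrier (vert M s)" "t = top_proj M s y" using M.top_proj_surj[OF s] by blast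
      have "R (E p \<odot>\<^sub>M y \<oplus>\<^sub>M \<zero>\<^sub>M) t" unfolding R_def using y M.path_sub_zero by blast
      then show "t \<in> h ` carrier ?E" using Rh by blast
     qed
    qed
   qed
  qed
 qed
qed

text \<open>For J the set of all nonzero paths ending at v, J M is the whole vertex space.\<close>

lemma gorenstein_projective_vert:
 assumes M: "left_module L M" and flat: "flat M"
  and top: "\<And>s. s \<in> verts Q \<Longrightarrow> gorenstein_projective A (top_module M s)"
  and v: "v \<in> verts Q"
 shows "gorenstein_projective A (vert M v)"
proof -
 interpret M: monomial_module A L Q N \<iota> E co ht M by (rule module_locale) (rule M)
 define J where "J = {p \<in> N. path_end Q p = v}"
 have J: "right_ideal J" by (auto simp: right_ideal_def J_def)
 have JN: "J \<subseteq> N" by (auto simp: J_def)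
 have "carrier (vert M v) \<subseteq> path_sub M J"
  using M.path_sub_base[OF JN, of "(v, [])"] N_trivial[OF v] by (auto simp: carrier_vert J_def)
 then have "path_sub M J = carrier (vert M v)"
  using M.path_sub_vert[OF JN v] by (auto simp: J_def)
 then show ?thesis
  using gorenstein_projective_path_sub[OF M flat top v J] by (auto simp: J_def)
qed

end

section \<open>Induced modules\<close>

lemma finsum_fmod:
 assumes "left_module R (fmod R H)" "\<And>v j. v \<in> H \<Longrightarrow> v j \<in> carrier R" "finite S" "\<And>i. i \<in> S \<Longrightarrow> f i \<in> H"
 shows "finsum (fmod R H) f S = (\<lambda>j. \<Oplus>\<^sub>R i\<in>S. f i j)"
proof -
 interpret left_module R "fmod R H" by fact
 show ?thesis using assms(3,4)
 proof (induction S rule: finite_induct)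
  case (insert x F)
  have "finsum (fmod R H) f (insert x F) = f x \<oplus>\<^bsub>fmod R H\<^esub> finsum (fmod R H) f F"
   using insert by (intro M.finsum_insert) auto
  also have "\<dots> = (\<lambda>j. \<Oplus>\<^sub>R i\<in>insert x F. f i j)"
   using insert assms(2) by auto
  finally show ?case .
 qed simp
qed

context monomial_algebra
begin

definition cov :: "('v, 'e) path \<Rightarrow> (nat \<Rightarrow> 'l) \<Rightarrow> nat \<Rightarrow> 'a" where
 "cov p W = (\<lambda>j. co p (W j))"

text \<open>\<open>induced w H\<close> is \<open>\<Lambda> e\<^sub>w \<otimes> H\<close>, realised by vectors with entries in \<open>\<Lambda> e\<^sub>w\<close>.\<close>

definition induced :: "'v \<Rightarrow> (nat \<Rightarrow> 'a) set \<Rightarrow> (nat \<Rightarrow> 'l) set" where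
 "induced w H = {W. (\<forall>j. W j \<in> carrier L) \<and> (\<forall>p\<in>N. cov p W \<in> (if fst p = w then H else {\<lambda>j. \<zero>\<^sub>A}))}"

text \<open>For an A-functional h on H this is 1 \<otimes> h, from \<Lambda> e_w \<otimes> H to
  \<Lambda>: h is applied to the coefficient vector at each path.\<close>

definition hat :: "((nat \<Rightarrow> 'a) \<Rightarrow> 'a) \<Rightarrow> (nat \<Rightarrow> 'l) \<Rightarrow> 'l" where
 "hat h W = (\<Oplus>\<^sub>L p\<in>N. \<iota> (h (cov p W)) \<otimes>\<^sub>L E p)"

definition induced_map :: "((nat \<Rightarrow> 'a) \<Rightarrow> (nat \<Rightarrow> 'a)) \<Rightarrow> (nat \<Rightarrow> 'l) \<Rightarrow> (nat \<Rightarrow> 'l)" where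
 "induced_map d W = (\<lambda>j. hat (\<lambda>v. d v j) W)"

text \<open>The element e_w \<otimes> v; this is the unit of the adjunction between induction and
  restriction.\<close>

definition delta :: "'v \<Rightarrow> (nat \<Rightarrow> 'a) \<Rightarrow> (nat \<Rightarrow> 'l)" where
 "delta w v = (\<lambda>j. \<iota> (v j) \<otimes>\<^sub>L E (w, []))"

end

locale induced_module = monomial_algebra A L Q N \<iota> E co ht
 for A :: "('a, 's) ring_scheme" and L :: "('l, 't) ring_scheme"
  and Q :: "('v, 'e) pre_digraph" and N :: "('v, 'e) path set"
  and \<iota> :: "'a \<Rightarrow> 'l" and E :: "('v, 'e) path \<Rightarrow> 'l" and co :: "('v, 'e) path \<Rightarrow> 'l \<Rightarrow> 'a"
  and ht :: "'v \<Rightarrow> nat" +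
 fixes w :: 'v and H :: "(nat \<Rightarrow> 'a) set"
 assumes w: "w \<in> verts Q" and H: "left_module A (fmod A H)" and HA: "\<And>v j. v \<in> H \<Longrightarrow> v j \<in> carrier A"
begin

lemma e: "(w, []) \<in> N" using N_trivial[OF w] .

lemma H_zero: "(\<lambda>j. \<zero>\<^sub>A) \<in> H"
 and H_add: "v \<in> H \<Longrightarrow> v' \<in> H \<Longrightarrow> (\<lambda>j. v j \<oplus>\<^sub>A v' j) \<in> H"
 and H_smult: "a \<in> carrier A \<Longrightarrow> v \<in> H \<Longrightarrow> (\<lambda>j. a \<otimes>\<^sub>A v j) \<in> H"
proof -
 interpret H: left_module A "fmod A H" by (rule H)
 show "(\<lambda>j. \<zero>\<^sub>A) \<in> H" using H.M.zero_closed by simp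
 show "v \<in> H \<Longrightarrow> v' \<in> H \<Longrightarrow> (\<lambda>j. v j \<oplus>\<^sub>A v' j) \<in> H" using H.M.a_closed[of v v'] by simp
 show "a \<in> carrier A \<Longrightarrow> v \<in> H \<Longrightarrow> (\<lambda>j. a \<otimes>\<^sub>A v j) \<in> H" using H.smult_closed[of a v] by simp
qed

lemma ind_L: "W \<in> induced w H \<Longrightarrow> W j \<in> carrier L"
 by (simp add: induced_def)

lemma ind_cov: "W \<in> induced w H \<Longrightarrow> p \<in> N \<Longrightarrow> cov p W \<in> H"
 using H_zero by (auto simp: induced_def split: if_splits)

lemma ind_cov0: "W \<in> induced w H \<Longrightarrow> p \<in> N \<Longrightarrow> fst p \<noteq> w \<Longrightarrow> cov p W = (\<lambda>j. \<zero>\<^sub>A)"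
 by (auto simp: induced_def)

lemma indI:
 assumes "\<And>j. W j \<in> carrier L" "\<And>p. p \<in> N \<Longrightarrow> fst p = w \<Longrightarrow> cov p W \<in> H"
  "\<And>p. p \<in> N \<Longrightarrow> fst p \<noteq> w \<Longrightarrow> cov p W = (\<lambda>j. \<zero>\<^sub>A)"
 shows "W \<in> induced w H"
 using assms by (auto simp: induced_def)

lemma cov_add: "p \<in> N \<Longrightarrow> (\<And>j. W j \<in> carrier L) \<Longrightarrow> (\<And>j. W' j \<in> carrier L) \<Longrightarrow>
  cov p (\<lambda>j. W j \<oplus>\<^sub>L W' j) = (\<lambda>j. cov p W j \<oplus>\<^sub>A cov p W' j)"
 by (simp add: cov_def co_add)

lemma cov_\<iota>: "p \<in> N \<Longrightarrow> a \<in> carrier A \<Longrightarrow> (\<And>j. W j \<in> carrier L) \<Longrightarrow>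
  cov p (\<lambda>j. \<iota> a \<otimes>\<^sub>L W j) = (\<lambda>j. a \<otimes>\<^sub>A cov p W j)"
 by (simp add: cov_def co_\<iota>)

lemma cov_E:
 assumes "r \<in> N" "p \<in> N" "\<And>j. W j \<in> carrier L"
 shows "(\<exists>q\<in>N. path_end Q q = fst p \<and> r = path_comp p q \<and> cov r (\<lambda>j. E p \<otimes>\<^sub>L W j) = cov q W) \<or>
  ((\<forall>q. path_end Q q = fst p \<longrightarrow> r \<noteq> path_comp p q) \<and> cov r (\<lambda>j. E p \<otimes>\<^sub>L W j) = (\<lambda>j. \<zero>\<^sub>A))"
proof (cases "\<exists>q. path_end Q q = fst p \<and> r = path_comp p q")
 case True
 then obtain q where q: "path_end Q q = fst p" "r = path_comp p q" by blast
 then have "q \<in> N" using N_comp(2)[of p q] assms(1) by simp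
 moreover have "cov r (\<lambda>j. E p \<otimes>\<^sub>L W j) = cov q W"
  using co_left[OF q(1)] q assms by (simp add: cov_def)
 ultimately show ?thesis using q by blast
next
 case False
 then have "cov r (\<lambda>j. E p \<otimes>\<^sub>L W j) = (\<lambda>j. \<zero>\<^sub>A)"
  using co_left_0[OF assms(1,2) _ assms(3)] unfolding cov_def by blast
 then show ?thesis using False by blast
qed

lemma ind_zero: "(\<lambda>j. \<zero>\<^sub>L) \<in> induced w H"
 using H_zero by (auto simp: induced_def cov_def)

lemma ind_add: "W \<in> induced w H \<Longrightarrow> W' \<in> induced w H \<Longrightarrow> (\<lambda>j. W j \<oplus>\<^sub>L W' j) \<in> induced w H"
 by (rule indI) (auto simp: ind_L cov_add ind_cov ind_cov0 H_add)

lemma ind_\<iota>: "a \<in> carrier A \<Longrightarrow> W \<in> induced w H \<Longrightarrow> (\<lambda>j. \<iota> a \<otimes>\<^sub>L W j) \<in> induced w H"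
 by (rule indI) (auto simp: ind_L cov_\<iota> ind_cov ind_cov0 H_smult)

lemma ind_E:
 assumes "p \<in> N" "W \<in> induced w H" shows "(\<lambda>j. E p \<otimes>\<^sub>L W j) \<in> induced w H"
proof (rule indI)
 show "E p \<otimes>\<^sub>L W j \<in> carrier L" for j using assms by (simp add: ind_L E_closed)
 fix r assume r: "r \<in> N"
 note c = cov_E[where W = W, OF r assms(1) ind_L[OF assms(2)]]
 show "cov r (\<lambda>j. E p \<otimes>\<^sub>L W j) \<in> H" using c ind_cov[OF assms(2)] H_zero by metis
 show "cov r (\<lambda>j. E p \<otimes>\<^sub>L W j) = (\<lambda>j. \<zero>\<^sub>A)" if "fst r \<noteq> w"
  using c ind_cov0[OF assms(2)] that by (metis path_comp_simps(1))
qed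

lemma ind_smult:
 assumes "l \<in> carrier L" "W \<in> induced w H" shows "(\<lambda>j. l \<otimes>\<^sub>L W j) \<in> induced w H"
 using assms(1)
proof (induction l rule: L_ind)
 case zero then show ?case using ind_zero assms by (simp add: ind_L)
next
 case (add a p m)
 have "(\<lambda>j. (\<iota> a \<otimes>\<^sub>L E p \<oplus>\<^sub>L m) \<otimes>\<^sub>L W j) = (\<lambda>j. (\<iota> a \<otimes>\<^sub>L (E p \<otimes>\<^sub>L W j)) \<oplus>\<^sub>L m \<otimes>\<^sub>L W j)"
  using add assms by (simp add: L.l_distr E_closed ind_L L.m_assoc)
 then show ?case using ind_add[OF ind_\<iota>[OF add(1) ind_E[OF add(2) assms(2)]] add.IH] by simp
qed

lemma left_module_induced: "left_module L (fmod L (induced w H))"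
 by (rule left_module_fmod) (auto simp: L.ring_axioms ind_L ind_zero ind_add ind_smult)

lemma ind_ext: "W \<in> induced w H \<Longrightarrow> W' \<in> induced w H' \<Longrightarrow> (\<And>j. W' j \<in> carrier L) \<Longrightarrow>
  (\<And>p. p \<in> N \<Longrightarrow> cov p W = cov p W') \<Longrightarrow> W = W'"
 by (rule ext, rule co_ext) (auto simp: ind_L cov_def dest: fun_cong)

context
 fixes h assumes h: "h \<in> dual A (fmod A H)"
begin

lemma h_closed: "v \<in> H \<Longrightarrow> h v \<in> carrier A"
 using hom_closed[OF h] by simp

lemma h_zero: "h (\<lambda>j. \<zero>\<^sub>A) = \<zero>\<^sub>A"
 using hom_zero[OF H left_module_regular[OF A.ring_axioms] h] by simp

lemma hat_closed: "W \<in> induced w H \<Longrightarrow> hat h W \<in> carrier L"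
 unfolding hat_def by (rule finsum_\<iota>E_closed) (auto simp: h_closed ind_cov)

lemma co_hat: "W \<in> induced w H \<Longrightarrow> p \<in> N \<Longrightarrow> co p (hat h W) = h (cov p W)"
 unfolding hat_def by (rule co_finsum_\<iota>E) (auto simp: h_closed ind_cov)

lemma hat_add:
 assumes "W \<in> induced w H" "W' \<in> induced w H"
 shows "hat h (\<lambda>j. W j \<oplus>\<^sub>L W' j) = hat h W \<oplus>\<^sub>L hat h W'"
proof (rule co_ext)
 fix p assume p: "p \<in> N"
 have "h (\<lambda>j. cov p W j \<oplus>\<^sub>A cov p W' j) = h (cov p W) \<oplus>\<^sub>A h (cov p W')"
  using hom_add[OF h, of "cov p W" "cov p W'"] assms ind_cov p by simp
 then show "co p (hat h (\<lambda>j. W j \<oplus>\<^sub>L W' j)) = co p (hat h W \<oplus>\<^sub>L hat h W')"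
  using assms p by (simp add: co_hat ind_add cov_add ind_L co_add hat_closed)
qed (use assms in \<open>auto simp: hat_closed ind_add\<close>)

lemma hat_\<iota>:
 assumes "W \<in> induced w H" "a \<in> carrier A"
 shows "hat h (\<lambda>j. \<iota> a \<otimes>\<^sub>L W j) = \<iota> a \<otimes>\<^sub>L hat h W"
proof (rule co_ext)
 fix p assume p: "p \<in> N"
 have "h (\<lambda>j. a \<otimes>\<^sub>A cov p W j) = a \<otimes>\<^sub>A h (cov p W)"
  using hom_smult[OF h, of a "cov p W"] assms ind_cov p by simp
 then show "co p (hat h (\<lambda>j. \<iota> a \<otimes>\<^sub>L W j)) = co p (\<iota> a \<otimes>\<^sub>L hat h W)"
  using assms p by (simp add: co_hat ind_\<iota> cov_\<iota> ind_L co_\<iota> hat_closed)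
qed (use assms in \<open>auto simp: hat_closed ind_\<iota>\<close>)

lemma hat_E:
 assumes "W \<in> induced w H" "p \<in> N"
 shows "hat h (\<lambda>j. E p \<otimes>\<^sub>L W j) = E p \<otimes>\<^sub>L hat h W"
proof (rule co_ext)
 fix r assume r: "r \<in> N"
 from cov_E[where W = W, OF r assms(2) ind_L[OF assms(1)]]
 show "co r (hat h (\<lambda>j. E p \<otimes>\<^sub>L W j)) = co r (E p \<otimes>\<^sub>L hat h W)"
 proof (elim disjE bexE conjE)
  fix q assume "q \<in> N" "path_end Q q = fst p" "r = path_comp p q" "cov r (\<lambda>j. E p \<otimes>\<^sub>L W j) = cov q W"
  then show ?thesis using co_left[of q p "hat h W"] r assms by (simp add: co_hat ind_E hat_closed)
 next
  assume "\<forall>q. path_end Q q = fst p \<longrightarrow> r \<noteq> path_comp p q" "cov r (\<lambda>j. E p \<otimes>\<^sub>L W j) = (\<lambda>j. \<zero>\<^sub>A)"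
  moreover from this have "co r (E p \<otimes>\<^sub>L hat h W) = \<zero>\<^sub>A"
   by (intro co_left_0[OF r assms(2) _ hat_closed[OF assms(1)]]) blast
  ultimately show ?thesis using r assms by (simp add: co_hat ind_E h_zero)
 qed
qed (use assms in \<open>auto simp: hat_closed ind_E E_closed\<close>)

lemma hat_smult:
 assumes "W \<in> induced w H" "l \<in> carrier L"
 shows "hat h (\<lambda>j. l \<otimes>\<^sub>L W j) = l \<otimes>\<^sub>L hat h W"
 using assms(2)
proof (induction l rule: L_ind)
 case zero
 have "hat h (\<lambda>j. \<zero>\<^sub>L) = \<zero>\<^sub>L"
  by (rule co_ext) (use ind_zero in \<open>auto simp: hat_closed co_hat cov_def h_zero\<close>)
 then show ?case using assms by (simp add: ind_L hat_closed)
next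
 case (add a p m)
 have "(\<lambda>j. (\<iota> a \<otimes>\<^sub>L E p \<oplus>\<^sub>L m) \<otimes>\<^sub>L W j) = (\<lambda>j. (\<iota> a \<otimes>\<^sub>L (E p \<otimes>\<^sub>L W j)) \<oplus>\<^sub>L m \<otimes>\<^sub>L W j)"
  using add assms by (simp add: L.l_distr E_closed ind_L L.m_assoc)
 moreover have "hat h (\<lambda>j. (\<iota> a \<otimes>\<^sub>L (E p \<otimes>\<^sub>L W j)) \<oplus>\<^sub>L m \<otimes>\<^sub>L W j)
   = hat h (\<lambda>j. \<iota> a \<otimes>\<^sub>L (E p \<otimes>\<^sub>L W j)) \<oplus>\<^sub>L hat h (\<lambda>j. m \<otimes>\<^sub>L W j)"
  by (rule hat_add[OF ind_\<iota>[OF add(1) ind_E[OF add(2) assms(1)]] ind_smult[OF add(3) assms(1)]])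
 ultimately show ?case
  using add assms by (simp add: hat_\<iota>[OF ind_E[OF add(2) assms(1)] add(1)] hat_E L.l_distr E_closed hat_closed L.m_assoc)
qed

lemma hat_hom: "hat h \<in> dual L (fmod L (induced w H))"
 by (rule module_homI) (auto simp: hat_closed hat_add hat_smult)

end

lemma delta_L: "v \<in> H \<Longrightarrow> delta w v j \<in> carrier L"
 by (simp add: delta_def E_closed e HA)

lemma cov_delta: "v \<in> H \<Longrightarrow> p \<in> N \<Longrightarrow> cov p (delta w v) = (if p = (w, []) then v else (\<lambda>j. \<zero>\<^sub>A))"
 by (auto simp: cov_def delta_def co_\<iota>E e HA)

lemma delta_ind: "v \<in> H \<Longrightarrow> delta w v \<in> induced w H"
 by (rule indI) (auto simp: delta_L cov_delta H_zero)

text \<open>A dual basis of H induces one: functionals become \<open>hat\<close>, generators become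
  \<open>delta\<close>. At paths not starting at w both sides of the expansion have coordinate
  zero.\<close>

lemma fgp_induced:
 assumes "fgp A (fmod A H)" shows "fgp L (fmod L (induced w H))"
proof -
 from assms obtain n :: nat and x c where x: "\<And>i. i < n \<Longrightarrow> x i \<in> carrier (fmod A H)"
  and c: "\<And>i. i < n \<Longrightarrow> c i \<in> dual A (fmod A H)"
  and sum: "\<And>y. y \<in> carrier (fmod A H) \<Longrightarrow> y = (\<Oplus>\<^bsub>fmod A H\<^esub>i\<in>{..<n}. c i y \<odot>\<^bsub>fmod A H\<^esub> x i)" by (rule fgpE) blast
 have x': "x i \<in> H" if "i < n" for i using x[OF that] by simp
 show ?thesis
 proof (rule fgpI[OF left_module_induced, of n "\<lambda>i. delta w (x i)" "\<lambda>i. hat (c i)"])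
  show "delta w (x i) \<in> carrier (fmod L (induced w H))" if "i < n" for i using delta_ind[OF x'[OF that]] by simp
  show "hat (c i) \<in> dual L (fmod L (induced w H))" if "i < n" for i
   by (rule hat_hom[OF c[OF that]])
  fix W assume "W \<in> carrier (fmod L (induced w H))"
  then have W: "W \<in> induced w H" by simp
  note cc = h_closed[OF c ind_cov[OF W]]
  note hc = hat_closed[OF c W]
  let ?g = "\<lambda>i. hat (c i) W \<odot>\<^bsub>fmod L (induced w H)\<^esub> delta w (x i)"
  have g: "?g i \<in> induced w H" if "i < n" for i using ind_smult[OF hc[OF that] delta_ind[OF x'[OF that]]] by simp
  have "(\<Oplus>\<^bsub>fmod L (induced w H)\<^esub>i\<in>{..<n}. ?g i) = (\<lambda>j. \<Oplus>\<^sub>L i\<in>{..<n}. ?g i j)"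
   using g by (intro finsum_fmod[OF left_module_induced]) (auto simp: ind_L)
  moreover have "W = (\<lambda>j. \<Oplus>\<^sub>L i\<in>{..<n}. ?g i j)"
  proof (rule ext, rule co_ext)
   fix j show "W j \<in> carrier L" using ind_L[OF W] .
   show "(\<Oplus>\<^sub>L i\<in>{..<n}. ?g i j) \<in> carrier L" using ind_L[OF g] by (intro L.finsum_closed) auto
   fix p assume p: "p \<in> N"
   have "co p (\<Oplus>\<^sub>L i\<in>{..<n}. ?g i j) = (\<Oplus>\<^sub>A i\<in>{..<n}. co p (?g i j))"
    using p ind_L[OF g] by (intro co_finsum) auto
   also have "\<dots> = (\<Oplus>\<^sub>A i\<in>{..<n}. c i (cov p W) \<otimes>\<^sub>A x i j)"
   proof (rule A.finsum_cong')
    show "(\<lambda>i. c i (cov p W) \<otimes>\<^sub>A x i j) \<in> {..<n} \<rightarrow> carrier A" using cc x' HA p by auto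
    fix i assume i: "i \<in> {..<n}"
    have xL: "\<iota> (x i j) \<in> carrier L" and xA: "x i j \<in> carrier A" using x' HA i by auto
    show "co p (?g i j) = c i (cov p W) \<otimes>\<^sub>A x i j"
    proof (cases "fst p = w")
     case True
     have "co p (hat (c i) W \<otimes>\<^sub>L \<iota> (x i j) \<otimes>\<^sub>L E (w, [])) = co p (hat (c i) W \<otimes>\<^sub>L \<iota> (x i j))"
      using co_right[of "(w, [])" p "hat (c i) W \<otimes>\<^sub>L \<iota> (x i j)"] True p hc i xL by auto
     then show ?thesis using p i hc xL xA e
      by (simp add: delta_def L.m_assoc E_closed co_\<iota>_right co_hat[OF c W])
    next
     case False
     have "co p (hat (c i) W \<otimes>\<^sub>L \<iota> (x i j) \<otimes>\<^sub>L E (w, [])) = \<zero>\<^sub>A"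
      using p i hc xL e False by (intro co_right_0) auto
     moreover have "c i (cov p W) = \<zero>\<^sub>A" using ind_cov0[OF W p False] h_zero[OF c] i by simp
     ultimately show ?thesis using p i hc xL xA e by (simp add: delta_def L.m_assoc E_closed)
    qed
   qed simp
   also have "\<dots> = cov p W j"
   proof -
    have "cov p W = (\<Oplus>\<^bsub>fmod A H\<^esub>i\<in>{..<n}. c i (cov p W) \<odot>\<^bsub>fmod A H\<^esub> x i)" using sum ind_cov[OF W p] by simp
    also have "\<dots> = (\<lambda>j. \<Oplus>\<^sub>A i\<in>{..<n}. (c i (cov p W) \<odot>\<^bsub>fmod A H\<^esub> x i) j)"
     using cc p x' H_smult by (intro finsum_fmod[OF H]) (auto simp: HA)
    finally have "cov p W = (\<lambda>j. \<Oplus>\<^sub>A i\<in>{..<n}. c i (cov p W) \<otimes>\<^sub>A x i j)" by simp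
    from fun_cong[OF this, of j] show ?thesis by simp
   qed
   finally show "co p (W j) = co p (\<Oplus>\<^sub>L i\<in>{..<n}. ?g i j)" by (simp add: cov_def)
  qed
  ultimately show "W = (\<Oplus>\<^bsub>fmod L (induced w H)\<^esub>i\<in>{..<n}. ?g i)" by simp
 qed
qed

lemma induced_generators:
 assumes W: "W \<in> induced w H"
 shows "W = (\<Oplus>\<^bsub>fmod L (induced w H)\<^esub>p\<in>N. E p \<odot>\<^bsub>fmod L (induced w H)\<^esub> delta w (cov p W))"
proof -
 let ?g = "\<lambda>p. E p \<odot>\<^bsub>fmod L (induced w H)\<^esub> delta w (cov p W)"
 have g: "?g p \<in> induced w H" if "p \<in> N" for p
  using ind_E[OF that delta_ind[OF ind_cov[OF W that]]] by simp
 have "(\<Oplus>\<^bsub>fmod L (induced w H)\<^esub>p\<in>N. ?g p) = (\<lambda>j. \<Oplus>\<^sub>L p\<in>N. ?g p j)"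
  using g by (intro finsum_fmod[OF left_module_induced]) (auto simp: ind_L finite_N)
 moreover have "W j = (\<Oplus>\<^sub>L p\<in>N. ?g p j)" for j
 proof -
  have "W j = (\<Oplus>\<^sub>L p\<in>N. \<iota> (co p (W j)) \<otimes>\<^sub>L E p)" by (rule expansion[OF ind_L[OF W]])
  also have "\<dots> = (\<Oplus>\<^sub>L p\<in>N. ?g p j)"
  proof (rule L.finsum_cong')
   show "(\<lambda>p. ?g p j) \<in> N \<rightarrow> carrier L" using ind_L[OF g] by auto
   fix p assume p: "p \<in> N"
   note a = co_closed[OF p ind_L[OF W]]
   have gp: "?g p j = \<iota> (co p (W j)) \<otimes>\<^sub>L (E p \<otimes>\<^sub>L E (w, []))"
    using p e a by (simp add: delta_def cov_def E_closed L.m_assoc[symmetric] \<iota>_E)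
   show "\<iota> (co p (W j)) \<otimes>\<^sub>L E p = ?g p j"
   proof (cases "fst p = w")
    case True
    then show ?thesis using gp E_fst[OF p] by simp
   next
    case False
    then have "co p (W j) = \<zero>\<^sub>A" using fun_cong[OF ind_cov0[OF W p False], of j] by (simp add: cov_def)
    then show ?thesis using gp p e by (simp add: E_closed)
   qed
  qed simp
  finally show ?thesis .
 qed
 ultimately show ?thesis by auto
qed

text \<open>The elements e_w \<otimes> v generate, because W is the sum over all nonzero paths p of
  p times \<open>delta\<close> of its coefficient vector at p.\<close>

lemma induced_hom_eq:
 assumes Y: "left_module L Y" and f: "f \<in> module_hom L (fmod L (induced w H)) Y"
  and g: "g \<in> module_hom L (fmod L (induced w H)) Y"
  and eq: "\<And>v. v \<in> H \<Longrightarrow> f (delta w v) = g (delta w v)" and W: "W \<in> induced w H"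
 shows "f W = g W"
proof -
 let ?I = "fmod L (induced w H)"
 interpret Y: left_module L Y by (rule Y)
 have dc: "delta w (cov p W) \<in> carrier ?I" if "p \<in> N" for p using delta_ind[OF ind_cov[OF W that]] by simp
 have cc: "E p \<odot>\<^bsub>?I\<^esub> delta w (cov p W) \<in> carrier ?I" if "p \<in> N" for p
  using ind_E[OF that delta_ind[OF ind_cov[OF W that]]] by simp
 have *: "f' W = (\<Oplus>\<^sub>Y p\<in>N. E p \<odot>\<^sub>Y f' (delta w (cov p W)))" if f': "f' \<in> module_hom L ?I Y" for f'
 proof -
  have "f' W = f' (\<Oplus>\<^bsub>?I\<^esub>p\<in>N. E p \<odot>\<^bsub>?I\<^esub> delta w (cov p W))" using induced_generators[OF W] by simp
  also have "\<dots> = (\<Oplus>\<^sub>Y p\<in>N. f' (E p \<odot>\<^bsub>?I\<^esub> delta w (cov p W)))"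
   using cc by (intro hom_finsum[OF left_module_induced Y f' finite_N]) auto
  also have "\<dots> = (\<Oplus>\<^sub>Y p\<in>N. E p \<odot>\<^sub>Y f' (delta w (cov p W)))"
  proof (rule Y.M.finsum_cong')
   show "(\<lambda>p. E p \<odot>\<^sub>Y f' (delta w (cov p W))) \<in> N \<rightarrow> carrier Y"
    by (intro Pi_I Y.smult_closed E_closed hom_closed[OF f' dc])
   show "f' (E p \<odot>\<^bsub>?I\<^esub> delta w (cov p W)) = E p \<odot>\<^sub>Y f' (delta w (cov p W))" if "p \<in> N" for p
    by (rule hom_smult[OF f' E_closed[OF that] dc[OF that]])
  qed simp
  finally show ?thesis .
 qed
 have "(\<Oplus>\<^sub>Y p\<in>N. E p \<odot>\<^sub>Y f (delta w (cov p W))) = (\<Oplus>\<^sub>Y p\<in>N. E p \<odot>\<^sub>Y g (delta w (cov p W)))"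
  using hom_closed[OF g dc] by (intro Y.M.finsum_cong') (auto simp: eq ind_cov[OF W] E_closed)
 then show ?thesis using *[OF f] *[OF g] by simp
qed

end

section \<open>Induced complete resolutions\<close>

context monomial_algebra
begin

text \<open>Over A the induced complex is a sum of copies of the given one, indexed by the nonzero
  paths starting at w, so exactness is checked on each coefficient vector. A \<Lambda>-functional is
  determined by its values on e_w \<otimes> v, and their coordinates at the finitely many paths are
  A-functionals on \<open>H (i + 1)\<close>. Each of these extends by dual exactness over A.\<close>

lemma induced_resolution:
 assumes cr: "complete_resolution A (\<lambda>i. fmod A (H i)) d" and HA: "\<And>i v j. v \<in> H i \<Longrightarrow> v j \<in> carrier A"
  and w: "w \<in> verts Q"
 shows "complete_resolution L (\<lambda>i. fmod L (induced w (H i))) (\<lambda>i. induced_map (d i))"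
proof -
 note lm = cr_left_module[OF cr]
 have I: "induced_module A L Q N \<iota> E co ht w (H i)" for i
  by (intro induced_module.intro induced_module_axioms.intro monomial_algebra_axioms w lm HA)
 interpret I: induced_module A L Q N \<iota> E co ht w "H i" for i by (rule I)
 note dh = cr_hom[OF cr]
 have dH: "d i v \<in> H (i + 1)" if "v \<in> H i" for i v using hom_closed[OF dh, of v i] that by simp
 have comp: "(\<lambda>v. d i v j) \<in> dual A (fmod A (H i))" for i j
 proof (rule module_homI)
  show "d i x j \<in> carrier (regular_module A)" if "x \<in> carrier (fmod A (H i))" for x
   using HA[OF dH, of x i j] that by simp
  show "d i (x \<oplus>\<^bsub>fmod A (H i)\<^esub> y) j = d i x j \<oplus>\<^bsub>regular_module A\<^esub> d i y j"
   if "x \<in> carrier (fmod A (H i))" "y \<in> carrier (fmod A (H i))" for x y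
   using hom_add[OF dh that] by simp
  show "d i (r \<odot>\<^bsub>fmod A (H i)\<^esub> x) j = r \<odot>\<^bsub>regular_module A\<^esub> d i x j"
   if "r \<in> carrier A" "x \<in> carrier (fmod A (H i))" for r x
   using hom_smult[OF dh that] by simp
 qed
 define D where "D i = induced_map (d i)" for i
 have DL: "D i W j \<in> carrier L" if "W \<in> induced w (H i)" for i W j
  unfolding D_def induced_map_def by (rule I.hat_closed[OF comp that])
 have Dcov: "cov p (D i W) = d i (cov p W)" if "W \<in> induced w (H i)" "p \<in> N" for i W p
  unfolding D_def induced_map_def cov_def[of p "\<lambda>j. hat (\<lambda>v. d i v j) W"] by (simp add: I.co_hat[OF comp that])
 have d0: "d i (\<lambda>j. \<zero>\<^sub>A) = (\<lambda>j. \<zero>\<^sub>A)" for i using hom_zero[OF lm lm dh, of i] by simp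
 have DI: "D i W \<in> induced w (H (i + 1))" if W: "W \<in> induced w (H i)" for i W
  using I.ind_cov[OF W] I.ind_cov0[OF W] by (intro I.indI) (auto simp: DL[OF W] Dcov[OF W] dH d0)
 have DI2: "D (i + 1) W \<in> induced w (H (i + 2))" if W: "W \<in> induced w (H (i + 1))" for i W
  using DI[OF W] by (simp add: add.assoc)
 have zcov: "cov p (\<lambda>j. \<zero>\<^sub>L) = (\<lambda>j. \<zero>\<^sub>A)" if "p \<in> N" for p using that by (simp add: cov_def)
 have Ddelta: "delta w (d i v) = D i (delta w v)" if v: "v \<in> H i" for i v
 proof (rule I.ind_ext[OF I.delta_ind[OF dH[OF v]] DI[OF I.delta_ind[OF v]]])
  show "D i (delta w v) j \<in> carrier L" for j by (rule DL[OF I.delta_ind[OF v]])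
  show "cov p (delta w (d i v)) = cov p (D i (delta w v))" if p: "p \<in> N" for p
   using I.cov_delta[OF dH[OF v] p] I.cov_delta[OF v p] Dcov[OF I.delta_ind[OF v] p] d0 by simp
 qed
 have "complete_resolution L (\<lambda>i. fmod L (induced w (H i))) D"
 proof (rule complete_resolutionI)
  show "fgp L (fmod L (induced w (H i)))" for i by (rule I.fgp_induced[OF cr_fgp[OF cr]])
  show Dh: "D i \<in> module_hom L (fmod L (induced w (H i))) (fmod L (induced w (H (i + 1))))" for i
  proof (rule module_homI)
   show "D i W \<in> carrier (fmod L (induced w (H (i + 1))))" if "W \<in> carrier (fmod L (induced w (H i)))" for W
    using DI that by simp
   show "D i (W \<oplus>\<^bsub>fmod L (induced w (H i))\<^esub> W') = D i W \<oplus>\<^bsub>fmod L (induced w (H (i + 1)))\<^esub> D i W'"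
    if "W \<in> carrier (fmod L (induced w (H i)))" "W' \<in> carrier (fmod L (induced w (H i)))" for W W'
    using that I.hat_add[OF comp] by (simp add: D_def induced_map_def)
   show "D i (l \<odot>\<^bsub>fmod L (induced w (H i))\<^esub> W) = l \<odot>\<^bsub>fmod L (induced w (H (i + 1)))\<^esub> D i W"
    if "l \<in> carrier L" "W \<in> carrier (fmod L (induced w (H i)))" for l W
    using that I.hat_smult[OF comp] by (simp add: D_def induced_map_def)
  qed
  fix i
  show "D (i + 1) (D i W) = \<zero>\<^bsub>fmod L (induced w (H (i + 2)))\<^esub>" if "W \<in> carrier (fmod L (induced w (H i)))" for W
  proof -
   have W: "W \<in> induced w (H i)" using that by simp
   have "D (i + 1) (D i W) = (\<lambda>j. \<zero>\<^sub>L)"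
   proof (rule I.ind_ext[OF DI2[OF DI[OF W]] I.ind_zero])
    show "cov p (D (i + 1) (D i W)) = cov p (\<lambda>j. \<zero>\<^sub>L)" if p: "p \<in> N" for p
     using Dcov[OF DI[OF W] p] Dcov[OF W p] cr_dd[OF cr, of "cov p W" i] I.ind_cov[OF W p] zcov[OF p] by simp
   qed simp
   then show ?thesis by simp
  qed
  show "\<exists>U\<in>carrier (fmod L (induced w (H i))). W = D i U"
   if "W \<in> carrier (fmod L (induced w (H (i + 1))))" "D (i + 1) W = \<zero>\<^bsub>fmod L (induced w (H (i + 2)))\<^esub>" for W
  proof -
   have W: "W \<in> induced w (H (i + 1))" and z: "D (i + 1) W = (\<lambda>j. \<zero>\<^sub>L)" using that by simp_all
   have "\<exists>u\<in>H i. cov p W = d i u" if p: "p \<in> N" for p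
   proof -
    have "d (i + 1) (cov p W) = (\<lambda>j. \<zero>\<^sub>A)" using Dcov[OF W p] z zcov[OF p] by simp
    then show ?thesis using cr_exact[OF cr, of "cov p W" i] I.ind_cov[OF W p] by simp
   qed
   then obtain u' where u': "\<And>p. p \<in> N \<Longrightarrow> u' p \<in> H i" "\<And>p. p \<in> N \<Longrightarrow> cov p W = d i (u' p)" by metis
   \<comment> \<open>The chosen preimage of a zero vector may be nonzero; at paths not starting at w
     it is replaced by zero, so that U belongs to the induced module.\<close>
   define u where "u p = (if fst p = w then u' p else (\<lambda>j. \<zero>\<^sub>A))" for p
   have u: "u p \<in> H i" "cov p W = d i (u p)" if "p \<in> N" for p
    using that u' I.H_zero I.ind_cov0[OF W that] d0 by (auto simp: u_def)
   define U where "U j = (\<Oplus>\<^sub>L p\<in>N. \<iota> (u p j) \<otimes>\<^sub>L E p)" for j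
   have uA: "(\<lambda>p. u p j) \<in> N \<rightarrow> carrier A" for j by (intro Pi_I HA[OF u(1)])
   have Ucov: "cov p U = u p" if "p \<in> N" for p
    using co_finsum_\<iota>E[OF uA that] by (auto simp: cov_def U_def)
   have U: "U \<in> induced w (H i)"
   proof (rule I.indI)
    show "U j \<in> carrier L" for j unfolding U_def by (rule finsum_\<iota>E_closed[OF uA])
    fix p assume p: "p \<in> N"
    show "cov p U \<in> H i" using Ucov[OF p] u(1)[OF p] by simp
    show "cov p U = (\<lambda>j. \<zero>\<^sub>A)" if "fst p \<noteq> w" using Ucov[OF p] that by (simp add: u_def)
   qed
   have "W = D i U"
   proof (rule I.ind_ext[OF W DI[OF U]])
    show "D i U j \<in> carrier L" for j by (rule DL[OF U])
    show "cov p W = cov p (D i U)" if p: "p \<in> N" for p using Dcov[OF U p] Ucov[OF p] u(2)[OF p] by simp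
   qed
   then show ?thesis using U by auto
  qed
  show "\<exists>G\<in>module_hom L (fmod L (induced w (H (i + 2)))) (regular_module L).
    \<forall>W\<in>carrier (fmod L (induced w (H (i + 1)))). \<Phi> W = G (D (i + 1) W)"
   if \<Phi>: "\<Phi> \<in> module_hom L (fmod L (induced w (H (i + 1)))) (regular_module L)"
    and \<Phi>D: "\<And>W. W \<in> carrier (fmod L (induced w (H i))) \<Longrightarrow> \<Phi> (D i W) = \<zero>\<^sub>L" for \<Phi>
  proof -
   note regL = left_module_regular[OF L.ring_axioms]
   have \<Phi>c: "\<Phi> W \<in> carrier L" if "W \<in> induced w (H (i + 1))" for W using hom_closed[OF \<Phi>] that by simp
   define \<phi> where "\<phi> r v = co r (\<Phi> (delta w v))" for r v
   have del_add: "delta w (\<lambda>j. v j \<oplus>\<^sub>A v' j) = delta w v \<oplus>\<^bsub>fmod L (induced w (H (i + 1)))\<^esub> delta w v'"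
    if "v \<in> H (i + 1)" "v' \<in> H (i + 1)" for v v'
    using that HA I.e by (auto simp: delta_def \<iota>_add L.l_distr E_closed)
   have del_smult: "delta w (\<lambda>j. a \<otimes>\<^sub>A v j) = \<iota> a \<odot>\<^bsub>fmod L (induced w (H (i + 1)))\<^esub> delta w v"
    if "v \<in> H (i + 1)" "a \<in> carrier A" for v a
    using that HA I.e by (auto simp: delta_def \<iota>_mult L.m_assoc E_closed)
   have \<phi>: "\<phi> r \<in> dual A (fmod A (H (i + 1)))" if r: "r \<in> N" for r
   proof (rule module_homI)
    fix v assume v: "v \<in> carrier (fmod A (H (i + 1)))"
    then have dv: "delta w v \<in> induced w (H (i + 1))" by (simp add: I.delta_ind)
    then show "\<phi> r v \<in> carrier (regular_module A)" using co_closed[OF r \<Phi>c] by (simp add: \<phi>_def)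
    show "\<phi> r (a \<odot>\<^bsub>fmod A (H (i + 1))\<^esub> v) = a \<odot>\<^bsub>regular_module A\<^esub> \<phi> r v" if a: "a \<in> carrier A" for a
     using v dv a r hom_smult[OF \<Phi>, of "\<iota> a" "delta w v"] del_smult[of v a] \<Phi>c[OF dv] by (simp add: \<phi>_def co_\<iota>)
    fix v' assume v': "v' \<in> carrier (fmod A (H (i + 1)))"
    then have dv': "delta w v' \<in> induced w (H (i + 1))" by (simp add: I.delta_ind)
    show "\<phi> r (v \<oplus>\<^bsub>fmod A (H (i + 1))\<^esub> v') = \<phi> r v \<oplus>\<^bsub>regular_module A\<^esub> \<phi> r v'"
     using v dv v' dv' r hom_add[OF \<Phi>, of "delta w v" "delta w v'"] del_add[of v v'] \<Phi>c[OF dv] \<Phi>c[OF dv']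
     by (simp add: \<phi>_def co_add)
   qed
   have \<phi>d: "\<phi> r (d i v) = \<zero>\<^sub>A" if r: "r \<in> N" and v: "v \<in> carrier (fmod A (H i))" for r v
    using \<Phi>D[of "delta w v"] Ddelta[of v i] I.delta_ind[of v i] v r by (simp add: \<phi>_def)
   have "\<exists>g\<in>dual A (fmod A (H (i + 2))). \<forall>v\<in>carrier (fmod A (H (i + 1))). \<phi> r v = g (d (i + 1) v)"
    if r: "r \<in> N" for r
    by (rule cr_hom_exact[where i = i and f = "\<phi> r" and P = "\<lambda>i. fmod A (H i)", OF cr \<phi>[OF r] \<phi>d[OF r]])
   then obtain g where g: "\<And>r. r \<in> N \<Longrightarrow> g r \<in> dual A (fmod A (H (i + 2)))"
    and gd: "\<And>r v. r \<in> N \<Longrightarrow> v \<in> H (i + 1) \<Longrightarrow> \<phi> r v = g r (d (i + 1) v)" by (metis fmod_simps(1))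
   \<comment> \<open>Composed with the differential and evaluated at \<open>delta w v\<close>, this
     gives e_w times the expansion of \<open>\<Phi> (delta w v)\<close>, and e_w fixes that
     value.\<close>
   define G where "G W = (\<Oplus>\<^bsub>regular_module L\<^esub>r\<in>N. hat (g r) W \<odot>\<^bsub>regular_module L\<^esub> E r)" for W
   have G: "G \<in> module_hom L (fmod L (induced w (H (i + 2)))) (regular_module L)"
    unfolding G_def using finite_N
    by (intro hom_sum[OF regL] hom_mult_elem[OF regL] I.hat_hom g) (auto simp: E_closed)
   have D1h: "D (i + 1) \<in> module_hom L (fmod L (induced w (H (i + 1)))) (fmod L (induced w (H (i + 2))))"
    using Dh[of "i + 1"] by (simp add: add.assoc)
   have "\<Phi> W = G (D (i + 1) W)" if W: "W \<in> induced w (H (i + 1))" for W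
   proof (rule I.induced_hom_eq[OF regL \<Phi> hom_comp[OF D1h G] _ W])
    fix v assume v: "v \<in> H (i + 1)"
    note dv = I.delta_ind[OF v] and dD = DI2[OF I.delta_ind[OF v]]
    have ce: "\<phi> r v \<in> carrier A" if "r \<in> N" for r using hom_closed[OF \<phi>[OF that]] v by simp
    have hat: "hat (g r) (D (i + 1) (delta w v)) = \<iota> (\<phi> r v) \<otimes>\<^sub>L E (w, [])" if r: "r \<in> N" for r
    proof (rule co_ext)
     show "hat (g r) (D (i + 1) (delta w v)) \<in> carrier L" by (rule I.hat_closed[OF g[OF r] dD])
     show "\<iota> (\<phi> r v) \<otimes>\<^sub>L E (w, []) \<in> carrier L" using ce[OF r] I.e by (simp add: E_closed)
     fix p assume p: "p \<in> N"
     show "co p (hat (g r) (D (i + 1) (delta w v))) = co p (\<iota> (\<phi> r v) \<otimes>\<^sub>L E (w, []))"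
      using I.co_hat[OF g[OF r] dD p] Dcov[OF dv p] I.cov_delta[OF v p] gd[OF r v] d0 I.h_zero[OF g[OF r]]
       co_\<iota>E[OF p I.e ce[OF r]] by auto
    qed
    have del_E: "delta w v = E (w, []) \<odot>\<^bsub>fmod L (induced w (H (i + 1)))\<^esub> delta w v"
     using HA[OF v] I.e E_fst[OF I.e] by (auto simp: delta_def L.m_assoc[symmetric] E_closed \<iota>_E) (simp add: L.m_assoc E_closed)
    have "\<Phi> (delta w v) = E (w, []) \<otimes>\<^sub>L \<Phi> (delta w v)"
     using hom_smult[OF \<Phi> E_closed[OF I.e], of "delta w v"] dv del_E by simp
    also have "\<dots> = E (w, []) \<otimes>\<^sub>L (\<Oplus>\<^sub>L r\<in>N. \<iota> (\<phi> r v) \<otimes>\<^sub>L E r)"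
     using expansion[OF \<Phi>c[OF dv]] by (simp add: \<phi>_def)
    also have "\<dots> = (\<Oplus>\<^sub>L r\<in>N. E (w, []) \<otimes>\<^sub>L (\<iota> (\<phi> r v) \<otimes>\<^sub>L E r))"
     using ce I.e by (intro L.finsum_rdistr finite_N) (auto simp: E_closed)
    also have "\<dots> = (\<Oplus>\<^sub>L r\<in>N. hat (g r) (D (i + 1) (delta w v)) \<otimes>\<^sub>L E r)"
     using ce I.e by (intro L.finsum_cong') (auto simp: E_closed hat L.m_assoc[symmetric] \<iota>_E)
    also have "\<dots> = G (D (i + 1) (delta w v))"
     unfolding G_def by (subst finsum_record[of "regular_module L" L]) (simp_all add: regular_module_def)
    finally show "\<Phi> (delta w v) = G (D (i + 1) (delta w v))" .
   qed
   then show ?thesis using G by auto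
  qed
 qed
 then show ?thesis by (simp add: D_def[abs_def])
qed

text \<open>Being a cycle is a condition on each coefficient vector, so inducing the cycles gives
  the cycles of the induced resolution.\<close>

lemma gorenstein_projective_induced:
 assumes cr: "complete_resolution A (\<lambda>i. fmod A (H i)) d" and HA: "\<And>i v j. v \<in> H i \<Longrightarrow> v j \<in> carrier A"
  and w: "w \<in> verts Q"
 shows "gorenstein_projective L (fmod L (induced w {v \<in> H 0. d 0 v = (\<lambda>j. \<zero>\<^sub>A)}))" (is "gorenstein_projective L (fmod L (induced w ?Z))")
proof -
 note lm = cr_left_module[OF cr]
 have dh: "d 0 \<in> module_hom A (fmod A (H 0)) (fmod A (H 1))" using cr_hom[OF cr, of 0] by simp
 have sub: "submod A (fmod A (H 0)) ?Z"
  using submod_ker[OF lm lm dh] by (simp add: hom_ker_def)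
 have Z: "left_module A (fmod A ?Z)"
  using left_module_submod[OF lm sub] by (simp add: fmod_def)
 interpret I: induced_module A L Q N \<iota> E co ht w "H i" for i
  by (intro induced_module.intro induced_module_axioms.intro monomial_algebra_axioms w lm HA)
 interpret Z: induced_module A L Q N \<iota> E co ht w ?Z
  by (intro induced_module.intro induced_module_axioms.intro monomial_algebra_axioms w Z) (auto simp: HA)
 have comp: "(\<lambda>v. d 0 v j) \<in> dual A (fmod A (H 0))" for j
  using HA hom_closed[OF dh] hom_add[OF dh] hom_smult[OF dh] by (intro module_homI) auto
 have Dcov: "cov p (induced_map (d 0) W) = d 0 (cov p W)" if "W \<in> induced w (H 0)" "p \<in> N" for W p
  unfolding induced_map_def cov_def[of p "\<lambda>j. hat (\<lambda>v. d 0 v j) W"] by (simp add: I.co_hat[OF comp that])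
 have DL: "induced_map (d 0) W j \<in> carrier L" if "W \<in> induced w (H 0)" for W j
  unfolding induced_map_def by (rule I.hat_closed[OF comp that])
 have ZI: "W \<in> induced w (H 0)" if "W \<in> induced w ?Z" for W using that unfolding induced_def by (auto split: if_splits)
 have "W \<in> induced w ?Z \<longleftrightarrow> W \<in> induced w (H 0) \<and> induced_map (d 0) W = (\<lambda>j. \<zero>\<^sub>L)" for W
 proof
  assume W: "W \<in> induced w ?Z"
  have "induced_map (d 0) W j = \<zero>\<^sub>L" for j
  proof (rule co_ext[OF DL[OF ZI[OF W]] L.zero_closed])
   fix p assume p: "p \<in> N"
   have "cov p (induced_map (d 0) W) = (\<lambda>j. \<zero>\<^sub>A)" using Dcov[OF ZI[OF W] p] Z.ind_cov[OF W p] by simp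
   from fun_cong[OF this, of j] show "co p (induced_map (d 0) W j) = co p \<zero>\<^sub>L" using p by (simp add: cov_def)
  qed
  then show "W \<in> induced w (H 0) \<and> induced_map (d 0) W = (\<lambda>j. \<zero>\<^sub>L)" using ZI[OF W] by auto
 next
  assume W: "W \<in> induced w (H 0) \<and> induced_map (d 0) W = (\<lambda>j. \<zero>\<^sub>L)"
  then have W1: "W \<in> induced w (H 0)" by simp
  show "W \<in> induced w ?Z"
  proof (rule Z.indI)
   show "W j \<in> carrier L" for j by (rule I.ind_L[OF W1])
   fix p assume p: "p \<in> N"
   show "cov p W \<in> ?Z" using I.ind_cov[OF W1 p] Dcov[OF W1 p] W p by (simp add: cov_def)
   show "fst p \<noteq> w \<Longrightarrow> cov p W = (\<lambda>j. \<zero>\<^sub>A)" by (rule I.ind_cov0[OF W1 p])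
  qed
 qed
 then have "induced w ?Z = {W \<in> induced w (H 0). induced_map (d 0) W = (\<lambda>j. \<zero>\<^sub>L)}" by blast
 then have "cycle_iso L (fmod L (induced w ?Z)) (\<lambda>i. fmod L (induced w (H i))) (\<lambda>i. induced_map (d i)) (\<lambda>W. W)"
  unfolding cycle_iso_def by (auto intro!: module_homI)
 moreover have "complete_resolution L (\<lambda>i. fmod L (induced w (H i))) (\<lambda>i. induced_map (d i))"
  by (rule induced_resolution[OF cr _ w]) (rule HA)
 ultimately show ?thesis by (intro gorenstein_projectiveI[OF Z.left_module_induced])
qed

end

section \<open>Flat modules with Gorenstein-projective tops\<close>

context monomial_algebra
begin

text \<open>Closure under predecessors lets a path starting in U be prolonged at its start without
  leaving U, which makes \<open>from_verts U\<close> a right ideal.\<close>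

definition pred_closed :: "'v set \<Rightarrow> bool" where
 "pred_closed U \<longleftrightarrow> U \<subseteq> verts Q \<and> (\<forall>\<alpha>\<in>arcs Q. head Q \<alpha> \<in> U \<longrightarrow> tail Q \<alpha> \<in> U)"

definition from_verts :: "'v set \<Rightarrow> ('v, 'e) path set" where
 "from_verts U = {p \<in> N. fst p \<in> U}"

lemma pred_closed_path:
 assumes U: "pred_closed U" and p: "p \<in> N" "path_end Q p \<in> U" shows "fst p \<in> U"
proof -
 have "(u, es) \<in> N \<Longrightarrow> path_end Q (u, es) \<in> U \<Longrightarrow> u \<in> U" for u es
 proof (induction es rule: rev_induct)
  case (snoc x xs)
  have x: "x \<in> arcs Q" "path_end Q (u, xs) = tail Q x" using N_factors(2)[OF snoc.prems(1)] N_arrow by auto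
  have "tail Q x \<in> U" using U x(1) snoc.prems(2) by (auto simp: pred_closed_def path_end_eq)
  then show ?case using snoc.IH[OF N_factors(1)[OF snoc.prems(1)]] x(2) by simp
 qed simp
 from this[of "fst p" "snd p"] show ?thesis using p by simp
qed

lemma from_verts_N: "from_verts U \<subseteq> N"
 by (auto simp: from_verts_def)

lemma right_ideal_from_verts:
 assumes "pred_closed U" shows "right_ideal (from_verts U)"
 unfolding right_ideal_def
proof (intro conjI ballI allI impI from_verts_N)
 fix p q assume p: "p \<in> from_verts U" and q: "path_end Q q = fst p" and pq: "path_comp p q \<in> N"
 have "fst q \<in> U" using pred_closed_path[OF assms N_comp(2)[OF pq q]] p q by (simp add: from_verts_def)
 then show "path_comp p q \<in> from_verts U" using pq by (simp add: from_verts_def)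
qed

end

context monomial_module
begin

text \<open>The condition on a path concerns only its start, so these paths are also closed under
  left multiples and generate a submodule over \<Lambda>, not merely over A.\<close>

lemma path_sub_from_verts_smult:
 assumes l: "l \<in> carrier L" and x: "x \<in> path_sub M (from_verts U)"
 shows "l \<odot> x \<in> path_sub M (from_verts U)"
proof -
 note xc = path_sub_closed[OF from_verts_N x]
 have Ex: "E p \<odot> x \<in> path_sub M (from_verts U)" if p: "p \<in> N" for p
  by (rule path_sub_path[OF from_verts_N from_verts_N p x]) (simp add: from_verts_def)
 show ?thesis using l
 proof (induction l rule: L_ind)
  case zero then show ?case using xc path_sub_zero by simp
 next
  case (add a p m)
  have "(\<iota> a \<otimes>\<^sub>L E p \<oplus>\<^sub>L m) \<odot> x = \<iota> a \<odot> (E p \<odot> x) \<oplus> m \<odot> x"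
   using add xc by (simp add: M.smult_l_distr E_closed M.smult_assoc1)
  then show ?case
   using path_sub_plus[OF from_verts_N path_sub_\<iota>[OF from_verts_N Ex[OF add(2)] add(1)] add.IH] by simp
 qed
qed

lemma submod_from_verts: "submod L M (path_sub M (from_verts U))"
proof -
 show ?thesis
  unfolding submod_def
  using path_sub_closed[OF from_verts_N] path_sub_zero path_sub_plus[OF from_verts_N]
   path_sub_from_verts_smult by auto
qed

lemma path_sub_N: "path_sub M N = carrier M"
proof -
 have "l \<odot> x \<in> path_sub M N" if l: "l \<in> carrier L" and x: "x \<in> carrier M" for l x
  using l
 proof (induction l rule: L_ind)
  case zero then show ?case using x path_sub_zero by simp
 next
  case (add a p m)
  have "(\<iota> a \<otimes>\<^sub>L E p \<oplus>\<^sub>L m) \<odot> x = E p \<odot> (\<iota> a \<odot> x) \<oplus> m \<odot> x"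
   using add x by (simp add: M.smult_l_distr E_closed M.smult_assoc1 \<iota>_E_smult)
  then show ?case
   using path_sub_plus[OF order_refl path_sub_base[OF order_refl add(2)] add.IH] add(1) x by simp
 qed
 from this[OF L.one_closed] have "carrier M \<subseteq> path_sub M N" by auto
 then show ?thesis using path_sub_closed[OF order_refl] by blast
qed

text \<open>Adding a vertex \<open>w\<close> of maximal height to \<open>U'\<close> enlarges the submodule generated by \<open>U'\<close> by
 \<open>\<Lambda> e\<^sub>w \<otimes> T\<close>, where \<open>T\<close> is the top of \<open>M\<close> at \<open>w\<close>.  The projection is described by its graph \<open>R\<close>.\<close>

lemma gorenstein_projective_from_verts:
 assumes flat: "flat M"
  and top: "\<And>s. s \<in> verts Q \<Longrightarrow> gorenstein_projective A (top_module M s)"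
  and U: "pred_closed U"
 shows "gorenstein_projective L (M\<lparr>carrier := path_sub M (from_verts U)\<rparr>)"
proof -
 have "finite (verts Q)"
  using finite_subset[of "verts Q" "fst ` N"] finite_N N_trivial by force
 then have "finite U" using U by (auto simp: pred_closed_def intro: finite_subset)
 then show ?thesis using U
 proof (induction U rule: finite_psubset_induct)
  case (psubset U)
  note U = psubset.prems
  let ?J = "from_verts U"
  note J = right_ideal_from_verts[OF U] and JN = from_verts_N[of U]
  note lE = left_module_submod[OF M.left_module_axioms submod_from_verts[of U]]
  show ?case
  proof (cases "U = {}")
   case True
   then have "from_verts U = {}" by (simp add: from_verts_def)
   moreover have "path_sub M {} = {\<zero>}" using path_sub_empty path_sub_zero by blast
   ultimately show ?thesis using lE by (intro gorenstein_projective_zero) auto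
  next
   case False
   \<comment> \<open>By maximality of the height no arrow leads from w to another vertex of U, so U
     without w remains closed under predecessors.\<close>
   obtain w where wU: "w \<in> U" and max: "\<And>u. u \<in> U \<Longrightarrow> ht u \<le> ht w"
   proof -
    have "Max (ht ` U) \<in> ht ` U" using False psubset.hyps by simp
    then obtain w where "w \<in> U" "ht w = Max (ht ` U)" by auto
    then show ?thesis using that[of w] psubset.hyps by simp
   qed
   have w: "w \<in> verts Q" using U wU by (auto simp: pred_closed_def)
   let ?U' = "U - {w}"
   let ?J' = "from_verts ?U'"
   have U': "pred_closed ?U'"
    unfolding pred_closed_def
   proof (intro conjI ballI impI)
    show "?U' \<subseteq> verts Q" using U by (auto simp: pred_closed_def)
    fix \<alpha> assume \<alpha>: "\<alpha> \<in> arcs Q" "head Q \<alpha> \<in> ?U'"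
    then have "tail Q \<alpha> \<in> U" using U by (auto simp: pred_closed_def)
    moreover have "tail Q \<alpha> \<noteq> w" using ht_arrow[OF \<alpha>(1)] max[of "head Q \<alpha>"] \<alpha>(2) by auto
    ultimately show "tail Q \<alpha> \<in> ?U'" by blast
   qed
   have J'N: "?J' \<subseteq> N" by (rule from_verts_N)
   have gU': "gorenstein_projective L (M\<lparr>carrier := path_sub M ?J'\<rparr>)"
    using psubset.IH[OF _ U'] wU by blast
   have strict: "fst q \<in> U - {w}" if "q \<in> N" "path_end Q q \<in> U" "snd q \<noteq> []" for q
   proof -
    have "ht (fst q) < ht (path_end Q q)" using ht_le[OF that(1)] that(3) by (cases "snd q") auto
    then have "fst q \<noteq> w" using max[OF that(2)] by auto
    then show ?thesis using pred_closed_path[OF U that(1,2)] by blast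
   qed
   define Nw where "Nw = {p \<in> N. fst p = w}"
   have NwJ: "p \<in> ?J" "p \<in> N" if "p \<in> Nw" for p using that wU by (auto simp: Nw_def from_verts_def)
   \<comment> \<open>Any path from w may be deleted, whatever its length: a product p' q with p' in
     the ideal and q nontrivial starts in U without w, so it is never p.\<close>
   have Jp: "right_ideal (?J - {p})" if p: "p \<in> Nw" for p
    unfolding right_ideal_def
   proof (intro conjI ballI allI impI)
    show "?J - {p} \<subseteq> N" using JN by blast
    fix p' q assume p': "p' \<in> ?J - {p}" and q: "path_end Q q = fst p'" and pq: "path_comp p' q \<in> N"
    have "path_comp p' q \<noteq> p"
    proof
     assume eq: "path_comp p' q = p"
     show False
     proof (cases "snd q = []")
      case True
      then have "path_comp p' q = p'" using q by (simp add: path_comp_def path_end_eq)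
      then show False using eq p' by simp
     next
      case False
      have "fst q \<in> U - {w}"
       using strict[OF N_comp(2)[OF pq q] _ False] q p' by (simp add: from_verts_def)
      moreover have "fst q = w" using eq p by (auto simp: Nw_def)
      ultimately show False by blast
     qed
    qed
    then show "path_comp p' q \<in> ?J - {p}" using right_idealD(2)[OF J _ q pq] p' by blast
   qed
   \<comment> \<open>Induction is defined on coordinate vectors, so the top is replaced by its image
     Z among the cycles; below, t is the projection to the top followed by this
     identification.\<close>
   obtain H d f where cr: "complete_resolution A (\<lambda>i. fmod A (H i)) d"
    and f: "cycle_iso A (top_module M w) (\<lambda>i. fmod A (H i)) d f"
    and HA: "\<And>i v j. v \<in> H i \<Longrightarrow> v j \<in> carrier A"
    by (rule gorenstein_projectiveE[OF top[OF w]], rule that)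
   define Z where "Z = {v \<in> H 0. d 0 v = (\<lambda>j. \<zero>\<^sub>A)}"
   have gI: "gorenstein_projective L (fmod L (induced w Z))"
    unfolding Z_def by (rule gorenstein_projective_induced[OF cr _ w]) (rule HA)
   have fh: "f \<in> module_hom A (top_module M w) (fmod A (H 0))" and finj: "inj_on f (carrier (top_module M w))"
    and fim: "f ` carrier (top_module M w) = Z"
    using f by (auto simp: cycle_iso_def Z_def)
   note lH = cr_left_module[OF cr, of 0] and lT = left_module_top[OF w]
   have dh: "d 0 \<in> module_hom A (fmod A (H 0)) (fmod A (H 1))" using cr_hom[OF cr, of 0] by simp
   have "submod A (fmod A (H 0)) Z"
    using submod_ker[OF lH cr_left_module[OF cr] dh] by (simp add: hom_ker_def Z_def)
   then have lZ: "left_module A (fmod A Z)"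
    using left_module_submod[OF lH] by (simp add: fmod_def)
   interpret Z: induced_module A L Q N \<iota> E co ht w Z
    by (intro induced_module.intro induced_module_axioms.intro monomial_algebra_axioms w lZ) (auto simp: HA Z_def)
   note lI = Z.left_module_induced
   define t where "t y = f (top_proj M w y)" for y
   have th: "t \<in> module_hom A (vert M w) (fmod A (H 0))"
    unfolding t_def by (rule hom_comp[OF top_proj_hom[OF w] fh])
   have tZ: "t y \<in> Z" if "y \<in> carrier (vert M w)" for y
    unfolding t_def using fim hom_closed[OF top_proj_hom[OF w] that] by blast
   have ts: "\<exists>y\<in>carrier (vert M w). v = t y" if v: "v \<in> Z" for v
   proof -
    have "v \<in> f ` top_proj M w ` carrier (vert M w)" using v fim top_proj_surj[OF w] by simp
    then show ?thesis unfolding t_def by blast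
   qed
   interpret T: left_module A "top_module M w" by (rule lT)
   have tk: "t y = (\<lambda>j. \<zero>\<^sub>A) \<longleftrightarrow> y \<in> path_sub M (rad w)" if y: "y \<in> carrier (vert M w)" for y
   proof -
    have "t y = f \<zero>\<^bsub>top_module M w\<^esub> \<longleftrightarrow> top_proj M w y = \<zero>\<^bsub>top_module M w\<^esub>"
     unfolding t_def using finj hom_closed[OF top_proj_hom[OF w] y] by (intro inj_on_eq_iff) auto
    then show ?thesis using hom_zero[OF lT lH fh] top_proj_ker[OF w y] by simp
   qed
   have Vw: "y \<in> carrier M" "E (w, []) \<odot> y = y" if "y \<in> carrier (vert M w)" for y
    using that vert_iff[OF w] by auto
   interpret V: left_module A "vert M w" by (rule left_module_vert[OF w])
   have rad_sub: "E p \<odot> y \<in> path_sub M ?J'" if p: "p \<in> Nw" and y: "y \<in> path_sub M (rad w)" for p y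
   proof (rule path_sub_path[OF rad_N J'N NwJ(2)[OF p] y])
    fix q assume q: "q \<in> rad w" "path_end Q q = fst p" "path_comp p q \<in> N"
    have "fst q \<in> U - {w}" using strict[of q] q(1) wU by (auto simp: rad_def)
    then show "path_comp p q \<in> ?J'" using q(3) by (simp add: from_verts_def)
   qed
   have J'p: "?J' \<subseteq> ?J - {p}" if "p \<in> Nw" for p using that by (auto simp: from_verts_def Nw_def)
   \<comment> \<open>For each path p from w, the coefficient vector of W at p is the class of the
     p-component y of x. Different p use independent decompositions of the same x.\<close>
   define R where "R x W \<longleftrightarrow> x \<in> path_sub M ?J \<and> W \<in> induced w Z \<and> (\<forall>p\<in>Nw.
    \<exists>y\<in>carrier (vert M w). \<exists>z\<in>path_sub M (?J - {p}). x = E p \<odot> y \<oplus> z \<and> cov p W = t y)" for x W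
   have JpN: "?J - {p} \<subseteq> N" for p using JN by blast
   \<comment> \<open>A p-component has zero class in the top exactly when p y can be rewritten
     without p. Flatness gives one direction; for the other, p times the radical involves only paths
     that start outside w.\<close>
   have rad_iff: "E p \<odot> y \<in> path_sub M (?J - {p}) \<longleftrightarrow> E (w, []) \<odot> y \<in> path_sub M (rad w)"
    if p: "p \<in> Nw" and y: "y \<in> carrier M" for p y
   proof
    have fp: "fst p = w" using p by (simp add: Nw_def)
    show "E (w, []) \<odot> y \<in> path_sub M (rad w)" if "E p \<odot> y \<in> path_sub M (?J - {p})"
     using flat_rad[OF flat NwJ(2)[OF p] Jp[OF p] _ y that] fp by simp
    assume "E (w, []) \<odot> y \<in> path_sub M (rad w)"
    then have "E p \<odot> y \<in> path_sub M ?J'"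
     using rad_sub[OF p] E_smult_fst[OF NwJ(2)[OF p] y] fp by metis
    then show "E p \<odot> y \<in> path_sub M (?J - {p})" using path_sub_mono[OF J'p[OF p]] by blast
   qed
   have sub_eq: "E p \<odot> y \<in> path_sub M K" if "K \<subseteq> N" "z \<in> path_sub M K" "E p \<odot> y \<oplus> z \<in> path_sub M K"
    "p \<in> N" "y \<in> carrier M" for K p y z
   proof -
    have "E p \<odot> y \<oplus> z \<ominus> z \<in> path_sub M K" using path_sub_diff that(1,2,3) by blast
    moreover have "E p \<odot> y \<oplus> z \<ominus> z = E p \<odot> y"
     using path_sub_closed[OF that(1,2)] that(4,5) by (simp add: a_minus_def M.M.a_assoc M.M.r_neg)
    ultimately show ?thesis by simp
   qed
   have Rker1: "W = (\<lambda>j. \<zero>\<^sub>L)" if RW: "R x W" and x: "x \<in> path_sub M ?J'" for x W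
   proof (rule Z.ind_ext[OF _ Z.ind_zero])
    show W: "W \<in> induced w Z" using RW by (simp add: R_def)
    fix p assume p: "p \<in> N"
    show "cov p W = cov p (\<lambda>j. \<zero>\<^sub>L)"
    proof (cases "p \<in> Nw")
     case True
     then obtain y z where yz: "y \<in> carrier (vert M w)" "z \<in> path_sub M (?J - {p})"
      "x = E p \<odot> y \<oplus> z" "cov p W = t y" using RW unfolding R_def by blast
     have "E p \<odot> y \<oplus> z \<in> path_sub M (?J - {p})"
      using x yz(3) path_sub_mono[OF J'p[OF True]] by blast
     then have "E p \<odot> y \<in> path_sub M (?J - {p})"
      using sub_eq[OF JpN yz(2) _ p Vw(1)[OF yz(1)]] by blast
     then have "y \<in> path_sub M (rad w)" using rad_iff[OF True Vw(1)[OF yz(1)]] Vw(2)[OF yz(1)] by simp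
     then show ?thesis using tk[OF yz(1)] yz(4) p by (simp add: cov_def)
    next
     case False
     then have "fst p \<noteq> w" using p by (simp add: Nw_def)
     then show ?thesis using Z.ind_cov0[OF W p] p by (simp add: cov_def)
    qed
   qed simp
   \<comment> \<open>The paths of \<open>Nw\<close> are eliminated from the generators one at a
     time. As the class at p is zero, the p-component of x lies in the submodule generated by U
     without w, and the remaining summand does not use p.\<close>
   have Rker2: "x \<in> path_sub M ?J'" if RW: "R x (\<lambda>j. \<zero>\<^sub>L)" for x
   proof -
    have "x \<in> path_sub M (?J' \<union> (Nw - S))" if "finite S" "S \<subseteq> Nw" for S
     using that
    proof (induction S rule: finite_induct)
     case empty
     have "?J \<subseteq> ?J' \<union> (Nw - {})" by (auto simp: from_verts_def Nw_def)
     then show ?case using RW path_sub_mono unfolding R_def by blast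
    next
     case (insert p S)
     have p: "p \<in> Nw" using insert.prems by simp
     let ?K = "?J' \<union> (Nw - S)" and ?K' = "?J' \<union> (Nw - insert p S)"
     have KN: "?K \<subseteq> N" using J'N NwJ(2) by blast
     have pK: "p \<in> ?K" using p insert.hyps by simp
     have "x \<in> path_sub M ?K" using insert by simp
     then obtain y' z' where y': "y' \<in> carrier M" and z': "z' \<in> path_sub M (?K - {p})"
      and x': "x = E p \<odot> y' \<oplus> z'" using path_sub_split[OF KN pK] by blast
     have Ksub: "?K - {p} \<subseteq> ?J - {p}" using NwJ(1) by (auto simp: from_verts_def)
     have KpK: "?K - {p} \<subseteq> ?K'" by blast
     obtain y z where yz: "y \<in> carrier (vert M w)" "z \<in> path_sub M (?J - {p})"
      "x = E p \<odot> y \<oplus> z" "cov p (\<lambda>j. \<zero>\<^sub>L) = t y" using RW p unfolding R_def by blast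
     have "y \<in> path_sub M (rad w)" using tk[OF yz(1)] yz(4) NwJ(2)[OF p] by (simp add: cov_def)
     then have "E p \<odot> y \<in> path_sub M (?J - {p})"
      using rad_iff[OF p Vw(1)[OF yz(1)]] Vw(2)[OF yz(1)] by simp
     then have "x \<in> path_sub M (?J - {p})" using yz(2,3) path_sub_plus[OF JpN] by simp
     moreover have "z' \<in> path_sub M (?J - {p})" using z' path_sub_mono[OF Ksub] by blast
     ultimately have "E p \<odot> y' \<in> path_sub M (?J - {p})"
      using sub_eq[OF JpN _ _ NwJ(2)[OF p] y'] x' by blast
     then have "E (w, []) \<odot> y' \<in> path_sub M (rad w)" using rad_iff[OF p y'] by simp
     then have "E p \<odot> (E (w, []) \<odot> y') \<in> path_sub M ?J'" by (rule rad_sub[OF p])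
     then have "E p \<odot> y' \<in> path_sub M ?J'"
      using E_smult_fst[OF NwJ(2)[OF p] y'] p by (simp add: Nw_def)
     then have "E p \<odot> y' \<in> path_sub M ?K'" using path_sub_mono[of ?J' ?K'] by blast
     moreover have "z' \<in> path_sub M ?K'" using z' path_sub_mono[OF KpK] by blast
     moreover have "?K' \<subseteq> N" using KN by blast
     ultimately show ?case unfolding x' by (intro path_sub_plus)
    qed
    moreover have "finite Nw" using finite_N by (simp add: Nw_def)
    ultimately have "x \<in> path_sub M (?J' \<union> (Nw - Nw))" by blast
    then show ?thesis by simp
   qed
   have "\<exists>h\<in>module_hom L (M\<lparr>carrier := path_sub M ?J\<rparr>) (fmod L (induced w Z)). \<forall>x W. R x W \<longleftrightarrow>
    x \<in> carrier (M\<lparr>carrier := path_sub M ?J\<rparr>) \<and> W = h x"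
   proof (rule rel_hom[OF lE lI])
    show "x \<in> carrier (M\<lparr>carrier := path_sub M ?J\<rparr>) \<and> W \<in> carrier (fmod L (induced w Z))" if "R x W" for x W
     using that by (simp add: R_def)
    show "\<exists>W. R x W" if "x \<in> carrier (M\<lparr>carrier := path_sub M ?J\<rparr>)" for x
    proof -
     have x: "x \<in> path_sub M ?J" using that by simp
     have "\<exists>y\<in>carrier (vert M w). \<exists>z\<in>path_sub M (?J - {p}). x = E p \<odot> y \<oplus> z" if p: "p \<in> Nw" for p
     proof -
      obtain y z where yz: "y \<in> carrier M" "z \<in> path_sub M (?J - {p})" "x = E p \<odot> y \<oplus> z"
       using path_sub_split[OF JN NwJ(1)[OF p] x] by blast
      have "E p \<odot> (E (w, []) \<odot> y) = E p \<odot> y"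
       using E_smult_fst[OF NwJ(2)[OF p] yz(1)] p by (simp add: Nw_def)
      moreover have "E (w, []) \<odot> y \<in> carrier (vert M w)" using yz(1) by (simp add: carrier_vert)
      ultimately show ?thesis using yz(2,3) by metis
     qed
     then obtain Y where Y: "\<And>p. p \<in> Nw \<Longrightarrow> Y p \<in> carrier (vert M w)"
      and Yz: "\<And>p. p \<in> Nw \<Longrightarrow> \<exists>z\<in>path_sub M (?J - {p}). x = E p \<odot> Y p \<oplus> z" by metis
     define u where "u p = (if fst p = w then t (Y p) else (\<lambda>j. \<zero>\<^sub>A))" for p
     have uZ: "u p \<in> Z" if "p \<in> N" for p using that tZ[OF Y] Z.H_zero by (simp add: u_def Nw_def)
     define W where "W j = (\<Oplus>\<^sub>L p\<in>N. \<iota> (u p j) \<otimes>\<^sub>L E p)" for j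
     have uA: "(\<lambda>p. u p j) \<in> N \<rightarrow> carrier A" for j by (intro Pi_I Z.HA[OF uZ])
     have Wcov: "cov p W = u p" if "p \<in> N" for p
      using co_finsum_\<iota>E[OF uA that] by (auto simp: cov_def W_def)
     have W: "W \<in> induced w Z"
     proof (rule Z.indI)
      show "W j \<in> carrier L" for j unfolding W_def by (rule finsum_\<iota>E_closed[OF uA])
      fix p assume p: "p \<in> N"
      show "cov p W \<in> Z" using Wcov[OF p] uZ[OF p] by simp
      show "cov p W = (\<lambda>j. \<zero>\<^sub>A)" if "fst p \<noteq> w" using Wcov[OF p] that by (simp add: u_def)
     qed
     have "\<exists>y\<in>carrier (vert M w). \<exists>z\<in>path_sub M (?J - {p}). x = E p \<odot> y \<oplus> z \<and> cov p W = t y"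
      if p: "p \<in> Nw" for p
     proof -
      have "cov p W = t (Y p)" using Wcov[OF NwJ(2)[OF p]] p by (simp add: u_def Nw_def)
      then show ?thesis using Y[OF p] Yz[OF p] by blast
     qed
     then show ?thesis using x W unfolding R_def by blast
    qed
    show "R (x \<oplus>\<^bsub>M\<lparr>carrier := path_sub M ?J\<rparr>\<^esub> x') (W \<oplus>\<^bsub>fmod L (induced w Z)\<^esub> W')"
     if RW: "R x W" and RW': "R x' W'" for x x' W W'
     unfolding R_def
    proof (intro conjI ballI)
     have W: "W \<in> induced w Z" "W' \<in> induced w Z" and xJ: "x \<in> path_sub M ?J" "x' \<in> path_sub M ?J"
      using RW RW' by (auto simp: R_def)
     show "x \<oplus>\<^bsub>M\<lparr>carrier := path_sub M ?J\<rparr>\<^esub> x' \<in> path_sub M ?J" using path_sub_plus[OF JN xJ] by simp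
     show "W \<oplus>\<^bsub>fmod L (induced w Z)\<^esub> W' \<in> induced w Z" using Z.ind_add[OF W] by simp
     fix p assume p: "p \<in> Nw"
     obtain y z where yz: "y \<in> carrier (vert M w)" "z \<in> path_sub M (?J - {p})"
      "x = E p \<odot> y \<oplus> z" "cov p W = t y" using RW p unfolding R_def by blast
     obtain y' z' where yz': "y' \<in> carrier (vert M w)" "z' \<in> path_sub M (?J - {p})"
      "x' = E p \<odot> y' \<oplus> z'" "cov p W' = t y'" using RW' p unfolding R_def by blast
     have zc: "z \<in> carrier M" "z' \<in> carrier M" using path_sub_closed[OF JpN] yz(2) yz'(2) by blast+
     have "x \<oplus> x' = E p \<odot> (y \<oplus> y') \<oplus> (z \<oplus> z')"
      using yz(3) yz'(3) Vw(1)[OF yz(1)] Vw(1)[OF yz'(1)] NwJ(2)[OF p] zc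
      by (simp add: E_smult_add M.M.add.m_ac)
     moreover have "cov p (W \<oplus>\<^bsub>fmod L (induced w Z)\<^esub> W') = t (y \<oplus> y')"
      using hom_add[OF th yz(1) yz'(1)] Z.cov_add[OF NwJ(2)[OF p] Z.ind_L[OF W(1)] Z.ind_L[OF W(2)]] yz(4) yz'(4)
      by simp
     ultimately show "\<exists>y\<in>carrier (vert M w). \<exists>z\<in>path_sub M (?J - {p}).
      x \<oplus>\<^bsub>M\<lparr>carrier := path_sub M ?J\<rparr>\<^esub> x' = E p \<odot> y \<oplus> z \<and> cov p (W \<oplus>\<^bsub>fmod L (induced w Z)\<^esub> W') = t y"
      using V.M.a_closed[OF yz(1) yz'(1)] path_sub_plus[OF JpN yz(2) yz'(2)]
      by (intro bexI[of _ "y \<oplus> y'"] bexI[of _ "z \<oplus> z'"]) simp_all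
    qed
    have Radd: "R (x \<oplus> x') (\<lambda>j. W j \<oplus>\<^sub>L W' j)" if "R x W" "R x' W'" for x x' W W'
     using \<open>\<And>x x' W W'. R x W \<Longrightarrow> R x' W' \<Longrightarrow> R (x \<oplus>\<^bsub>M\<lparr>carrier := path_sub M ?J\<rparr>\<^esub> x') (W \<oplus>\<^bsub>fmod L (induced w Z)\<^esub> W')\<close>[OF that]
     by simp
    have R\<iota>: "R (\<iota> a \<odot> x) (\<lambda>j. \<iota> a \<otimes>\<^sub>L W j)" if a: "a \<in> carrier A" and RW: "R x W" for a x W
     unfolding R_def
    proof (intro conjI ballI)
     have W: "W \<in> induced w Z" and xJ: "x \<in> path_sub M ?J" using RW by (auto simp: R_def)
     show "\<iota> a \<odot> x \<in> path_sub M ?J" by (rule path_sub_\<iota>[OF JN xJ a])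
     show "(\<lambda>j. \<iota> a \<otimes>\<^sub>L W j) \<in> induced w Z" by (rule Z.ind_\<iota>[OF a W])
     fix p assume p: "p \<in> Nw"
     obtain y z where yz: "y \<in> carrier (vert M w)" "z \<in> path_sub M (?J - {p})"
      "x = E p \<odot> y \<oplus> z" "cov p W = t y" using RW p unfolding R_def by blast
     note zc = path_sub_closed[OF JpN yz(2)]
     have "\<iota> a \<odot> x = E p \<odot> (\<iota> a \<odot> y) \<oplus> \<iota> a \<odot> z"
      using yz(3) Vw(1)[OF yz(1)] NwJ(2)[OF p] zc a by (simp add: M.smult_r_distr \<iota>_E_smult)
     moreover have "cov p (\<lambda>j. \<iota> a \<otimes>\<^sub>L W j) = t (\<iota> a \<odot> y)"
      using hom_smult[OF th a yz(1)] Z.cov_\<iota>[OF NwJ(2)[OF p] a Z.ind_L[OF W]] yz(4) by simp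
     ultimately show "\<exists>y\<in>carrier (vert M w). \<exists>z\<in>path_sub M (?J - {p}).
      \<iota> a \<odot> x = E p \<odot> y \<oplus> z \<and> cov p (\<lambda>j. \<iota> a \<otimes>\<^sub>L W j) = t y"
      using V.smult_closed[OF a yz(1)] path_sub_\<iota>[OF JpN yz(2) a]
      by (intro bexI[of _ "\<iota> a \<odot> y"] bexI[of _ "\<iota> a \<odot> z"]) simp_all
    qed
    have RE: "R (E q \<odot> x) (\<lambda>j. E q \<otimes>\<^sub>L W j)" if q: "q \<in> N" and RW: "R x W" for q x W
     unfolding R_def
    proof (intro conjI ballI)
     have W: "W \<in> induced w Z" and xJ: "x \<in> path_sub M ?J" using RW by (auto simp: R_def)
     show EJ: "E q \<odot> x \<in> path_sub M ?J" by (rule path_sub_from_verts_smult[OF E_closed[OF q] xJ])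
     show "(\<lambda>j. E q \<otimes>\<^sub>L W j) \<in> induced w Z" by (rule Z.ind_E[OF q W])
     fix r assume r: "r \<in> Nw"
     from Z.cov_E[where W = W, OF NwJ(2)[OF r] q Z.ind_L[OF W]]
     show "\<exists>y\<in>carrier (vert M w). \<exists>z\<in>path_sub M (?J - {r}).
      E q \<odot> x = E r \<odot> y \<oplus> z \<and> cov r (\<lambda>j. E q \<otimes>\<^sub>L W j) = t y"
     proof (elim disjE bexE conjE)
      fix p assume p: "p \<in> N" "path_end Q p = fst q" "r = path_comp q p" "cov r (\<lambda>j. E q \<otimes>\<^sub>L W j) = cov p W"
      have pw: "p \<in> Nw" using p r by (simp add: Nw_def)
      obtain y z where yz: "y \<in> carrier (vert M w)" "z \<in> path_sub M (?J - {p})"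
       "x = E p \<odot> y \<oplus> z" "cov p W = t y" using RW pw unfolding R_def by blast
      note zc = path_sub_closed[OF JpN yz(2)]
      have "E q \<odot> x = E r \<odot> y \<oplus> E q \<odot> z"
       using yz(3) Vw(1)[OF yz(1)] p q zc NwJ(2)[OF r] by (simp add: E_smult_add E_smult_comp)
      moreover have "E q \<odot> z \<in> path_sub M (?J - {r})"
      proof (rule path_sub_path[OF JpN JpN q yz(2)])
       fix p' assume "p' \<in> ?J - {p}" "path_comp q p' \<in> N"
       then show "path_comp q p' \<in> ?J - {r}" using p(3) by (simp add: from_verts_def path_comp_right_cancel)
      qed
      ultimately show ?thesis using yz(1,4) p(4) by (intro bexI[of _ y] bexI[of _ "E q \<odot> z"]) simp_all
     next
      assume no: "\<forall>p. path_end Q p = fst q \<longrightarrow> r \<noteq> path_comp q p" "cov r (\<lambda>j. E q \<otimes>\<^sub>L W j) = (\<lambda>j. \<zero>\<^sub>A)"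
      have "E q \<odot> x \<in> path_sub M (?J - {r})"
      proof (rule path_sub_path[OF JN JpN q xJ])
       fix p' assume p': "p' \<in> ?J" "path_end Q p' = fst q" "path_comp q p' \<in> N"
       then have "path_comp q p' \<noteq> r" using no(1) by blast
       then show "path_comp q p' \<in> ?J - {r}" using p' by (simp add: from_verts_def)
      qed
      moreover have "t \<zero> = (\<lambda>j. \<zero>\<^sub>A)" using hom_zero[OF left_module_vert[OF w] lH th] by simp
      moreover have "\<zero> \<in> carrier (vert M w)" using V.M.zero_closed by simp
      moreover have "E q \<odot> x = E r \<odot> \<zero> \<oplus> E q \<odot> x"
       using NwJ(2)[OF r] path_sub_closed[OF JN EJ] by (simp add: E_closed)
      ultimately show ?thesis using no(2)
       by (intro bexI[of _ "\<zero>"] bexI[of _ "E q \<odot> x"]) simp_all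
     qed
    qed
    have Rc: "x \<in> carrier M" "W j \<in> carrier L" if "R x W" for x W j
     using that path_sub_closed[OF JN] Z.ind_L unfolding R_def by blast+
    have R0: "R \<zero> (\<lambda>j. \<zero>\<^sub>L)"
     unfolding R_def
    proof (intro conjI ballI path_sub_zero Z.ind_zero)
     fix p assume p: "p \<in> Nw"
     have "t \<zero> = (\<lambda>j. \<zero>\<^sub>A)" using hom_zero[OF left_module_vert[OF w] lH th] by simp
     moreover have "\<zero> \<in> carrier (vert M w)" using V.M.zero_closed by simp
     ultimately show "\<exists>y\<in>carrier (vert M w). \<exists>z\<in>path_sub M (?J - {p}). \<zero> = E p \<odot> y \<oplus> z \<and> cov p (\<lambda>j. \<zero>\<^sub>L) = t y"
      using NwJ(2)[OF p] path_sub_zero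
      by (intro bexI[of _ "\<zero>"]) (simp_all add: E_closed cov_def)
    qed
    show "R (l \<odot>\<^bsub>M\<lparr>carrier := path_sub M ?J\<rparr>\<^esub> x) (l \<odot>\<^bsub>fmod L (induced w Z)\<^esub> W)"
     if l: "l \<in> carrier L" and RW: "R x W" for l x W
    proof -
     have "R (l \<odot> x) (\<lambda>j. l \<otimes>\<^sub>L W j)" using l
     proof (induction l rule: L_ind)
      case zero then show ?case using R0 Rc[OF RW] by simp
     next
      case (add a p m)
      have "(\<iota> a \<otimes>\<^sub>L E p \<oplus>\<^sub>L m) \<odot> x = \<iota> a \<odot> (E p \<odot> x) \<oplus> m \<odot> x"
       using add Rc[OF RW] by (simp add: M.smult_l_distr E_closed M.smult_assoc1)
      moreover have "(\<lambda>j. (\<iota> a \<otimes>\<^sub>L E p \<oplus>\<^sub>L m) \<otimes>\<^sub>L W j) = (\<lambda>j. (\<iota> a \<otimes>\<^sub>L (E p \<otimes>\<^sub>L W j)) \<oplus>\<^sub>L m \<otimes>\<^sub>L W j)"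
       using add Rc[OF RW] by (simp add: L.l_distr E_closed L.m_assoc)
      ultimately show ?case using Radd[OF R\<iota>[OF add(1) RE[OF add(2) RW]] add.IH] by simp
     qed
     then show ?thesis by simp
    qed
    show "W = \<zero>\<^bsub>fmod L (induced w Z)\<^esub>" if "R \<zero>\<^bsub>M\<lparr>carrier := path_sub M ?J\<rparr>\<^esub> W" for W
     using Rker1[of "\<zero>" W] that path_sub_zero by simp
   qed
   then obtain h where h: "h \<in> module_hom L (M\<lparr>carrier := path_sub M ?J\<rparr>) (fmod L (induced w Z))"
    and Rh: "\<And>x W. R x W \<longleftrightarrow> x \<in> carrier (M\<lparr>carrier := path_sub M ?J\<rparr>) \<and> W = h x" by blast
   show ?thesis
   proof (rule gorenstein_projective_extension[OF lE gU' gI _ _ h])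
    have J'J: "path_sub M ?J' \<subseteq> path_sub M ?J"
     by (rule path_sub_mono) (auto simp: from_verts_def)
    show "(\<lambda>x. x) \<in> module_hom L (M\<lparr>carrier := path_sub M ?J'\<rparr>) (M\<lparr>carrier := path_sub M ?J\<rparr>)"
     using J'J by (intro module_homI) auto
    show "inj_on (\<lambda>x. x) (carrier (M\<lparr>carrier := path_sub M ?J'\<rparr>))" by (rule inj_onI)
    show "h x = \<zero>\<^bsub>fmod L (induced w Z)\<^esub> \<longleftrightarrow> x \<in> (\<lambda>x. x) ` carrier (M\<lparr>carrier := path_sub M ?J'\<rparr>)"
     if x: "x \<in> carrier (M\<lparr>carrier := path_sub M ?J\<rparr>)" for x
    proof -
     have "R x (h x)" using Rh x by blast
     then show ?thesis using Rker1[of x "h x"] Rker2[of x] by auto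
    qed
    show "h ` carrier (M\<lparr>carrier := path_sub M ?J\<rparr>) = carrier (fmod L (induced w Z))"
    proof
     show "h ` carrier (M\<lparr>carrier := path_sub M ?J\<rparr>) \<subseteq> carrier (fmod L (induced w Z))"
      using hom_closed[OF h] by blast
     show "carrier (fmod L (induced w Z)) \<subseteq> h ` carrier (M\<lparr>carrier := path_sub M ?J\<rparr>)"
     proof
      fix W assume "W \<in> carrier (fmod L (induced w Z))"
      then have W: "W \<in> induced w Z" by simp
      obtain Y where Y: "\<And>p. p \<in> Nw \<Longrightarrow> Y p \<in> carrier (vert M w)" and Yt: "\<And>p. p \<in> Nw \<Longrightarrow> cov p W = t (Y p)"
       using ts[OF Z.ind_cov[OF W NwJ(2)]] by metis
      have fN: "finite Nw" using finite_N by (simp add: Nw_def)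
      have EY: "E p \<odot> Y p \<in> path_sub M (?J - {q})" if "p \<in> Nw" "p \<noteq> q" for p q
       using that NwJ(1) Vw(1)[OF Y] by (intro path_sub_base[OF JpN]) auto
      have EYc: "E p \<odot> Y p \<in> carrier M" if "p \<in> Nw" for p using NwJ(2)[OF that] Vw(1)[OF Y[OF that]] by simp
      \<comment> \<open>\<open>Y p\<close> lifts the coefficient vector of W at p. In the
        decomposition of x at p all summands for other paths form the remainder.\<close>
      define x where "x = (\<Oplus>p\<in>Nw. E p \<odot> Y p)"
      have xJ: "x \<in> path_sub M ?J"
       unfolding x_def using NwJ(1) Vw(1)[OF Y] by (intro path_sub_finsum[OF JN fN] path_sub_base[OF JN])
      have "R x W"
       unfolding R_def
      proof (intro conjI ballI xJ W)
       fix p assume p: "p \<in> Nw"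
       have "x = (\<Oplus>p\<in>insert p (Nw - {p}). E p \<odot> Y p)" using p by (simp add: x_def insert_absorb)
       also have "\<dots> = E p \<odot> Y p \<oplus> (\<Oplus>p\<in>Nw - {p}. E p \<odot> Y p)"
        using fN EYc p by (intro M.M.finsum_insert) auto
       finally have "x = E p \<odot> Y p \<oplus> (\<Oplus>p\<in>Nw - {p}. E p \<odot> Y p)" .
       moreover have "(\<Oplus>p\<in>Nw - {p}. E p \<odot> Y p) \<in> path_sub M (?J - {p})"
        using fN EY by (intro path_sub_finsum[OF JpN]) auto
       ultimately show "\<exists>y\<in>carrier (vert M w). \<exists>z\<in>path_sub M (?J - {p}). x = E p \<odot> y \<oplus> z \<and> cov p W = t y"
        using Y[OF p] Yt[OF p] by blast
      qed
      then show "W \<in> h ` carrier (M\<lparr>carrier := path_sub M ?J\<rparr>)" using Rh by blast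
     qed
    qed
   qed
  qed
 qed
qed

lemma gorenstein_projective_flat:
 assumes flat: "flat M"
  and top: "\<And>s. s \<in> verts Q \<Longrightarrow> gorenstein_projective A (top_module M s)"
 shows "gorenstein_projective L M"
proof -
 have "pred_closed (verts Q)"
  using N_verts(1)[of "(tail Q \<alpha>, [\<alpha>])" for \<alpha>] N_arrow by (auto simp: pred_closed_def)
 then have "gorenstein_projective L (M\<lparr>carrier := path_sub M (from_verts (verts Q))\<rparr>)"
  by (intro gorenstein_projective_from_verts[OF flat top])
 moreover have "from_verts (verts Q) = N" using N_verts(1) by (auto simp: from_verts_def)
 ultimately show ?thesis using path_sub_N by simp
qed

end

context monomial_algebra
begin

theorem gorenstein_projective_iff_flat:
 assumes M: "left_module L M"
 shows "gorenstein_projective L M \<longleftrightarrow> flat M \<and> (\<forall>v\<in>verts Q. gorenstein_projective A (vert M v) \<and>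
  gorenstein_projective A (top_module M v))"
proof
 assume g: "gorenstein_projective L M"
 obtain P :: "int \<Rightarrow> ('l, nat \<Rightarrow> 'l) module" and d f where
  cr: "complete_resolution L P d" and f: "cycle_iso L M P d f"
  using g unfolding gorenstein_projective_iff by (elim conjE exE)
 note flat = flat_cycles[OF cr M f]
 then show "flat M \<and> (\<forall>v\<in>verts Q. gorenstein_projective A (vert M v) \<and> gorenstein_projective A (top_module M v))"
  using gorenstein_projective_top[OF g] gorenstein_projective_vert[OF M flat] by blast
next
 interpret M: monomial_module A L Q N \<iota> E co ht M by (rule module_locale) (rule M)
 show "flat M \<and> (\<forall>v\<in>verts Q. gorenstein_projective A (vert M v) \<and> gorenstein_projective A (top_module M v)) \<Longrightarrow>
  gorenstein_projective L M"
  using M.gorenstein_projective_flat by blast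
qed

end

section \<open>Monic representations and flat modules\<close>

text \<open>Several elements of the same member can be merged since it is closed under addition, so
  indexed sums and unordered sums give the same set. This connects \<open>submodule_sum\<close> with
  \<open>path_sub\<close>.\<close>

lemma submodule_sum_eq_gspan:
 assumes M: "abelian_group M" and S: "finite S"
  and X: "\<And>i. i \<in> S \<Longrightarrow> X i \<subseteq> carrier M" "\<And>i. i \<in> S \<Longrightarrow> \<zero>\<^sub>M \<in> X i"
  "\<And>i x y. i \<in> S \<Longrightarrow> x \<in> X i \<Longrightarrow> y \<in> X i \<Longrightarrow> x \<oplus>\<^sub>M y \<in> X i"
 shows "submodule_sum M X S = gspan M (\<Union>i\<in>S. X i)"
proof -
 interpret abelian_group M by fact
 have sub: "(\<Union>i\<in>S. X i) \<subseteq> carrier M" using X(1) by blast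
 show ?thesis
 proof
  show "submodule_sum M X S \<subseteq> gspan M (\<Union>i\<in>S. X i)"
  proof
   fix s assume "s \<in> submodule_sum M X S"
   then obtain x where x: "\<forall>i\<in>S. x i \<in> X i" "s = (\<Oplus>\<^sub>M i\<in>S. x i)" unfolding submodule_sum_def by blast
   show "s \<in> gspan M (\<Union>i\<in>S. X i)" unfolding x(2)
    using x(1) by (intro gspan_finsum[OF M sub S] gspan_base[OF M sub]) blast
  qed
  show "gspan M (\<Union>i\<in>S. X i) \<subseteq> submodule_sum M X S"
  proof
   fix s assume "s \<in> gspan M (\<Union>i\<in>S. X i)"
   then show "s \<in> submodule_sum M X S"
   proof induction
    case zero
    have "(\<Oplus>\<^sub>M i\<in>S. \<zero>\<^sub>M) = \<zero>\<^sub>M" by simp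
    then show ?case unfolding submodule_sum_def
     using X(2) by (intro CollectI exI[of _ "\<lambda>_. \<zero>\<^sub>M"]) simp
   next
    case (add g z)
    then obtain x i where x: "\<forall>i\<in>S. x i \<in> X i" "z = (\<Oplus>\<^sub>M i\<in>S. x i)" and i: "i \<in> S" "g \<in> X i"
     unfolding submodule_sum_def by blast
    have c: "x j \<in> carrier M" if "j \<in> S" for j using that x(1) X(1) by blast
    have gc: "g \<in> carrier M" using i X(1) by blast
    have "(\<Oplus>\<^sub>M j\<in>S. if i = j then g else \<zero>\<^sub>M) = g"
     using gc by (intro finsum_singleton[OF i(1) S, of "\<lambda>_. g"]) auto
    then have "g \<oplus>\<^sub>M z = (\<Oplus>\<^sub>M j\<in>S. if i = j then g else \<zero>\<^sub>M) \<oplus>\<^sub>M (\<Oplus>\<^sub>M j\<in>S. x j)" using x(2) by simp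
    also have "\<dots> = (\<Oplus>\<^sub>M j\<in>S. (if i = j then g else \<zero>\<^sub>M) \<oplus>\<^sub>M x j)"
     using c gc by (intro finsum_addf[symmetric]) auto
    finally have eq: "g \<oplus>\<^sub>M z = (\<Oplus>\<^sub>M j\<in>S. (if i = j then g else \<zero>\<^sub>M) \<oplus>\<^sub>M x j)" .
    have "(if i = j then g else \<zero>\<^sub>M) \<oplus>\<^sub>M x j \<in> X j" if "j \<in> S" for j
     using that x(1) X(2,3) i by auto
    then show ?case unfolding submodule_sum_def using eq by blast
   qed
  qed
 qed
qed

section \<open>Paths of a quiver as walks\<close>

lemma paths_iff_awalk: "wf_digraph Q \<Longrightarrow> (u, es) \<in> paths Q \<longleftrightarrow> pre_digraph.awalk Q u es (path_end Q (u, es))"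
proof -
 assume "wf_digraph Q"
 then interpret wf_digraph Q .
 show ?thesis by (auto simp: paths_def path_end_def)
qed

lemma paths_append:
 "wf_digraph Q \<Longrightarrow> (u, xs @ ys) \<in> paths Q \<longleftrightarrow> (u, xs) \<in> paths Q \<and> (path_end Q (u, xs), ys) \<in> paths Q"
proof -
 assume wf: "wf_digraph Q"
 then interpret wf_digraph Q .
 have "awalk u (xs @ ys) v \<longleftrightarrow> awalk u xs (path_end Q (u, xs)) \<and> awalk (path_end Q (u, xs)) ys v" for v
  by (simp add: path_end_def)
 then show ?thesis unfolding paths_iff_awalk[OF wf, of u xs] by (auto simp: paths_def)
qed

lemma paths_Nil: "wf_digraph Q \<Longrightarrow> (u, []) \<in> paths Q \<longleftrightarrow> u \<in> verts Q"
proof -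
 assume "wf_digraph Q"
 then interpret wf_digraph Q .
 show ?thesis by (auto simp: paths_def awalk_Nil_iff)
qed

lemma paths_single: "wf_digraph Q \<Longrightarrow> (u, [\<alpha>]) \<in> paths Q \<longleftrightarrow> \<alpha> \<in> arcs Q \<and> u = tail Q \<alpha>"
proof -
 assume "wf_digraph Q"
 then interpret wf_digraph Q .
 show ?thesis by (auto simp: paths_def awalk_simps)
qed

lemma paths_verts: "wf_digraph Q \<Longrightarrow> p \<in> paths Q \<Longrightarrow> fst p \<in> verts Q \<and> path_end Q p \<in> verts Q"
proof -
 assume wf: "wf_digraph Q" and p: "p \<in> paths Q"
 interpret wf_digraph Q by (rule wf)
 have "awalk (fst p) (snd p) (path_end Q p)" using p paths_iff_awalk[OF wf, of "fst p" "snd p"] by simp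
 then show ?thesis by auto
qed

lemma paths_comp:
 "wf_digraph Q \<Longrightarrow> path_end Q q = fst p \<Longrightarrow> path_comp p q \<in> paths Q \<longleftrightarrow> p \<in> paths Q \<and> q \<in> paths Q"
 using paths_append[of Q "fst q" "snd q" "snd p"] by (auto simp: path_comp_def)

section \<open>The representation attached to a module\<close>

context monomial_algebra
begin

definition rep_of :: "('l, 'm, 'w) module_scheme \<Rightarrow> ('v, 'e, 'a, 'm) quiver_rep" where
 "rep_of M = \<lparr>rep_space = vert M, rep_map = (\<lambda>\<alpha> x. E (arrow_path Q \<alpha>) \<odot>\<^sub>M x)\<rparr>"

lemma arrow_N: "\<alpha> \<in> arcs Q \<Longrightarrow> arrow_path Q \<alpha> \<in> N"
 by (simp add: arrow_path_def N_arrow)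

lemma arrow_path_simps [simp]:
 "fst (arrow_path Q \<alpha>) = tail Q \<alpha>" "snd (arrow_path Q \<alpha>) = [\<alpha>]" "path_end Q (arrow_path Q \<alpha>) = head Q \<alpha>"
 by (simp_all add: arrow_path_def path_end_eq)

lemma finite_in_arcs: "finite (in_arcs Q v)"
proof -
 have "arrow_path Q ` in_arcs Q v \<subseteq> N" using arrow_N by auto
 then have "finite (arrow_path Q ` in_arcs Q v)" using finite_N finite_subset by blast
 moreover have "inj_on (arrow_path Q) (in_arcs Q v)" by (auto simp: inj_on_def arrow_path_def)
 ultimately show ?thesis by (rule finite_imageD)
qed

end

context monomial_module
begin

lemma rep_of_simps: "rep_space (rep_of M) = vert M"
 "rep_map (rep_of M) = (\<lambda>\<alpha> x. E (arrow_path Q \<alpha>) \<odot> x)"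
 by (simp_all add: rep_of_def)

lemma vert_E: "p \<in> N \<Longrightarrow> x \<in> carrier M \<Longrightarrow> E p \<odot> x \<in> carrier (vert M (path_end Q p))"
 using vert_iff[OF N_verts(2)] E_smult_end by simp

text \<open>The arrows act one after another, with product \<open>E\<close> of the path while it
  stays nonzero. Once an initial segment leaves N, no prolongation returns to N, in accordance with
  the value zero.\<close>

lemma rep_path_rep_of:
 assumes wf: "wf_digraph Q" and "(u, es) \<in> paths Q" "x \<in> carrier M" "E (u, []) \<odot> x = x"
 shows "rep_path (rep_of M) (u, es) x = (if (u, es) \<in> N then E (u, es) \<odot> x else \<zero>)"
 using assms(2)
proof (induction es rule: rev_induct)
 case Nil
 then have "(u, []) \<in> N" using paths_Nil[OF wf] N_trivial by blast
 then show ?case using assms(4) by (simp add: rep_path_def)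
next
 case (snoc \<alpha> xs)
 have *: "(u, xs) \<in> paths Q" "\<alpha> \<in> arcs Q" "path_end Q (u, xs) = tail Q \<alpha>"
  using snoc.prems paths_append[OF wf] paths_single[OF wf] by auto
 note a = arrow_N[OF *(2)]
 have c: "path_comp (arrow_path Q \<alpha>) (u, xs) = (u, xs @ [\<alpha>])" by (simp add: path_comp_def)
 have "rep_path (rep_of M) (u, xs @ [\<alpha>]) x = E (arrow_path Q \<alpha>) \<odot> rep_path (rep_of M) (u, xs) x"
  by (simp add: rep_path_def rep_of_def)
 also have "\<dots> = (if (u, xs @ [\<alpha>]) \<in> N then E (u, xs @ [\<alpha>]) \<odot> x else \<zero>)"
  using snoc.IH[OF *(1)] a assms(3) *(3) N_factors(1)[of u xs "[\<alpha>]"]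
  by (auto simp: E_smult_comp c E_closed)
 finally show ?case .
qed

lemma rep_path_image_rep_of:
 assumes wf: "wf_digraph Q" and NP: "N \<subseteq> paths Q" and p: "p \<in> N"
 shows "rep_path_image (rep_of M) p = {E p \<odot> y | y. y \<in> carrier M}"
proof -
 note v = N_verts(1)[OF p]
 have *: "rep_path (rep_of M) p x = E p \<odot> x" if "x \<in> carrier (vert M (fst p))" for x
  using rep_path_rep_of[OF wf, of "fst p" "snd p" x] p NP that vert_iff[OF v] by auto
 have "rep_path_image (rep_of M) p = (\<lambda>x. E p \<odot> x) ` carrier (vert M (fst p))"
  using * by (simp add: rep_path_image_def path_start_def rep_of_simps)
 also have "\<dots> = {E p \<odot> y | y. y \<in> carrier M}"
 proof (intro equalityI subsetI)
  show "x \<in> {E p \<odot> y | y. y \<in> carrier M}" if "x \<in> (\<lambda>x. E p \<odot> x) ` carrier (vert M (fst p))" for x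
   using that vert_iff[OF v] by blast
  fix x assume "x \<in> {E p \<odot> y | y. y \<in> carrier M}"
  then obtain y where y: "y \<in> carrier M" "x = E p \<odot> y" by blast
  then have "E (fst p, []) \<odot> y \<in> carrier (vert M (fst p))" by (simp add: carrier_vert)
  then show "x \<in> (\<lambda>x. E p \<odot> x) ` carrier (vert M (fst p))"
   using E_smult_fst[OF p y(1)] y(2) by (metis image_eqI)
 qed
 finally show ?thesis .
qed

lemma submodule_sum_paths:
 assumes wf: "wf_digraph Q" and NP: "N \<subseteq> paths Q" and v: "v \<in> verts Q"
  and K: "K \<subseteq> N" "\<And>p. p \<in> K \<Longrightarrow> path_end Q p = v"
 shows "submodule_sum (vert M v) (rep_path_image (rep_of M)) K = path_sub M K"
proof -
 interpret V: left_module A "vert M v" by (rule left_module_vert[OF v])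
 have im: "rep_path_image (rep_of M) p = {E p \<odot> y | y. y \<in> carrier M}" if "p \<in> K" for p
  using rep_path_image_rep_of[OF wf NP] K(1) that by blast
 have "submodule_sum (vert M v) (rep_path_image (rep_of M)) K = gspan (vert M v) (\<Union>p\<in>K. rep_path_image (rep_of M) p)"
 proof (rule submodule_sum_eq_gspan[OF V.M.abelian_group_axioms])
  show "finite K" using K(1) finite_N finite_subset by blast
  fix p assume p: "p \<in> K"
  then have pN: "p \<in> N" using K(1) by blast
  show "rep_path_image (rep_of M) p \<subseteq> carrier (vert M v)"
   using vert_E[OF pN] K(2)[OF p] by (auto simp: im[OF p])
  show "\<zero>\<^bsub>vert M v\<^esub> \<in> rep_path_image (rep_of M) p"
   using pN by (auto simp: im[OF p] E_closed intro!: exI[of _ "\<zero>"])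
  show "x \<oplus>\<^bsub>vert M v\<^esub> y \<in> rep_path_image (rep_of M) p"
   if "x \<in> rep_path_image (rep_of M) p" "y \<in> rep_path_image (rep_of M) p" for x y
   using that E_smult_add[OF pN] by (auto simp: im[OF p]) (metis M.M.a_closed)
 qed
 also have "\<dots> = gspan M (\<Union>p\<in>K. rep_path_image (rep_of M) p)"
  by (rule gspan_cong) (simp_all add: vert_def)
 also have "(\<Union>p\<in>K. rep_path_image (rep_of M) p) = {E p \<odot> y | p y. p \<in> K \<and> y \<in> carrier M}"
  using im by blast
 finally show ?thesis by (simp add: path_sub_def)
qed

text \<open>A path with last arrow \<alpha> factors through \<alpha>, so its image is contained in
  that of \<alpha>. The larger index set is a right ideal, as flatness requires, while a set of
  arrows in general is not.\<close>

lemma path_sub_arrows: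
 assumes "S \<subseteq> in_arcs Q v"
 shows "path_sub M (arrow_path Q ` S) = path_sub M {p \<in> N. path_end Q p = v \<and> snd p \<noteq> [] \<and> last (snd p) \<in> S}"
  (is "?l = path_sub M ?K")
proof
 have sN: "arrow_path Q ` S \<subseteq> N" using assms arrow_N by auto
 show "?l \<subseteq> path_sub M ?K" using sN assms by (intro path_sub_mono) auto
 show "path_sub M ?K \<subseteq> ?l"
 proof
  fix x assume x: "x \<in> path_sub M ?K"
  have KN: "?K \<subseteq> N" by blast
  from KN x show "x \<in> ?l"
  proof (induction x rule: path_sub_induct)
   case zero show ?case by (rule path_sub_zero)
  next
   case (add p y z)
   obtain xs \<alpha> where p: "snd p = xs @ [\<alpha>]" using add(1) by (cases "snd p" rule: rev_cases) auto
   have pN: "(fst p, xs @ [\<alpha>]) \<in> N" using add(2) p by (metis prod.collapse)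
   have \<alpha>: "\<alpha> \<in> S" using add(1) p by simp
   have q: "(fst p, xs) \<in> N" "path_end Q (fst p, xs) = tail Q \<alpha>"
    using N_factors[OF pN] N_arrow by auto
   have "path_comp (arrow_path Q \<alpha>) (fst p, xs) = p" using p by (simp add: prod_eq_iff)
   then have "E p \<odot> y = E (arrow_path Q \<alpha>) \<odot> (E (fst p, xs) \<odot> y)"
    using q add(2,3) sN \<alpha> by (subst E_smult_comp) auto
   then have "E p \<odot> y \<in> ?l"
    using path_sub_base[OF sN, of "arrow_path Q \<alpha>" "E (fst p, xs) \<odot> y"] \<alpha> q add(3) by simp
   then show ?case using add path_sub_plus[OF sN] by blast
  qed
 qed
qed

lemma submodule_sum_arrows:
 assumes wf: "wf_digraph Q" and NP: "N \<subseteq> paths Q" and v: "v \<in> verts Q" and S: "S \<subseteq> in_arcs Q v"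
 shows "submodule_sum (vert M v) (\<lambda>\<alpha>. rep_path_image (rep_of M) (arrow_path Q \<alpha>)) S = path_sub M (arrow_path Q ` S)"
proof -
 interpret V: left_module A "vert M v" by (rule left_module_vert[OF v])
 have "submodule_sum (vert M v) (rep_path_image (rep_of M)) (arrow_path Q ` S) = path_sub M (arrow_path Q ` S)"
  using S arrow_N by (intro submodule_sum_paths[OF wf NP v]) auto
 moreover have "submodule_sum (vert M v) (\<lambda>\<alpha>. rep_path_image (rep_of M) (arrow_path Q \<alpha>)) S =
  gspan (vert M v) (\<Union>\<alpha>\<in>S. rep_path_image (rep_of M) (arrow_path Q \<alpha>))"
 proof (rule submodule_sum_eq_gspan[OF V.M.abelian_group_axioms])
  show "finite S" using S finite_in_arcs finite_subset by blast
  fix \<alpha> assume "\<alpha> \<in> S"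
  then have a: "arrow_path Q \<alpha> \<in> N" "head Q \<alpha> = v" using S arrow_N by auto
  note im = rep_path_image_rep_of[OF wf NP a(1)]
  show "rep_path_image (rep_of M) (arrow_path Q \<alpha>) \<subseteq> carrier (vert M v)"
   using vert_E[OF a(1)] a(2) by (auto simp: im)
  show "\<zero>\<^bsub>vert M v\<^esub> \<in> rep_path_image (rep_of M) (arrow_path Q \<alpha>)"
   using a(1) by (auto simp: im E_closed intro!: exI[of _ "\<zero>"])
  show "x \<oplus>\<^bsub>vert M v\<^esub> y \<in> rep_path_image (rep_of M) (arrow_path Q \<alpha>)"
   if "x \<in> rep_path_image (rep_of M) (arrow_path Q \<alpha>)" "y \<in> rep_path_image (rep_of M) (arrow_path Q \<alpha>)" for x y
   using that E_smult_add[OF a(1)] by (auto simp: im) (metis M.M.a_closed)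
 qed
 moreover have "gspan (vert M v) (\<Union>\<alpha>\<in>S. rep_path_image (rep_of M) (arrow_path Q \<alpha>)) =
  gspan M (\<Union>\<alpha>\<in>S. rep_path_image (rep_of M) (arrow_path Q \<alpha>))"
  by (rule gspan_cong) (simp_all add: vert_def)
 moreover have "(\<Union>\<alpha>\<in>S. rep_path_image (rep_of M) (arrow_path Q \<alpha>)) =
   (\<Union>\<alpha>\<in>S. {E (arrow_path Q \<alpha>) \<odot> y | y. y \<in> carrier M})"
  using rep_path_image_rep_of[OF wf NP arrow_N] S by (intro SUP_cong refl) (simp add: subset_iff)
 moreover have "\<dots> = {E p \<odot> y | p y. p \<in> arrow_path Q ` S \<and> y \<in> carrier M}"
  by blast
 ultimately show ?thesis by (simp add: path_sub_def)
qed

lemma rep_radical_rep_of: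
 assumes wf: "wf_digraph Q" and NP: "N \<subseteq> paths Q" and v: "v \<in> verts Q"
 shows "rep_radical Q (rep_of M) v = path_sub M (rad v)"
proof -
 have "last (snd p) \<in> in_arcs Q v" if p: "p \<in> N" "path_end Q p = v" "snd p \<noteq> []" for p
 proof -
  obtain xs \<alpha> where x: "snd p = xs @ [\<alpha>]" using p(3) by (cases "snd p" rule: rev_cases) auto
  have pN: "(fst p, xs @ [\<alpha>]) \<in> N" using p(1) x by (metis prod.collapse)
  have "\<alpha> \<in> arcs Q" using N_factors(2)[OF pN] N_arrow by auto
  then show ?thesis using p x by (simp add: path_end_eq)
 qed
 then have "rad v = {p \<in> N. path_end Q p = v \<and> snd p \<noteq> [] \<and> last (snd p) \<in> in_arcs Q v}"
  by (auto simp: rad_def)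
 then show ?thesis
  using submodule_sum_arrows[OF wf NP v order_refl] path_sub_arrows[OF order_refl]
  by (simp add: rep_radical_def rep_of_simps)
qed

lemma quiver_representation_rep_of:
 assumes wf: "wf_digraph Q" and NP: "N \<subseteq> paths Q" and fg: "finitely_generated L M"
  and nz: "\<And>p. p \<in> paths Q \<Longrightarrow> nonzero_path K I p \<longleftrightarrow> p \<in> N"
 shows "quiver_representation K A Q I (rep_of M)"
 unfolding quiver_representation_def
proof (intro conjI ballI impI)
 fix v assume v: "v \<in> verts Q"
 show "left_module A (rep_space (rep_of M) v)" using left_module_vert[OF v] by (simp add: rep_of_def)
 obtain S where S: "finite S" "S \<subseteq> carrier M"
  and gen: "\<And>x. x \<in> carrier M \<Longrightarrow> \<exists>c \<in> S \<rightarrow> carrier L. x = (\<Oplus>s\<in>S. c s \<odot> s)"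
  using fg unfolding finitely_generated_def by (elim exE conjE) (rule that, auto)
 define T where "T = (\<lambda>(p, s). E p \<odot> s) ` ({p \<in> N. path_end Q p = v} \<times> S)"
 have "finitely_generated A (vert M v)"
 proof (rule finitely_generatedI[OF left_module_vert[OF v]])
  show "finite T" using finite_N S(1) by (simp add: T_def)
  show "T \<subseteq> carrier (vert M v)"
   using S(2) by (auto simp: T_def intro!: vert_E)
  fix H x assume H: "submod A (vert M v) H" "T \<subseteq> H" and x: "x \<in> carrier (vert M v)"
  \<comment> \<open>The elements that every nonzero path into v sends into H. They form a
    \<Lambda>-submodule containing the generators S of M, hence contain x; the trivial path at v
    then gives x in H.\<close>
  define H' where "H' = {x \<in> carrier M. \<forall>p\<in>N. path_end Q p = v \<longrightarrow> E p \<odot> x \<in> H}"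
  have H0: "\<zero> \<in> H" and Ha: "\<And>x y. x \<in> H \<Longrightarrow> y \<in> H \<Longrightarrow> x \<oplus> y \<in> H"
   and Hs: "\<And>a x. a \<in> carrier A \<Longrightarrow> x \<in> H \<Longrightarrow> \<iota> a \<odot> x \<in> H"
   using H(1) by (auto simp: submod_def)
  have "submod L M H'"
   unfolding submod_def
  proof (intro conjI ballI)
   show "H' \<subseteq> carrier M" by (auto simp: H'_def)
   show "\<zero> \<in> H'" using H0 by (simp add: H'_def E_closed)
   show "x \<oplus> y \<in> H'" if "x \<in> H'" "y \<in> H'" for x y
    using that Ha by (simp add: H'_def E_smult_add)
   fix l x assume l: "l \<in> carrier L" and x: "x \<in> H'"
   have xc: "x \<in> carrier M" using x by (simp add: H'_def)
   have "E p \<odot> (l \<odot> x) \<in> H" if p: "p \<in> N" "path_end Q p = v" for p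
    using l
   proof (induction l rule: L_ind)
    case zero then show ?case using H0 p xc by (simp add: E_closed)
   next
    case (add a q m)
    have "E p \<odot> ((\<iota> a \<otimes>\<^sub>L E q \<oplus>\<^sub>L m) \<odot> x) = \<iota> a \<odot> (E p \<odot> (E q \<odot> x)) \<oplus> E p \<odot> (m \<odot> x)"
     using add p xc by (simp add: M.smult_l_distr E_closed M.smult_assoc1 E_smult_add \<iota>_E_smult)
    moreover have "E p \<odot> (E q \<odot> x) \<in> H"
     using x p add(2) H0 by (auto simp: E_smult_comp H'_def)
    ultimately show ?case using Ha[OF Hs[OF add(1)] add.IH] by simp
   qed
   then show "l \<odot> x \<in> H'" using l xc by (simp add: H'_def)
  qed
  moreover have "S \<subseteq> H'" using H(2) S(2) by (auto simp: H'_def T_def)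
  moreover have xM: "x \<in> carrier M" "E (v, []) \<odot> x = x" using x vert_iff[OF v] by auto
  moreover obtain c where "c \<in> S \<rightarrow> carrier L" "x = (\<Oplus>s\<in>S. c s \<odot> s)" using gen[OF xM(1)] by blast
  ultimately have "x \<in> H'"
   using submod_finsum[OF M.left_module_axioms, of H' S "\<lambda>s. c s \<odot> s"] S(1) by (auto simp: submod_def Pi_iff subset_iff)
  then show "x \<in> H" using xM(2) N_trivial[OF v] by (auto simp: H'_def)
 qed
 then show "finitely_generated A (rep_space (rep_of M) v)" by (simp add: rep_of_def)
next
 fix \<alpha> assume \<alpha>: "\<alpha> \<in> arcs Q"
 note a = arrow_N[OF \<alpha>]
 have t: "tail Q \<alpha> \<in> verts Q" and h: "head Q \<alpha> \<in> verts Q" using N_verts[OF a] by simp_all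
 have "(\<lambda>x. E (arrow_path Q \<alpha>) \<odot> x) \<in> module_hom A (vert M (tail Q \<alpha>)) (vert M (head Q \<alpha>))"
  using E_smult_end[OF a] a
  by (intro module_homI) (auto simp: vert_iff[OF t] vert_iff[OF h] E_smult_add \<iota>_E_smult)
 then show "rep_map (rep_of M) \<alpha> \<in> module_hom A (rep_space (rep_of M) (tail Q \<alpha>)) (rep_space (rep_of M) (head Q \<alpha>))"
  by (simp add: rep_of_def)
next
 fix p x assume p: "p \<in> paths Q" "\<not> nonzero_path K I p" and x: "x \<in> carrier (rep_space (rep_of M) (path_start p))"
 have v: "fst p \<in> verts Q" using paths_verts[OF wf p(1)] by simp
 have "x \<in> carrier M" "E (fst p, []) \<odot> x = x" using x vert_iff[OF v] by (auto simp: rep_of_def path_start_def)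
 then have "rep_path (rep_of M) p x = \<zero>"
  using rep_path_rep_of[OF wf, of "fst p" "snd p" x] p nz[OF p(1)] by simp
 then show "rep_path (rep_of M) p x = \<zero>\<^bsub>rep_space (rep_of M) (path_end Q p)\<^esub>" by (simp add: rep_of_def)
qed

text \<open>The set K of an arrow is the colon (0 : \<alpha>). A trivial path cannot annihilate
  \<alpha>, which accounts for the positive length in \<open>K_paths\<close>.\<close>

lemma K_paths_colon:
 assumes wf: "wf_digraph Q" and NP: "N \<subseteq> paths Q" and \<alpha>: "\<alpha> \<in> arcs Q"
  and nz: "\<And>p. p \<in> paths Q \<Longrightarrow> nonzero_path K I p \<longleftrightarrow> p \<in> N"
 shows "K_paths K Q I (arrow_path Q \<alpha>) = colon {} (arrow_path Q \<alpha>)"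
proof -
 note a = arrow_N[OF \<alpha>]
 have "path_comp (arrow_path Q \<alpha>) q \<in> N" if "path_end Q q = tail Q \<alpha>" "snd q = []" for q
 proof -
  have "q = (tail Q \<alpha>, [])" using that by (simp add: path_end_eq prod_eq_iff)
  then show ?thesis using a path_comp_Nil(1)[of "arrow_path Q \<alpha>"] by simp
 qed
 moreover have "nonzero_path K I (path_comp (arrow_path Q \<alpha>) q) \<longleftrightarrow> path_comp (arrow_path Q \<alpha>) q \<in> N"
  if "q \<in> paths Q" "path_end Q q = tail Q \<alpha>" for q
  using paths_comp[OF wf, of q "arrow_path Q \<alpha>"] that a NP by (intro nz) auto
 ultimately show ?thesis
  using NP nz by (auto simp: K_paths_def colon_def path_start_def path_length_def Suc_le_eq)
qed

text \<open>For (m1), a summand \<beta> y of a vanishing sum lies in J M, where J consists of the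
  nontrivial paths into v whose last arrow is not \<beta>. Flatness puts y, at the start of \<beta>,
  into (J : \<beta>) M. No product \<beta> r lies in J, so (J : \<beta>) consists of paths killed by
  \<beta>, and \<beta> y = 0. Condition (m2) is flatness for the empty right ideal.\<close>

lemma flat_imp_monic:
 assumes wf: "wf_digraph Q" and NP: "N \<subseteq> paths Q" and fg: "finitely_generated L M"
  and nz: "\<And>p. p \<in> paths Q \<Longrightarrow> nonzero_path K I p \<longleftrightarrow> p \<in> N" and flat: "flat M"
 shows "monic_rep K A Q I (rep_of M)"
 unfolding monic_rep_def
proof (intro conjI ballI quiver_representation_rep_of[OF wf NP fg nz])
 have re: "right_ideal {}" by (simp add: right_ideal_def)
 fix v assume v: "v \<in> verts Q"
 interpret V: left_module A "vert M v" by (rule left_module_vert[OF v])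
 have "\<forall>\<alpha>\<in>in_arcs Q v. x \<alpha> = \<zero>"
  if x: "\<And>\<alpha>. \<alpha> \<in> in_arcs Q v \<Longrightarrow> x \<alpha> \<in> rep_path_image (rep_of M) (arrow_path Q \<alpha>)"
   and sum: "(\<Oplus>\<^bsub>vert M v\<^esub>\<alpha>\<in>in_arcs Q v. x \<alpha>) = \<zero>" for x
 proof
  fix \<beta> assume \<beta>: "\<beta> \<in> in_arcs Q v"
  have \<beta>a: "\<beta> \<in> arcs Q" "head Q \<beta> = v" using \<beta> by auto
  note b = arrow_N[OF \<beta>a(1)]
  obtain y where y: "y \<in> carrier M" "x \<beta> = E (arrow_path Q \<beta>) \<odot> y"
   using x[OF \<beta>] rep_path_image_rep_of[OF wf NP b] by auto
  have xv: "x \<alpha> \<in> carrier (vert M v)" if "\<alpha> \<in> in_arcs Q v" for \<alpha>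
  proof -
   have a: "arrow_path Q \<alpha> \<in> N" "head Q \<alpha> = v" using that arrow_N by auto
   show ?thesis using x[OF that] rep_path_image_rep_of[OF wf NP a(1)] vert_E[OF a(1)] a(2) by auto
  qed
  let ?S = "in_arcs Q v - {\<beta>}"
  let ?J = "{p \<in> N. path_end Q p = v \<and> snd p \<noteq> [] \<and> last (snd p) \<in> ?S}"
  have JN: "?J \<subseteq> N" by blast
  have J: "right_ideal ?J" by (auto simp: right_ideal_def)
  have "(\<Oplus>\<^bsub>vert M v\<^esub>\<alpha>\<in>?S. x \<alpha>) \<in> submodule_sum (vert M v) (\<lambda>\<alpha>. rep_path_image (rep_of M) (arrow_path Q \<alpha>)) ?S"
   using x unfolding submodule_sum_def by blast
  then have s: "(\<Oplus>\<^bsub>vert M v\<^esub>\<alpha>\<in>?S. x \<alpha>) \<in> path_sub M ?J"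
   using submodule_sum_arrows[OF wf NP v, of ?S] path_sub_arrows[of ?S v] by blast
  have "\<zero> = (\<Oplus>\<^bsub>vert M v\<^esub>\<alpha>\<in>insert \<beta> ?S. x \<alpha>)" using \<beta> sum by (simp add: insert_absorb)
  also have "\<dots> = x \<beta> \<oplus>\<^bsub>vert M v\<^esub> (\<Oplus>\<^bsub>vert M v\<^esub>\<alpha>\<in>?S. x \<alpha>)"
   using finite_in_arcs xv \<beta> by (intro V.M.finsum_insert) auto
  finally have "x \<beta> \<oplus> (\<Oplus>\<^bsub>vert M v\<^esub>\<alpha>\<in>?S. x \<alpha>) = \<zero>" by simp
  then have "x \<beta> = \<ominus> (\<Oplus>\<^bsub>vert M v\<^esub>\<alpha>\<in>?S. x \<alpha>)"
   using M.M.minus_equality[of "x \<beta>"] xv[OF \<beta>] path_sub_closed[OF JN s] by (simp add: vert_iff[OF v])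
  then have "E (arrow_path Q \<beta>) \<odot> y \<in> path_sub M ?J" using path_sub_minus[OF JN s] y(2) by simp
  then have "E (tail Q \<beta>, []) \<odot> y \<in> path_sub M (colon ?J (arrow_path Q \<beta>))"
   using flatD[OF flat b J y(1)] by simp
  then have "E (arrow_path Q \<beta>) \<odot> (E (tail Q \<beta>, []) \<odot> y) \<in> path_sub M {}"
   by (rule path_sub_path[OF right_idealD(1)[OF right_ideal_colon[OF J b]] empty_subsetI b])
    (auto simp: colon_def)
  then show "x \<beta> = \<zero>" using path_sub_empty E_smult_fst[OF b y(1)] y(2) by simp
 qed
 then show "sum_is_direct (rep_space (rep_of M) v) (\<lambda>\<alpha>. rep_path_image (rep_of M) (arrow_path Q \<alpha>)) (in_arcs Q v)"
  unfolding sum_is_direct_def by (auto simp: rep_of_simps)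
next
 have re: "right_ideal {}" by (simp add: right_ideal_def)
 fix \<alpha> assume \<alpha>: "\<alpha> \<in> arcs Q"
 note a = arrow_N[OF \<alpha>]
 have t: "tail Q \<alpha> \<in> verts Q" using N_verts[OF a] by simp
 note CN = right_idealD(1)[OF right_ideal_colon[OF re a]]
 have "hom_ker (vert M (tail Q \<alpha>)) (vert M (head Q \<alpha>)) (\<lambda>x. E (arrow_path Q \<alpha>) \<odot> x) = path_sub M (colon {} (arrow_path Q \<alpha>))"
 proof
  show "hom_ker (vert M (tail Q \<alpha>)) (vert M (head Q \<alpha>)) (\<lambda>x. E (arrow_path Q \<alpha>) \<odot> x) \<subseteq> path_sub M (colon {} (arrow_path Q \<alpha>))"
  proof
   fix x assume "x \<in> hom_ker (vert M (tail Q \<alpha>)) (vert M (head Q \<alpha>)) (\<lambda>x. E (arrow_path Q \<alpha>) \<odot> x)"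
   then have x: "x \<in> carrier M" "E (tail Q \<alpha>, []) \<odot> x = x" "E (arrow_path Q \<alpha>) \<odot> x = \<zero>"
    by (auto simp: hom_ker_def vert_iff[OF t])
   then show "x \<in> path_sub M (colon {} (arrow_path Q \<alpha>))"
    using flatD[OF flat a re x(1)] path_sub_zero by simp
  qed
  show "path_sub M (colon {} (arrow_path Q \<alpha>)) \<subseteq> hom_ker (vert M (tail Q \<alpha>)) (vert M (head Q \<alpha>)) (\<lambda>x. E (arrow_path Q \<alpha>) \<odot> x)"
  proof
   fix x assume x: "x \<in> path_sub M (colon {} (arrow_path Q \<alpha>))"
   have "E (arrow_path Q \<alpha>) \<odot> x \<in> path_sub M {}"
    by (rule path_sub_path[OF CN empty_subsetI a x]) (auto simp: colon_def)
   then have "E (arrow_path Q \<alpha>) \<odot> x = \<zero>" by (rule path_sub_empty)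
   moreover have "x \<in> carrier (vert M (tail Q \<alpha>))"
    using path_sub_vert[OF CN t] x by (auto simp: colon_def)
   ultimately show "x \<in> hom_ker (vert M (tail Q \<alpha>)) (vert M (head Q \<alpha>)) (\<lambda>x. E (arrow_path Q \<alpha>) \<odot> x)"
    by (simp add: hom_ker_def)
  qed
 qed
 moreover have "submodule_sum (vert M (tail Q \<alpha>)) (rep_path_image (rep_of M)) (colon {} (arrow_path Q \<alpha>)) = path_sub M (colon {} (arrow_path Q \<alpha>))"
  by (rule submodule_sum_paths[OF wf NP t CN]) (simp add: colon_def)
 ultimately show "hom_ker (rep_space (rep_of M) (tail Q \<alpha>)) (rep_space (rep_of M) (head Q \<alpha>)) (rep_map (rep_of M) \<alpha>) =
   submodule_sum (rep_space (rep_of M) (tail Q \<alpha>)) (rep_path_image (rep_of M)) (K_paths K Q I (arrow_path Q \<alpha>))"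
  using K_paths_colon[OF wf NP \<alpha> nz] by (simp add: rep_of_simps)
qed

text \<open>Induction along p = \<beta> p', removing the last arrow. At the end of p an element of J
  M splits as \<beta> z1 + w with z1 in (J : \<beta>) M and w coming through the other arrows. Then
  (m1) gives \<beta> (p' x - z1) = 0, and (m2) puts p' x - z1 into (0 : \<beta>) M. So p' x lies in
  (J : \<beta>) M, and the induction hypothesis is used for p' and (J : \<beta>), which is why J is
  generalised.\<close>

lemma monic_imp_flat:
 assumes wf: "wf_digraph Q" and NP: "N \<subseteq> paths Q"
  and nz: "\<And>p. p \<in> paths Q \<Longrightarrow> nonzero_path K I p \<longleftrightarrow> p \<in> N" and monic: "monic_rep K A Q I (rep_of M)"
 shows "flat M"
proof -
 have rs: "rep_space (rep_of M) = vert M" and rm: "rep_map (rep_of M) = (\<lambda>\<alpha> x. E (arrow_path Q \<alpha>) \<odot> x)"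
  by (simp_all add: rep_of_def)
 have m1: "sum_is_direct (vert M v) (\<lambda>\<alpha>. rep_path_image (rep_of M) (arrow_path Q \<alpha>)) (in_arcs Q v)" if "v \<in> verts Q" for v
  using monic that unfolding monic_rep_def rs by blast
 have re: "right_ideal {}" by (simp add: right_ideal_def)
 have m2: "x \<in> path_sub M (colon {} (arrow_path Q \<alpha>))"
  if \<alpha>: "\<alpha> \<in> arcs Q" and x: "x \<in> carrier (vert M (tail Q \<alpha>))" "E (arrow_path Q \<alpha>) \<odot> x = \<zero>" for \<alpha> x
 proof -
  note a = arrow_N[OF \<alpha>]
  have t: "tail Q \<alpha> \<in> verts Q" using N_verts[OF a] by simp
  note CN = right_idealD(1)[OF right_ideal_colon[OF re a]]
  have "hom_ker (vert M (tail Q \<alpha>)) (vert M (head Q \<alpha>)) (\<lambda>x. E (arrow_path Q \<alpha>) \<odot> x) =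
   submodule_sum (vert M (tail Q \<alpha>)) (rep_path_image (rep_of M)) (K_paths K Q I (arrow_path Q \<alpha>))"
   using monic \<alpha> unfolding monic_rep_def rs rm by blast
  also have "K_paths K Q I (arrow_path Q \<alpha>) = colon {} (arrow_path Q \<alpha>)"
   using K_paths_colon[OF wf NP \<alpha>] nz by blast
  also have "submodule_sum (vert M (tail Q \<alpha>)) (rep_path_image (rep_of M)) \<dots> = path_sub M (colon {} (arrow_path Q \<alpha>))"
   by (rule submodule_sum_paths[OF wf NP t CN]) (simp add: colon_def)
  finally show ?thesis using x by (auto simp: hom_ker_def)
 qed
 define J1 where "J1 \<beta> = {p \<in> N. path_end Q p = head Q \<beta> \<and> snd p \<noteq> [] \<and> last (snd p) \<in> in_arcs Q (head Q \<beta>) - {\<beta>}}" for \<beta>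
 have J1N: "J1 \<beta> \<subseteq> N" for \<beta> by (auto simp: J1_def)
 have m1': "E (arrow_path Q \<beta>) \<odot> y = \<zero>"
  if \<beta>: "\<beta> \<in> arcs Q" and y: "y \<in> carrier M" and z: "z \<in> path_sub M (J1 \<beta>)" and eq: "E (arrow_path Q \<beta>) \<odot> y \<oplus> z = \<zero>" for \<beta> y z
 proof -
  note b = arrow_N[OF \<beta>]
  define v where "v = head Q \<beta>"
  have v: "v \<in> verts Q" using N_verts[OF b] by (simp add: v_def)
  interpret V: left_module A "vert M v" by (rule left_module_vert[OF v])
  let ?S = "in_arcs Q v - {\<beta>}"
  have S: "?S \<subseteq> in_arcs Q v" by blast
  have "z \<in> submodule_sum (vert M v) (\<lambda>\<alpha>. rep_path_image (rep_of M) (arrow_path Q \<alpha>)) ?S"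
   using z submodule_sum_arrows[OF wf NP v S] path_sub_arrows[OF S] by (simp add: J1_def v_def)
  then obtain x where x: "\<forall>\<alpha>\<in>?S. x \<alpha> \<in> rep_path_image (rep_of M) (arrow_path Q \<alpha>)" "z = (\<Oplus>\<^bsub>vert M v\<^esub>\<alpha>\<in>?S. x \<alpha>)"
   unfolding submodule_sum_def by blast
  \<comment> \<open>(m1) is applied to the family with the value
    \<open>E (arrow_path Q \<beta>) \<odot> y\<close> at \<beta> and the summands of z at the other
    arrows.\<close>
  define x' where "x' = x(\<beta> := E (arrow_path Q \<beta>) \<odot> y)"
  have \<beta>v: "\<beta> \<in> in_arcs Q v" using \<beta> by (simp add: v_def)
  have x': "\<forall>\<alpha>\<in>in_arcs Q v. x' \<alpha> \<in> rep_path_image (rep_of M) (arrow_path Q \<alpha>)"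
   using x(1) rep_path_image_rep_of[OF wf NP b] y by (auto simp: x'_def)
  have xv: "x' \<alpha> \<in> carrier (vert M v)" if "\<alpha> \<in> in_arcs Q v" for \<alpha>
  proof -
   have a: "arrow_path Q \<alpha> \<in> N" "head Q \<alpha> = v" using that arrow_N by auto
   have "x' \<alpha> \<in> rep_path_image (rep_of M) (arrow_path Q \<alpha>)" using x' that by blast
   then show ?thesis using rep_path_image_rep_of[OF wf NP a(1)] vert_E[OF a(1)] a(2) by auto
  qed
  have "(\<Oplus>\<^bsub>vert M v\<^esub>\<alpha>\<in>in_arcs Q v. x' \<alpha>) = (\<Oplus>\<^bsub>vert M v\<^esub>\<alpha>\<in>insert \<beta> ?S. x' \<alpha>)" using \<beta>v by (simp add: insert_absorb)
  also have "\<dots> = x' \<beta> \<oplus>\<^bsub>vert M v\<^esub> (\<Oplus>\<^bsub>vert M v\<^esub>\<alpha>\<in>?S. x' \<alpha>)"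
   using finite_in_arcs xv \<beta>v by (intro V.M.finsum_insert) auto
  also have "(\<Oplus>\<^bsub>vert M v\<^esub>\<alpha>\<in>?S. x' \<alpha>) = z"
  proof -
   have "x \<alpha> \<in> carrier (vert M v)" if "\<alpha> \<in> ?S" for \<alpha> using xv[of \<alpha>] that by (simp add: x'_def)
   then show ?thesis unfolding x(2) by (intro V.M.finsum_cong') (auto simp: x'_def)
  qed
  finally have "(\<Oplus>\<^bsub>vert M v\<^esub>\<alpha>\<in>in_arcs Q v. x' \<alpha>) = \<zero>\<^bsub>vert M v\<^esub>" using eq by (simp add: x'_def)
  then have "x' \<beta> = \<zero>\<^bsub>vert M v\<^esub>" using m1[OF v] x' \<beta>v unfolding sum_is_direct_def by blast
  then show ?thesis by (simp add: x'_def)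
 qed
 have main: "E (u, []) \<odot> x \<in> path_sub M (colon J (u, es))"
  if "(u, es) \<in> N" "right_ideal J" "x \<in> carrier M" "E (u, es) \<odot> x \<in> path_sub M J" for u es J x
  using that
 proof (induction es arbitrary: J rule: rev_induct)
  case Nil
  note CN = right_idealD(1)[OF right_ideal_colon[OF Nil.prems(2,1)]]
  have "E (u, []) \<odot> (E (u, []) \<odot> x) \<in> path_sub M (colon J (u, []))"
   by (rule path_sub_path[OF right_idealD(1)[OF Nil.prems(2)] CN Nil.prems(1,4)]) (auto simp: colon_def)
  then show ?case using E_smult_fst[OF Nil.prems(1,3)] by simp
 next
  case (snoc \<beta> xs)
  note J = snoc.prems(2) and JN = right_idealD(1)[OF snoc.prems(2)] and x = snoc.prems(3)
  note p' = N_factors(1)[OF snoc.prems(1)]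
  have \<beta>: "\<beta> \<in> arcs Q" "path_end Q (u, xs) = tail Q \<beta>" using N_factors(2)[OF snoc.prems(1)] N_arrow by auto
  define v where "v = head Q \<beta>"
  let ?b = "arrow_path Q \<beta>"
  note b = arrow_N[OF \<beta>(1)]
  have v: "v \<in> verts Q" and t: "tail Q \<beta> \<in> verts Q" using N_verts[OF b] by (simp_all add: v_def)
  have c: "path_comp ?b (u, xs) = (u, xs @ [\<beta>])" by (simp add: path_comp_def)
  have pv: "path_end Q (u, xs @ [\<beta>]) = v" by (simp add: path_end_eq v_def)
  note CN = right_idealD(1)[OF right_ideal_colon[OF J snoc.prems(1)]]
  have uN: "(u, []) \<in> N" using triv_N[OF p'] by simp
  show ?case
  proof (cases "(v, []) \<in> J")
   \<comment> \<open>With the trivial path at the end of p in J, the colon contains the trivial path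
     at u, and the claim holds for every x. In the other case each path of J ending at v has a last
     arrow, and \<open>split\<close> sorts by whether it is \<beta>.\<close>
   case True
   have "(u, []) \<in> colon J (u, xs @ [\<beta>])"
    using right_idealD(2)[OF J True, of "(u, xs @ [\<beta>])"] pv uN by (simp add: colon_def path_comp_def)
   then show ?thesis using path_sub_base[OF CN _ x] by blast
  next
   case False
   note cb = right_ideal_colon[OF J b]
   note cbN = right_idealD(1)[OF cb]
   have split: "\<exists>z1\<in>path_sub M (colon J ?b). \<exists>w\<in>path_sub M (J1 \<beta>). E (v, []) \<odot> z = E ?b \<odot> z1 \<oplus> w"
    if "z \<in> path_sub M J" for z
    using JN that
   proof (induction z rule: path_sub_induct)
    case zero
    show ?case using N_trivial[OF v] b path_sub_zero
     by (intro bexI[of _ "\<zero>"]) (simp_all add: E_closed)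
   next
    case (add q y z)
    then obtain z1 w where z1: "z1 \<in> path_sub M (colon J ?b)" and w: "w \<in> path_sub M (J1 \<beta>)"
     and eq: "E (v, []) \<odot> z = E ?b \<odot> z1 \<oplus> w" by blast
    have z1c: "z1 \<in> carrier M" and wc: "w \<in> carrier M" using path_sub_closed[OF cbN z1] path_sub_closed[OF J1N w] .
    note vN = N_trivial[OF v]
    have sum: "E (v, []) \<odot> (E q \<odot> y \<oplus> z) = E (v, []) \<odot> (E q \<odot> y) \<oplus> (E ?b \<odot> z1 \<oplus> w)"
     using add vN eq by (simp add: E_smult_add)
    show ?case
    proof (cases "path_end Q q = v")
     case True
     have Eq: "E (v, []) \<odot> (E q \<odot> y) = E q \<odot> y" using E_smult_end[OF add(2,3)] True by simp
     have "snd q \<noteq> []"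
     proof
      assume "snd q = []"
      then have "q = (v, [])" using True by (simp add: path_end_eq prod_eq_iff)
      then show False using \<open>(v, []) \<notin> J\<close> add(1) by simp
     qed
     then obtain ys \<alpha> where q: "snd q = ys @ [\<alpha>]" by (cases "snd q" rule: rev_cases) auto
     have qN: "(fst q, ys @ [\<alpha>]) \<in> N" using add(2) q by (metis prod.collapse)
     have \<alpha>: "\<alpha> \<in> arcs Q" "path_end Q (fst q, ys) = tail Q \<alpha>" using N_factors(2)[OF qN] N_arrow by auto
     note q' = N_factors(1)[OF qN]
     have \<alpha>v: "head Q \<alpha> = v" using True q by (simp add: path_end_eq)
     have qc: "path_comp (arrow_path Q \<alpha>) (fst q, ys) = q" using q by (simp add: prod_eq_iff)
     show ?thesis
     proof (cases "\<alpha> = \<beta>")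
      case True
      have "E q \<odot> y = E ?b \<odot> (E (fst q, ys) \<odot> y)"
       using E_smult_comp[OF b q' add(3)] \<alpha> qc add(2) True by simp
      moreover have qy: "E (fst q, ys) \<odot> y \<in> path_sub M (colon J ?b)"
       using path_sub_base[OF cbN _ add(3)] q' \<alpha> qc add(1) True by (simp add: colon_def)
      ultimately have "E (v, []) \<odot> (E q \<odot> y \<oplus> z) = E ?b \<odot> (E (fst q, ys) \<odot> y \<oplus> z1) \<oplus> w"
       using sum Eq z1c wc b add(3) q' by (simp add: E_smult_add M.M.a_assoc)
      then show ?thesis using path_sub_plus[OF cbN qy z1] w by blast
     next
      case False
      have "q \<in> J1 \<beta>" using add(2) \<open>path_end Q q = v\<close> q \<alpha>(1) \<alpha>v False by (simp add: J1_def v_def)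
      then have qy: "E q \<odot> y \<in> path_sub M (J1 \<beta>)" using path_sub_base[OF J1N _ add(3)] by blast
      have "E (v, []) \<odot> (E q \<odot> y \<oplus> z) = E ?b \<odot> z1 \<oplus> (E q \<odot> y \<oplus> w)"
       using sum Eq z1c wc b add(2,3) by (simp add: M.M.a_lcomm)
      then show ?thesis using path_sub_plus[OF J1N qy w] z1 by blast
     qed
    next
     case False
     then have "E (v, []) \<odot> (E q \<odot> y) = \<zero>" using E_smult_comp[OF vN add(2,3)] by simp
     then show ?thesis using sum z1 w z1c wc b by (intro bexI[OF _ z1] bexI[OF _ w]) simp
    qed
   qed
   define X where "X = E (u, xs) \<odot> x"
   have Xc: "X \<in> carrier M" using x p' by (simp add: X_def)
   have EX: "E (u, xs @ [\<beta>]) \<odot> x = E ?b \<odot> X"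
    unfolding X_def using E_smult_comp[OF b p' x] \<beta>(2) c snoc.prems(1) by simp
   obtain z1 w where z1: "z1 \<in> path_sub M (colon J ?b)" and w: "w \<in> path_sub M (J1 \<beta>)"
    and eq: "E (v, []) \<odot> (E (u, xs @ [\<beta>]) \<odot> x) = E ?b \<odot> z1 \<oplus> w"
    using split[OF snoc.prems(4)] by blast
   have z1c: "z1 \<in> carrier M" and wc: "w \<in> carrier M" using path_sub_closed[OF cbN z1] path_sub_closed[OF J1N w] .
   have eq': "E ?b \<odot> X = E ?b \<odot> z1 \<oplus> w"
    using eq E_smult_end[OF snoc.prems(1) x] pv EX by simp
   have "E ?b \<odot> (X \<ominus> z1) = w"
   proof -
    have "E ?b \<odot> (X \<ominus> z1) = (E ?b \<odot> z1 \<oplus> w) \<ominus> E ?b \<odot> z1"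
     using E_smult_diff[OF b Xc z1c] eq' by simp
    then show ?thesis using z1c wc b by (simp add: a_minus_def M.M.a_ac M.M.r_neg)
   qed
   then have "E ?b \<odot> (X \<ominus> z1) \<oplus> (\<ominus> w) = \<zero>" using wc by (simp add: M.M.r_neg)
   then have z: "E ?b \<odot> (X \<ominus> z1) = \<zero>"
    using m1'[OF \<beta>(1) _ path_sub_minus[OF J1N w]] Xc z1c by simp
   have "X \<in> carrier (vert M (tail Q \<beta>))" using E_smult_end[OF p' x] Xc \<beta>(2) by (simp add: vert_iff[OF t] X_def)
   moreover have "z1 \<in> carrier (vert M (tail Q \<beta>))"
    using path_sub_vert[OF cbN t] z1 by (auto simp: colon_def)
   ultimately have "X \<ominus> z1 \<in> carrier (vert M (tail Q \<beta>))"
    using N_trivial[OF t] by (simp add: vert_iff[OF t] E_smult_diff)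
   then have "X \<ominus> z1 \<in> path_sub M (colon {} ?b)" using m2[OF \<beta>(1) _ z] by blast
   moreover have "colon {} ?b \<subseteq> colon J ?b" by (auto simp: colon_def)
   ultimately have "X \<ominus> z1 \<in> path_sub M (colon J ?b)" using path_sub_mono by blast
   then have "X \<ominus> z1 \<oplus> z1 \<in> path_sub M (colon J ?b)" using path_sub_plus[OF cbN _ z1] by blast
   then have "X \<in> path_sub M (colon J ?b)" using M.M.minus_add_cancel[OF Xc z1c] by simp
   then have "E (u, []) \<odot> x \<in> path_sub M (colon (colon J ?b) (u, xs))"
    using snoc.IH[OF p' cb x] by (simp add: X_def)
   \<comment> \<open>The implications in the two colons compose because a factor of a nonzero path
     is nonzero.\<close>
   moreover have "colon (colon J ?b) (u, xs) \<subseteq> colon J (u, xs @ [\<beta>])"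
   proof
    fix r assume r: "r \<in> colon (colon J ?b) (u, xs)"
    have cc: "path_comp (u, xs @ [\<beta>]) r = path_comp ?b (path_comp (u, xs) r)"
     unfolding c[symmetric] by (rule path_comp_assoc)
    have "path_comp (u, xs @ [\<beta>]) r \<in> J" if N: "path_comp (u, xs @ [\<beta>]) r \<in> N"
    proof -
     have re: "path_end Q r = u" using r by (simp add: colon_def)
     have "path_comp (u, xs) r \<in> N"
      using N_comp(2)[of ?b "path_comp (u, xs) r"] N re \<beta>(2) unfolding cc by simp
     then have "path_comp (u, xs) r \<in> colon J ?b" using r by (simp add: colon_def)
     then show ?thesis using N unfolding cc by (simp add: colon_def)
    qed
    then show "r \<in> colon J (u, xs @ [\<beta>])" using r by (simp add: colon_def)
   qed
   ultimately show ?thesis using path_sub_mono by blast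
  qed
 qed
 show ?thesis
  unfolding flat_def
 proof (intro ballI allI impI)
  fix p J x assume "p \<in> N" "right_ideal J" "x \<in> carrier M" "E p \<odot> x \<in> path_sub M J"
  then show "E (fst p, []) \<odot> x \<in> path_sub M (colon J p)" using main[of "fst p" "snd p" J x] by simp
 qed
qed

end

context monomial_algebra
begin

theorem gorenstein_projective_iff_monic:
 assumes wf: "wf_digraph Q" and NP: "N \<subseteq> paths Q" and M: "left_module L M" "finitely_generated L M"
  and nz: "\<And>p. p \<in> paths Q \<Longrightarrow> nonzero_path K I p \<longleftrightarrow> p \<in> N"
 shows "gorenstein_projective L M \<longleftrightarrow> monic_rep K A Q I (rep_of M) \<and>
  (\<forall>i \<in> verts Q. gorenstein_projective A (rep_space (rep_of M) i) \<and>
   gorenstein_projective A (quot_module (rep_space (rep_of M) i) (rep_radical Q (rep_of M) i)))"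
proof -
 interpret M: monomial_module A L Q N \<iota> E co ht M by (rule module_locale) fact
 have "flat M \<longleftrightarrow> monic_rep K A Q I (rep_of M)"
  using M.flat_imp_monic[OF wf NP M(2) nz] M.monic_imp_flat[OF wf NP nz] by blast
 then show ?thesis
  unfolding gorenstein_projective_iff_flat[OF M(1)]
  by (simp add: top_module_def M.rep_radical_rep_of[OF wf NP] M.rep_of_simps)
qed

end

section \<open>Path algebras of acyclic quivers\<close>

text \<open>A repeated vertex would cut out a closed walk and hence give a cycle. So all walks have
  distinct vertices, and a finite digraph has only finitely many of these.\<close>

lemma (in fin_digraph) finite_paths:
 assumes "acyclic_quiver G"
 shows "finite (paths G)"
proof -
 have "distinct (awalk_verts u es)" if "awalk u es v" for u es v
 proof (rule ccontr)
  assume "\<not> distinct (awalk_verts u es)"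
  then obtain q r s w where "0 < length r" "awalk w r w" using awalk_not_distinct_decomp[OF \<open>awalk u es v\<close>] by blast
  then have "closed_w r" by (auto simp: closed_w_def)
  then show False using closed_w_imp_cycle assms unfolding acyclic_quiver_def by blast
 qed
 moreover have "(u, es) \<in> (\<lambda>(u, es, v). (u, es)) ` {(u, p, v). apath u p v}" if "apath u es v" for u es v
  by (rule image_eqI[of _ _ "(u, es, v)"]) (use that in simp_all)
 ultimately have "paths G \<subseteq> (\<lambda>(u, es, v). (u, es)) ` {(u, p, v). apath u p v}"
  unfolding paths_def apath_def by blast
 then show ?thesis using apaths_finite_triple finite_subset by blast
qed

text \<open>Cutting a list at i and its remainder at j amounts to cutting at m = i + j and then the
  initial part at i. This is the combinatorics behind associativity of the path algebra.\<close>

lemma (in abelian_monoid) finsum_triangle: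
 fixes n :: nat
 assumes F: "\<And>i m. F i m \<in> carrier G"
 shows "(\<Oplus>i\<in>{..n}. \<Oplus>j\<in>{..n - i}. F i (i + j)) = (\<Oplus>m\<in>{..n}. \<Oplus>i\<in>{..m}. F i m)"
proof (induction n)
 case 0
 then show ?case using F by simp
next
 case (Suc n)
 have "(\<Oplus>i\<in>{..Suc n}. \<Oplus>j\<in>{..Suc n - i}. F i (i + j)) =
   (\<Oplus>j\<in>{..Suc n - Suc n}. F (Suc n) (Suc n + j)) \<oplus> (\<Oplus>i\<in>{..n}. \<Oplus>j\<in>{..Suc n - i}. F i (i + j))"
  using F by (intro finsum_Suc) auto
 also have "(\<Oplus>j\<in>{..Suc n - Suc n}. F (Suc n) (Suc n + j)) = F (Suc n) (Suc n)" using F by simp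
 also have "(\<Oplus>i\<in>{..n}. \<Oplus>j\<in>{..Suc n - i}. F i (i + j)) =
   (\<Oplus>i\<in>{..n}. F i (Suc n) \<oplus> (\<Oplus>j\<in>{..n - i}. F i (i + j)))"
  using F by (intro finsum_cong') (auto simp: Suc_diff_le)
 also have "\<dots> = (\<Oplus>i\<in>{..n}. F i (Suc n)) \<oplus> (\<Oplus>m\<in>{..n}. \<Oplus>i\<in>{..m}. F i m)"
  using F by (subst finsum_addf) (auto simp: Suc.IH)
 also have "F (Suc n) (Suc n) \<oplus> \<dots> = (\<Oplus>i\<in>{..Suc n}. F i (Suc n)) \<oplus> (\<Oplus>m\<in>{..n}. \<Oplus>i\<in>{..m}. F i m)"
  using F by (simp add: a_assoc)
 also have "\<dots> = (\<Oplus>m\<in>{..Suc n}. \<Oplus>i\<in>{..m}. F i m)"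
  using F by simp
 finally show ?case .
qed

definition path_mono :: "('k, 'r) ring_scheme \<Rightarrow> 'k \<Rightarrow> ('v, 'e) path \<Rightarrow> ('v, 'e) path \<Rightarrow> 'k" where
 "path_mono K c p = (\<lambda>q. if q = p then c else \<zero>\<^sub>K)"

lemma path_elem_eq: "path_elem K p = path_mono K \<one>\<^sub>K p"
 by (simp add: path_elem_def path_mono_def)

locale acyclic_path_algebra = K: field K + fin_digraph Q
 for K :: "('k, 'r) ring_scheme" (structure) and Q :: "('v, 'e) pre_digraph" +
 assumes acyclic: "acyclic_quiver Q"
begin

abbreviation "PA \<equiv> path_algebra K Q"

lemma carrier_PA: "f \<in> carrier PA \<longleftrightarrow> (\<forall>p. f p \<in> carrier K) \<and> (\<forall>p. p \<notin> paths Q \<longrightarrow> f p = \<zero>)"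
proof -
 have "finite {p. f p \<noteq> \<zero>}" if "{p. f p \<noteq> \<zero>} \<subseteq> paths Q"
  using that finite_paths[OF acyclic] finite_subset by blast
 moreover have "f \<in> carrier PA \<longleftrightarrow> range f \<subseteq> carrier K \<and> {p. f p \<noteq> \<zero>} \<subseteq> paths Q \<and> finite {p. f p \<noteq> \<zero>}"
  by (simp add: path_algebra_def)
 ultimately show ?thesis by blast
qed

lemma PA_coeff: "f \<in> carrier PA \<Longrightarrow> f p \<in> carrier K"
 unfolding carrier_PA by blast

lemma PA_simps:
 "(f \<oplus>\<^bsub>PA\<^esub> g) p = f p \<oplus> g p" "\<zero>\<^bsub>PA\<^esub> p = \<zero>" "(c \<odot>\<^bsub>PA\<^esub> f) p = c \<otimes> f p"
 "\<one>\<^bsub>PA\<^esub> (u, es) = (if u \<in> verts Q \<and> es = [] then \<one> else \<zero>)"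
 "(f \<otimes>\<^bsub>PA\<^esub> g) (u, es) =
  (\<Oplus>i\<in>{..length es}. f (path_end Q (u, take i es), drop i es) \<otimes> g (u, take i es))"
 by (simp_all add: path_algebra_def)

lemma path_split:
 "(u, es) \<in> paths Q \<longleftrightarrow> (u, take i es) \<in> paths Q \<and> (path_end Q (u, take i es), drop i es) \<in> paths Q"
 using paths_append[OF wf_digraph_axioms, of u "take i es" "drop i es"] by simp

lemma PA_m_closed: "f \<in> carrier PA \<Longrightarrow> g \<in> carrier PA \<Longrightarrow> f \<otimes>\<^bsub>PA\<^esub> g \<in> carrier PA"
proof -
 assume f: "f \<in> carrier PA" and g: "g \<in> carrier PA"
 have "(f \<otimes>\<^bsub>PA\<^esub> g) (u, es) = \<zero>" if p: "(u, es) \<notin> paths Q" for u es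
 proof -
  have "f (path_end Q (u, take i es), drop i es) \<otimes> g (u, take i es) = \<zero>" for i
   using path_split[of u es i] p f g by (auto simp: carrier_PA)
  then show ?thesis by (simp add: PA_simps)
 qed
 then show ?thesis using PA_coeff[OF f] PA_coeff[OF g] by (auto simp: carrier_PA PA_simps)
qed

lemma PA_m_assoc:
 assumes f: "f \<in> carrier PA" and g: "g \<in> carrier PA" and h: "h \<in> carrier PA"
 shows "(f \<otimes>\<^bsub>PA\<^esub> g) \<otimes>\<^bsub>PA\<^esub> h = f \<otimes>\<^bsub>PA\<^esub> (g \<otimes>\<^bsub>PA\<^esub> h)"
proof (rule ext, clarify)
 fix u es
 let ?e = "\<lambda>i. path_end Q (u, take i es)"
 note [simp] = PA_coeff[OF f] PA_coeff[OF g] PA_coeff[OF h]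
 \<comment> \<open>The term for cutting a path into three parts, at positions i and m with i at most
   m.\<close>
 define F where "F i m = f (?e m, drop m es) \<otimes> (g (?e i, take (m - i) (drop i es)) \<otimes> h (u, take i es))" for i m
 have Fc: "F i m \<in> carrier K" for i m by (simp add: F_def)
 have e: "path_end Q (?e i, take j (drop i es)) = ?e (i + j)" for i j
  by (simp add: take_add path_end_eq)
 have "((f \<otimes>\<^bsub>PA\<^esub> g) \<otimes>\<^bsub>PA\<^esub> h) (u, es) = (\<Oplus>i\<in>{..length es}. \<Oplus>j\<in>{..length es - i}. F i (i + j))"
  unfolding PA_simps
 proof (intro K.finsum_cong' refl)
  fix i assume "i \<in> {..length es}"
  have "(\<Oplus>j\<in>{..length (drop i es)}. f (path_end Q (?e i, take j (drop i es)), drop j (drop i es)) \<otimes>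
    g (?e i, take j (drop i es))) \<otimes> h (u, take i es) =
   (\<Oplus>j\<in>{..length (drop i es)}. f (path_end Q (?e i, take j (drop i es)), drop j (drop i es)) \<otimes>
    g (?e i, take j (drop i es)) \<otimes> h (u, take i es))"
   by (intro K.finsum_ldistr) auto
  also have "\<dots> = (\<Oplus>j\<in>{..length es - i}. F i (i + j))"
   by (intro K.finsum_cong') (auto simp: F_def e K.m_assoc add.commute)
  finally show "(\<Oplus>j\<in>{..length (drop i es)}. f (path_end Q (?e i, take j (drop i es)), drop j (drop i es)) \<otimes>
    g (?e i, take j (drop i es))) \<otimes> h (u, take i es) = (\<Oplus>j\<in>{..length es - i}. F i (i + j))" .
 qed (auto simp: Fc)
 also have "\<dots> = (\<Oplus>m\<in>{..length es}. \<Oplus>i\<in>{..m}. F i m)"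
  by (rule K.finsum_triangle[OF Fc])
 also have "\<dots> = (f \<otimes>\<^bsub>PA\<^esub> (g \<otimes>\<^bsub>PA\<^esub> h)) (u, es)"
  unfolding PA_simps
 proof (intro K.finsum_cong' refl)
  fix m assume m: "m \<in> {..length es}"
  have "(\<Oplus>i\<in>{..m}. F i m) = (\<Oplus>i\<in>{..length (take m es)}. f (?e m, drop m es) \<otimes>
    (g (path_end Q (u, take i (take m es)), drop i (take m es)) \<otimes> h (u, take i (take m es))))"
   using m by (intro K.finsum_cong') (auto simp: F_def drop_take)
  also have "\<dots> = f (?e m, drop m es) \<otimes> (\<Oplus>i\<in>{..length (take m es)}.
    g (path_end Q (u, take i (take m es)), drop i (take m es)) \<otimes> h (u, take i (take m es)))"
   by (intro K.finsum_rdistr[symmetric]) auto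
  finally show "(\<Oplus>i\<in>{..m}. F i m) = f (?e m, drop m es) \<otimes> (\<Oplus>i\<in>{..length (take m es)}.
    g (path_end Q (u, take i (take m es)), drop i (take m es)) \<otimes> h (u, take i (take m es)))" .
 qed auto
 finally show "((f \<otimes>\<^bsub>PA\<^esub> g) \<otimes>\<^bsub>PA\<^esub> h) (u, es) = (f \<otimes>\<^bsub>PA\<^esub> (g \<otimes>\<^bsub>PA\<^esub> h)) (u, es)" .
qed

lemma finsum_delta:
 assumes "finite S" "i \<in> S" "c \<in> carrier K" "\<And>j. j \<in> S \<Longrightarrow> F j = (if j = i then c else \<zero>)"
 shows "(\<Oplus>j\<in>S. F j) = c"
proof -
 have "(\<Oplus>j\<in>S. F j) = (\<Oplus>j\<in>S. if i = j then c else \<zero>)"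
  using assms by (intro K.finsum_cong') auto
 then show ?thesis using K.finsum_singleton[OF assms(2,1), of "\<lambda>_. c"] assms(3) by simp
qed

lemma PA_one:
 assumes g: "g \<in> carrier PA"
 shows "\<one>\<^bsub>PA\<^esub> \<otimes>\<^bsub>PA\<^esub> g = g" "g \<otimes>\<^bsub>PA\<^esub> \<one>\<^bsub>PA\<^esub> = g"
proof -
 note [simp] = PA_coeff[OF g]
 show "\<one>\<^bsub>PA\<^esub> \<otimes>\<^bsub>PA\<^esub> g = g"
 proof (rule ext, clarify)
  fix u es
  have z: "g (u, es) = \<zero>" if "path_end Q (u, es) \<notin> verts Q"
   using that g paths_verts[OF wf_digraph_axioms, of "(u, es)"] by (auto simp: carrier_PA)
  show "(\<one>\<^bsub>PA\<^esub> \<otimes>\<^bsub>PA\<^esub> g) (u, es) = g (u, es)"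
   unfolding PA_simps by (rule finsum_delta[where i = "length es"]) (auto simp: z)
 qed
 show "g \<otimes>\<^bsub>PA\<^esub> \<one>\<^bsub>PA\<^esub> = g"
 proof (rule ext, clarify)
  fix u es
  have z: "g (u, es) = \<zero>" if "u \<notin> verts Q"
   using that g paths_verts[OF wf_digraph_axioms, of "(u, es)"] by (auto simp: carrier_PA)
  show "(g \<otimes>\<^bsub>PA\<^esub> \<one>\<^bsub>PA\<^esub>) (u, es) = g (u, es)"
   unfolding PA_simps by (rule finsum_delta[where i = 0]) (auto simp: z)
 qed
qed

lemma PA_abelian_group: "abelian_group PA"
proof (rule abelian_groupI)
 show "\<exists>y\<in>carrier PA. y \<oplus>\<^bsub>PA\<^esub> x = \<zero>\<^bsub>PA\<^esub>" if "x \<in> carrier PA" for x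
  using that by (intro bexI[of _ "\<lambda>p. \<ominus> x p"] ext) (auto simp: carrier_PA PA_simps K.l_neg)
qed (auto simp: carrier_PA PA_simps K.add.m_ac intro!: ext)

lemma PA_ring: "ring PA"
proof (rule ringI[OF PA_abelian_group])
 show "monoid PA"
 proof (rule monoidI)
  show "\<one>\<^bsub>PA\<^esub> \<in> carrier PA" by (auto simp: carrier_PA PA_simps paths_Nil[OF wf_digraph_axioms])
 qed (simp_all add: PA_m_closed PA_m_assoc PA_one)
 fix x y z assume xyz: "x \<in> carrier PA" "y \<in> carrier PA" "z \<in> carrier PA"
 note [simp] = xyz[THEN PA_coeff]
 show "(x \<oplus>\<^bsub>PA\<^esub> y) \<otimes>\<^bsub>PA\<^esub> z = x \<otimes>\<^bsub>PA\<^esub> z \<oplus>\<^bsub>PA\<^esub> y \<otimes>\<^bsub>PA\<^esub> z"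
  by (rule ext) (auto simp: PA_simps K.l_distr)
 show "z \<otimes>\<^bsub>PA\<^esub> (x \<oplus>\<^bsub>PA\<^esub> y) = z \<otimes>\<^bsub>PA\<^esub> x \<oplus>\<^bsub>PA\<^esub> z \<otimes>\<^bsub>PA\<^esub> y"
  by (rule ext) (auto simp: PA_simps K.r_distr)
qed

lemma PA_smult:
 assumes c: "c \<in> carrier K" and f: "f \<in> carrier PA"
 shows "c \<odot>\<^bsub>PA\<^esub> f \<in> carrier PA"
  and "g \<in> carrier PA \<Longrightarrow> (c \<odot>\<^bsub>PA\<^esub> f) \<otimes>\<^bsub>PA\<^esub> g = c \<odot>\<^bsub>PA\<^esub> (f \<otimes>\<^bsub>PA\<^esub> g)"
  and "g \<in> carrier PA \<Longrightarrow> f \<otimes>\<^bsub>PA\<^esub> (c \<odot>\<^bsub>PA\<^esub> g) = c \<odot>\<^bsub>PA\<^esub> (f \<otimes>\<^bsub>PA\<^esub> g)"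
proof -
 note [simp] = f[THEN PA_coeff]
 show "c \<odot>\<^bsub>PA\<^esub> f \<in> carrier PA" using c f by (auto simp: carrier_PA PA_simps)
 assume g: "g \<in> carrier PA"
 note [simp] = g[THEN PA_coeff]
 show "(c \<odot>\<^bsub>PA\<^esub> f) \<otimes>\<^bsub>PA\<^esub> g = c \<odot>\<^bsub>PA\<^esub> (f \<otimes>\<^bsub>PA\<^esub> g)"
  using c by (intro ext) (auto simp: PA_simps K.finsum_rdistr K.m_assoc)
 show "f \<otimes>\<^bsub>PA\<^esub> (c \<odot>\<^bsub>PA\<^esub> g) = c \<odot>\<^bsub>PA\<^esub> (f \<otimes>\<^bsub>PA\<^esub> g)"
  using c by (intro ext) (auto simp: PA_simps K.finsum_rdistr K.m_lcomm)
qed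

lemma path_mono_closed [simp]: "c \<in> carrier K \<Longrightarrow> p \<in> paths Q \<Longrightarrow> path_mono K c p \<in> carrier PA"
 by (auto simp: carrier_PA path_mono_def)

lemma path_mono_mult:
 assumes "c \<in> carrier K" "d \<in> carrier K"
 shows "path_mono K c p \<otimes>\<^bsub>PA\<^esub> path_mono K d q =
  (if path_end Q q = fst p then path_mono K (c \<otimes> d) (path_comp p q) else \<zero>\<^bsub>PA\<^esub>)"
proof (rule ext, clarify)
 fix u es
 let ?t = "\<lambda>i. path_mono K c p (path_end Q (u, take i es), drop i es) \<otimes> path_mono K d q (u, take i es)"
 let ?c = "path_end Q q = fst p \<and> (u, es) = path_comp p q"
 have t: "?t i = (if ?c \<and> i = length (snd q) then c \<otimes> d else \<zero>)" if "i \<le> length es" for i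
 proof (cases "?c \<and> i = length (snd q)")
  case True
  then have "(u, take i es) = q" "(path_end Q (u, take i es), drop i es) = p"
   by (auto simp: prod_eq_iff)
  then show ?thesis using True by (simp add: path_mono_def)
 next
  case False
  have "(path_end Q (u, take i es), drop i es) \<noteq> p \<or> (u, take i es) \<noteq> q"
  proof (rule ccontr)
   assume "\<not> ?thesis"
   then have *: "p = (path_end Q (u, take i es), drop i es)" "q = (u, take i es)" by auto
   then have "i = length (snd q)" using that by simp
   moreover have "(u, es) = path_comp p q" using * by (simp add: path_comp_def)
   ultimately show False using False * by simp
  qed
  then have "?t i = \<zero>" using assms by (auto simp: path_mono_def)
  then show ?thesis using False by auto
 qed
 show "(path_mono K c p \<otimes>\<^bsub>PA\<^esub> path_mono K d q) (u, es) =
  (if path_end Q q = fst p then path_mono K (c \<otimes> d) (path_comp p q) else \<zero>\<^bsub>PA\<^esub>) (u, es)"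
 proof (cases ?c)
  case True
  then have "length (snd q) \<le> length es" by (auto simp: path_comp_def)
  then have "(\<Oplus>i\<in>{..length es}. ?t i) = c \<otimes> d"
   using assms t True by (intro finsum_delta[where i = "length (snd q)"]) auto
  moreover have "(path_mono K c p \<otimes>\<^bsub>PA\<^esub> path_mono K d q) (u, es) = (\<Oplus>i\<in>{..length es}. ?t i)"
   by (simp add: PA_simps)
  ultimately show ?thesis using True by (simp add: path_mono_def)
 next
  case False
  then have "(\<Oplus>i\<in>{..length es}. ?t i) = (\<Oplus>i\<in>{..length es}. \<zero>)"
   using t by (intro K.finsum_cong') auto
  then show ?thesis using False by (auto simp: PA_simps path_mono_def)
 qed
qed

lemma PA_induct:
 assumes "finite S" "S \<subseteq> paths Q" "f \<in> carrier PA" "{p. f p \<noteq> \<zero>} \<subseteq> S"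
  and zero: "P \<zero>\<^bsub>PA\<^esub>"
  and add: "\<And>c p g. c \<in> carrier K \<Longrightarrow> p \<in> S \<Longrightarrow> g \<in> carrier PA \<Longrightarrow> P g \<Longrightarrow> P (path_mono K c p \<oplus>\<^bsub>PA\<^esub> g)"
 shows "P f"
proof -
 have "P f" if "finite T" "T \<subseteq> S" "f \<in> carrier PA" "{p. f p \<noteq> \<zero>} \<subseteq> T" for T f
  using that
 proof (induction T arbitrary: f rule: finite_induct)
  case empty
  then have "f = \<zero>\<^bsub>PA\<^esub>" by (auto simp: PA_simps)
  then show ?case using zero by simp
 next
  case (insert p T)
  let ?g = "f(p := \<zero>)"
  have g: "?g \<in> carrier PA" using insert.prems(2) by (auto simp: carrier_PA)
  have f: "f = path_mono K (f p) p \<oplus>\<^bsub>PA\<^esub> ?g"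
   using PA_coeff[OF insert.prems(2)] by (intro ext) (simp add: PA_simps path_mono_def)
  have "P ?g" using insert.prems by (intro insert.IH g) auto
  then have "P (path_mono K (f p) p \<oplus>\<^bsub>PA\<^esub> ?g)"
   using PA_coeff[OF insert.prems(2)] insert.prems(1) by (intro add g) auto
  then show ?case using f by simp
 qed
 then show ?thesis using assms by blast
qed

end

section \<open>Monomial ideals and the bound quiver algebra\<close>

locale bound_quiver = acyclic_path_algebra K Q
 for K :: "('k, 'r) ring_scheme" (structure) and Q :: "('v, 'e) pre_digraph" +
 fixes \<rho> :: "('v, 'e) path set" and I :: "(('v, 'e) path \<Rightarrow> 'k) set"
 assumes rho: "\<rho> \<subseteq> paths Q" "\<forall>p\<in>\<rho>. path_length p \<ge> 2"
  and I: "I = relation_ideal K Q \<rho>"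
begin

text \<open>A combinatorial substitute for being nonzero in the quotient, from which closure under
  factors is immediate; \<open>nonzero_path_iff\<close> identifies the two notions.\<close>

definition N :: "('v, 'e) path set" where
 "N = {p \<in> paths Q. \<not> (\<exists>r\<in>\<rho>. \<exists>xs ys. snd p = xs @ snd r @ ys \<and> path_end Q (fst p, xs) = fst r)}"

lemma N_paths: "N \<subseteq> paths Q"
 by (auto simp: N_def)

lemma N_factors:
 assumes "(u, xs @ ys) \<in> N"
 shows "(u, xs) \<in> N" "(path_end Q (u, xs), ys) \<in> N"
proof -
 have p: "(u, xs) \<in> paths Q" "(path_end Q (u, xs), ys) \<in> paths Q"
  using assms paths_append[OF wf_digraph_axioms, of u xs ys] by (auto simp: N_def)
 have n: False if "r \<in> \<rho>" "xs @ ys = as @ snd r @ bs" "path_end Q (u, as) = fst r" for r as bs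
  using assms that by (auto simp: N_def)
 show "(u, xs) \<in> N"
  using p(1) n by (force simp: N_def)
 have "path_end Q (u, xs @ as) = path_end Q (path_end Q (u, xs), as)" for as
  by (simp add: path_end_eq)
 then have "False" if "r \<in> \<rho>" "ys = as @ snd r @ bs" "path_end Q (path_end Q (u, xs), as) = fst r" for r as bs
  using n[OF that(1), of "xs @ as" bs] that by simp
 then show "(path_end Q (u, xs), ys) \<in> N"
  using p(2) by (force simp: N_def)
qed

text \<open>Relations have length at least 2, so vertices and arrows survive in the
  quotient.\<close>

lemma N_short: "length (snd p) < 2 \<Longrightarrow> p \<in> paths Q \<Longrightarrow> p \<in> N"
proof -
 assume p: "length (snd p) < 2" "p \<in> paths Q"
 have "length (snd r) \<ge> 2" if "r \<in> \<rho>" for r using rho(2) that by (simp add: path_length_def)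
 then show "p \<in> N" using p by (fastforce simp: N_def)
qed

text \<open>Cutting a path of N gives two paths of N, so every term of a product with one factor
  vanishing on N is zero there.\<close>

lemma zero_on_N_ideal: "ideal {f \<in> carrier PA. \<forall>p\<in>N. f p = \<zero>} PA"
proof -
 interpret PA: ring PA by (rule PA_ring)
 let ?W = "{f \<in> carrier PA. \<forall>p\<in>N. f p = \<zero>}"
 show ?thesis
 proof (rule idealI[OF PA_ring])
  show "subgroup ?W (add_monoid PA)"
  proof (rule PA.add.subgroupI)
   show "\<ominus>\<^bsub>PA\<^esub> f \<in> ?W" if "f \<in> ?W" for f
   proof -
    have f: "f \<in> carrier PA" "\<And>p. p \<in> N \<Longrightarrow> f p = \<zero>" using that by auto
    have "(\<ominus>\<^bsub>PA\<^esub> f) p = \<zero>" if "p \<in> N" for p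
    proof -
     have "(\<ominus>\<^bsub>PA\<^esub> f) p = (\<ominus>\<^bsub>PA\<^esub> f) p \<oplus> f p"
      using f(2)[OF that] PA_coeff[OF PA.a_inv_closed[OF f(1)]] by simp
     also have "\<dots> = \<zero>"
      using arg_cong[OF PA.l_neg[OF f(1)], of "\<lambda>h. h p"] by (simp add: PA_simps)
     finally show ?thesis .
    qed
    then show ?thesis using f by simp
   qed
  qed (auto simp: PA_simps)
 next
  fix f g assume f: "f \<in> ?W" and g: "g \<in> carrier PA"
  note [simp] = PA_coeff[OF g]
  have fc: "f \<in> carrier PA" and f0: "\<And>p. p \<in> N \<Longrightarrow> f p = \<zero>" using f by auto
  have "(g \<otimes>\<^bsub>PA\<^esub> f) (u, es) = \<zero>" "(f \<otimes>\<^bsub>PA\<^esub> g) (u, es) = \<zero>" if p: "(u, es) \<in> N" for u es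
  proof -
   have "(u, take i es) \<in> N" "(path_end Q (u, take i es), drop i es) \<in> N" for i
    using N_factors[of u "take i es" "drop i es"] p by simp_all
   then show "(g \<otimes>\<^bsub>PA\<^esub> f) (u, es) = \<zero>" "(f \<otimes>\<^bsub>PA\<^esub> g) (u, es) = \<zero>" by (simp_all add: PA_simps f0)
  qed
  then show "g \<otimes>\<^bsub>PA\<^esub> f \<in> ?W" "f \<otimes>\<^bsub>PA\<^esub> g \<in> ?W" using fc g by auto
 qed
qed

text \<open>The functions vanishing on N form an ideal containing the relations, hence containing I.
  Conversely a path outside N has the form y r x with r in \<rho>, so it lies in I, and a function
  vanishing on N is a combination of such paths.\<close>

lemma I_eq: "I = {f \<in> carrier PA. \<forall>p\<in>N. f p = \<zero>}"
proof
 interpret PA: ring PA by (rule PA_ring)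
 have rc: "path_elem K ` \<rho> \<subseteq> carrier PA" using rho(1) by (auto simp: path_elem_eq)
 have rI: "path_elem K r \<in> I" if "r \<in> \<rho>" for r
  using PA.genideal_self[OF rc] that unfolding I relation_ideal_def by blast
 interpret I: ideal I PA unfolding I relation_ideal_def by (rule PA.genideal_ideal[OF rc])
 have "path_elem K r \<in> {f \<in> carrier PA. \<forall>p\<in>N. f p = \<zero>}" if r: "r \<in> \<rho>" for r
 proof -
  have "r \<notin> N" by (auto simp: N_def intro!: bexI[OF _ r] exI[of _ "[]"])
  then show ?thesis using r rc by (auto simp: path_elem_def)
 qed
 then show "I \<subseteq> {f \<in> carrier PA. \<forall>p\<in>N. f p = \<zero>}"
  unfolding I relation_ideal_def by (intro PA.genideal_minimal zero_on_N_ideal) blast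
 have m: "path_mono K c p \<in> I" if c: "c \<in> carrier K" and p: "p \<in> paths Q - N" for c p
 proof -
  obtain r xs ys where r: "r \<in> \<rho>" "snd p = xs @ snd r @ ys" "path_end Q (fst p, xs) = fst r"
   using p by (auto simp: N_def)
  have "(fst p, xs @ snd r @ ys) \<in> paths Q" using p r(2) by (metis DiffD1 prod.collapse)
  then have x: "(fst p, xs) \<in> paths Q" and y: "(path_end Q r, ys) \<in> paths Q"
   using r(3) by (auto simp: paths_append[OF wf_digraph_axioms])
  have "path_mono K c (path_end Q r, ys) \<otimes>\<^bsub>PA\<^esub> (path_elem K r \<otimes>\<^bsub>PA\<^esub> path_mono K \<one> (fst p, xs)) \<in> I"
   using rI[OF r(1)] x y c by (intro I.I_l_closed I.I_r_closed) auto
  moreover have "path_comp (path_end Q r, ys) (path_comp r (fst p, xs)) = p"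
   using r(2) by (simp add: prod_eq_iff)
  ultimately show ?thesis using c r(3) by (simp add: path_elem_eq path_mono_mult)
 qed
 show "{f \<in> carrier PA. \<forall>p\<in>N. f p = \<zero>} \<subseteq> I"
 proof
  fix f assume f: "f \<in> {f \<in> carrier PA. \<forall>p\<in>N. f p = \<zero>}"
  show "f \<in> I"
  proof (rule PA_induct[where S = "paths Q - N"])
   show "{p. f p \<noteq> \<zero>} \<subseteq> paths Q - N" using f carrier_PA[of f] by blast
   show "path_mono K c p \<oplus>\<^bsub>PA\<^esub> g \<in> I" if "c \<in> carrier K" "p \<in> paths Q - N" "g \<in> I" for c p g
    using m[OF that(1,2)] that(3) by (rule I.a_closed)
  qed (use f finite_paths[OF acyclic] I.zero_closed in auto)
 qed
qed

sublocale I: ideal I PA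
 unfolding I_eq by (rule zero_on_N_ideal)

lemma nonzero_path_iff: "p \<in> paths Q \<Longrightarrow> nonzero_path K I p \<longleftrightarrow> p \<in> N"
proof -
 assume p: "p \<in> paths Q"
 have "path_mono K \<one> p q = \<zero> \<longleftrightarrow> q \<noteq> p" for q
  by (simp add: path_mono_def)
 then show ?thesis
  unfolding nonzero_path_def path_elem_eq I_eq using path_mono_closed[OF K.one_closed p] by blast
qed

abbreviation "B \<equiv> bound_quiver_algebra K Q I"

abbreviation quiver_proj :: "(('v, 'e) path \<Rightarrow> 'k) \<Rightarrow> (('v, 'e) path \<Rightarrow> 'k) set" ("\<pi>") where
 "\<pi> f \<equiv> I +>\<^bsub>PA\<^esub> f"

lemma B_ring: "ring B"
proof -
 interpret F: ring "PA Quot I" by (rule I.quotient_is_ring)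
 have e: "carrier B = carrier (PA Quot I)" "mult B = mult (PA Quot I)" "one B = one (PA Quot I)"
  "ring.zero B = ring.zero (PA Quot I)" "add B = add (PA Quot I)"
  by (simp_all add: bound_quiver_algebra_def quot_module_def)
 show ?thesis
 proof (rule ringI)
  show "abelian_group B"
  proof (rule abelian_groupI)
   show "\<exists>y\<in>carrier B. y \<oplus>\<^sub>B x = \<zero>\<^sub>B" if "x \<in> carrier B" for x
    using that F.l_neg F.a_inv_closed unfolding e by blast
  qed (simp_all add: e F.add.m_ac)
  show "monoid B" by (rule monoidI) (auto simp: e F.m_assoc)
 qed (auto simp: e F.l_distr F.r_distr)
qed

lemma proj_eq_iff:
 assumes "f \<in> carrier PA" "g \<in> carrier PA"
 shows "\<pi> f = \<pi> g \<longleftrightarrow> (\<forall>p\<in>N. f p = g p)"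
proof -
 have "\<pi> f = \<pi> g \<longleftrightarrow> f \<ominus>\<^bsub>PA\<^esub> g \<in> I"
  using I.quotient_eq_iff_same_a_r_cos[OF I.ideal_axioms assms] by simp
 also have "\<dots> \<longleftrightarrow> (\<forall>p\<in>N. f p = g p)"
 proof -
  have *: "(f \<ominus>\<^bsub>PA\<^esub> g) p \<oplus> g p = f p" for p
  proof -
   have "(f \<ominus>\<^bsub>PA\<^esub> g) \<oplus>\<^bsub>PA\<^esub> g = f"
    using assms by (simp add: a_minus_def I.a_assoc I.l_neg)
   then show ?thesis by (metis PA_simps(1))
  qed
  have c: "(f \<ominus>\<^bsub>PA\<^esub> g) p \<in> carrier K" "g p \<in> carrier K" for p using assms by (simp_all add: PA_coeff)
  have "(f \<ominus>\<^bsub>PA\<^esub> g) p = \<zero> \<longleftrightarrow> f p = g p" for p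
   using *[of p] c[of p] K.add.right_cancel[of "g p" "(f \<ominus>\<^bsub>PA\<^esub> g) p" \<zero>] by auto
  moreover have "f \<ominus>\<^bsub>PA\<^esub> g \<in> carrier PA" using assms by (rule I.minus_closed)
  ultimately show ?thesis unfolding I_eq by blast
 qed
 finally show ?thesis .
qed

lemma proj_self: "f \<in> carrier PA \<Longrightarrow> f \<in> \<pi> f"
 by (rule I.a_rcos_self)

lemma proj_memD:
 assumes "f \<in> carrier PA" "x \<in> \<pi> f" shows "x \<in> carrier PA" "\<pi> x = \<pi> f"
proof -
 show "x \<in> carrier PA" using I.a_elemrcos_carrier[OF assms] .
 show "\<pi> x = \<pi> f" using I.a_repr_independence[OF assms(2,1)] I.a_subgroup by simp
qed

lemma carrier_B: "carrier B = \<pi> ` carrier PA"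
 by (auto simp: bound_quiver_algebra_def quot_module_def FactRing_def A_RCOSETS_def')

lemma B_simps:
 assumes "f \<in> carrier PA" "g \<in> carrier PA"
 shows "\<pi> f \<oplus>\<^sub>B \<pi> g = \<pi> (f \<oplus>\<^bsub>PA\<^esub> g)" "\<pi> f \<otimes>\<^sub>B \<pi> g = \<pi> (f \<otimes>\<^bsub>PA\<^esub> g)"
 using ring_hom_add[OF I.rcos_ring_hom assms] ring_hom_mult[OF I.rcos_ring_hom assms]
 by (simp_all add: bound_quiver_algebra_def quot_module_def)

lemma B_zero: "\<zero>\<^sub>B = \<pi> \<zero>\<^bsub>PA\<^esub>"
proof -
 have "\<zero>\<^sub>B = I" by (simp add: bound_quiver_algebra_def quot_module_def FactRing_def)
 then show ?thesis using I.a_coset_join2[OF I.zero_closed I.a_subgroup] by simp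
qed

lemma B_smult:
 assumes c: "c \<in> carrier K" and f: "f \<in> carrier PA"
 shows "c \<odot>\<^sub>B \<pi> f = \<pi> (c \<odot>\<^bsub>PA\<^esub> f)"
proof -
 have "\<pi> (c \<odot>\<^bsub>PA\<^esub> x) = \<pi> (c \<odot>\<^bsub>PA\<^esub> f)" if "x \<in> \<pi> f" for x
 proof -
  have x: "x \<in> carrier PA" "\<And>p. p \<in> N \<Longrightarrow> x p = f p"
   using proj_memD[OF f that] proj_eq_iff[OF _ f, of x] by auto
  then show ?thesis using f c by (subst proj_eq_iff) (auto simp: PA_smult PA_simps)
 qed
 then have "(\<Union>x\<in>\<pi> f. \<pi> (c \<odot>\<^bsub>PA\<^esub> x)) = \<pi> (c \<odot>\<^bsub>PA\<^esub> f)"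
  using proj_self[OF f] by blast
 moreover have "c \<odot>\<^sub>B \<pi> f = (\<Union>x\<in>\<pi> f. \<pi> (c \<odot>\<^bsub>PA\<^esub> x))"
  by (simp add: bound_quiver_algebra_def quot_module_def)
 ultimately show ?thesis by simp
qed

lemma B_smult_closed: "c \<in> carrier K \<Longrightarrow> b \<in> carrier B \<Longrightarrow> c \<odot>\<^sub>B b \<in> carrier B"
 by (auto simp: carrier_B B_smult PA_smult)

lemma B_smult_assoc:
 assumes "c \<in> carrier K" "b \<in> carrier B" "b' \<in> carrier B"
 shows "(c \<odot>\<^sub>B b) \<otimes>\<^sub>B b' = c \<odot>\<^sub>B (b \<otimes>\<^sub>B b')" "b \<otimes>\<^sub>B (c \<odot>\<^sub>B b') = c \<odot>\<^sub>B (b \<otimes>\<^sub>B b')"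
 using assms by (auto simp: carrier_B B_smult B_simps PA_smult)

text \<open>For p in N the value at p does not depend on the representative, since the elements of I
  vanish on N.\<close>

definition coB :: "('v, 'e) path \<Rightarrow> (('v, 'e) path \<Rightarrow> 'k) set \<Rightarrow> 'k" where
 "coB p b = (SOME f. f \<in> b) p"

lemma coB_proj:
 assumes "p \<in> N" "f \<in> carrier PA"
 shows "coB p (\<pi> f) = f p"
proof -
 have x: "(SOME x. x \<in> \<pi> f) \<in> \<pi> f" using someI[of "\<lambda>x. x \<in> \<pi> f", OF proj_self[OF assms(2)]] .
 then show ?thesis using assms proj_memD[OF assms(2) x] proj_eq_iff[OF _ assms(2)] by (simp add: coB_def)
qed

lemma coB:
 assumes "p \<in> N" "b \<in> carrier B"
 shows "coB p b \<in> carrier K"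
  and "b' \<in> carrier B \<Longrightarrow> coB p (b \<oplus>\<^sub>B b') = coB p b \<oplus> coB p b'"
  and "c \<in> carrier K \<Longrightarrow> coB p (c \<odot>\<^sub>B b) = c \<otimes> coB p b"
 using assms by (auto simp: carrier_B coB_proj B_simps PA_coeff PA_simps B_smult PA_smult)

lemma path_mono_apply: "path_mono K c p q = (if q = p then c else \<zero>)"
 by (simp add: path_mono_def)

lemma path_class_eq: "path_class K Q I p = \<pi> (path_mono K \<one> p)"
 by (simp add: path_class_def path_elem_eq)

lemma path_class_closed: "p \<in> paths Q \<Longrightarrow> path_class K Q I p \<in> carrier B"
 by (simp add: path_class_eq carrier_B)

lemma coB_path_class: "p \<in> N \<Longrightarrow> q \<in> N \<Longrightarrow> coB p (path_class K Q I q) = (if p = q then \<one> else \<zero>)"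
 using N_paths by (simp add: path_class_eq coB_proj path_mono_apply subsetD)

lemma proj_mono:
 assumes "c \<in> carrier K" "p \<in> paths Q"
 shows "\<pi> (path_mono K c p) = (if p \<in> N then c \<odot>\<^sub>B path_class K Q I p else \<zero>\<^sub>B)"
proof (cases "p \<in> N")
 case True
 have "c \<odot>\<^bsub>PA\<^esub> path_mono K \<one> p = path_mono K c p"
  using assms(1) by (intro ext) (simp add: PA_simps path_mono_def)
 then show ?thesis using True assms by (simp add: path_class_eq B_smult)
next
 case False
 then have "\<pi> (path_mono K c p) = \<pi> \<zero>\<^bsub>PA\<^esub>"
  using assms by (subst proj_eq_iff) (auto simp: path_mono_apply PA_simps)
 then show ?thesis using False by (simp add: B_zero)
qed

lemma path_class_mult:
 assumes "p \<in> paths Q" "q \<in> paths Q"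
 shows "path_class K Q I p \<otimes>\<^sub>B path_class K Q I q =
  (if path_end Q q = fst p \<and> path_comp p q \<in> N then path_class K Q I (path_comp p q) else \<zero>\<^sub>B)"
proof -
 have "path_class K Q I p \<otimes>\<^sub>B path_class K Q I q =
   \<pi> (if path_end Q q = fst p then path_mono K \<one> (path_comp p q) else \<zero>\<^bsub>PA\<^esub>)"
  using assms by (simp add: path_class_eq B_simps path_mono_mult)
 moreover have "\<pi> (path_mono K \<one> (path_comp p q)) =
   (if path_comp p q \<in> N then path_class K Q I (path_comp p q) else \<zero>\<^sub>B)" if "path_end Q q = fst p"
 proof (cases "path_comp p q \<in> N")
  case True
  then show ?thesis by (simp only: path_class_eq if_True)
 next
  case False
  then show ?thesis
   using proj_mono[OF K.one_closed, of "path_comp p q"] paths_comp[OF wf_digraph_axioms that] assms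
   by (simp only: if_False)
 qed
 ultimately show ?thesis by (simp add: B_zero)
qed

lemma B_induct:
 assumes b: "b \<in> carrier B" and zero: "P \<zero>\<^sub>B"
  and add: "\<And>c p b. c \<in> carrier K \<Longrightarrow> p \<in> N \<Longrightarrow> b \<in> carrier B \<Longrightarrow> P b \<Longrightarrow>
   P ((c \<odot>\<^sub>B path_class K Q I p) \<oplus>\<^sub>B b)"
 shows "P b"
proof -
 interpret B: ring B by (rule B_ring)
 obtain f where f: "f \<in> carrier PA" "b = \<pi> f" using b by (auto simp: carrier_B)
 have "P (\<pi> f)"
 proof (rule PA_induct[where S = "paths Q"])
  fix c p g assume *: "c \<in> carrier K" "p \<in> paths Q" "g \<in> carrier PA" "P (\<pi> g)"
  have g: "\<pi> g \<in> carrier B" using *(3) by (simp add: carrier_B)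
  have "\<pi> (path_mono K c p \<oplus>\<^bsub>PA\<^esub> g) = \<pi> (path_mono K c p) \<oplus>\<^sub>B \<pi> g" using * by (simp add: B_simps)
  also have "\<dots> = (if p \<in> N then (c \<odot>\<^sub>B path_class K Q I p) \<oplus>\<^sub>B \<pi> g else \<pi> g)"
   using proj_mono[OF *(1,2)] g by simp
  finally show "P (\<pi> (path_mono K c p \<oplus>\<^bsub>PA\<^esub> g))" using add[OF *(1) _ g *(4)] *(4) by simp
 qed (use f finite_paths[OF acyclic] carrier_PA zero B_zero in auto)
 then show ?thesis using f by simp
qed

end

section \<open>Tensor products of algebras\<close>

lemma (in abelian_group) eq_diffI:
 assumes "x \<oplus> y = z" "x \<in> carrier G" "y \<in> carrier G" shows "x = z \<ominus> y"
 unfolding assms(1)[symmetric] using assms(2,3) by (simp add: a_minus_def a_assoc r_neg)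

locale tensor_product = A: ring A + B: ring B
 for A :: "('k, 'a, 's) module_scheme" and B :: "('k, 'b, 'z) module_scheme" +
 fixes K :: "('k, 'r) ring_scheme"
 assumes A_smult: "\<And>c a. c \<in> carrier K \<Longrightarrow> a \<in> carrier A \<Longrightarrow> c \<odot>\<^sub>A a \<in> carrier A"
   "\<And>c a a'. c \<in> carrier K \<Longrightarrow> a \<in> carrier A \<Longrightarrow> a' \<in> carrier A \<Longrightarrow>
    (c \<odot>\<^sub>A a) \<otimes>\<^sub>A a' = c \<odot>\<^sub>A (a \<otimes>\<^sub>A a')"
   "\<And>c a a'. c \<in> carrier K \<Longrightarrow> a \<in> carrier A \<Longrightarrow> a' \<in> carrier A \<Longrightarrow>
    a \<otimes>\<^sub>A (c \<odot>\<^sub>A a') = c \<odot>\<^sub>A (a \<otimes>\<^sub>A a')"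
  and B_smult: "\<And>c b. c \<in> carrier K \<Longrightarrow> b \<in> carrier B \<Longrightarrow> c \<odot>\<^sub>B b \<in> carrier B"
   "\<And>c b b'. c \<in> carrier K \<Longrightarrow> b \<in> carrier B \<Longrightarrow> b' \<in> carrier B \<Longrightarrow>
    (c \<odot>\<^sub>B b) \<otimes>\<^sub>B b' = c \<odot>\<^sub>B (b \<otimes>\<^sub>B b')"
   "\<And>c b b'. c \<in> carrier K \<Longrightarrow> b \<in> carrier B \<Longrightarrow> b' \<in> carrier B \<Longrightarrow>
    b \<otimes>\<^sub>B (c \<odot>\<^sub>B b') = c \<odot>\<^sub>B (b \<otimes>\<^sub>B b')"
begin

abbreviation "R \<equiv> pair_ring A B"
abbreviation "T \<equiv> tensor_kernel K A B"
abbreviation "L \<equiv> tensor_algebra K A B"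
abbreviation "S \<equiv> carrier A \<times> carrier B"
abbreviation "supp x \<equiv> Poly_Mapping.keys x \<subseteq> S"
abbreviation tensor (infixl "\<star>" 72) where "a \<star> b \<equiv> pure_tensor K A B a b"

lemma R_simps [simp]:
 "x \<in> carrier R \<longleftrightarrow> supp x" "x \<oplus>\<^sub>R y = x + y" "\<zero>\<^sub>R = 0"
 "\<one>\<^sub>R = frag_of (\<one>\<^sub>A, \<one>\<^sub>B)"
 "frag_of (a, b) \<otimes>\<^sub>R frag_of (a', b') = frag_of (a \<otimes>\<^sub>A a', b \<otimes>\<^sub>B b')"
 by (simp_all add: pair_ring_def)

lemma R_mult_0_left [simp]: "0 \<otimes>\<^sub>R y = 0"
 by (simp add: pair_ring_def)

lemma R_mult_diff_left: "(x - x') \<otimes>\<^sub>R y = x \<otimes>\<^sub>R y - x' \<otimes>\<^sub>R y"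
 by (simp add: pair_ring_def frag_extend_diff)

lemma R_mult_add_left: "(x + x') \<otimes>\<^sub>R y = x \<otimes>\<^sub>R y + x' \<otimes>\<^sub>R y"
 by (simp add: pair_ring_def frag_extend_add)

text \<open>In the first argument the product is additive by construction. In the second, additivity
  holds for each generator x, because the inner map is again a \<open>frag_extend\<close>, and
  spreads by induction on x.\<close>

lemma R_mult_diff_right: "x \<otimes>\<^sub>R (y - y') = x \<otimes>\<^sub>R y - x \<otimes>\<^sub>R y'"
 using subset_UNIV
proof (induction x rule: frag_induction)
 case (one ab)
 show ?case by (cases ab) (simp add: pair_ring_def frag_extend_diff)
next
 case (diff x x')
 then show ?case by (simp add: R_mult_diff_left)
qed simp

lemma R_mult_0_right [simp]: "x \<otimes>\<^sub>R 0 = 0"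
 using R_mult_diff_right[of x 0 0] by simp

lemma R_mult_add_right: "x \<otimes>\<^sub>R (y + y') = x \<otimes>\<^sub>R y + x \<otimes>\<^sub>R y'"
proof -
 have "x \<otimes>\<^sub>R (y + y') - x \<otimes>\<^sub>R y' = x \<otimes>\<^sub>R y"
  using R_mult_diff_right[of x "y + y'" y'] by (simp only: add_diff_cancel_right')
 then show ?thesis by (simp only: diff_eq_eq)
qed

lemma keys_diff_subset: "Poly_Mapping.keys x \<subseteq> U \<Longrightarrow> Poly_Mapping.keys y \<subseteq> U \<Longrightarrow> Poly_Mapping.keys (x - y) \<subseteq> U"
 using keys_diff[of x y] by (meson Un_least subset_trans)

lemma R_m_closed:
 assumes "supp x" "supp y"
 shows "supp (x \<otimes>\<^sub>R y)"
 using assms(1)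
proof (induction x rule: frag_induction)
 case (one ab)
 obtain a b where ab: "ab = (a, b)" "a \<in> carrier A" "b \<in> carrier B" using one by blast
 show ?case using assms(2)
 proof (induction y rule: frag_induction)
  case (one ab')
  then show ?case using ab by (cases ab') simp
 next
  case (diff y y')
  then show ?case unfolding R_mult_diff_right by (rule keys_diff_subset)
 qed simp
next
 case (diff x x')
 then show ?case unfolding R_mult_diff_left by (rule keys_diff_subset)
qed simp

lemma R_m_assoc:
 assumes x: "supp x" and y: "supp y" and z: "supp z"
 shows "(x \<otimes>\<^sub>R y) \<otimes>\<^sub>R z = x \<otimes>\<^sub>R (y \<otimes>\<^sub>R z)"
 using x
proof (induction x rule: frag_induction)
 case (one p)
 show ?case using y
 proof (induction y rule: frag_induction)
  case (one q)
  show ?case using z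
  proof (induction z rule: frag_induction)
   case (one r)
   then show ?case using \<open>p \<in> S\<close> \<open>q \<in> S\<close>
    by (cases p; cases q; cases r) (simp add: A.m_assoc B.m_assoc)
  qed (simp_all add: R_mult_diff_right)
 qed (simp_all add: R_mult_diff_right R_mult_diff_left)
qed (simp_all add: R_mult_diff_left)

lemma R_one: "supp x \<Longrightarrow> \<one>\<^sub>R \<otimes>\<^sub>R x = x \<and> x \<otimes>\<^sub>R \<one>\<^sub>R = x"
proof (induction x rule: frag_induction)
 case (one p)
 then show ?case by (cases p) simp
next
 case (diff x y)
 then show ?case by (simp only: R_mult_diff_left R_mult_diff_right)
qed simp

lemma R_ring: "ring R"
proof (rule ringI)
 show "abelian_group R"
 proof (rule abelian_groupI)
  show "x \<oplus>\<^sub>R y \<in> carrier R" if "x \<in> carrier R" "y \<in> carrier R" for x y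
   using that keys_add[of x y] by auto
  show "\<exists>y\<in>carrier R. y \<oplus>\<^sub>R x = \<zero>\<^sub>R" if "x \<in> carrier R" for x
   using that by (intro bexI[of _ "- x"]) simp_all
 qed (simp_all add: add_ac)
 show "monoid R"
 proof (rule monoidI)
  show "\<one>\<^sub>R \<in> carrier R" by simp
  show "\<one>\<^sub>R \<otimes>\<^sub>R x = x" "x \<otimes>\<^sub>R \<one>\<^sub>R = x" if "x \<in> carrier R" for x
   using that R_one[of x] by (simp_all only: R_simps(1))
 qed (simp_all add: R_m_closed R_m_assoc)
qed (simp_all add: R_mult_add_left R_mult_add_right)

sublocale R: ring R by (rule R_ring)

lemma rel_cases:
 assumes "r \<in> tensor_relations K A B"
 obtains a a' b where "a \<in> carrier A" "a' \<in> carrier A" "b \<in> carrier B"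
   "r = frag_of (a \<oplus>\<^sub>A a', b) - frag_of (a, b) - frag_of (a', b)"
  | a b b' where "a \<in> carrier A" "b \<in> carrier B" "b' \<in> carrier B"
   "r = frag_of (a, b \<oplus>\<^sub>B b') - frag_of (a, b) - frag_of (a, b')"
  | c a b where "c \<in> carrier K" "a \<in> carrier A" "b \<in> carrier B"
   "r = frag_of (c \<odot>\<^sub>A a, b) - frag_of (a, c \<odot>\<^sub>B b)"
 using assms unfolding tensor_relations_def
 by (elim UnE CollectE exE conjE) (erule (3) that)+

lemma rel_carrier: "r \<in> tensor_relations K A B \<Longrightarrow> supp r"
 by (cases rule: rel_cases, assumption) (simp_all add: keys_diff_subset A_smult B_smult)

lemma T_zero: "0 \<in> T"
 using generate.one[of "free_Abelian_group S"] by (simp add: tensor_kernel_def)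

lemma T_rel: "r \<in> tensor_relations K A B \<Longrightarrow> r \<in> T"
 by (simp add: tensor_kernel_def generate.incl)

lemma T_add: "x \<in> T \<Longrightarrow> y \<in> T \<Longrightarrow> x + y \<in> T"
 using generate.eng[of x "free_Abelian_group S" _ y] by (simp add: tensor_kernel_def)

lemma T_subgroup: "subgroup T (free_Abelian_group S)"
 unfolding tensor_kernel_def
 using rel_carrier by (intro group.generate_is_subgroup) auto

lemma T_carrier: "x \<in> T \<Longrightarrow> supp x"
 using subsetD[OF subgroup.subset[OF T_subgroup]] by (simp only: carrier_free_Abelian_group_iff)

lemma T_minus: "x \<in> T \<Longrightarrow> - x \<in> T"
 using subgroup.m_inv_closed[OF T_subgroup, of x] T_carrier[of x] by simp

lemma T_diff: "x \<in> T \<Longrightarrow> y \<in> T \<Longrightarrow> x - y \<in> T"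
 using T_add[of x "- y"] T_minus[of y] by simp

lemma T_induct [consumes 1, case_names zero rel diff]:
 assumes "x \<in> T" and "P 0" and rel: "\<And>r. r \<in> tensor_relations K A B \<Longrightarrow> P r"
  and diff: "\<And>x y. x \<in> T \<Longrightarrow> y \<in> T \<Longrightarrow> P x \<Longrightarrow> P y \<Longrightarrow> P (x - y)"
 shows "P x"
 using assms(1)[unfolded tensor_kernel_def]
proof (induction rule: generate.induct)
 case one
 then show ?case using assms(2) by simp
next
 case (incl r)
 then show ?case by (rule rel)
next
 case (inv r)
 then show ?case using diff[OF T_zero T_rel[OF inv] assms(2) rel[OF inv]] rel_carrier[OF inv] by simp
next
 case (eng x y)
 then have "x \<in> T" "y \<in> T" by (simp_all add: tensor_kernel_def)
 then show ?case
  using diff[OF \<open>x \<in> T\<close> T_diff[OF T_zero \<open>y \<in> T\<close>] eng(3) diff[OF T_zero \<open>y \<in> T\<close> assms(2) eng(4)]] by simp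
qed

lemma relI:
 "a \<in> carrier A \<Longrightarrow> a' \<in> carrier A \<Longrightarrow> b \<in> carrier B \<Longrightarrow>
  frag_of (a \<oplus>\<^sub>A a', b) - frag_of (a, b) - frag_of (a', b) \<in> T"
 "a \<in> carrier A \<Longrightarrow> b \<in> carrier B \<Longrightarrow> b' \<in> carrier B \<Longrightarrow>
  frag_of (a, b \<oplus>\<^sub>B b') - frag_of (a, b) - frag_of (a, b') \<in> T"
 "c \<in> carrier K \<Longrightarrow> a \<in> carrier A \<Longrightarrow> b \<in> carrier B \<Longrightarrow> frag_of (c \<odot>\<^sub>A a, b) - frag_of (a, c \<odot>\<^sub>B b) \<in> T"
 by (rule T_rel, unfold tensor_relations_def, blast)+

text \<open>A bilinearity relation times a generator is a relation of the same kind, so the subgroup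
  generated by the relations is a two-sided ideal.\<close>

lemma rel_mult:
 assumes "r \<in> tensor_relations K A B" "a0 \<in> carrier A" "b0 \<in> carrier B"
 shows "frag_of (a0, b0) \<otimes>\<^sub>R r \<in> T" "r \<otimes>\<^sub>R frag_of (a0, b0) \<in> T"
proof -
 note dist = R_mult_diff_left R_mult_diff_right A.l_distr A.r_distr B.l_distr B.r_distr A_smult B_smult
 have "frag_of (a0, b0) \<otimes>\<^sub>R r \<in> T \<and> r \<otimes>\<^sub>R frag_of (a0, b0) \<in> T"
  using assms(1)
 proof (cases rule: rel_cases)
  case (1 a a' b)
  then show ?thesis
   using relI(1)[of "a0 \<otimes>\<^sub>A a" "a0 \<otimes>\<^sub>A a'" "b0 \<otimes>\<^sub>B b"]
    relI(1)[of "a \<otimes>\<^sub>A a0" "a' \<otimes>\<^sub>A a0" "b \<otimes>\<^sub>B b0"] assms(2,3) by (simp add: dist)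
 next
  case (2 a b b')
  then show ?thesis
   using relI(2)[of "a0 \<otimes>\<^sub>A a" "b0 \<otimes>\<^sub>B b" "b0 \<otimes>\<^sub>B b'"]
    relI(2)[of "a \<otimes>\<^sub>A a0" "b \<otimes>\<^sub>B b0" "b' \<otimes>\<^sub>B b0"] assms(2,3) by (simp add: dist)
 next
  case (3 c a b)
  then show ?thesis
   using relI(3)[of c "a0 \<otimes>\<^sub>A a" "b0 \<otimes>\<^sub>B b"]
    relI(3)[of c "a \<otimes>\<^sub>A a0" "b \<otimes>\<^sub>B b0"] assms(2,3) by (simp add: dist)
 qed
 then show "frag_of (a0, b0) \<otimes>\<^sub>R r \<in> T" "r \<otimes>\<^sub>R frag_of (a0, b0) \<in> T" by blast+
qed

lemma T_mult:
 assumes t: "t \<in> T" and x: "supp x"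
 shows "x \<otimes>\<^sub>R t \<in> T" "t \<otimes>\<^sub>R x \<in> T"
proof -
 have "x \<otimes>\<^sub>R t \<in> T \<and> t \<otimes>\<^sub>R x \<in> T"
  using x
 proof (induction x rule: frag_induction)
  case (one p)
  obtain a b where p: "p = (a, b)" "a \<in> carrier A" "b \<in> carrier B" using one by blast
  show ?case using t unfolding p(1)
  proof (induction rule: T_induct)
   case (rel r)
   then show ?case using rel_mult[OF rel p(2,3)] by blast
  qed (simp_all add: T_zero T_diff R_mult_diff_left R_mult_diff_right)
 qed (simp_all add: T_zero T_diff R_mult_diff_left R_mult_diff_right)
 then show "x \<otimes>\<^sub>R t \<in> T" "t \<otimes>\<^sub>R x \<in> T" by blast+
qed

lemma R_a_inv: "supp x \<Longrightarrow> \<ominus>\<^sub>R x = - x"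
 by (rule R.minus_equality) simp_all

sublocale T: ideal T R
proof (rule idealI[OF R_ring])
 show "subgroup T (add_monoid R)"
  by (rule R.add.subgroupI) (use T_carrier T_zero in \<open>auto simp: R_a_inv T_minus T_add\<close>)
qed (simp_all add: T_mult)

sublocale L: ring L
 unfolding tensor_algebra_def by (rule T.quotient_is_ring)

abbreviation tproj ("\<tau>") where "\<tau> x \<equiv> T +>\<^bsub>R\<^esub> x"

lemma carrier_L: "carrier L = \<tau> ` {x. supp x}"
 by (auto simp: tensor_algebra_def FactRing_def A_RCOSETS_def')

lemma tensor_eq: "a \<star> b = \<tau> (frag_of (a, b))"
 by (simp add: pure_tensor_def)

lemma proj_eq_iff: "supp x \<Longrightarrow> supp y \<Longrightarrow> \<tau> x = \<tau> y \<longleftrightarrow> x - y \<in> T"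
 using R.quotient_eq_iff_same_a_r_cos[OF T.ideal_axioms, of x y] by (simp add: a_minus_def R_a_inv)

lemma proj_hom:
 assumes "supp x" "supp y"
 shows "\<tau> (x + y) = \<tau> x \<oplus>\<^sub>L \<tau> y" "\<tau> (x \<otimes>\<^sub>R y) = \<tau> x \<otimes>\<^sub>L \<tau> y" "\<tau> 0 = \<zero>\<^sub>L"
 using ring_hom_add[OF T.rcos_ring_hom, of x y] ring_hom_mult[OF T.rcos_ring_hom, of x y] assms
  ring_hom_zero[OF T.rcos_ring_hom R_ring T.quotient_is_ring]
 by (simp_all add: tensor_algebra_def)

lemma tensor_closed [simp]: "a \<in> carrier A \<Longrightarrow> b \<in> carrier B \<Longrightarrow> a \<star> b \<in> carrier L"
 by (auto simp: tensor_eq carrier_L)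

lemma tensor_add_left:
 assumes "a \<in> carrier A" "a' \<in> carrier A" "b \<in> carrier B"
 shows "(a \<oplus>\<^sub>A a') \<star> b = a \<star> b \<oplus>\<^sub>L a' \<star> b"
proof -
 have "\<tau> (frag_of (a \<oplus>\<^sub>A a', b)) = \<tau> (frag_of (a, b) + frag_of (a', b))"
  using assms relI(1)[OF assms] keys_add[of "frag_of (a, b)" "frag_of (a', b)"]
  by (subst proj_eq_iff) (auto simp: diff_diff_eq)
 then show ?thesis using assms by (simp add: tensor_eq proj_hom)
qed

lemma tensor_add_right:
 assumes "a \<in> carrier A" "b \<in> carrier B" "b' \<in> carrier B"
 shows "a \<star> (b \<oplus>\<^sub>B b') = a \<star> b \<oplus>\<^sub>L a \<star> b'"
proof -
 have "\<tau> (frag_of (a, b \<oplus>\<^sub>B b')) = \<tau> (frag_of (a, b) + frag_of (a, b'))"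
  using assms relI(2)[OF assms] keys_add[of "frag_of (a, b)" "frag_of (a, b')"]
  by (subst proj_eq_iff) (auto simp: diff_diff_eq)
 then show ?thesis using assms by (simp add: tensor_eq proj_hom)
qed

lemma tensor_smult:
 "c \<in> carrier K \<Longrightarrow> a \<in> carrier A \<Longrightarrow> b \<in> carrier B \<Longrightarrow> (c \<odot>\<^sub>A a) \<star> b = a \<star> (c \<odot>\<^sub>B b)"
 by (simp add: tensor_eq proj_eq_iff A_smult B_smult relI)

lemma tensor_mult:
 "a \<in> carrier A \<Longrightarrow> b \<in> carrier B \<Longrightarrow> a' \<in> carrier A \<Longrightarrow> b' \<in> carrier B \<Longrightarrow>
  (a \<star> b) \<otimes>\<^sub>L (a' \<star> b') = (a \<otimes>\<^sub>A a') \<star> (b \<otimes>\<^sub>B b')"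
 by (simp add: tensor_eq flip: proj_hom)

lemma tensor_one: "\<one>\<^sub>A \<star> \<one>\<^sub>B = \<one>\<^sub>L"
 using ring_hom_one[OF T.rcos_ring_hom] by (simp add: tensor_eq tensor_algebra_def)

lemma tensor_zero: "a \<in> carrier A \<Longrightarrow> a \<star> \<zero>\<^sub>B = \<zero>\<^sub>L" "b \<in> carrier B \<Longrightarrow> \<zero>\<^sub>A \<star> b = \<zero>\<^sub>L"
 using tensor_add_right[of a "\<zero>\<^sub>B" "\<zero>\<^sub>B"] tensor_add_left[of "\<zero>\<^sub>A" "\<zero>\<^sub>A" b] by simp_all

lemma tensor_minus:
 assumes "a \<in> carrier A" "b \<in> carrier B" shows "\<ominus>\<^sub>L (a \<star> b) = (\<ominus>\<^sub>A a) \<star> b"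
 using assms tensor_add_left[of "\<ominus>\<^sub>A a" a b] tensor_zero(2)[of b]
 by (intro L.minus_equality) (simp_all add: A.l_neg)

lemma tensor_induct [consumes 1, case_names zero tensor diff]:
 assumes l: "l \<in> carrier L" and "P \<zero>\<^sub>L" and "\<And>a b. a \<in> carrier A \<Longrightarrow> b \<in> carrier B \<Longrightarrow> P (a \<star> b)"
  and diff: "\<And>x y. x \<in> carrier L \<Longrightarrow> y \<in> carrier L \<Longrightarrow> P x \<Longrightarrow> P y \<Longrightarrow> P (x \<ominus>\<^sub>L y)"
 shows "P l"
proof -
 obtain x where x: "supp x" "l = \<tau> x" using l by (auto simp: carrier_L)
 have "P (\<tau> x)"
 proof (rule free_Abelian_group_induct[OF x(1), of "\<lambda>x. P (\<tau> x)"])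
  show "P (\<tau> 0)" using assms(2) proj_hom(3)[of 0 0] by simp
 next
  fix x y assume k: "supp x" "supp y" and P: "P (\<tau> x)" "P (\<tau> y)"
  have c: "\<tau> x \<in> carrier L" "\<tau> y \<in> carrier L" using k unfolding carrier_L by blast+
  have "\<tau> (x - y) \<oplus>\<^sub>L \<tau> y = \<tau> x"
   using proj_hom(1)[OF keys_diff_subset[OF k] k(2)] by simp
  moreover have "\<tau> (x - y) \<in> carrier L" using keys_diff_subset[OF k] unfolding carrier_L by blast
  ultimately have "\<tau> (x - y) = \<tau> x \<ominus>\<^sub>L \<tau> y"
   using c(2) by (intro L.eq_diffI)
  then show "P (\<tau> (x - y))" using diff[OF c P] by simp
 next
  show "P (\<tau> (frag_of p))" if "p \<in> S" for p
   using that assms(3) by (cases p) (simp add: tensor_eq)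
 qed
 then show ?thesis using x(2) by simp
qed

text \<open>The universal property for biadditive balanced maps: such a map extends to the free
  abelian group and kills the three kinds of relations. It is used to define coordinates on
  \<Lambda>.\<close>

lemma tensor_lift:
 fixes H (structure)
 assumes H: "abelian_group H"
  and closed: "\<And>a b. a \<in> carrier A \<Longrightarrow> b \<in> carrier B \<Longrightarrow> \<phi> a b \<in> carrier H"
  and add_l: "\<And>a a' b. a \<in> carrier A \<Longrightarrow> a' \<in> carrier A \<Longrightarrow> b \<in> carrier B \<Longrightarrow> \<phi> (a \<oplus>\<^sub>A a') b = \<phi> a b \<oplus> \<phi> a' b"
  and add_r: "\<And>a b b'. a \<in> carrier A \<Longrightarrow> b \<in> carrier B \<Longrightarrow> b' \<in> carrier B \<Longrightarrow> \<phi> a (b \<oplus>\<^sub>B b') = \<phi> a b \<oplus> \<phi> a b'"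
  and smult: "\<And>c a b. c \<in> carrier K \<Longrightarrow> a \<in> carrier A \<Longrightarrow> b \<in> carrier B \<Longrightarrow> \<phi> (c \<odot>\<^sub>A a) b = \<phi> a (c \<odot>\<^sub>B b)"
 obtains h where "\<And>l. l \<in> carrier L \<Longrightarrow> h l \<in> carrier H"
  "\<And>l l'. l \<in> carrier L \<Longrightarrow> l' \<in> carrier L \<Longrightarrow> h (l \<oplus>\<^sub>L l') = h l \<oplus> h l'"
  "\<And>a b. a \<in> carrier A \<Longrightarrow> b \<in> carrier B \<Longrightarrow> h (a \<star> b) = \<phi> a b"
proof -
 interpret H: abelian_group H by (rule H)

 have "(\<lambda>(a, b). \<phi> a b) ` S \<subseteq> carrier (add_monoid H)" using closed by auto
 then obtain g where g: "g \<in> hom (free_Abelian_group S) (add_monoid H)"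
  "\<And>p. p \<in> S \<Longrightarrow> g (frag_of p) = (\<lambda>(a, b). \<phi> a b) p"
  using comm_group.free_Abelian_group_universal[OF H.a_comm_group] by blast
 have gc: "g x \<in> carrier H" if "supp x" for x
  using g(1) that by (auto simp: hom_def)
 have ga: "g (x + y) = g x \<oplus> g y" if "supp x" "supp y" for x y
  using hom_mult[OF g(1), of x y] that by simp
 have gd: "g (x - y) = g x \<ominus> g y" if "supp x" "supp y" for x y
 proof -
  note d = keys_diff_subset[OF that]
  have "g (x - y) \<oplus> g y = g x" using ga[OF d that(2)] by simp
  then show ?thesis using gc[OF d] gc[OF that(2)] by (intro H.eq_diffI)
 qed
 have gf: "g (frag_of (a, b)) = \<phi> a b" if "a \<in> carrier A" "b \<in> carrier B" for a b using g(2)[of "(a, b)"] that by simp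
 have g0: "g 0 = \<zero>" using gd[of 0 0] gc[of 0] by (simp add: a_minus_def)
 have gT: "g t = \<zero>" if "t \<in> T" for t
  using that
 proof (induction rule: T_induct)
  case (rel r)
  then show ?case
  proof (cases rule: rel_cases)
   case (1 a a' b)
   then show ?thesis
    by (simp add: gd gf keys_diff_subset add_l closed a_minus_def H.a_ac H.r_neg)
  next
   case (2 a b b')
   then show ?thesis
    by (simp add: gd gf keys_diff_subset add_r closed a_minus_def H.a_ac H.r_neg)
  next
   case (3 c a b)
   then show ?thesis by (simp add: gd gf A_smult B_smult smult closed a_minus_def H.r_neg)
  qed
 next
  case (diff x y)
  then show ?case by (simp add: gd T_carrier a_minus_def)
 qed (simp add: g0)
 have gq: "g x = g y" if "supp x" "supp y" "\<tau> x = \<tau> y" for x y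
 proof -
  have "g x = g (x - y) \<oplus> g y" using ga[OF keys_diff_subset[OF that(1,2)] that(2)] by simp
  then show ?thesis using gT[of "x - y"] that proj_eq_iff gc by simp
 qed
 define h where "h l = g (SOME x. supp x \<and> \<tau> x = l)" for l
 have h: "h (\<tau> x) = g x" if "supp x" for x
 proof -
  let ?y = "SOME y. supp y \<and> \<tau> y = \<tau> x"
  have "supp ?y \<and> \<tau> ?y = \<tau> x"
   by (rule someI[of "\<lambda>y. supp y \<and> \<tau> y = \<tau> x" x]) (simp add: that)
  then show ?thesis unfolding h_def using gq that by blast
 qed
 show ?thesis
 proof (rule that[of h])
  show "h l \<in> carrier H" if "l \<in> carrier L" for l using that h gc by (auto simp: carrier_L)
  show "h (a \<star> b) = \<phi> a b" if "a \<in> carrier A" "b \<in> carrier B" for a b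
   using that h gf by (simp add: tensor_eq)
  fix l l' assume "l \<in> carrier L" "l' \<in> carrier L"
  then obtain x y where x: "supp x" "l = \<tau> x" and y: "supp y" "l' = \<tau> y"
   by (auto simp: carrier_L)
  have "supp (x + y)" using keys_add[of x y] x(1) y(1) by blast
  then show "h (l \<oplus>\<^sub>L l') = h l \<oplus> h l'"
   using h[of "x + y"] h[OF x(1)] h[OF y(1)] proj_hom(1)[OF x(1) y(1)] ga[OF x(1) y(1)] x(2) y(2) by simp
 qed
qed

end

section \<open>The algebra of a bound quiver over \<open>A\<close>\<close>

text \<open>Appending an arrow to a longest path shows that this increases along arrows; the maximum
  exists because an acyclic finite quiver has only finitely many paths.\<close>

definition height :: "('v, 'e) pre_digraph \<Rightarrow> 'v \<Rightarrow> nat" where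
 "height Q v = Max ((\<lambda>p. length (snd p)) ` {p \<in> paths Q. path_end Q p = v})"

lemma (in acyclic_path_algebra) height_arc:
 assumes \<alpha>: "\<alpha> \<in> arcs Q"
 shows "height Q (tail Q \<alpha>) < height Q (head Q \<alpha>)"
proof -
 let ?X = "\<lambda>v. {p \<in> paths Q. path_end Q p = v}"
 have fin: "finite ((\<lambda>p. length (snd p)) ` ?X v)" for v using finite_paths[OF acyclic] by simp
 have "(tail Q \<alpha>, []) \<in> ?X (tail Q \<alpha>)" using \<alpha> by (simp add: paths_Nil[OF wf_digraph_axioms])
 then have "height Q (tail Q \<alpha>) \<in> (\<lambda>p. length (snd p)) ` ?X (tail Q \<alpha>)"
  unfolding height_def using fin by (intro Max_in) blast+
 then obtain p where p: "p \<in> paths Q" "path_end Q p = tail Q \<alpha>" "height Q (tail Q \<alpha>) = length (snd p)" by blast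
 have "(fst p, snd p @ [\<alpha>]) \<in> ?X (head Q \<alpha>)"
  using p(1,2) \<alpha> by (simp add: paths_append[OF wf_digraph_axioms] paths_single[OF wf_digraph_axioms] path_end_eq)
 then have "length (snd p @ [\<alpha>]) \<in> (\<lambda>p. length (snd p)) ` ?X (head Q \<alpha>)" by (intro image_eqI) auto
 then have "length (snd p @ [\<alpha>]) \<le> height Q (head Q \<alpha>)"
  unfolding height_def using fin by (intro Max_ge)
 then show ?thesis using p(3) by simp
qed

locale bound_quiver_over = bound_quiver K Q \<rho> I
 for K :: "('k, 'r) ring_scheme" (structure) and Q :: "('v, 'e) pre_digraph"
  and \<rho> :: "('v, 'e) path set" and I :: "(('v, 'e) path \<Rightarrow> 'k) set" +
 fixes A :: "('k, 'a, 's) module_scheme"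
 assumes assoc_algebra: "assoc_algebra K A"
begin

sublocale KA: assoc_algebra K A by (rule assoc_algebra)

sublocale TP: tensor_product A B K
proof (intro tensor_product.intro tensor_product_axioms.intro)
 show "ring A" by (rule KA.ring_axioms)
 show "ring B" by (rule B_ring)
qed (simp_all add: KA.smult_assoc2 KA.smult_assoc3 B_smult_closed B_smult_assoc)

abbreviation "L \<equiv> Lambda_algebra K A Q I"
abbreviation "T \<equiv> tensor_algebra K A B"
abbreviation "\<iota> a \<equiv> pure_tensor K A B a \<one>\<^sub>B"
abbreviation "E p \<equiv> pure_tensor K A B \<one>\<^sub>A (path_class K Q I p)"

text \<open>The coefficient of b at p is K-linear in b, so multiplying a by it is biadditive and
  balanced in a and b, and the universal property applies.\<close>

lemma coordinate_exists:
 assumes p: "p \<in> N"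
 shows "\<exists>c. (\<forall>l\<in>carrier T. c l \<in> carrier A) \<and>
  (\<forall>l\<in>carrier T. \<forall>m\<in>carrier T. c (l \<oplus>\<^sub>T m) = c l \<oplus>\<^sub>A c m) \<and>
  (\<forall>a\<in>carrier A. \<forall>b\<in>carrier B. c (pure_tensor K A B a b) = coB p b \<odot>\<^sub>A a)"
proof -
 have "coB p (c \<odot>\<^sub>B b) \<odot>\<^sub>A a = coB p b \<odot>\<^sub>A (c \<odot>\<^sub>A a)"
  if "c \<in> carrier K" "a \<in> carrier A" "b \<in> carrier B" for a b c
  using that coB[OF p that(3)] by (simp add: K.m_comm flip: KA.smult_assoc1)
 note bal = this
 show ?thesis
 proof (rule TP.tensor_lift[OF KA.M.abelian_group_axioms, of "\<lambda>a b. coB p b \<odot>\<^sub>A a"])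
  fix h assume "\<And>l. l \<in> carrier T \<Longrightarrow> h l \<in> carrier A"
   "\<And>l m. l \<in> carrier T \<Longrightarrow> m \<in> carrier T \<Longrightarrow> h (l \<oplus>\<^sub>T m) = h l \<oplus>\<^sub>A h m"
   "\<And>a b. a \<in> carrier A \<Longrightarrow> b \<in> carrier B \<Longrightarrow> h (pure_tensor K A B a b) = coB p b \<odot>\<^sub>A a"
  then show ?thesis by blast
 qed (use coB[OF p] bal in \<open>simp_all add: KA.smult_l_distr KA.smult_r_distr\<close>)
qed

definition co where
 "co p = (SOME c. (\<forall>l\<in>carrier T. c l \<in> carrier A) \<and>
  (\<forall>l\<in>carrier T. \<forall>m\<in>carrier T. c (l \<oplus>\<^sub>T m) = c l \<oplus>\<^sub>A c m) \<and>
  (\<forall>a\<in>carrier A. \<forall>b\<in>carrier B. c (pure_tensor K A B a b) = coB p b \<odot>\<^sub>A a))"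

lemma co:
 assumes "p \<in> N"
 shows "l \<in> carrier T \<Longrightarrow> co p l \<in> carrier A"
  and "l \<in> carrier T \<Longrightarrow> m \<in> carrier T \<Longrightarrow> co p (l \<oplus>\<^sub>T m) = co p l \<oplus>\<^sub>A co p m"
  and "a \<in> carrier A \<Longrightarrow> b \<in> carrier B \<Longrightarrow> co p (pure_tensor K A B a b) = coB p b \<odot>\<^sub>A a"
 using someI_ex[OF coordinate_exists[OF assms]] unfolding co_def[symmetric] by blast+

lemma co_left:
 assumes p: "p \<in> N" and a: "a \<in> carrier A" and l: "l \<in> carrier T"
 shows "co p (\<iota> a \<otimes>\<^sub>T l) = a \<otimes>\<^sub>A co p l"
proof -
 interpret Br: ring B by (rule B_ring)
 have \<iota>a: "\<iota> a \<in> carrier T" using a by simp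
 have z: "co p \<zero>\<^sub>T = \<zero>\<^sub>A"
  using co(2)[OF p, of "\<zero>\<^sub>T" "\<zero>\<^sub>T"] co(1)[OF p, of "\<zero>\<^sub>T"] by simp
 have d: "co p (x \<ominus>\<^sub>T y) = co p x \<ominus>\<^sub>A co p y" if "x \<in> carrier T" "y \<in> carrier T" for x y
 proof (rule KA.M.eq_diffI)
  have "(x \<ominus>\<^sub>T y) \<oplus>\<^sub>T y = x" using that by (simp add: a_minus_def TP.L.a_assoc TP.L.l_neg)
  then show "co p (x \<ominus>\<^sub>T y) \<oplus>\<^sub>A co p y = co p x"
   using co(2)[OF p, of "x \<ominus>\<^sub>T y" y] that by simp
 qed (use that in \<open>simp_all add: co(1)[OF p]\<close>)
 show ?thesis using l
 proof (induction l rule: TP.tensor_induct)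
  case zero
  then show ?case using \<iota>a a by (simp add: z)
 next
  case (tensor a' b)
  then show ?case using a coB(1)[OF p] by (simp add: TP.tensor_mult co(3)[OF p] KA.smult_assoc3)
 next
  case (diff x y)
  have "\<iota> a \<otimes>\<^sub>T (x \<ominus>\<^sub>T y) = \<iota> a \<otimes>\<^sub>T x \<ominus>\<^sub>T \<iota> a \<otimes>\<^sub>T y"
   using diff(1,2) \<iota>a by (simp add: a_minus_def TP.L.r_distr TP.L.r_minus)
  also have "co p \<dots> = a \<otimes>\<^sub>A co p x \<ominus>\<^sub>A a \<otimes>\<^sub>A co p y"
   using diff \<iota>a by (simp add: d)
  also have "\<dots> = a \<otimes>\<^sub>A (co p x \<ominus>\<^sub>A co p y)"
   using co(1)[OF p] diff(1,2) a by (simp add: a_minus_def KA.r_distr KA.r_minus)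
  finally show ?case using d[OF diff(1,2)] by simp
 qed
qed

text \<open>In a pure tensor the second factor is written in path classes, and its scalars from K
  are moved to the side of A; what remains are terms of the form (a \<otimes> 1)(1 \<otimes>
  p).\<close>

lemma Lambda_induct:
 assumes l: "l \<in> carrier T" and zero: "P \<zero>\<^sub>T"
  and add: "\<And>a p m. a \<in> carrier A \<Longrightarrow> p \<in> N \<Longrightarrow> m \<in> carrier T \<Longrightarrow> P m \<Longrightarrow>
   P ((\<iota> a \<otimes>\<^sub>T E p) \<oplus>\<^sub>T m)"
 shows "P l"
proof -
 interpret Br: ring B by (rule B_ring)
 \<comment> \<open>The claim is strengthened to stability of P under adding x, so that the pieces of
   an element can be added one after another.\<close>
 let ?P = "\<lambda>x. \<forall>m\<in>carrier T. P m \<longrightarrow> P (x \<oplus>\<^sub>T m)"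
 have pt: "?P (pure_tensor K A B a b)" if a: "a \<in> carrier A" and b: "b \<in> carrier B" for a b
 proof (rule B_induct[OF b])
  show "?P (pure_tensor K A B a \<zero>\<^sub>B)" using a by (simp add: TP.tensor_zero)
 next
  fix c p b assume c: "c \<in> carrier K" and p: "p \<in> N" and b: "b \<in> carrier B"
   and IH: "?P (pure_tensor K A B a b)"
  have pp: "path_class K Q I p \<in> carrier B" using p N_paths path_class_closed by blast
  have ca: "c \<odot>\<^sub>A a \<in> carrier A" using c a by simp
  have "pure_tensor K A B a (c \<odot>\<^sub>B path_class K Q I p \<oplus>\<^sub>B b) =
    pure_tensor K A B (c \<odot>\<^sub>A a) (path_class K Q I p) \<oplus>\<^sub>T pure_tensor K A B a b"
   using a b c pp by (simp add: TP.tensor_add_right B_smult_closed TP.tensor_smult)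
  also have "pure_tensor K A B (c \<odot>\<^sub>A a) (path_class K Q I p) = \<iota> (c \<odot>\<^sub>A a) \<otimes>\<^sub>T E p"
   using ca pp by (simp add: TP.tensor_mult)
  finally have eq: "pure_tensor K A B a (c \<odot>\<^sub>B path_class K Q I p \<oplus>\<^sub>B b) =
    \<iota> (c \<odot>\<^sub>A a) \<otimes>\<^sub>T E p \<oplus>\<^sub>T pure_tensor K A B a b" .
  show "?P (pure_tensor K A B a (c \<odot>\<^sub>B path_class K Q I p \<oplus>\<^sub>B b))"
  proof (intro ballI impI)
   fix m assume m: "m \<in> carrier T" "P m"
   have "P (\<iota> (c \<odot>\<^sub>A a) \<otimes>\<^sub>T E p \<oplus>\<^sub>T (pure_tensor K A B a b \<oplus>\<^sub>T m))"
    using m IH a b by (intro add[OF ca p]) auto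
   then show "P (pure_tensor K A B a (c \<odot>\<^sub>B path_class K Q I p \<oplus>\<^sub>B b) \<oplus>\<^sub>T m)"
    unfolding eq using m a b ca pp by (simp add: TP.L.a_assoc)
  qed
 qed
 \<comment> \<open>General elements are reached from pure tensors by differences, so an element and
   its negative are carried along together.\<close>
 have "?P l \<and> ?P (\<ominus>\<^sub>T l)" using l
 proof (induction l rule: TP.tensor_induct)
  case (tensor a b)
  then show ?case using pt[of a b] pt[of "\<ominus>\<^sub>A a" b] by (simp add: TP.tensor_minus)
 next
  case (diff x y)
  have "P (x \<ominus>\<^sub>T y \<oplus>\<^sub>T m)" "P (\<ominus>\<^sub>T (x \<ominus>\<^sub>T y) \<oplus>\<^sub>T m)" if m: "m \<in> carrier T" "P m" for m
  proof -
   have "P (x \<oplus>\<^sub>T (\<ominus>\<^sub>T y \<oplus>\<^sub>T m))" "P (y \<oplus>\<^sub>T (\<ominus>\<^sub>T x \<oplus>\<^sub>T m))"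
    using diff m by simp_all
   then show "P (x \<ominus>\<^sub>T y \<oplus>\<^sub>T m)" "P (\<ominus>\<^sub>T (x \<ominus>\<^sub>T y) \<oplus>\<^sub>T m)"
    using diff(1,2) m(1) by (simp_all add: a_minus_def TP.L.a_assoc TP.L.minus_add TP.L.add.m_lcomm)
  qed
  then show ?case by blast
 qed simp
 then have "P (l \<oplus>\<^sub>T \<zero>\<^sub>T)" using zero by blast
 then show ?thesis using l by simp
qed

sublocale monomial: monomial_algebra A L Q N \<iota> E co "height Q"
 unfolding Lambda_algebra_def
proof (intro monomial_algebra.intro monomial_algebra_axioms.intro)
 interpret Br: ring B by (rule B_ring)
 have cl: "path_class K Q I p \<in> carrier B" if "p \<in> N" for p using that N_paths path_class_closed by blast
 note wf = wf_digraph_axioms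
 show "ring A" "ring T" by (rule KA.ring_axioms, rule TP.L.ring_axioms)
 show "finite N" using finite_paths[OF acyclic] N_paths finite_subset by blast
 show "fst p \<in> verts Q" "path_end Q p \<in> verts Q" if "p \<in> N" for p
  using paths_verts[OF wf] that N_paths by blast+
 show "(v, []) \<in> N" if "v \<in> verts Q" for v using that paths_Nil[OF wf] by (intro N_short) simp_all
 show "(u, [\<alpha>]) \<in> N \<longleftrightarrow> \<alpha> \<in> arcs Q \<and> u = tail Q \<alpha>" for u \<alpha>
  using paths_single[OF wf, of u \<alpha>] N_short[of "(u, [\<alpha>])"] N_paths by auto
 show "\<iota> \<in> ring_hom A T"
  by (rule ring_hom_memI) (simp_all add: TP.tensor_mult TP.tensor_add_left TP.tensor_one)
 show "E p \<otimes>\<^sub>T E q = (if path_end Q q = fst p \<and> path_comp p q \<in> N then E (path_comp p q) else \<zero>\<^sub>T)"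
  if "p \<in> N" "q \<in> N" for p q
  using that cl N_paths by (simp add: TP.tensor_mult path_class_mult TP.tensor_zero subsetD)
 show "co p (E q) = (if p = q then \<one>\<^sub>A else \<zero>\<^sub>A)" if "p \<in> N" "q \<in> N" for p q
  using that cl by (simp add: co coB_path_class)
 show "P l" if "l \<in> carrier T" "P \<zero>\<^sub>T"
  "\<And>a p m. a \<in> carrier A \<Longrightarrow> p \<in> N \<Longrightarrow> m \<in> carrier T \<Longrightarrow> P m \<Longrightarrow> P ((\<iota> a \<otimes>\<^sub>T E p) \<oplus>\<^sub>T m)" for P l
  using that by (rule Lambda_induct)
qed (use N_factors height_arc in \<open>simp_all add: co co_left TP.tensor_mult path_class_closed N_paths[THEN subsetD] B_ring[THEN ring.ring_simprules(6)]\<close>)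

end

theorem theorem4p1:
  fixes K :: "('k, 'r) ring_scheme"
    and A :: "('k, 'a, 's) module_scheme"
    and Q :: "('v, 'e) pre_digraph"
    and \<rho> :: "('v, 'e) path set"
    and I :: "(('v, 'e) path \<Rightarrow> 'k) set"
    and \<Lambda> :: "('a \<times> (('v, 'e) path \<Rightarrow> 'k) set \<Rightarrow>\<^sub>0 int) set ring"
    and M :: "(('a \<times> (('v, 'e) path \<Rightarrow> 'k) set \<Rightarrow>\<^sub>0 int) set, 'm, 'w) module_scheme"
    and X :: "('v, 'e, 'a, 'm) quiver_rep"
  assumes A: "fin_dim_algebra K A"
    and Q: "fin_digraph Q" "acyclic_quiver Q"
    and rho: "\<rho> \<subseteq> paths Q" "\<forall>p \<in> \<rho>. path_length p \<ge> 2"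
    and I: "I = relation_ideal K Q \<rho>"
    and Lambda: "\<Lambda> = Lambda_algebra K A Q I"
    and M: "left_module \<Lambda> M" "finitely_generated \<Lambda> M"
    and X: "X = rep_of_module K A Q I M"
  shows "gorenstein_projective \<Lambda> M \<longleftrightarrow>
    monic_rep K A Q I X \<and>
    (\<forall>i \<in> verts Q. gorenstein_projective A (rep_space X i) \<and>
      gorenstein_projective A (quot_module (rep_space X i) (rep_radical Q X i)))"
proof -
 interpret A: fin_dim_algebra K A by (rule A)
 interpret bound_quiver_over K Q \<rho> I A
  by (intro bound_quiver_over.intro bound_quiver.intro acyclic_path_algebra.intro
    bound_quiver_axioms.intro bound_quiver_over_axioms.intro acyclic_path_algebra_axioms.intro
    A.field_axioms A.assoc_algebra_axioms Q rho I)
 \<comment> \<open>Vertex spaces and arrow maps were set up with the same fields and the same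
   elements of \<Lambda>, so the two representations are equal as records and not merely
   isomorphic.\<close>
 have "X = monomial.rep_of M"
  by (simp add: X rep_of_module_def monomial.rep_of_def monomial.vert_def Let_def trivial_path_def fun_eq_iff)
 then show ?thesis
  using monomial.gorenstein_projective_iff_monic[OF wf_digraph_axioms N_paths, of M K I] M nonzero_path_iff
  unfolding Lambda by simp
qed

end
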